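(* Let $\mathrm{char}(\mathbb{F})=2$. Then $K_k\cong V(\lambda^\circ_{k-2})$ (as $G$-modules) for every $k=2,3,\dots,n$.
   Context: Let $n\ge 1$, let $\mathbb{F}$ be a field of characteristic $2$, $V$ a $(2n+1)$-dimensional $\mathbb{F}$-vector space, and $\eta$ a non-singular quadratic form on $V$ of Witt index $n$. Up to rescaling $\eta$, fix a basis $e_1,\dots,e_{2n+1}$ of $V$ with $\eta(x_1,\dots,x_{2n+1})=\sum_{i=1}^n x_ix_{n+i}+x_{2n+1}^2$. Let $G=\mathrm{SO}(2n+1,\mathbb{F})$ be the stabilizer of $\eta$ in $\mathrm{SL}(V)$. For $1\le k\le n$ let $W_k=\bigwedge^kV$ with the natural action of $G$, and let $W^\circ_k$ be the $G$-submodule of $W_k$ spanned by the vectors $v_1\wedge\dots\wedge v_k$ with $\langle v_1,\dots,v_k\rangle$ a $k$-dimensional subspace totally singular for $\eta$. Let $\lambda_1,\dots,\lambda_n$ be the fundamental dominant weights of the root system of type $B_n$ (usual numbering, the $n$-th simple root being short). Put $\lambda_0^\circ=0$, $\lambda_k^\circ=\lambda_k$ for $1\le k<n$, and $\lambda_n^\circ=2\lambda_n$. Let $\mathfrak{A}_{\mathbb{Z}}$ be the Kostant $\mathbb{Z}$-form of the universal enveloping algebra of $\mathfrak{o}(2n+1,\mathbb{C})$, let $V_{\mathbb{C}}(\lambda)$ be the irreducible module of highest weight $\lambda$ with highest weight vector $v^+$, and put $V(\lambda)=V_{\mathbb{F}}(\lambda):=\mathbb{F}\otimes_{\mathbb{Z}}\mathfrak{A}_{\mathbb{Z}}v^+$.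 This is a module for $\mathbb{F}\otimes\mathfrak{A}_{\mathbb{Z}}$. For $\lambda=\lambda_k^\circ$ it is a $G$-module (the Weyl module of $G$ of highest weight $\lambda_k^\circ$), the root elements $x_\alpha(t)$ acting as $\sum_m t^m X_\alpha^m/m!$. $V(\lambda^\circ_0)$ is the trivial $1$-dimensional $G$-module. For $1\le k\le n$ there is a surjective module homomorphism $\varphi_k:V(\lambda_k^\circ)\to W_k^\circ$, unique up to scalars, mapping the span of $v^+$ (the weight space of weight $\lambda^\circ_k$) onto $\langle e_1\wedge\dots\wedge e_k\rangle$. Put $K_k=\ker\varphi_k$. *)

theory Defs
  imports
    Complex_Main
    "HOL-Algebra.Generated_Rings"
    "HOL-Algebra.QuotRing"
    "HOL-Library.Poly_Mapping"
    "Jordan_Normal_Form.Determinant"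
    "Jordan_Normal_Form.VS_Connect"
begin

section \<open>Modules given by generators and relations\<close>

definition quot_module :: "('r, 'm) module \<Rightarrow> 'm set \<Rightarrow> ('r, 'm set) module" where
  "quot_module M N = \<lparr>carrier = a_rcosets\<^bsub>M\<^esub> N, mult = undefined, one = undefined,
     zero = N, add = set_add M, smult = (\<lambda>c X. \<Union>x\<in>X. N +>\<^bsub>M\<^esub> (c \<odot>\<^bsub>M\<^esub> x))\<rparr>"

definition free_module :: "'x set \<Rightarrow> ('f::field, 'x \<Rightarrow>\<^sub>0 'f) module" where
  "free_module X = \<lparr>carrier = {p. Poly_Mapping.keys p \<subseteq> X}, mult = undefined, one = undefined,
     zero = 0, add = (+), smult = (\<lambda>c. Poly_Mapping.map ((*) c))\<rparr>"

definition relation_span :: "'x set \<Rightarrow> ('x \<Rightarrow>\<^sub>0 'f::field) set \<Rightarrow> ('x \<Rightarrow>\<^sub>0 'f) set" where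
  "relation_span X R = module.span class_ring (free_module X) R"

definition presented_module ::
    "'x set \<Rightarrow> ('x \<Rightarrow>\<^sub>0 'f::field) set \<Rightarrow> ('f, ('x \<Rightarrow>\<^sub>0 'f) set) module" where
  "presented_module X R = quot_module (free_module X) (relation_span X R)"

definition generator ::
    "'x set \<Rightarrow> ('x \<Rightarrow>\<^sub>0 'f::field) set \<Rightarrow> 'x \<Rightarrow> ('x \<Rightarrow>\<^sub>0 'f) set" where
  "generator X R x = relation_span X R +>\<^bsub>free_module X\<^esub> Poly_Mapping.single x 1"

text \<open>The linear endomorphism of \<^term>\<open>presented_module X R\<close> that sends the generator of each
  \<open>x \<in> X\<close> to the generator of \<open>f x\<close>; meaningful when \<open>f\<close> maps \<open>X\<close> to \<open>X\<close> and respects the relations.\<close>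
definition presented_map ::
    "'x set \<Rightarrow> ('x \<Rightarrow>\<^sub>0 'f::field) set \<Rightarrow> ('x \<Rightarrow> 'x) \<Rightarrow> ('x \<Rightarrow>\<^sub>0 'f) set \<Rightarrow> ('x \<Rightarrow>\<^sub>0 'f) set" where
  "presented_map X R f C =
     (\<Union>p\<in>C. relation_span X R +>\<^bsub>free_module X\<^esub>
        (\<Sum>x\<in>Poly_Mapping.keys p. Poly_Mapping.single (f x) (Poly_Mapping.lookup p x)))"

text \<open>\<open>F \<otimes>\<^sub>\<int> L\<close> for an additive subgroup \<open>L\<close> of \<open>M\<close>, presented as an \<open>F\<close>-space: the generator of
  \<open>x \<in> L\<close> is \<open>1 \<otimes> x\<close>, and the relations are additivity in \<open>x\<close>.\<close>
definition tensor_rels :: "('r, 'v) module \<Rightarrow> 'v set \<Rightarrow> ('v \<Rightarrow>\<^sub>0 'f::field) set" where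
  "tensor_rels M L = {Poly_Mapping.single (x \<oplus>\<^bsub>M\<^esub> y) 1 - Poly_Mapping.single x 1
       - Poly_Mapping.single y 1 | x y. x \<in> L \<and> y \<in> L}"

definition scalar_ext :: "('r, 'v) module \<Rightarrow> 'v set \<Rightarrow> ('f::field, ('v \<Rightarrow>\<^sub>0 'f) set) module" where
  "scalar_ext M L = presented_module L (tensor_rels M L)"

text \<open>The exterior power \<open>\<Lambda>\<^sup>k F\<^sup>N\<close>: generators are the \<open>k\<close>-tuples of vectors (as lists of length
  \<open>k\<close>), relations are multilinearity and vanishing on tuples with a repeated entry.\<close>
definition tuples :: "nat \<Rightarrow> nat \<Rightarrow> 'f::field vec list set" where
  "tuples N k = {vs. length vs = k \<and> set vs \<subseteq> carrier_vec N}"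

definition wedge_rels :: "nat \<Rightarrow> nat \<Rightarrow> ('f::field vec list \<Rightarrow>\<^sub>0 'f) set" where
  "wedge_rels N k =
     {Poly_Mapping.single (vs[i := a + b]) 1 - Poly_Mapping.single (vs[i := a]) 1
        - Poly_Mapping.single (vs[i := b]) 1 | vs i a b.
        vs \<in> tuples N k \<and> i < k \<and> a \<in> carrier_vec N \<and> b \<in> carrier_vec N}
   \<union> {Poly_Mapping.single (vs[i := c \<cdot>\<^sub>v a]) 1 - Poly_Mapping.single (vs[i := a]) c | vs i a c.
        vs \<in> tuples N k \<and> i < k \<and> a \<in> carrier_vec N}
   \<union> {Poly_Mapping.single vs 1 | vs i j.
        vs \<in> tuples N k \<and> i < j \<and> j < k \<and> vs ! i = vs ! j}"

definition ext_power :: "nat \<Rightarrow> nat \<Rightarrow> ('f::field, ('f vec list \<Rightarrow>\<^sub>0 'f) set) module" where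
  "ext_power N k = presented_module (tuples N k) (wedge_rels N k)"

definition wedge :: "nat \<Rightarrow> 'f::field vec list \<Rightarrow> ('f vec list \<Rightarrow>\<^sub>0 'f) set" where
  "wedge N vs = generator (tuples N (length vs)) (wedge_rels N (length vs)) vs"

definition ext_power_act ::
    "nat \<Rightarrow> nat \<Rightarrow> 'f::field mat \<Rightarrow> ('f vec list \<Rightarrow>\<^sub>0 'f) set \<Rightarrow> ('f vec list \<Rightarrow>\<^sub>0 'f) set" where
  "ext_power_act N k g = presented_map (tuples N k) (wedge_rels N k) (map (\<lambda>v. g *\<^sub>v v))"


section \<open>Representations of groups\<close>

definition is_gmodule ::
    "('g, 'a) monoid_scheme \<Rightarrow> ('f::field, 'm) module \<Rightarrow> ('g \<Rightarrow> 'm \<Rightarrow> 'm) \<Rightarrow> bool" where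
  "is_gmodule G M \<sigma> \<longleftrightarrow>
     vectorspace class_ring M \<and>
     (\<forall>g\<in>carrier G. \<sigma> g \<in> module_hom class_ring M M) \<and>
     (\<forall>v\<in>carrier M. \<sigma> \<one>\<^bsub>G\<^esub> v = v) \<and>
     (\<forall>g\<in>carrier G. \<forall>h\<in>carrier G. \<forall>v\<in>carrier M. \<sigma> (g \<otimes>\<^bsub>G\<^esub> h) v = \<sigma> g (\<sigma> h v))"

definition gmodule_hom ::
    "('g, 'a) monoid_scheme \<Rightarrow> ('f::field, 'm) module \<Rightarrow> ('g \<Rightarrow> 'm \<Rightarrow> 'm) \<Rightarrow>
     ('f, 'n) module \<Rightarrow> ('g \<Rightarrow> 'n \<Rightarrow> 'n) \<Rightarrow> ('m \<Rightarrow> 'n) set" where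
  "gmodule_hom G M \<sigma> N \<tau> =
     {f \<in> module_hom class_ring M N. \<forall>g\<in>carrier G. \<forall>v\<in>carrier M. f (\<sigma> g v) = \<tau> g (f v)}"

definition gmodule_iso ::
    "('g, 'a) monoid_scheme \<Rightarrow> ('f::field, 'm) module \<Rightarrow> ('g \<Rightarrow> 'm \<Rightarrow> 'm) \<Rightarrow>
     ('f, 'n) module \<Rightarrow> ('g \<Rightarrow> 'n \<Rightarrow> 'n) \<Rightarrow> bool" where
  "gmodule_iso G M \<sigma> N \<tau> \<longleftrightarrow>
     (\<exists>f\<in>gmodule_hom G M \<sigma> N \<tau>. bij_betw f (carrier M) (carrier N))"


section \<open>The quadratic form, the orthogonal group and the modules \<open>W\<^sub>k\<^sup>\<circ>\<close>\<close>

text \<open>Coordinates are counted from 0: the basis vector \<open>e\<^sub>i\<close> (\<open>1 \<le> i \<le> 2n + 1\<close>) is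
  \<open>unit_vec (2n + 1) (i - 1)\<close>.\<close>
definition qform :: "nat \<Rightarrow> 'a::comm_ring_1 vec \<Rightarrow> 'a" where
  "qform n x = (\<Sum>i<n. x $ i * x $ (n + i)) + (x $ (2 * n))\<^sup>2"

definition SO :: "nat \<Rightarrow> 'f::field mat monoid" where
  "SO n = \<lparr>carrier = {A \<in> carrier_mat (2 * n + 1) (2 * n + 1). det A = 1 \<and>
       (\<forall>x\<in>carrier_vec (2 * n + 1). qform n (A *\<^sub>v x) = qform n x)},
     mult = (*), one = 1\<^sub>m (2 * n + 1)\<rparr>"

definition totally_singular_tuple :: "nat \<Rightarrow> nat \<Rightarrow> 'f::field vec list \<Rightarrow> bool" where
  "totally_singular_tuple n k vs \<longleftrightarrow>
     (let V = module_vec TYPE('f) (2 * n + 1); U = module.span class_ring V (set vs) in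
        vs \<in> tuples (2 * n + 1) k \<and> vectorspace.dim class_ring (V\<lparr>carrier := U\<rparr>) = k \<and>
        (\<forall>u\<in>U. qform n u = 0))"

definition W_circ :: "nat \<Rightarrow> nat \<Rightarrow> ('f::field, ('f vec list \<Rightarrow>\<^sub>0 'f) set) module" where
  "W_circ n k = (ext_power (2 * n + 1) k)
     \<lparr>carrier := module.span class_ring (ext_power (2 * n + 1) k)
        {wedge (2 * n + 1) vs | vs. totally_singular_tuple n k vs}\<rparr>"


section \<open>The Lie algebra \<open>\<oo>(2n + 1, \<complex>)\<close>, its roots and a Chevalley basis\<close>

definition bilform :: "nat \<Rightarrow> 'a::comm_ring_1 vec \<Rightarrow> 'a vec \<Rightarrow> 'a" where
  "bilform n x y = qform n (x + y) - qform n x - qform n y"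

definition lie_o :: "nat \<Rightarrow> complex mat set" where
  "lie_o n = {A \<in> carrier_mat (2 * n + 1) (2 * n + 1).
     \<forall>x\<in>carrier_vec (2 * n + 1). \<forall>y\<in>carrier_vec (2 * n + 1).
       bilform n (A *\<^sub>v x) y + bilform n x (A *\<^sub>v y) = 0}"

text \<open>The roots \<open>\<epsilon>\<^sub>i - \<epsilon>\<^sub>j\<close>, \<open>\<epsilon>\<^sub>i + \<epsilon>\<^sub>j\<close>, \<open>-\<epsilon>\<^sub>i - \<epsilon>\<^sub>j\<close>, \<open>\<epsilon>\<^sub>i\<close>, \<open>-\<epsilon>\<^sub>i\<close>, with indices counted from 0.\<close>
datatype broot = Diff nat nat | Plus nat nat | Minus nat nat | Short nat | NegShort nat

definition roots :: "nat \<Rightarrow> broot set" where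
  "roots n = {Diff i j | i j. i < n \<and> j < n \<and> i \<noteq> j}
     \<union> {Plus i j | i j. i < j \<and> j < n} \<union> {Minus i j | i j. i < j \<and> j < n}
     \<union> {Short i | i. i < n} \<union> {NegShort i | i. i < n}"

definition pos_roots :: "nat \<Rightarrow> broot set" where
  "pos_roots n = {Diff i j | i j. i < j \<and> j < n} \<union> {Plus i j | i j. i < j \<and> j < n}
     \<union> {Short i | i. i < n}"

text \<open>The simple roots \<open>\<alpha>\<^sub>1, \<dots>, \<alpha>\<^sub>n\<close>, here with the usual numbering from 1; \<open>\<alpha>\<^sub>n\<close> is short.\<close>
definition simple_root :: "nat \<Rightarrow> nat \<Rightarrow> broot" where
  "simple_root n j = (if j < n then Diff (j - 1) j else Short (n - 1))"

fun neg_root :: "broot \<Rightarrow> broot" where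
  "neg_root (Diff i j) = Diff j i"
| "neg_root (Plus i j) = Minus i j"
| "neg_root (Minus i j) = Plus i j"
| "neg_root (Short i) = NegShort i"
| "neg_root (NegShort i) = Short i"

definition mat_unit :: "nat \<Rightarrow> nat \<Rightarrow> nat \<Rightarrow> int mat" where
  "mat_unit N i j = mat N N (\<lambda>(r, s). if r = i \<and> s = j then 1 else 0)"

text \<open>The root vectors \<open>X\<^sub>\<alpha>\<close> of a Chevalley basis; they are integral, and \<open>[X\<^sub>\<alpha>, X\<^sub>-\<^sub>\<alpha>]\<close> is the coroot of \<open>\<alpha>\<close>.\<close>
fun root_vector :: "nat \<Rightarrow> broot \<Rightarrow> int mat" where
  "root_vector n (Diff i j) = mat_unit (2*n+1) i j - mat_unit (2*n+1) (n+j) (n+i)"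
| "root_vector n (Plus i j) = mat_unit (2*n+1) i (n+j) - mat_unit (2*n+1) j (n+i)"
| "root_vector n (Minus i j) = mat_unit (2*n+1) (n+j) i - mat_unit (2*n+1) (n+i) j"
| "root_vector n (Short i) = 2 \<cdot>\<^sub>m mat_unit (2*n+1) i (2*n) - mat_unit (2*n+1) (2*n) (n+i)"
| "root_vector n (NegShort i) = mat_unit (2*n+1) (2*n) i - 2 \<cdot>\<^sub>m mat_unit (2*n+1) (n+i) (2*n)"

definition coroot :: "nat \<Rightarrow> broot \<Rightarrow> int mat" where
  "coroot n \<alpha> = root_vector n \<alpha> * root_vector n (neg_root \<alpha>)
     - root_vector n (neg_root \<alpha>) * root_vector n \<alpha>"

text \<open>The root element \<open>x\<^sub>\<alpha>(t) = exp(t X\<^sub>\<alpha>)\<close> of \<open>SO(2n + 1, F)\<close>. Note that \<open>X\<^sub>\<alpha>\<^sup>3 = 0\<close>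
  and that \<open>X\<^sub>\<alpha>\<^sup>2 / 2\<close> is integral, so the division below is exact.\<close>
definition root_elem :: "nat \<Rightarrow> broot \<Rightarrow> 'f::field \<Rightarrow> 'f mat" where
  "root_elem n \<alpha> t = mat (2*n+1) (2*n+1) (\<lambda>(r, s).
     \<Sum>m\<le>2. t ^ m * of_int ((root_vector n \<alpha> ^\<^sub>m m) $$ (r, s) div fact m))"


section \<open>The universal enveloping algebra and its Kostant \<open>\<int>\<close>-form\<close>

datatype 'a word = Word (letters: "'a list")

instantiation word :: (type) monoid_add
begin
definition "0 = Word []"
definition "u + v = Word (letters u @ letters v)"
instance by standard (simp_all add: zero_word_def plus_word_def)
end

text \<open>The free associative unital \<open>\<complex>\<close>-algebra on \<open>A\<close> is the algebra of the monoid of words over \<open>A\<close>.\<close>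
definition free_algebra :: "'a set \<Rightarrow> ('a word \<Rightarrow>\<^sub>0 complex) ring" where
  "free_algebra A = \<lparr>carrier = {p. \<forall>w\<in>Poly_Mapping.keys p. set (letters w) \<subseteq> A},
     mult = (*), one = 1, zero = 0, add = (+)\<rparr>"

abbreviation monomial :: "complex \<Rightarrow> 'a list \<Rightarrow> 'a word \<Rightarrow>\<^sub>0 complex" where
  "monomial c xs \<equiv> Poly_Mapping.single (Word xs) c"

definition env_rels :: "nat \<Rightarrow> (complex mat word \<Rightarrow>\<^sub>0 complex) set" where
  "env_rels n =
     {monomial 1 [X + Y] - monomial 1 [X] - monomial 1 [Y] | X Y. X \<in> lie_o n \<and> Y \<in> lie_o n}
   \<union> {monomial 1 [c \<cdot>\<^sub>m X] - monomial c [X] | c X. X \<in> lie_o n}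
   \<union> {monomial 1 [X * Y - Y * X] - (monomial 1 [X, Y] - monomial 1 [Y, X]) | X Y.
        X \<in> lie_o n \<and> Y \<in> lie_o n}"

definition env_ideal :: "nat \<Rightarrow> (complex mat word \<Rightarrow>\<^sub>0 complex) set" where
  "env_ideal n = genideal (free_algebra (lie_o n)) (env_rels n)"

definition env_algebra :: "nat \<Rightarrow> (complex mat word \<Rightarrow>\<^sub>0 complex) set ring" where
  "env_algebra n = free_algebra (lie_o n) Quot env_ideal n"

definition divided_power :: "nat \<Rightarrow> broot \<Rightarrow> nat \<Rightarrow> (complex mat word \<Rightarrow>\<^sub>0 complex) set" where
  "divided_power n \<alpha> m = env_ideal n +>\<^bsub>free_algebra (lie_o n)\<^esub>
     monomial (1 / fact m) (replicate m (map_mat of_int (root_vector n \<alpha>)))"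

definition kostant_form :: "nat \<Rightarrow> (complex mat word \<Rightarrow>\<^sub>0 complex) set set" where
  "kostant_form n = generate_ring (env_algebra n) {divided_power n \<alpha> m | \<alpha> m. \<alpha> \<in> roots n}"


section \<open>Irreducible highest weight modules over \<open>\<complex>\<close>\<close>

definition lie_rep :: "nat \<Rightarrow> (complex, 'v) module \<Rightarrow> (complex mat \<Rightarrow> 'v \<Rightarrow> 'v) \<Rightarrow> bool" where
  "lie_rep n M \<rho> \<longleftrightarrow>
     vectorspace class_ring M \<and>
     (\<forall>X\<in>lie_o n. \<rho> X \<in> module_hom class_ring M M) \<and>
     (\<forall>X\<in>lie_o n. \<forall>Y\<in>lie_o n. \<forall>v\<in>carrier M. \<rho> (X + Y) v = \<rho> X v \<oplus>\<^bsub>M\<^esub> \<rho> Y v) \<and>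
     (\<forall>c. \<forall>X\<in>lie_o n. \<forall>v\<in>carrier M. \<rho> (c \<cdot>\<^sub>m X) v = c \<odot>\<^bsub>M\<^esub> \<rho> X v) \<and>
     (\<forall>X\<in>lie_o n. \<forall>Y\<in>lie_o n. \<forall>v\<in>carrier M.
        \<rho> (X * Y - Y * X) v = \<rho> X (\<rho> Y v) \<ominus>\<^bsub>M\<^esub> \<rho> Y (\<rho> X v))"

definition irreducible_rep ::
    "nat \<Rightarrow> (complex, 'v) module \<Rightarrow> (complex mat \<Rightarrow> 'v \<Rightarrow> 'v) \<Rightarrow> bool" where
  "irreducible_rep n M \<rho> \<longleftrightarrow>
     lie_rep n M \<rho> \<and> carrier M \<noteq> {\<zero>\<^bsub>M\<^esub>} \<and>
     (\<forall>H. subspace class_ring H M \<and> (\<forall>X\<in>lie_o n. \<forall>h\<in>H. \<rho> X h \<in> H)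
        \<longrightarrow> H = {\<zero>\<^bsub>M\<^esub>} \<or> H = carrier M)"

text \<open>An integral weight is given by its coefficients with respect to the fundamental weights
  \<open>\<lambda>\<^sub>1, \<dots>, \<lambda>\<^sub>n\<close>, that is, by its values on the simple coroots.\<close>
type_synonym weight = "nat \<Rightarrow> int"

definition fund_weight :: "nat \<Rightarrow> weight" where
  "fund_weight k = (\<lambda>j. if j = k then 1 else 0)"

definition lambda_circ :: "nat \<Rightarrow> nat \<Rightarrow> weight" where
  "lambda_circ n k =
     (if k = 0 then (\<lambda>_. 0) else if k < n then fund_weight k else (\<lambda>j. 2 * fund_weight n j))"

definition highest_weight_vector ::
    "nat \<Rightarrow> (complex, 'v) module \<Rightarrow> (complex mat \<Rightarrow> 'v \<Rightarrow> 'v) \<Rightarrow> weight \<Rightarrow> 'v \<Rightarrow> bool" where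
  "highest_weight_vector n M \<rho> \<mu> v \<longleftrightarrow>
     v \<in> carrier M \<and> v \<noteq> \<zero>\<^bsub>M\<^esub> \<and>
     (\<forall>\<alpha>\<in>pos_roots n. \<rho> (map_mat of_int (root_vector n \<alpha>)) v = \<zero>\<^bsub>M\<^esub>) \<and>
     (\<forall>j\<in>{1..n}. \<rho> (map_mat of_int (coroot n (simple_root n j))) v = of_int (\<mu> j) \<odot>\<^bsub>M\<^esub> v)"

definition irreducible_hw_module ::
    "nat \<Rightarrow> (complex, 'v) module \<Rightarrow> (complex mat \<Rightarrow> 'v \<Rightarrow> 'v) \<Rightarrow> weight \<Rightarrow> 'v \<Rightarrow> bool" where
  "irreducible_hw_module n M \<rho> \<mu> v \<longleftrightarrow>
     irreducible_rep n M \<rho> \<and> highest_weight_vector n M \<rho> \<mu> v"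

text \<open>The action of the enveloping algebra: a coset acts through any of its representatives, the
  word \<open>X\<^sub>1 \<dots> X\<^sub>r\<close> acting as \<open>\<rho> X\<^sub>1 \<circ> \<dots> \<circ> \<rho> X\<^sub>r\<close>.\<close>
definition env_act ::
    "(complex, 'v) module \<Rightarrow> (complex mat \<Rightarrow> 'v \<Rightarrow> 'v) \<Rightarrow>
     (complex mat word \<Rightarrow>\<^sub>0 complex) set \<Rightarrow> 'v \<Rightarrow> 'v" where
  "env_act M \<rho> u v = the_elem
     ((\<lambda>p. \<Oplus>\<^bsub>M\<^esub>w\<in>Poly_Mapping.keys p. Poly_Mapping.lookup p w \<odot>\<^bsub>M\<^esub> foldr \<rho> (letters w) v) ` u)"


section \<open>Weyl modules\<close>

definition kostant_lattice ::
    "nat \<Rightarrow> (complex, 'v) module \<Rightarrow> (complex mat \<Rightarrow> 'v \<Rightarrow> 'v) \<Rightarrow> 'v \<Rightarrow> 'v set" where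
  "kostant_lattice n M \<rho> v = {env_act M \<rho> u v | u. u \<in> kostant_form n}"

definition weyl_module ::
    "nat \<Rightarrow> (complex, 'v) module \<Rightarrow> (complex mat \<Rightarrow> 'v \<Rightarrow> 'v) \<Rightarrow> 'v \<Rightarrow>
     ('f::field, ('v \<Rightarrow>\<^sub>0 'f) set) module" where
  "weyl_module n M \<rho> v = scalar_ext M (kostant_lattice n M \<rho> v)"

text \<open>The vector \<open>1 \<otimes> x\<close> of the Weyl module, and the action of \<open>1 \<otimes> u\<close> for \<open>u\<close> in the Kostant form.\<close>
definition weyl_vector ::
    "nat \<Rightarrow> (complex, 'v) module \<Rightarrow> (complex mat \<Rightarrow> 'v \<Rightarrow> 'v) \<Rightarrow> 'v \<Rightarrow> 'v \<Rightarrow> ('v \<Rightarrow>\<^sub>0 'f::field) set" where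
  "weyl_vector n M \<rho> v x =
     generator (kostant_lattice n M \<rho> v) (tensor_rels M (kostant_lattice n M \<rho> v)) x"

definition weyl_act ::
    "nat \<Rightarrow> (complex, 'v) module \<Rightarrow> (complex mat \<Rightarrow> 'v \<Rightarrow> 'v) \<Rightarrow> 'v \<Rightarrow>
     (complex mat word \<Rightarrow>\<^sub>0 complex) set \<Rightarrow> ('v \<Rightarrow>\<^sub>0 'f::field) set \<Rightarrow> ('v \<Rightarrow>\<^sub>0 'f) set" where
  "weyl_act n M \<rho> v u =
     presented_map (kostant_lattice n M \<rho> v) (tensor_rels M (kostant_lattice n M \<rho> v)) (env_act M \<rho> u)"

text \<open>\<open>\<Sum>\<^sub>m t\<^sup>m X\<^sub>\<alpha>\<^sup>m / m!\<close>, applied to \<open>x\<close>; only finitely many terms are nonzero.\<close>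
definition weyl_root_act ::
    "nat \<Rightarrow> (complex, 'v) module \<Rightarrow> (complex mat \<Rightarrow> 'v \<Rightarrow> 'v) \<Rightarrow> 'v \<Rightarrow>
     broot \<Rightarrow> 'f::field \<Rightarrow> ('v \<Rightarrow>\<^sub>0 'f) set \<Rightarrow> ('v \<Rightarrow>\<^sub>0 'f) set" where
  "weyl_root_act n M \<rho> v \<alpha> t x =
     (\<Oplus>\<^bsub>weyl_module n M \<rho> v\<^esub>
        m\<in>{m. weyl_act n M \<rho> v (divided_power n \<alpha> m) x \<noteq> \<zero>\<^bsub>weyl_module n M \<rho> v\<^esub>}.
        t ^ m \<odot>\<^bsub>weyl_module n M \<rho> v\<^esub> weyl_act n M \<rho> v (divided_power n \<alpha> m) x)"

text \<open>If \<open>F\<close> is not perfect, the root elements generate a proper normal subgroup of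
  \<open>SO(2n + 1, F)\<close>. In characteristic 2 they still determine \<open>\<sigma>\<close> for the weights
  \<^const>\<open>lambda_circ\<close>: two extensions differ by a character of the quotient, which is an
  elementary abelian 2-group, and so has only the trivial character with values in \<open>F\<close>.
  In particular \<open>\<sigma>\<close> is trivial for the weight 0.\<close>
definition weyl_group_action ::
    "nat \<Rightarrow> (complex, 'v) module \<Rightarrow> (complex mat \<Rightarrow> 'v \<Rightarrow> 'v) \<Rightarrow> 'v \<Rightarrow>
     ('f::field mat \<Rightarrow> ('v \<Rightarrow>\<^sub>0 'f) set \<Rightarrow> ('v \<Rightarrow>\<^sub>0 'f) set) \<Rightarrow> bool" where
  "weyl_group_action n M \<rho> v \<sigma> \<longleftrightarrow>
     is_gmodule (SO n) (weyl_module n M \<rho> v) \<sigma> \<and>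
     (\<forall>\<alpha>\<in>roots n. \<forall>t. \<forall>x\<in>carrier (weyl_module n M \<rho> v).
        \<sigma> (root_elem n \<alpha> t) x = weyl_root_act n M \<rho> v \<alpha> t x)"

definition grassmann_hom ::
    "nat \<Rightarrow> nat \<Rightarrow> (complex, 'v) module \<Rightarrow> (complex mat \<Rightarrow> 'v \<Rightarrow> 'v) \<Rightarrow> 'v \<Rightarrow>
     ('f::field mat \<Rightarrow> ('v \<Rightarrow>\<^sub>0 'f) set \<Rightarrow> ('v \<Rightarrow>\<^sub>0 'f) set) \<Rightarrow>
     (('v \<Rightarrow>\<^sub>0 'f) set \<Rightarrow> ('f vec list \<Rightarrow>\<^sub>0 'f) set) \<Rightarrow> bool" where
  "grassmann_hom n k M \<rho> v \<sigma> \<phi> \<longleftrightarrow>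
     \<phi> \<in> gmodule_hom (SO n) (weyl_module n M \<rho> v) \<sigma> (W_circ n k) (ext_power_act (2 * n + 1) k) \<and>
     \<phi> ` carrier (weyl_module n M \<rho> v) = carrier (W_circ n k) \<and>
     \<phi> ` module.span class_ring (weyl_module n M \<rho> v) {weyl_vector n M \<rho> v v} =
       module.span class_ring (ext_power (2 * n + 1) k)
         {wedge (2 * n + 1) (map (unit_vec (2 * n + 1)) [0..<k])}"

end

theory Submission
 imports Defs
begin

text \<open>The irreducible module of highest weight \<open>\<lambda>\<^sub>k\<^sup>\<circ>\<close> is realised inside the endomorphisms of the
 fermionic Fock space of \<open>n\<close> sites: the root vectors act as commutators with products of two
 Clifford generators, and the highest weight vector is \<open>e\<^sub>1 \<dots> e\<^sub>k\<close>. The Kostant lattice then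
 consists of integral matrices. It is primitive modulo 2, because it has rank at most
 \<open>(2n + 1 choose k)\<close> and contains lifts of as many matrices that are independent modulo 2;
 the latter are indexed by disjoint sets \<open>X\<close>, \<open>Y\<close> of sites together with a standard matching \<open>Q\<close>
 on the complement, \<open>|X| + |Y| + 2|Q| \<le> k\<close>. Hence in characteristic 2 the Weyl module embeds
 into one space of matrices for all \<open>k\<close>, with the image for \<open>k - 2\<close> contained in the image for \<open>k\<close>.
 Each of the basis matrices is a sum over tuples of singular vectors, so its image in the exterior power
 is computable: it vanishes when \<open>|X| + |Y| + 2|Q| \<le> k - 2\<close>, and the others stay independent.
 Thus the kernel and the smaller Weyl module have the same image. The group is generated by root
 elements and a torus; for the latter the action is determined up to a scalar of square 1.\<close>

text \<open>The shift by 2 has one source: the square of e_{2n+1} is 1 in the Clifford algebra and 0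
  in the exterior algebra. As a matrix such a filler is the parity operator, which is the identity
  modulo 2; hence the matrices found for k - 2 recur for k. In the exterior power one filler
  survives, but two of them give a repeated factor. Two obstacles shape the rest. The irreducible
  modules are given abstractly, so the comparison with the model is only a relation at first; a
  positive definite contravariant form shows that the vector determines the matrix, and
  irreducibility shows the converse. Over an imperfect field the root elements generate a proper
  subgroup, so the action of a torus element has to be pinned down by its commutation with what they
  do generate and by its square.\<close>

abbreviation cvec :: "nat => 'a vec set" where "cvec n \<equiv> carrier_vec (2*n+1)"
abbreviation cmat :: "nat => 'a mat set" where "cmat n \<equiv> carrier_mat (2*n+1) (2*n+1)"
abbreviation "pkeys \<equiv> Poly_Mapping.keys"
abbreviation "plookup \<equiv> Poly_Mapping.lookup"
abbreviation "psingle \<equiv> Poly_Mapping.single"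
abbreviation "pscale c \<equiv> Poly_Mapping.map ((*) c)"

section \<open>Operators on the fermionic Fock space\<close>

typedef (overloaded) 'a fock_op = "{f :: (nat set => 'a::comm_ring_1) => nat set => 'a.
  (\<forall>x y. f (%S. x S + y S) = (%S. f x S + f y S)) \<and>
  (\<forall>c x. f (%S. c*x S) = (%S. c*f x S))}"
 by (rule exI[of _ id]) auto

setup_lifting type_definition_fock_op

instantiation fock_op :: (comm_ring_1) ring_1
begin
lift_definition zero_fock_op :: "'a fock_op" is "%_ _. 0" by simp
lift_definition one_fock_op :: "'a fock_op" is "%f. f" by simp
lift_definition plus_fock_op :: "'a fock_op => 'a fock_op => 'a fock_op"
 is "%A B f S. A f S + B f S" by (simp add: algebra_simps)
lift_definition minus_fock_op :: "'a fock_op => 'a fock_op => 'a fock_op"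
 is "%A B f S. A f S - B f S" by (simp add: algebra_simps)
lift_definition uminus_fock_op :: "'a fock_op => 'a fock_op"
 is "%A f S. - A f S" by simp
lift_definition times_fock_op :: "'a fock_op => 'a fock_op => 'a fock_op"
 is "%A B f. A (B f)" by simp
instance
proof
 show "(0 :: 'a fock_op) ~= 1"
  by transfer (metis zero_neq_one)
qed (transfer; simp add: algebra_simps fun_eq_iff)+
end

text \<open>Scalars enter as central operators, so that a single ring carries the whole
  computation.\<close>

lift_definition scal :: "'a::comm_ring_1 => 'a fock_op" is "%c f S. c*f S"
 by (simp add: algebra_simps)

lemma scal_add: "scal (a + b) = scal a + scal b"
 and scal_diff: "scal (a - b) = scal a - scal b"
 and scal_minus: "scal (- a) = - scal a"
 and scal_mult: "scal (a*b) = scal a * scal b"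
 and scal_0 [simp]: "scal 0 = 0"
 and scal_1 [simp]: "scal 1 = 1"
 by (transfer; simp add: algebra_simps fun_eq_iff)+

lemma scal_commute: "A * scal c = scal c*A"
 by transfer (simp add: fun_eq_iff)

lemma scal_left_commute: "A*(scal c*B) = scal c*(A*B)"
 by (metis mult.assoc scal_commute)

lemma scal_sum: "scal (sum f I) = (\<Sum>i\<in>I. scal (f i))"
 by (induct I rule: infinite_finite_induct) (auto simp: scal_add)

lemma scal_of_nat [simp]: "scal (of_nat k) = of_nat k"
 by (induct k) (auto simp: scal_add)

lemma scal_of_int [simp]: "scal (of_int k) = of_int k"
 by (cases k) (auto simp: scal_minus scal_add scal_diff)

text \<open>The Jordan-Wigner sign, which makes operators at different sites anticommute.\<close>

definition sgn_below :: "nat => nat set => 'a::comm_ring_1" where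
 "sgn_below i S = (- 1) ^ card {j : S. j < i}"

lemma sgn_below_insert:
 "j ~: S ==> sgn_below i (insert j S) = (if j < i then - sgn_below i S else sgn_below i S)"
proof -
 assume "j ~: S"
 have "{k : insert j S. k < i} = (if j < i then insert j {k : S. k < i} else {k : S. k < i})"
  by auto
 with \<open>j \<notin> S\<close> show ?thesis by (simp add: sgn_below_def)
qed

lemma sgn_below_remove:
 "j : S ==> sgn_below i (S - {j}) = (if j < i then - sgn_below i S else sgn_below i S :: 'a::comm_ring_1)"
 using sgn_below_insert[of j "S - {j}" i, where 'a='a]
 by (simp add: insert_absorb)

lemma sgn_below_sq [simp]: "sgn_below i S * sgn_below i S = (1 :: 'a::comm_ring_1)"
 by (simp add: sgn_below_def flip: power_add mult_2)

lemma sgn_below_sq' [simp]: "sgn_below i S*(sgn_below i S*x) = (x :: 'a::comm_ring_1)"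
 by (simp flip: mult.assoc)

text \<open>Operators act on coefficient functions: creation at \<open>i\<close> reads the
  coefficient of the set without \<open>i\<close>, annihilation that of the set with
  \<open>i\<close>.\<close>

lift_definition cre :: "nat => 'a::comm_ring_1 fock_op"
 is "%i f S. if i : S then sgn_below i S*f (S - {i}) else 0"
 by (auto simp: algebra_simps fun_eq_iff)

lift_definition ann :: "nat => 'a::comm_ring_1 fock_op"
 is "%i f S. if i : S then 0 else sgn_below i S*f (insert i S)"
 by (auto simp: algebra_simps fun_eq_iff)

text \<open>Parity of the number of occupied sites below \<open>n\<close>. It anticommutes with the
  operators at those sites and squares to 1, as the image of e_{2n+1} must.\<close>

lift_definition par :: "nat => 'a::comm_ring_1 fock_op"
 is "%n f S. (- 1) ^ card (S \<inter> {..<n})*f S"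
 by (auto simp: algebra_simps fun_eq_iff)

lemma cre_sq: "cre i*cre i = 0"
 by transfer (simp add: fun_eq_iff)

lemma ann_sq: "ann i*ann i = 0"
 by transfer (simp add: fun_eq_iff)

lemma par_sq: "par n*par n = 1"
 by transfer (simp add: fun_eq_iff flip: mult.assoc power_add mult_2)

lemma cre_cre: "cre i*cre j + cre j*cre i = (0 :: 'a::comm_ring_1 fock_op)"
proof -
 have lt: "cre i*cre j + cre j*cre i = (0 :: 'a fock_op)" if "i < j" for i j
 proof -
  have "(if i : S then sgn_below i S*(if j : S - {i} then sgn_below j (S - {i})*f (S - {i} - {j}) else 0) else 0) +
   (if j : S then sgn_below j S*(if i : S - {j} then sgn_below i (S - {j})*f (S - {j} - {i}) else 0) else 0) = 0"
   for f :: "nat set => 'a" and S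
  proof -
   have eq: "S - {j} - {i} = S - {i} - {j}" by blast
   show ?thesis unfolding eq using that by (simp add: sgn_below_remove)
  qed
  then show ?thesis by transfer (intro ext)
 qed
 show ?thesis
  using lt[of i j] lt[of j i] by (cases i j rule: linorder_cases) (auto simp: cre_sq add.commute)
qed

lemma ann_ann: "ann i*ann j + ann j*ann i = (0 :: 'a::comm_ring_1 fock_op)"
proof -
 have lt: "ann i*ann j + ann j*ann i = (0 :: 'a fock_op)" if "i < j" for i j
 proof -
  have "(if i : S then 0 else sgn_below i S*(if j : insert i S then 0 else sgn_below j (insert i S)*f (insert j (insert i S)))) +
   (if j : S then 0 else sgn_below j S*(if i : insert j S then 0 else sgn_below i (insert j S)*f (insert i (insert j S)))) = 0"
   for f :: "nat set => 'a" and S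
  proof -
   have eq: "insert j (insert i S) = insert i (insert j S)" by blast
   show ?thesis unfolding eq using that by (simp add: sgn_below_insert)
  qed
  then show ?thesis by transfer (intro ext)
 qed
 show ?thesis
  using lt[of i j] lt[of j i] by (cases i j rule: linorder_cases) (auto simp: ann_sq add.commute)
qed

lemma cre_ann_same: "cre i*ann i + ann i*cre i = 1"
 by transfer (auto simp: fun_eq_iff sgn_below_insert sgn_below_remove insert_absorb simp flip: mult.assoc)

lemma cre_ann:
 assumes "i ~= j"
 shows "cre i*ann j + ann j*cre i = (0 :: 'a::comm_ring_1 fock_op)"
proof -
 have "(if i : S then sgn_below i S*(if j : S - {i} then 0 else sgn_below j (S - {i})*f (insert j (S - {i}))) else 0) +
  (if j : S then 0 else sgn_below j S*(if i : insert j S then sgn_below i (insert j S)*f (insert j S - {i}) else 0)) = 0"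
  for f :: "nat set => 'a" and S
 proof -
  have eq: "insert j (S - {i}) = insert j S - {i}" using assms by blast
  show ?thesis
   unfolding eq using assms by (cases "i < j") (simp_all add: sgn_below_insert sgn_below_remove)
 qed
 then show ?thesis by transfer (intro ext)
qed

lemma card_remove_below: "i : S ==> i < (n::nat) ==> card (S \<inter> {..<n}) = Suc (card ((S - {i}) \<inter> {..<n}))"
proof -
 assume "i : S" "i < n"
 then have "S \<inter> {..<n} = insert i ((S - {i}) \<inter> {..<n})" by auto
 then have "card (S \<inter> {..<n}) = card (insert i ((S - {i}) \<inter> {..<n}))" by (rule arg_cong)
 also have "... = Suc (card ((S - {i}) \<inter> {..<n}))" by (rule card_insert_disjoint) auto
 finally show ?thesis .
qed

lemma cre_par: "i < n ==> cre i*par n + par n*cre i = 0"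
 by transfer (auto simp: fun_eq_iff card_remove_below algebra_simps)

lemma ann_par: "i < n ==> ann i*par n + par n*ann i = 0"
 by transfer (auto simp: fun_eq_iff algebra_simps)

subsection \<open>The Clifford algebra of the quadratic form\<close>

definition gen :: "nat => nat => 'a::comm_ring_1 fock_op" where
 "gen n j = (if j < n then cre j else if j < 2*n then ann (j - n) else par n)"

text \<open>The bilinear form of \<^const>\<open>qform\<close> on basis vectors.\<close>
definition bm :: "nat => nat => nat => nat" where
 "bm n i j = (if i = 2*n & j = 2*n then 2
   else if i < 2*n & j < 2*n & (i + n = j \<or> j + n = i) then 1 else 0)"

lemma bm_commute: "bm n i j = bm n j i"
 by (auto simp: bm_def)

text \<open>The Clifford relations in polarized form. In characteristic 2 they lose the squares of
  the generators, which are recorded separately in \<open>gen_isotropic_sq\<close> and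
  \<open>gen_last_sq\<close>.\<close>

lemma gen_anticomm:
 assumes "i < 2*n+1" "j < 2*n+1"
 shows "gen n i*gen n j + gen n j*gen n i = (of_nat (bm n i j) :: 'a::comm_ring_1 fock_op)"
proof -
 have sym: "gen n i*gen n j + gen n j*gen n i = (of_nat (bm n i j) :: 'a fock_op)"
  if ij: "i \<le> j" "j < 2*n+1" for i j
 proof -
  consider (1) "j < n" | (2) "n \<le> j" "j < 2*n" | (3) "j = 2*n"
   using ij by linarith
  then show ?thesis
  proof cases
   case 1
   then show ?thesis using ij by (simp add: gen_def bm_def cre_cre)
  next
   case 2
   show ?thesis
   proof (cases "i < n")
    case True
    then show ?thesis using 2 ij
     by (cases "j = i + n") (simp_all add: gen_def bm_def cre_ann_same cre_ann)
   next
    case False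
    then show ?thesis using 2 ij by (simp add: gen_def bm_def ann_ann)
   qed
  next
   case 3
   consider (a) "i < n" | (b) "n \<le> i" "i < 2*n" | (c) "i = 2*n"
    using ij 3 by linarith
   then show ?thesis
   proof cases
    case a
    then show ?thesis using 3 by (simp add: gen_def bm_def cre_par)
   next
    case b
    then have "i - n < n" by linarith
    then show ?thesis using b 3 ann_par[of "i - n" n] by (simp add: gen_def bm_def)
   next
    case c
    then show ?thesis using 3 by (simp add: gen_def bm_def par_sq)
   qed
  qed
 qed
 show ?thesis
  using sym[of i j] sym[of j i] assms by (cases "i \<le> j") (simp_all add: bm_commute add.commute)
qed

definition ad :: "'r::ring_1 => 'r => 'r" where
 "ad a b = a*b - b*a"

lemma ad_add_right: "ad a (b + c) = ad a b + ad a c"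
 and ad_add_left: "ad (a + b) c = ad a c + ad b c"
 and ad_diff_right: "ad a (b - c) = ad a b - ad a c"
 and ad_diff_left: "ad (a - b) c = ad a c - ad b c"
 and ad_minus_right: "ad a (- b) = - ad a b"
 and ad_0_right [simp]: "ad a 0 = 0"
 and ad_0_left [simp]: "ad 0 a = 0"
 and ad_1_right [simp]: "ad a 1 = 0"
 and ad_mult_right: "ad a (b*c) = ad a b*c + b*ad a c"
 and ad_anti: "ad a b = - ad b a"
 and ad_Jacobi: "ad (ad a b) c = ad a (ad b c) - ad b (ad a c)"
 by (simp_all add: ad_def algebra_simps)

lemma ad_sum_right: "ad a (sum f I) = (\<Sum>i\<in>I. ad a (f i))"
 by (induct I rule: infinite_finite_induct) (auto simp: ad_add_right)

lemma ad_scal_right: "ad a (scal c*b) = scal c*ad a b"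
 by (simp add: ad_def right_diff_distrib scal_left_commute mult.assoc)

lemma ad_scal_left: "ad (scal c*a) b = scal c*ad a b"
 by (simp add: ad_def right_diff_distrib scal_left_commute mult.assoc)

lemma ad_scal: "ad a (scal c) = 0" "ad (scal c) a = 0"
 by (simp_all add: ad_def scal_commute)

text \<open>Since [ab, c] = a{b, c} - {a, c}b, commutators with products of two generators preserve
  the span of the generators; this is how the orthogonal Lie algebra acts on the natural
  module.\<close>

lemma ad_gen_gen:
 assumes "a < 2*n+1" "b < 2*n+1" "j < 2*n+1"
 shows "ad (gen n a*gen n b) (gen n j) =
  of_nat (bm n b j)*gen n a - (of_nat (bm n a j)*gen n b :: 'a::comm_ring_1 fock_op)"
proof -
 have "ad (gen n a*gen n b) (gen n j) = gen n a*(gen n b*gen n j + gen n j*gen n b)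
   - (gen n a*gen n j + gen n j*gen n a)*(gen n b :: 'a fock_op)"
  by (simp add: ad_def algebra_simps)
 then show ?thesis
  using assms by (simp add: gen_anticomm) (metis mult_of_nat_commute)
qed

text \<open>Every root vector acts on the vector space as the commutator with a product of two of the
 generators of the Clifford algebra.\<close>
fun root_pair :: "nat => broot => nat \<times> nat" where
 "root_pair n (Diff i j) = (i, n + j)"
| "root_pair n (Plus i j) = (i, j)"
| "root_pair n (Minus i j) = (n + j, n + i)"
| "root_pair n (Short i) = (i, 2*n)"
| "root_pair n (NegShort i) = (2*n, n + i)"

definition rsp :: "nat => broot => 'a::comm_ring_1 fock_op" where
 "rsp n \<alpha> = gen n (fst (root_pair n \<alpha>))*gen n (snd (root_pair n \<alpha>))"

text \<open>The two indices of a root are distinct and orthogonal, and an index other than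
  \<open>2*n\<close> is isotropic. Most later arguments about roots rest on these facts, which
  avoids distinguishing the five kinds.\<close>

lemma root_pair_bounds:
 assumes "\<alpha> : roots n" "root_pair n \<alpha> = (a, b)"
 shows "a < 2*n+1" "b < 2*n+1" "bm n a b = 0" "a ~= b"
  "a = 2*n \<or> bm n a a = 0" "b = 2*n \<or> bm n b b = 0" "bm n b a = 0"
 using assms by (auto simp: roots_def bm_def)

lemma bm_low: "j < n ==> bm n j s = (if s = n + j then 1 else 0)"
 and bm_high: "j < n ==> bm n (n + j) s = (if s = j then 1 else 0)"
 and bm_mid: "bm n (2*n) s = (if s = 2*n then 2 else 0)"
 by (auto simp: bm_def)

lemma root_vector_index:
 assumes "\<alpha> : roots n" "root_pair n \<alpha> = (a, b)" "r < 2*n+1" "s < 2*n+1"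
 shows "root_vector n \<alpha> $$ (r, s) =
  (if r = a then int (bm n b s) else 0) - (if r = b then int (bm n a s) else 0)"
proof -
 have "root_vector n \<alpha> $$ (r, s) =
  (if r = fst (root_pair n \<alpha>) then int (bm n (snd (root_pair n \<alpha>)) s) else 0) -
  (if r = snd (root_pair n \<alpha>) then int (bm n (fst (root_pair n \<alpha>)) s) else 0)"
  using assms(1,3,4)
  by (cases \<alpha>) (simp_all add: roots_def mat_unit_def bm_low bm_high bm_mid)
 then show ?thesis by (simp add: assms(2))
qed

lemma root_vector_carrier [simp]: "root_vector n \<alpha> : cmat n"
 by (cases \<alpha>) (auto simp: mat_unit_def)

lemma ad_rsp_gen:
 assumes "\<alpha> : roots n" "j < 2*n+1"
 shows "ad (rsp n \<alpha>) (gen n j) =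
  (\<Sum>i<2*n+1. of_int (root_vector n \<alpha> $$ (i, j))*(gen n i :: 'a::comm_ring_1 fock_op))"
proof -
 obtain a b where ab: "root_pair n \<alpha> = (a, b)" by fastforce
 note bd = root_pair_bounds[OF assms(1) ab]
 have "(\<Sum>i<2*n+1. of_int (root_vector n \<alpha> $$ (i, j))*(gen n i :: 'a fock_op)) =
  (\<Sum>i<2*n+1. (if i = a then of_nat (bm n b j)*gen n a else 0) - (if i = b then of_nat (bm n a j)*gen n b else 0))"
  by (rule sum.cong) (auto simp: root_vector_index[OF assms(1) ab _ assms(2)])
 also have "... = of_nat (bm n b j)*gen n a - of_nat (bm n a j)*gen n b"
  using bd by (simp add: sum_subtractf)
 finally show ?thesis
  using bd ab assms(2) by (simp add: rsp_def ad_gen_gen)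
qed

lemma gen_isotropic_sq: "j < 2*n ==> gen n j*gen n j = (0 :: 'a::comm_ring_1 fock_op)"
 by (auto simp: gen_def cre_sq ann_sq)

text \<open>Moving the inner factors past each other leaves the product of two squares, and at least
  one index is isotropic. Hence the divided powers of the commutator vanish above the second, and
  the exponential is conjugation by the unit \<open>1 + scal t*rsp n \<alpha>\<close>.\<close>

lemma rsp_sq:
 assumes "\<alpha> : roots n"
 shows "rsp n \<alpha>*rsp n \<alpha> = (0 :: 'a::comm_ring_1 fock_op)"
proof -
 obtain a b where ab: "root_pair n \<alpha> = (a, b)" by fastforce
 note bd = root_pair_bounds[OF assms(1) ab]
 have "gen n a*gen n b + gen n b*gen n a = (0 :: 'a fock_op)"
  using bd gen_anticomm[of a n b] by simp
 then have *: "gen n b*gen n a = - (gen n a*gen n b :: 'a fock_op)"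
  by (simp add: add_eq_0_iff)
 have "rsp n \<alpha>*rsp n \<alpha> = gen n a*(gen n b*gen n a)*(gen n b :: 'a fock_op)"
  by (simp add: rsp_def ab mult.assoc)
 also have "... = - (gen n a*gen n a)*(gen n b*gen n b)"
  by (simp add: * mult.assoc)
 also have "... = 0"
 proof (cases "a = 2*n")
  case True
  then have "b < 2*n" using bd by simp
  then show ?thesis by (simp add: gen_isotropic_sq)
 next
  case False
  then show ?thesis using bd by (simp add: gen_isotropic_sq)
 qed
 finally show ?thesis .
qed

subsection \<open>Matrix entries\<close>

lift_definition ent :: "'a::comm_ring_1 fock_op => nat set => nat set => 'a"
 is "%A T S. A (%Z. of_bool (Z = S)) T" .

lemma ent_add: "ent (A + B) T S = ent A T S + ent B T S"
 and ent_diff: "ent (A - B) T S = ent A T S - ent B T S"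
 and ent_minus: "ent (- A) T S = - ent A T S"
 and ent_scal: "ent (scal c*A) T S = c*ent A T S"
 and ent_0 [simp]: "ent 0 T S = 0"
 and ent_1: "ent 1 T S = of_bool (T = S)"
 by (transfer; simp)+

text \<open>Multiplication by a generator, written on bare matrices. Restriction to \<open>n\<close>
  sites, integrality and reduction modulo 2 then become statements about functions instead of
  operators over different rings.\<close>

definition lgen :: "nat => nat => (nat set => nat set => 'a::comm_ring_1) => nat set => nat set => 'a" where
 "lgen n j F T S =
  (if j < n then (if j : T then sgn_below j T*F (T - {j}) S else 0)
   else if j < 2*n then (if j - n : T then 0 else sgn_below (j - n) T*F (insert (j - n) T) S)
   else (- 1) ^ card (T \<inter> {..<n})*F T S)"

definition rgen :: "nat => nat => (nat set => nat set => 'a::comm_ring_1) => nat set => nat set => 'a" where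
 "rgen n j F T S =
  (if j < n then (if j : S then 0 else sgn_below j S*F T (insert j S))
   else if j < 2*n then (if j - n : S then sgn_below (j - n) S*F T (S - {j - n}) else 0)
   else (- 1) ^ card (S \<inter> {..<n})*F T S)"

lemma ent_gen_mult: "ent (gen n j*A) = lgen n j (ent A)"
proof -
 have "ent (gen n j*A) T S = lgen n j (ent A) T S" for T S
  unfolding gen_def lgen_def
  by (simp add: ent.rep_eq times_fock_op.rep_eq cre.rep_eq ann.rep_eq par.rep_eq)
 then show ?thesis by (simp add: fun_eq_iff)
qed

lemma ent_apply_delta:
 assumes "!!Z. B (%Z. of_bool (Z = S)) Z = c*of_bool (Z = S')"
 shows "Rep_fock_op A (B (%Z. of_bool (Z = S))) T = c*ent A T S'"
proof -
 have "B (%Z. of_bool (Z = S)) = (%Z. c*of_bool (Z = S'))"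
  using assms by auto
 moreover have "Rep_fock_op A (%Z. c*of_bool (Z = S')) T = c * Rep_fock_op A (%Z. of_bool (Z = S')) T"
  using Rep_fock_op[of A] by simp
 ultimately show ?thesis by (simp add: ent.rep_eq mult.commute)
qed

lemma ent_mult_gen: "ent (A*gen n j) = rgen n j (ent A)"
proof -
 have c: "ent (A*cre i) T S = (if i : S then 0 else sgn_below i S*ent A T (insert i S))" for i T S
 proof -
  have *: "Rep_fock_op (cre i) (%Z. of_bool (Z = S)) Z
   = (if i : S then 0 else sgn_below i S :: 'a)*of_bool (Z = insert i S)" for Z
   by (auto simp: cre.rep_eq sgn_below_insert)
  show ?thesis
   using ent_apply_delta[where B = "Rep_fock_op (cre i)", OF *, of A T]
   by (simp add: ent.rep_eq times_fock_op.rep_eq mult.commute)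
 qed
 have a: "ent (A*ann i) T S = (if i : S then sgn_below i S*ent A T (S - {i}) else 0)" for i T S
 proof -
  have *: "Rep_fock_op (ann i) (%Z. of_bool (Z = S)) Z
   = (if i : S then sgn_below i S else 0 :: 'a)*of_bool (Z = S - {i})" for Z
   by (auto simp: ann.rep_eq sgn_below_insert sgn_below_remove insert_absorb)
  show ?thesis
   using ent_apply_delta[where B = "Rep_fock_op (ann i)", OF *, of A T]
   by (simp add: ent.rep_eq times_fock_op.rep_eq mult.commute)
 qed
 have p: "ent (A*par n) T S = (- 1) ^ card (S \<inter> {..<n})*ent A T S" for T S
 proof -
  have *: "Rep_fock_op (par n) (%Z. of_bool (Z = S)) Z
   = ((- 1) ^ card (S \<inter> {..<n}) :: 'a)*of_bool (Z = S)" for Z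
   by (auto simp: par.rep_eq)
  show ?thesis
   using ent_apply_delta[where B = "Rep_fock_op (par n)", OF *, of A T]
   by (simp add: ent.rep_eq times_fock_op.rep_eq mult.commute)
 qed
 have "ent (A*gen n j) T S = rgen n j (ent A) T S" for T S
  unfolding gen_def rgen_def
  by (cases "j < n"; cases "j < 2*n"; simp add: c a p)
 then show ?thesis by (simp add: fun_eq_iff)
qed

section \<open>The Lie algebra and its root vectors\<close>

declare sum.lessThan_Suc [simp del]

text \<open>The form pairs the basis vector \<open>r\<close> with \<open>du n r\<close> only, and
  the value is \<open>bw n r\<close>.\<close>

definition du :: "nat => nat => nat" where
 "du n r = (if r < n then n + r else if r < 2*n then r - n else r)"

definition bw :: "nat => nat => nat" where
 "bw n r = (if r = 2*n then 2 else 1)"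

lemma du_bound: "r < 2*n+1 ==> du n r < 2*n+1"
 and du_du [simp]: "du n (du n r) = r"
 and bw_du [simp]: "bw n (du n r) = bw n r"
 by (auto simp: du_def bw_def)

lemma du_eq_iff [simp]: "du n r = du n s \<longleftrightarrow> r = s"
 by (metis du_du)

lemma bm_du: "r < 2*n+1 ==> s < 2*n+1 ==> bm n r s = (if s = du n r then bw n r else 0)"
 by (auto simp: bm_def du_def bw_def)

text \<open>The endomorphism given by the bivector of the basis vectors \<open>a\<close> and
  \<open>b\<close>: it sends x to (e_b, x) e_a - (e_a, x) e_b. The root vectors and the Cartan
  elements \<open>hmat\<close> all have this form.\<close>

definition gmat :: "nat => nat => nat => 'a::comm_ring_1 mat" where
 "gmat n a b = mat (2*n+1) (2*n+1) (%(r, s).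
   (if r = a then of_nat (bm n b s) else 0) - (if r = b then of_nat (bm n a s) else 0))"

lemma gmat_carrier [simp]: "gmat n a b : cmat n"
 and gmat_carrier_Suc [simp]: "gmat n a b : carrier_mat (Suc (2*n)) (Suc (2*n))"
 and gmat_dim [simp]: "dim_row (gmat n a b) = 2*n+1" "dim_col (gmat n a b) = 2*n+1"
 and gmat_index: "r < 2*n+1 ==> s < 2*n+1 ==> gmat n a b $$ (r, s) =
   (if r = a then of_nat (bm n b s) else 0) - (if r = b then of_nat (bm n a s) else 0)"
 by (auto simp: gmat_def)

lemma root_vector_gmat:
 assumes "\<alpha> : roots n" "root_pair n \<alpha> = (a, b)"
 shows "root_vector n \<alpha> = gmat n a b"
 using assms root_vector_carrier[of n \<alpha>]
 by (intro eq_matI) (auto simp: root_vector_index gmat_index simp del: root_vector_carrier)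

definition crv :: "nat => broot => complex mat" where
 "crv n \<alpha> = map_mat of_int (root_vector n \<alpha>)"

lemma crv_gmat: "\<alpha> : roots n ==> root_pair n \<alpha> = (a, b) ==> crv n \<alpha> = gmat n a b"
 by (intro eq_matI) (auto simp: crv_def root_vector_gmat gmat_index)

text \<open>Diagonal with 1 at \<open>i\<close> and -1 at \<open>n + i\<close>, so that its
  eigenvalue on a weight vector is the coordinate of the weight at \<epsilon>_i.\<close>

definition hmat :: "nat => nat => complex mat" where
 "hmat n i = gmat n i (n + i)"

lemma gmat_swap: "gmat n b a = (- 1) \<cdot>\<^sub>m (gmat n a b :: 'a::comm_ring_1 mat)"
 by (intro eq_matI) (auto simp: gmat_index)

lemma gmat_cases:
 assumes "a < 2*n+1" "b < 2*n+1" "a ~= b"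
 obtains \<alpha> where "\<alpha> : roots n" "root_pair n \<alpha> = (a, b) \<or> root_pair n \<alpha> = (b, a)"
 | i where "i < n" "(a, b) = (i, n + i) \<or> (b, a) = (i, n + i)"
proof -
 have main: thesis if ab: "a < b" "b < 2*n+1"
  and r: "!!\<alpha>. \<alpha> : roots n ==> root_pair n \<alpha> = (a, b) \<or> root_pair n \<alpha> = (b, a) ==> thesis"
  and h: "!!i. i < n ==> (a, b) = (i, n + i) \<or> (b, a) = (i, n + i) ==> thesis" for a b thesis
 proof -
  consider (1) "b < n" | (2) "a < n" "n \<le> b" "b < 2*n" | (3) "n \<le> a" "b < 2*n"
   | (4) "a < n" "b = 2*n" | (5) "n \<le> a" "b = 2*n"
   using ab by linarith
  then show thesis
  proof cases
   case 1
   then show thesis using r[of "Plus a b"] ab by (auto simp: roots_def)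
  next
   case 2
   show thesis
   proof (cases "b = n + a")
    case True
    then show thesis using h[of a] 2 by auto
   next
    case False
    then have "Diff a (b - n) : roots n" "n + (b - n) = b" using 2 by (auto simp: roots_def)
    then show thesis using r[of "Diff a (b - n)"] by auto
   qed
  next
   case 3
   then have "Minus (a - n) (b - n) : roots n" "n + (b - n) = b" "n + (a - n) = a"
    using ab by (auto simp: roots_def)
   then show thesis using r[of "Minus (a - n) (b - n)"] by auto
  next
   case 4
   then show thesis using r[of "Short a"] by (auto simp: roots_def)
  next
   case 5
   then have "NegShort (a - n) : roots n" "n + (a - n) = a"
    using ab by (auto simp: roots_def)
   then show thesis using r[of "NegShort (a - n)"] 5 by auto
  qed
 qed
 show thesis
 proof (cases "a < b")
  case True
  then show thesis using main[of a b] assms that by blast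
 next
  case False
  then show thesis using main[of b a] assms that by (metis linorder_neqE_nat)
 qed
qed

lemma bilform_expand:
 assumes "x : cvec n" "y : cvec n"
 shows "bilform n x y = (\<Sum>i<n. x $ i*y $ (n + i) + x $ (n + i)*y $ i)
  + 2*x $ (2*n)*y $ (2*n)"
proof -
 have "bilform n x y = (\<Sum>i<n. (x $ i + y $ i)*(x $ (n + i) + y $ (n + i)))
  - (\<Sum>i<n. x $ i*x $ (n + i)) - (\<Sum>i<n. y $ i*y $ (n + i)) + 2*x $ (2*n)*y $ (2*n)"
  using assms by (simp add: bilform_def qform_def power2_eq_square algebra_simps)
 also have "... = (\<Sum>i<n. x $ i*y $ (n + i) + x $ (n + i)*y $ i) + 2*x $ (2*n)*y $ (2*n)"
 proof -
  have "(\<Sum>i<n. y $ i*x $ (n + i)) = (\<Sum>i<n. x $ (n + i)*y $ i)" by (simp add: mult.commute)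
  then show ?thesis by (simp add: distrib_left distrib_right sum.distrib)
 qed
 finally show ?thesis .
qed

lemma sum_split_2n1: "(\<Sum>i<2*n+(1::nat). f i) = (\<Sum>i<n. f i + f (n + i)) + (f (2*n) :: 'a::comm_monoid_add)"
proof -
 have "(\<Sum>i<2*n+1. f i) = (\<Sum>i<n + n. f i) + f (2*n)"
  by (simp add: mult_2 sum.lessThan_Suc)
 also have "(\<Sum>i<n + m. f i) = (\<Sum>i<n. f i) + (\<Sum>i<m. f (n + i))" for m
  by (induct m) (auto simp: add.assoc sum.lessThan_Suc)
 finally show ?thesis by (simp add: sum.distrib)
qed

text \<open>The bilinear form of the basis vector \<open>a\<close> with \<open>x\<close>.\<close>

definition bcov :: "nat => nat => 'a::comm_ring_1 vec => 'a" where
 "bcov n a x = of_nat (bw n a)*x $ du n a"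

lemma bilform_bcov:
 assumes "x : cvec n" "y : cvec n"
 shows "bilform n x y = (\<Sum>r<2*n+1. x $ r*bcov n r y)"
 unfolding bilform_expand[OF assms] sum_split_2n1
 by (simp add: bcov_def bw_def du_def algebra_simps)

lemma bilform_unit:
 assumes "x : cvec n" "i < 2*n+1"
 shows "bilform n x (unit_vec (2*n+1) i) = bcov n i x"
  and "bilform n (unit_vec (2*n+1) i) x = bcov n i x"
proof -
 have "bilform n (unit_vec (2*n+1) i) x = (\<Sum>r<2*n+1. if r = i then bcov n i x else 0)"
  unfolding bilform_bcov[OF unit_vec_carrier assms(1)] using assms(2)
  by (intro sum.cong) auto
 then show *: "bilform n (unit_vec (2*n+1) i) x = bcov n i x"
  using assms(2) by simp
 have "x + y = y + x" if "y : cvec n" for y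
  using assms(1) that by (rule comm_add_vec)
 then show "bilform n x (unit_vec (2*n+1) i) = bcov n i x"
  using * by (simp add: bilform_def algebra_simps)
qed

lemma bcov_sum:
 assumes "a < 2*n+1"
 shows "bcov n a x = (\<Sum>s<2*n+1. of_nat (bm n a s)*x $ s)"
proof -
 have "(\<Sum>s<2*n+1. of_nat (bm n a s)*x $ s) = (\<Sum>s<2*n+1. if s = du n a then of_nat (bw n a)*x $ s else 0)"
  using assms by (intro sum.cong) (auto simp: bm_du)
 then show ?thesis
  using du_bound[OF assms] by (simp add: bcov_def)
qed

lemma gmat_mult_vec:
 assumes "x : cvec n" "a < 2*n+1" "b < 2*n+1" "r < 2*n+1"
 shows "(gmat n a b *\<^sub>v x) $ r =
  (if r = a then bcov n b x else 0) - (if r = b then bcov n a x else 0)"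
proof -
 have "(gmat n a b *\<^sub>v x) $ r = (\<Sum>s<2*n+1. gmat n a b $$ (r, s)*x $ s)"
  using assms by (simp add: scalar_prod_def atLeast0LessThan)
 also have "... = (if r = a then bcov n b x else 0) - (if r = b then bcov n a x else 0)"
  using assms by (simp add: gmat_index bcov_sum left_diff_distrib sum_subtractf)
 finally show ?thesis .
qed

lemma gmat_lie_o:
 assumes "a < 2*n+1" "b < 2*n+1"
 shows "gmat n a b : lie_o n"
proof -
 have *: "bilform n (gmat n a b *\<^sub>v x) y = bcov n b x*bcov n a y - bcov n a x*bcov n b y"
  if "x : cvec n" "y : cvec n" for x y :: "complex vec"
 proof -
  have "gmat n a b *\<^sub>v x : cvec n" by (simp add: carrier_vecI)
  then have "bilform n (gmat n a b *\<^sub>v x) y = (\<Sum>r<2*n+1. (gmat n a b *\<^sub>v x) $ r*bcov n r y)"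
   using that(2) by (rule bilform_bcov)
  also have "... = (\<Sum>r<2*n+1. (if r = a then bcov n b x*bcov n a y else 0)
    - (if r = b then bcov n a x*bcov n b y else 0))"
   by (intro sum.cong) (auto simp: gmat_mult_vec[OF that(1) assms] algebra_simps simp del: index_mult_mat_vec)
  also have "... = bcov n b x*bcov n a y - bcov n a x*bcov n b y"
   using assms by (simp add: sum_subtractf)
  finally show ?thesis .
 qed
 have comm: "bilform n x y = bilform n y x"
  if "x : cvec n" "y : cvec n" for x y :: "complex vec"
  using comm_add_vec[OF that] by (simp add: bilform_def algebra_simps)
 have "bilform n (gmat n a b *\<^sub>v x) y + bilform n x (gmat n a b *\<^sub>v y) = 0"
  if "x : cvec n" "y : cvec n" for x y :: "complex vec"
 proof -
  have "gmat n a b *\<^sub>v y : cvec n" by (simp add: carrier_vecI)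
  then show ?thesis using that by (simp add: * comm[of x])
 qed
 then show ?thesis by (simp add: lie_o_def)
qed

lemma lie_o_carrier: "A : lie_o n ==> A : cmat n"
 by (simp add: lie_o_def)

lemma crv_lie_o: "\<alpha> : roots n ==> crv n \<alpha> : lie_o n"
 using crv_gmat[of \<alpha> n "fst (root_pair n \<alpha>)" "snd (root_pair n \<alpha>)"]
  root_pair_bounds[of \<alpha> n "fst (root_pair n \<alpha>)" "snd (root_pair n \<alpha>)"]
 by (simp add: gmat_lie_o)

lemma hmat_lie_o: "i < n ==> hmat n i : lie_o n"
 by (simp add: hmat_def gmat_lie_o)

lemma lie_o_entries:
 assumes "A : lie_o n" "i < 2*n+1" "j < 2*n+1"
 shows "of_nat (bw n i)*A $$ (du n i, j) = - (of_nat (bw n j)*A $$ (du n j, i))"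
proof -
 have A: "A : cmat n" using assms(1) by (rule lie_o_carrier)
 have col: "(A *\<^sub>v unit_vec (2*n+1) j) $ r = A $$ (r, j)" if "j < 2*n+1" "r < 2*n+1" for j r
  using A that by simp
 have cv: "A *\<^sub>v unit_vec (2*n+1) j : cvec n" for j
  using A by (simp add: mult_mat_vec_carrier[of _ _ "2*n+1"])
 have "bilform n (A *\<^sub>v unit_vec (2*n+1) j) (unit_vec (2*n+1) i)
  + bilform n (unit_vec (2*n+1) j) (A *\<^sub>v unit_vec (2*n+1) i) = 0"
  using assms(1) by (simp add: lie_o_def)
 then have "bcov n i (A *\<^sub>v unit_vec (2*n+1) j) + bcov n j (A *\<^sub>v unit_vec (2*n+1) i) = 0"
  unfolding bilform_unit(1)[OF cv assms(2)] bilform_unit(2)[OF cv assms(3)] .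
 then show ?thesis
  using col[OF assms(2) du_bound[OF assms(3)]] col[OF assms(3) du_bound[OF assms(2)]]
  by (simp add: bcov_def add_eq_0_iff2)
qed

lemma smult_mat_mult_vec:
 assumes "A : carrier_mat m k" "x : carrier_vec k"
 shows "(c \<cdot>\<^sub>m A) *\<^sub>v x = c \<cdot>\<^sub>v (A *\<^sub>v (x :: 'a::comm_ring_1 vec))"
 using assms by (intro eq_vecI) auto

lemma lie_o_add: "A : lie_o n ==> B : lie_o n ==> A + B : lie_o n"
 and lie_o_smult: "A : lie_o n ==> c \<cdot>\<^sub>m A : lie_o n"
proof -
 have lin: "bilform n (u + w) y = bilform n u y + bilform n w y" "bilform n (c \<cdot>\<^sub>v u) y = c*bilform n u y"
  "bilform n y (u + w) = bilform n y u + bilform n y w" "bilform n y (c \<cdot>\<^sub>v u) = c*bilform n y u"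
  if "u : cvec n" "w : cvec n" "y : cvec n"
  for u w y :: "complex vec" and c
  using that
  by (simp_all add: bilform_expand sum.distrib algebra_simps sum_distrib_left)
 {
  assume AB: "A : lie_o n" "B : lie_o n"
  note c = AB[THEN lie_o_carrier]
  have "bilform n ((A + B) *\<^sub>v x) y + bilform n x ((A + B) *\<^sub>v y) = 0"
   if xy: "x : cvec n" "y : cvec n" for x y
  proof -
   note cc = c(1)[THEN mult_mat_vec_carrier, OF xy(1)] c(2)[THEN mult_mat_vec_carrier, OF xy(1)]
    c(1)[THEN mult_mat_vec_carrier, OF xy(2)] c(2)[THEN mult_mat_vec_carrier, OF xy(2)]
   have "bilform n (A *\<^sub>v x) y + bilform n x (A *\<^sub>v y) = 0"
    "bilform n (B *\<^sub>v x) y + bilform n x (B *\<^sub>v y) = 0"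
    using AB xy by (simp_all add: lie_o_def)
   then have "(bilform n (A *\<^sub>v x) y + bilform n (B *\<^sub>v x) y) +
    (bilform n x (A *\<^sub>v y) + bilform n x (B *\<^sub>v y)) = 0"
    by (metis (no_types, opaque_lifting) add.assoc add.left_commute add.right_neutral)
   then show ?thesis
    unfolding add_mult_distrib_mat_vec[OF c xy(1)] add_mult_distrib_mat_vec[OF c xy(2)]
     lin(1)[OF cc(1,2) xy(2)] lin(3)[OF cc(3,4) xy(1)] .
  qed
  then show "A + B : lie_o n"
   using c by (simp add: lie_o_def)
 }
 {
  assume AB: "A : lie_o n"
  note c = AB[THEN lie_o_carrier]
  have "bilform n ((c \<cdot>\<^sub>m A) *\<^sub>v x) y + bilform n x ((c \<cdot>\<^sub>m A) *\<^sub>v y) = 0"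
   if xy: "x : cvec n" "y : cvec n" for x y
  proof -
   note cc = c[THEN mult_mat_vec_carrier, OF xy(1)] c[THEN mult_mat_vec_carrier, OF xy(2)]
   have "bilform n (A *\<^sub>v x) y + bilform n x (A *\<^sub>v y) = 0"
    using AB xy by (simp_all add: lie_o_def)
   then have "c*bilform n (A *\<^sub>v x) y + c*bilform n x (A *\<^sub>v y) = 0"
    by (metis distrib_left mult_zero_right)
   then show ?thesis
    unfolding smult_mat_mult_vec[OF c xy(1)] smult_mat_mult_vec[OF c xy(2)]
     lin(2)[OF cc(1,1) xy(2)] lin(4)[OF cc(2,2) xy(1)] .
  qed
  then show "c \<cdot>\<^sub>m A : lie_o n"
   using c by (simp add: lie_o_def)
 }
qed

text \<open>Skew endomorphisms are combinations of bivectors. An induction over one explicit double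
  sum takes the place of a basis.\<close>

lemma lie_o_induct_gmat:
 assumes A: "A : lie_o n"
  and g: "!!a b. a < 2*n+1 ==> b < 2*n+1 ==> P (gmat n a b)"
  and add: "!!A B. A : lie_o n ==> B : lie_o n ==> P A ==> P B ==> P (A + B)"
  and smult: "!!c A. A : lie_o n ==> P A ==> P (c \<cdot>\<^sub>m A)"
 shows "P A"
proof -
 \<comment> \<open>The sum runs over ordered pairs and so meets each bivector twice, whence the 2;
   \<open>bw n b\<close> undoes the value of the form in column \<open>du n b\<close> of
   \<open>gmat n a b\<close>.\<close>
 define c where "c = (%(a, b). A $$ (a, du n b) / (2*of_nat (bw n b)))"
 define M where "M I = mat (2*n+1) (2*n+1) (%rs. \<Sum>p\<in>I. c p*gmat n (fst p) (snd p) $$ rs)" for I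
 let ?U = "{..<2*n+1} \<times> {..<2*n+1}"
 have fin: "finite I ==> I <= ?U ==> M I : lie_o n & P (M I)" for I
 proof (induct I rule: finite_induct)
  case empty
  have "M {} = 0 \<cdot>\<^sub>m gmat n 0 0" by (intro eq_matI) (auto simp: M_def)
  then show ?case using g[of 0 0] smult[of "gmat n 0 0" 0] by (simp add: gmat_lie_o lie_o_smult)
 next
  case (insert p I)
  have "M (insert p I) = c p \<cdot>\<^sub>m gmat n (fst p) (snd p) + M I"
   using insert by (intro eq_matI) (auto simp: M_def)
  moreover have "gmat n (fst p) (snd p) : lie_o n" "P (gmat n (fst p) (snd p))"
   using insert by (auto intro!: gmat_lie_o g)
  ultimately show ?case
   using insert by (simp add: add smult lie_o_add lie_o_smult)
 qed
 have "A = M ?U"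
 proof (rule eq_matI)
  have Ac: "A : cmat n" using A by (rule lie_o_carrier)
  then show "dim_row A = dim_row (M ?U)" "dim_col A = dim_col (M ?U)" by (auto simp: M_def)
  fix r s assume "r < dim_row (M ?U)" "s < dim_col (M ?U)"
  then have rs: "r < 2*n+1" "s < 2*n+1" by (auto simp: M_def)
  have "M ?U $$ (r, s) = (\<Sum>a<2*n+1. \<Sum>b<2*n+1. c (a, b)*gmat n a b $$ (r, s))"
   using rs by (simp add: M_def sum.cartesian_product case_prod_unfold)
  also have "... = (\<Sum>a<2*n+1. \<Sum>b<2*n+1. (if b = du n s then if r = a then c (r, du n s)*of_nat (bw n s) else 0 else 0)
    - (if r = b then if a = du n s then c (du n s, r)*of_nat (bw n s) else 0 else 0))"
   using rs by (intro sum.cong) (auto simp: gmat_index bm_du algebra_simps)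
  also have "... = c (r, du n s)*of_nat (bw n s) - c (du n s, r)*of_nat (bw n s)"
   using rs du_bound[OF rs(2)] by (simp add: sum_subtractf if_distrib[of "%x. sum x _"] cong: if_cong)
  also have "... = A $$ (r, s)"
  proof -
   have rel: "of_nat (bw n r)*A $$ (r, s) = - (of_nat (bw n s)*A $$ (du n s, du n r))"
    using lie_o_entries[OF A du_bound[OF rs(1)] rs(2)] by simp
   have nz: "of_nat (bw n r) ~= (0::complex)" "of_nat (bw n s) ~= (0::complex)" by (auto simp: bw_def)
   have "c (du n s, r)*of_nat (bw n s) = (of_nat (bw n s)*A $$ (du n s, du n r)) / (2*of_nat (bw n r))"
    by (simp add: c_def)
   also have "of_nat (bw n s)*A $$ (du n s, du n r) = - (of_nat (bw n r)*A $$ (r, s))"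
    using rel by simp
   finally have "c (du n s, r)*of_nat (bw n s) = - A $$ (r, s) / 2" using nz by simp
   moreover have "c (r, du n s)*of_nat (bw n s) = A $$ (r, s) / 2" using nz by (simp add: c_def)
   ultimately show ?thesis by (simp only:) simp
  qed
  finally show "A $$ (r, s) = M ?U $$ (r, s)" by simp
 qed
 then show ?thesis using fin[of ?U] by simp
qed

lemma lie_o_induct:
 assumes A: "A : lie_o n"
  and root: "!!\<alpha>. \<alpha> : roots n ==> P (crv n \<alpha>)"
  and cart: "!!i. i < n ==> P (hmat n i)"
  and add: "!!A B. A : lie_o n ==> B : lie_o n ==> P A ==> P B ==> P (A + B)"
  and smult: "!!c A. A : lie_o n ==> P A ==> P (c \<cdot>\<^sub>m A)"
  and n: "0 < n"
 shows "P A"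
 using A
proof (rule lie_o_induct_gmat)
 fix a b assume ab: "a < 2*n+1" "b < 2*n+1"
 show "P (gmat n a b)"
 proof (cases "a = b")
  case True
  \<comment> \<open>The zero matrix has to come from one of the cases of the induction; this is
    where \<open>n\<close> must be positive.\<close>
  then have "gmat n a b = 0 \<cdot>\<^sub>m hmat n 0" by (intro eq_matI) (auto simp: gmat_index hmat_def)
  then show ?thesis using cart[OF n] smult[OF hmat_lie_o[OF n]] by simp
 next
  case False
  with ab show ?thesis
  proof (cases rule: gmat_cases)
   case (1 \<alpha>)
   then show ?thesis
    using root[OF 1(1)] smult[OF crv_lie_o[OF 1(1)], of "- 1"] gmat_swap[of n a b]
    by (metis crv_gmat)
  next
   case (2 i)
   then show ?thesis
    using cart[OF 2(1)] smult[OF hmat_lie_o[OF 2(1)], of "- 1"] gmat_swap[of n a b]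
    by (metis hmat_def prod.inject)
  qed
 qed
qed (use add smult in auto)

section \<open>The Clifford algebra as a module of the Lie algebra\<close>

definition implements :: "nat => complex fock_op => complex mat => bool" where
 "implements n s A \<longleftrightarrow>
  (\<forall>j<2*n+1. ad s (gen n j) = (\<Sum>r<2*n+1. scal (A $$ (r, j))*gen n r))"

inductive_set cliff :: "nat => complex fock_op set" for n where
 cliff_1: "1 : cliff n"
| cliff_gen: "j < 2*n+1 ==> gen n j : cliff n"
| cliff_add: "x : cliff n ==> y : cliff n ==> x + y : cliff n"
| cliff_mult: "x : cliff n ==> y : cliff n ==> x*y : cliff n"
| cliff_scal: "x : cliff n ==> scal c*x : cliff n"

lemma cliff_minus: "x : cliff n ==> - x : cliff n"
 using cliff_scal[of x n "- 1"] by (simp add: scal_minus)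

lemma cliff_diff: "x : cliff n ==> y : cliff n ==> x - y : cliff n"
 using cliff_add[OF _ cliff_minus] by (metis diff_conv_add_uminus)

lemma cliff_ad: "x : cliff n ==> y : cliff n ==> ad x y : cliff n"
 by (simp add: ad_def cliff_diff cliff_mult)

text \<open>Two derivations that agree on the generators agree on the algebra they generate. The
  implementing operator itself is ambiguous, for instance by scalars, which is why later statements
  quantify over it.\<close>

lemma implements_unique:
 assumes "implements n s A" "implements n s' A" "y : cliff n"
 shows "ad s y = ad s' y"
 using assms(3)
proof induct
 case (cliff_gen j)
 then show ?case using assms(1,2) by (simp add: implements_def)
qed (simp_all add: ad_add_right ad_mult_right ad_scal)

lemma implements_add:
 assumes "implements n s A" "implements n t B" "A : lie_o n" "B : lie_o n"
 shows "implements n (s + t) (A + B)"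
 using assms lie_o_carrier[OF assms(3)] lie_o_carrier[OF assms(4)]
 by (auto simp: implements_def ad_add_left scal_add distrib_right sum.distrib)

lemma implements_smult:
 assumes "implements n s A" "A : lie_o n"
 shows "implements n (scal c * s) (c \<cdot>\<^sub>m A)"
 using assms lie_o_carrier[OF assms(2)]
 by (auto simp: implements_def ad_scal_left scal_mult mult.assoc simp flip: sum_distrib_left)

lemma implements_ad:
 assumes "implements n s A" "implements n t B" "A : lie_o n" "B : lie_o n"
 shows "implements n (ad s t) (A*B - B*A)"
 unfolding implements_def
proof (intro allI impI)
 fix j assume j: "j < 2*n+1"
 note c = lie_o_carrier[OF assms(3)] lie_o_carrier[OF assms(4)]
 have step: "ad s (ad t (gen n j)) = (\<Sum>r<2*n+1. scal ((A*B) $$ (r, j))*gen n r)"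
  if "implements n s A" "implements n t B" "A : lie_o n" "B : lie_o n" for s t A B
 proof -
  note c = lie_o_carrier[OF that(3)] lie_o_carrier[OF that(4)]
  have "ad s (ad t (gen n j)) = (\<Sum>u<2*n+1. scal (B $$ (u, j))*(\<Sum>r<2*n+1. scal (A $$ (r, u))*gen n r))"
   using that(1,2) j by (simp add: implements_def ad_sum_right ad_scal_right)
  also have "... = (\<Sum>u<2*n+1. \<Sum>r<2*n+1. scal (A $$ (r, u)*B $$ (u, j))*gen n r)"
   by (intro sum.cong refl) (simp add: sum_distrib_left scal_mult[symmetric] mult.assoc[symmetric] mult.commute)
  also have "... = (\<Sum>r<2*n+1. \<Sum>u<2*n+1. scal (A $$ (r, u)*B $$ (u, j))*gen n r)"
   by (rule sum.swap)
  also have "... = (\<Sum>r<2*n+1. scal ((A*B) $$ (r, j))*gen n r)"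
  proof (intro sum.cong refl)
   fix r assume r: "r : {..<2*n+1}"
   have "(A*B) $$ (r, j) = (\<Sum>u<2*n+1. A $$ (r, u)*B $$ (u, j))"
    using r j c by (simp add: scalar_prod_def atLeast0LessThan)
   then show "(\<Sum>u<2*n+1. scal (A $$ (r, u)*B $$ (u, j))*gen n r) = scal ((A*B) $$ (r, j))*gen n r"
    by (simp add: scal_sum sum_distrib_right)
  qed
  finally show ?thesis .
 qed
 have "ad (ad s t) (gen n j) = (\<Sum>r<2*n+1. scal ((A*B) $$ (r, j))*gen n r)
   - (\<Sum>r<2*n+1. scal ((B*A) $$ (r, j))*gen n r)"
  using step[OF assms] step[OF assms(2,1,4,3)] by (simp add: ad_Jacobi)
 also have "... = (\<Sum>r<2*n+1. scal ((A*B - B*A) $$ (r, j))*gen n r)"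
  using c j by (simp add: sum_subtractf[symmetric] left_diff_distrib[symmetric] scal_diff[symmetric])
 finally show "ad (ad s t) (gen n j) = (\<Sum>r<2*n+1. scal ((A*B - B*A) $$ (r, j))*gen n r)" .
qed

lemma lie_o_comm: 
 assumes "A : lie_o n" "B : lie_o n"
 shows "A*B - B*A : lie_o n"
proof -
 note c = lie_o_carrier[OF assms(1)] lie_o_carrier[OF assms(2)]
 have "bilform n ((A*B - B*A) *\<^sub>v x) y + bilform n x ((A*B - B*A) *\<^sub>v y) = 0"
  if xy: "x : cvec n" "y : cvec n" for x y
 proof -
  have cv: "C *\<^sub>v z : cvec n"
   if "C : cmat n" "z : cvec n" for C z :: "_"
   using that by (rule mult_mat_vec_carrier)
  have d: "(A*B - B*A) *\<^sub>v z = A *\<^sub>v (B *\<^sub>v z) - B *\<^sub>v (A *\<^sub>v z)" if "z : cvec n" for z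
   using that c by (simp add: minus_mult_distrib_mat_vec[of _ "2*n+1" "2*n+1"] assoc_mult_mat_vec[of _ "2*n+1" "2*n+1" _ "2*n+1"] mult_carrier_mat[of _ "2*n+1" "2*n+1" _ "2*n+1"])
  have lin: "bilform n (u - w) z = bilform n u z - bilform n w z"
   "bilform n z (u - w) = bilform n z u - bilform n z w"
   if "u : cvec n" "w : cvec n" "z : cvec n"
   for u w z :: "complex vec"
   using that by (simp_all add: bilform_expand sum.distrib sum_subtractf algebra_simps)
  have skew: "bilform n (C *\<^sub>v u) w = - bilform n u (C *\<^sub>v w)"
   if "C : lie_o n" "u : cvec n" "w : cvec n" for C u w
   using that by (simp add: lie_o_def add_eq_0_iff2)
  have m: "A *\<^sub>v z : cvec n" "B *\<^sub>v z : cvec n"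
   if "z : cvec n" for z
   using that c by (auto intro: cv)
  show ?thesis
   unfolding d[OF xy(1)] d[OF xy(2)]
   using xy m by (simp add: lin skew[OF assms(1)] skew[OF assms(2)])
 qed
 then show ?thesis
  using minus_carrier_mat[OF mult_carrier_mat[OF c(2,1)], of "A*B"] by (simp add: lie_o_def)
qed

lemma implements_gmat:
 assumes "a < 2*n+1" "b < 2*n+1"
 shows "implements n (gen n a*gen n b) (gmat n a b)"
 unfolding implements_def
proof (intro allI impI)
 fix j assume j: "j < 2*n+1"
 have "ad (gen n a*gen n b) (gen n j) = of_nat (bm n b j)*gen n a - (of_nat (bm n a j)*gen n b :: complex fock_op)"
  by (rule ad_gen_gen[OF assms j])
 also have "... = (\<Sum>r<2*n+1. (if r = a then of_nat (bm n b j)*gen n a else 0) - (if r = b then of_nat (bm n a j)*gen n b else 0))"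
  using assms by (simp add: sum_subtractf)
 also have "... = (\<Sum>r<2*n+1. scal (gmat n a b $$ (r, j))*gen n r)"
  using j by (intro sum.cong refl) (auto simp: gmat_index scal_diff left_diff_distrib)
 finally show "ad (gen n a*gen n b) (gen n j) = (\<Sum>r<2*n+1. scal (gmat n a b $$ (r, j))*(gen n r :: complex fock_op))" .
qed

lemma implements_crv: "\<alpha> : roots n ==> implements n (rsp n \<alpha>) (crv n \<alpha>)"
 using implements_gmat[of "fst (root_pair n \<alpha>)" n "snd (root_pair n \<alpha>)"] 
  root_pair_bounds[of \<alpha> n "fst (root_pair n \<alpha>)" "snd (root_pair n \<alpha>)"]
  crv_gmat[of \<alpha> n "fst (root_pair n \<alpha>)" "snd (root_pair n \<alpha>)"]
 by (simp add: rsp_def)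

lemma implements_exists:
 assumes "A : lie_o n"
 shows "\<exists>s\<in>cliff n. implements n s A"
 using assms
proof (rule lie_o_induct_gmat, goal_cases)
 case (1 a b)
 then show ?case using implements_gmat[OF 1]
  by (intro bexI[of _ "gen n a*gen n b"]) (auto intro!: cliff_mult cliff_gen)
next
 case (2 A B)
 then show ?case using implements_add[of n _ A _ B] by (meson cliff_add)
next
 case (3 c A)
 then show ?case using implements_smult[of n _ A c] by (meson cliff_scal)
qed

lemma rsp_cliff: "\<alpha> : roots n ==> rsp n \<alpha> : cliff n"
 using root_pair_bounds[of \<alpha> n "fst (root_pair n \<alpha>)" "snd (root_pair n \<alpha>)"]
 by (auto simp: rsp_def intro!: cliff_mult cliff_gen)

subsection \<open>The highest weight vector of the model\<close>

definition hwop :: "nat => nat => 'a::comm_ring_1 fock_op" where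
 "hwop n k = prod_list (map (gen n) [0..<k])"

lemma hwop_0 [simp]: "hwop n 0 = 1"
 and hwop_Suc: "hwop n (Suc k) = hwop n k*gen n k"
 by (simp_all add: hwop_def)

lemma hwop_cliff: "k \<le> n ==> hwop n k : cliff n"
 by (induct k) (auto simp: hwop_Suc cliff_1 intro!: cliff_mult cliff_gen)

lemma gen_hwop_commute:
 assumes "a < 2*n+1" "k \<le> n" "!!j. j < k ==> bm n a j = 0"
 shows "gen n a*hwop n k = (- 1) ^ k*(hwop n k*gen n a :: 'a::comm_ring_1 fock_op)"
 using assms(2,3)
proof (induct k)
 case (Suc k)
 have "gen n a*gen n k + gen n k*gen n a = (0 :: 'a fock_op)"
  using Suc.prems gen_anticomm[of a n k] assms(1) by simp
 then have *: "gen n a*gen n k = - (gen n k*gen n a :: 'a fock_op)" by (simp add: add_eq_0_iff2)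
 have "gen n a*hwop n (Suc k) = (gen n a*hwop n k)*(gen n k :: 'a fock_op)"
  by (simp add: hwop_Suc mult.assoc)
 also have "... = (- 1) ^ k*(hwop n k*(gen n a*gen n k))"
  using Suc by (simp add: mult.assoc)
 also have "... = (- 1) ^ Suc k*(hwop n (Suc k)*gen n a)"
  by (simp add: * hwop_Suc mult.assoc)
 finally show ?case .
qed simp

lemma bm_low_low: "i < n ==> j < n ==> bm n i j = 0"
 by (simp add: bm_def)

lemma hwop_gen_zero: "i < k ==> k \<le> n ==> hwop n k*gen n i = (0 :: 'a::comm_ring_1 fock_op)"
proof (induct k)
 case (Suc k)
 have "gen n k*gen n i + gen n i*gen n k = (0 :: 'a fock_op)"
  using Suc.prems gen_anticomm[of k n i] by (simp add: bm_low_low)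
 then have *: "gen n k*gen n i = - (gen n i*gen n k :: 'a fock_op)" by (simp add: add_eq_0_iff2)
 show ?case
 proof (cases "i = k")
  case True
  then show ?thesis using Suc.prems by (simp add: hwop_Suc mult.assoc gen_isotropic_sq)
 next
  case False
  have "hwop n (Suc k)*gen n i = - ((hwop n k*gen n i)*(gen n k :: 'a fock_op))"
   by (simp add: hwop_Suc mult.assoc *)
  then show ?thesis using Suc False by simp
 qed
qed simp

lemma gen_hwop_zero:
 assumes "i < k" "k \<le> n"
 shows "gen n i*hwop n k = (0 :: 'a::comm_ring_1 fock_op)"
proof -
 have "gen n i*hwop n k = (- 1) ^ k*(hwop n k*gen n i :: 'a fock_op)"
  using assms by (intro gen_hwop_commute) (auto simp: bm_low_low)
 then show ?thesis using hwop_gen_zero[OF assms, where 'a='a] by simp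
qed

lemma ad_hwop_commute:
 assumes "a < 2*n+1" "b < 2*n+1" "k \<le> n" "!!j. j < k ==> bm n a j = 0" "!!j. j < k ==> bm n b j = 0"
 shows "ad (gen n a*gen n b) (hwop n k) = (0 :: 'a::comm_ring_1 fock_op)"
proof -
 have c: "(- 1) ^ k*x = x*(- 1) ^ k" for x :: "'a fock_op"
  by (cases "even k") auto
 have "gen n a*gen n b*hwop n k = (gen n a*((- 1) ^ k*hwop n k))*(gen n b :: 'a fock_op)"
  using assms by (simp add: gen_hwop_commute mult.assoc)
 also have "... = (- 1) ^ k*(gen n a*hwop n k)*gen n b"
  by (metis c mult.assoc)
 also have "... = (- 1) ^ k*((- 1) ^ k*(hwop n k*gen n a))*gen n b"
  using assms by (simp add: gen_hwop_commute)
 also have "... = hwop n k*gen n a*gen n b"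
  by (simp add: mult.assoc[symmetric] power_add[symmetric] flip: mult_2)
 finally show ?thesis by (simp add: ad_def mult.assoc)
qed

text \<open>If the first index \<open>i\<close> of the root is below \<open>k\<close>, that
  generator occurs in the product and kills it from either side. Otherwise both factors pass through
  with the same sign; positivity ensures that the second index is not dual to one of the first
  \<open>k\<close>.\<close>

lemma ad_pos_hwop:
 assumes "\<beta> : pos_roots n" "k \<le> n"
 shows "ad (rsp n \<beta>) (hwop n k) = (0 :: 'a::comm_ring_1 fock_op)"
proof -
 obtain i b where ib: "root_pair n \<beta> = (i, b)" by fastforce
 have i: "i < n" and b: "b < 2*n+1" "bm n i b = 0" and z: "k \<le> i ==> j < k ==> bm n b j = 0" for j
  using assms ib by (auto simp: pos_roots_def bm_def)
 show ?thesis
 proof (cases "i < k")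
  case True
  have "gen n i*gen n b + gen n b*gen n i = (0 :: 'a fock_op)"
   using i b gen_anticomm[of i n b] by simp
  then have *: "gen n i*gen n b = - (gen n b*gen n i :: 'a fock_op)" by (simp add: add_eq_0_iff2)
  have "gen n i*gen n b*hwop n k = - (gen n b*(gen n i*hwop n k :: 'a fock_op))"
   by (simp add: * mult.assoc)
  moreover have "hwop n k*(gen n i*gen n b) = (hwop n k*gen n i)*(gen n b :: 'a fock_op)"
   by (simp add: mult.assoc)
  ultimately show ?thesis
   using True assms by (simp add: ad_def rsp_def ib gen_hwop_zero hwop_gen_zero)
 next
  case False
  then show ?thesis
   using i b z assms by (auto simp: rsp_def ib bm_low_low intro!: ad_hwop_commute)
 qed
qed

text \<open>The weight is the sum of the first \<open>k\<close> coordinates \<epsilon>_i, which is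
  \<open>lambda_circ n k\<close> also for \<open>k = n\<close>, where it is twice the last
  fundamental weight.\<close>

lemma ad_h_hwop:
 assumes "i < n" "k \<le> n"
 shows "ad (gen n i*gen n (n + i)) (hwop n k) = (if i < k then hwop n k else 0 :: 'a::comm_ring_1 fock_op)"
proof (cases "i < k")
 case True
 have "gen n i*gen n (n + i) + gen n (n + i)*gen n i = (1 :: 'a fock_op)"
  using assms gen_anticomm[of i n "n + i"] by (simp add: bm_low)
 then have *: "gen n i*gen n (n + i) = 1 - (gen n (n + i)*gen n i :: 'a fock_op)" by (simp add: eq_diff_eq)
 have "gen n i*gen n (n + i)*hwop n k = hwop n k - gen n (n + i)*(gen n i*hwop n k :: 'a fock_op)"
  by (simp add: * left_diff_distrib mult.assoc)
 moreover have "hwop n k*(gen n i*gen n (n + i)) = (hwop n k*gen n i)*(gen n (n + i) :: 'a fock_op)"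
  by (simp add: mult.assoc)
 ultimately show ?thesis
  using True assms by (simp add: ad_def gen_hwop_zero hwop_gen_zero)
next
 case False
 then show ?thesis using assms by (auto simp: bm_low_low bm_def intro!: ad_hwop_commute)
qed

text \<open>The entry is a sign, and squaring it avoids computing which one. In particular the model
  vector has a nonzero matrix.\<close>

lemma hwop_entry: "k \<le> n ==> ent (hwop n k) {..<k} {}*ent (hwop n k) {..<k} {} = (1 :: 'a::comm_ring_1)"
proof (induct k)
 case 0
 then show ?case by (simp add: ent_1)
next
 case (Suc k)
 have "gen n k*hwop n k = (- 1) ^ k*(hwop n k*gen n k :: 'a fock_op)"
  using Suc.prems by (intro gen_hwop_commute) (auto simp: bm_low_low)
 then have "hwop n (Suc k) = (- 1) ^ k*(gen n k*hwop n k :: 'a fock_op)"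
  by (simp add: hwop_Suc mult.assoc[symmetric] power_add[symmetric] flip: mult_2)
 also have "... = scal ((- 1) ^ k)*(gen n k*hwop n k)"
  by (cases "even k") (simp_all add: scal_minus)
 finally have "ent (hwop n (Suc k)) {..<Suc k} {} = ((- 1) ^ k*lgen n k (ent (hwop n k)) {..<Suc k} {} :: 'a)"
  by (simp only: ent_scal ent_gen_mult)
 also have "... = (- 1) ^ k*(sgn_below k {..<Suc k}*ent (hwop n k) {..<k} ({} :: nat set) :: 'a)"
  using Suc.prems by (simp add: lgen_def lessThan_Suc)
 finally have e: "ent (hwop n (Suc k)) {..<Suc k} {} = (- 1) ^ k * sgn_below k {..<Suc k}*(ent (hwop n k) {..<k} {} :: 'a)"
  by (simp add: mult.assoc)
 have sq: "(e * s*x)*(e * s*x) = (e*e)*(s * s)*(x*x)" for e s x :: 'a by (simp add: algebra_simps)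
 then show ?case using Suc unfolding e sq by (simp add: power_add[symmetric] flip: mult_2)
qed

section \<open>Comparing an irreducible module with the model\<close>

lemma gmat_mult_index:
 assumes "c < 2*n+1" "d < 2*n+1" "r < 2*n+1" "s < 2*n+1"
 shows "(gmat n a b*gmat n c d :: 'a::comm_ring_1 mat) $$ (r, s) =
  gmat n a b $$ (r, c)*of_nat (bm n d s) - gmat n a b $$ (r, d)*of_nat (bm n c s)"
proof -
 have "(gmat n a b*gmat n c d :: 'a mat) $$ (r, s) = (\<Sum>t<2*n+1. gmat n a b $$ (r, t)*gmat n c d $$ (t, s))"
  using assms by (simp add: scalar_prod_def atLeast0LessThan)
 also have "... = (\<Sum>t<2*n+1. (if t = c then gmat n a b $$ (r, c)*of_nat (bm n d s) else 0)
   - (if t = d then gmat n a b $$ (r, d)*of_nat (bm n c s) else 0))"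
  using assms by (intro sum.cong refl) (auto simp: gmat_index algebra_simps)
 finally show ?thesis using assms by (simp add: sum_subtractf)
qed

lemma coroot_Diff:
 assumes "i < n" "j < n" "i ~= j"
 shows "map_mat of_int (coroot n (Diff i j)) = hmat n i + (- 1) \<cdot>\<^sub>m hmat n j"
proof -
 have r: "Diff i j : roots n" "Diff j i : roots n" using assms by (auto simp: roots_def)
 have c: "coroot n (Diff i j) = gmat n i (n + j)*gmat n j (n + i) - gmat n j (n + i)*gmat n i (n + j)"
  using root_vector_gmat[OF r(1)] root_vector_gmat[OF r(2)] by (simp add: coroot_def del: root_vector.simps)
 show ?thesis
  unfolding c
  using assms
  by (intro eq_matI) (simp_all add: gmat_mult_index gmat_index hmat_def bm_low bm_high bm_mid del: index_mult_mat(1))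
qed

lemma coroot_Short:
 assumes "i < n"
 shows "map_mat of_int (coroot n (Short i)) = 2 \<cdot>\<^sub>m hmat n i"
proof -
 have r: "Short i : roots n" "NegShort i : roots n" using assms by (auto simp: roots_def)
 have c: "coroot n (Short i) = gmat n i (2*n)*gmat n (2*n) (n + i) - gmat n (2*n) (n + i)*gmat n i (2*n)"
  using root_vector_gmat[OF r(1)] root_vector_gmat[OF r(2)] by (simp add: coroot_def del: root_vector.simps)
 show ?thesis
  unfolding c
  using assms
  by (intro eq_matI) (simp_all add: gmat_mult_index gmat_index hmat_def bm_low bm_high bm_mid del: index_mult_mat(1))
qed

section \<open>Grading of the Lie algebra by height\<close>

definition hdeg :: "nat => nat => int" where
 "hdeg n r = (if r < n then int (n - r) else if r < 2*n then - int (2*n - r) else 0)"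

lemma hdeg_du: "hdeg n (du n r) = - hdeg n r"
 by (auto simp: hdeg_def du_def)

text \<open>For \<open>j = n\<close> this is half the sum of the positive coroots, on which every
  simple root takes the value 1; \<open>hdeg\<close> lists its eigenvalues. The partial versions
  serve an induction over the Cartan elements.\<close>

definition grading_mat :: "nat => nat => complex mat" where
 "grading_mat n j = mat (2*n+1) (2*n+1) (%(r, s).
   if r = s & (r < j \<or> n \<le> r & r < n + j) then of_int (hdeg n r) else 0)"

lemma grading_mat_Suc:
 assumes "j < n"
 shows "grading_mat n (Suc j) = grading_mat n j + of_nat (n - j) \<cdot>\<^sub>m hmat n j"
 using assms
 by (intro eq_matI) (auto simp: grading_mat_def hmat_def gmat_index bm_low bm_high hdeg_def of_nat_diff)

lemma grading_mat_0: "grading_mat n 0 = 0\<^sub>m (2*n+1) (2*n+1)"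
 by (intro eq_matI) (auto simp: grading_mat_def)

lemma grading_mat_carrier [simp]: "grading_mat n j : cmat n"
 by (simp add: grading_mat_def)

lemma zero_lie_o: "0\<^sub>m (2*n+1) (2*n+1) : lie_o n"
proof -
 have eq: "0 \<cdot>\<^sub>m (gmat n 0 0 :: complex mat) = 0\<^sub>m (2*n+1) (2*n+1)" by (intro eq_matI) auto
 have "gmat n 0 0 : lie_o n" by (rule gmat_lie_o) auto
 from lie_o_smult[OF this, of 0] show ?thesis unfolding eq .
qed

lemma grading_mat_lie_o: "j \<le> n ==> grading_mat n j : lie_o n"
 by (induct j) (auto simp: grading_mat_0 zero_lie_o[simplified] grading_mat_Suc intro!: lie_o_add lie_o_smult hmat_lie_o)

lemma grading_comm:
 assumes "a < 2*n+1" "b < 2*n+1"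
 shows "grading_mat n n*gmat n a b - gmat n a b*grading_mat n n = of_int (hdeg n a + hdeg n b) \<cdot>\<^sub>m gmat n a b"
proof (rule eq_matI)
 fix r s assume "r < dim_row (of_int (hdeg n a + hdeg n b) \<cdot>\<^sub>m (gmat n a b :: complex mat))"
  "s < dim_col (of_int (hdeg n a + hdeg n b) \<cdot>\<^sub>m (gmat n a b :: complex mat))"
 then have rs: "r < 2*n+1" "s < 2*n+1" by auto
 have g: "grading_mat n n $$ (r, s) = (if r = s then of_int (hdeg n r) else 0)"
  if "r < 2*n+1" "s < 2*n+1" for r s
  using that by (auto simp: grading_mat_def hdeg_def)
 have "(grading_mat n n*gmat n a b) $$ (r, s) = (\<Sum>t<2*n+1. grading_mat n n $$ (r, t)*gmat n a b $$ (t, s))"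
  using rs by (simp add: scalar_prod_def atLeast0LessThan grading_mat_def)
 also have "... = (\<Sum>t<2*n+1. if t = r then of_int (hdeg n r)*gmat n a b $$ (r, s) else 0)"
  using rs by (intro sum.cong refl) (auto simp: g)
 finally have 1: "(grading_mat n n*gmat n a b) $$ (r, s) = of_int (hdeg n r)*gmat n a b $$ (r, s)"
  using rs by simp
 have "(gmat n a b*grading_mat n n) $$ (r, s) = (\<Sum>t<2*n+1. gmat n a b $$ (r, t)*grading_mat n n $$ (t, s))"
  using rs by (simp add: scalar_prod_def atLeast0LessThan grading_mat_def)
 also have "... = (\<Sum>t<2*n+1. if t = s then of_int (hdeg n s)*gmat n a b $$ (r, s) else 0)"
  using rs by (intro sum.cong refl) (auto simp: g)
 finally have 2: "(gmat n a b*grading_mat n n) $$ (r, s) = of_int (hdeg n s)*gmat n a b $$ (r, s)"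
  using rs by simp
 have d: "bm n c s ~= 0 ==> hdeg n s = - hdeg n c" if "c < 2*n+1" for c
  using that rs(2) by (simp add: bm_du hdeg_du split: if_splits)
 have "of_int (hdeg n r)*gmat n a b $$ (r, s) - of_int (hdeg n s)*gmat n a b $$ (r, s)
  = of_int (hdeg n a + hdeg n b)*(gmat n a b $$ (r, s) :: complex)"
  using rs d[OF assms(1)] d[OF assms(2)]
  by (cases "bm n a s = 0"; cases "bm n b s = 0") (auto simp: gmat_index algebra_simps)
 then show "(grading_mat n n*gmat n a b - gmat n a b*grading_mat n n) $$ (r, s)
   = (of_int (hdeg n a + hdeg n b) \<cdot>\<^sub>m gmat n a b) $$ (r, s)"
  using rs 1 2 by (simp add: grading_mat_def del: index_mult_mat(1))
qed (auto simp: grading_mat_def)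

lemma neg_root_pair:
 assumes "\<beta> : roots n" "root_pair n \<beta> = (a, b)"
 shows "root_pair n (neg_root \<beta>) = (du n b, du n a)" "neg_root \<beta> : roots n"
 using assms by (auto simp: roots_def du_def)

lemma pos_roots_roots: "\<beta> : pos_roots n ==> \<beta> : roots n"
 by (auto simp: pos_roots_def roots_def)

lemma roots_cases_pos: "\<alpha> : roots n ==> \<alpha> : pos_roots n \<or> (\<exists>\<beta>\<in>pos_roots n. \<alpha> = neg_root \<beta>)"
 unfolding roots_def pos_roots_def
 by (auto simp: Bex_def) (metis neg_root.simps linorder_neqE_nat)+

lemma pos_root_height:
 assumes "\<beta> : pos_roots n" "root_pair n \<beta> = (a, b)"
 shows "hdeg n a + hdeg n b > 0"
 using assms by (auto simp: pos_roots_def hdeg_def)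

subsection \<open>Weights and the contravariant form on matrices\<close>

definition wt :: "nat => nat set => int" where
 "wt n T = (\<Sum>i\<in>T \<inter> {..<n}. int (n - i))"

lemma wt_remove: "i : T ==> i < n ==> wt n (T - {i}) = wt n T - int (n - i)"
proof -
 assume "i : T" "i < n"
 then have "T \<inter> {..<n} = insert i ((T - {i}) \<inter> {..<n})" by auto
 then have "wt n T = sum (%i. int (n - i)) (insert i ((T - {i}) \<inter> {..<n}))" unfolding wt_def by (rule arg_cong)
 then show ?thesis by (simp add: wt_def)
qed

lemma wt_insert: "i ~: T ==> i < n ==> wt n (insert i T) = wt n T + int (n - i)"
 using wt_remove[of i "insert i T" n] by simp

lemma lgen_wt:
 assumes "lgen n j F T S ~= 0" "j < 2*n+1"
 shows "\<exists>T'. F T' S ~= 0 & wt n T = wt n T' + hdeg n j"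
proof -
 consider "j < n" | "n \<le> j" "j < 2*n" | "j = 2*n" using assms(2) by linarith
 then show ?thesis
 proof cases
  case 1
  then show ?thesis
   using assms wt_remove[of j T n]
   by (intro exI[of _ "T - {j}"]) (auto simp: lgen_def hdeg_def split: if_splits)
 next
  case 2
  then have "j - n < n" by linarith
  with 2 show ?thesis
   using assms wt_insert[of "j - n" T n]
   by (intro exI[of _ "insert (j - n) T"]) (auto simp: lgen_def hdeg_def split: if_splits)
 next
  case 3
  then show ?thesis using assms by (intro exI[of _ T]) (auto simp: lgen_def hdeg_def)
 qed
qed

text \<open>Creation and annihilation at a site are transposes of each other, so facts on right
  multiplication follow from those on left multiplication.\<close>

lemma rgen_lgen_transpose: "rgen n j F T S = lgen n (du n j) (%S T. F T S) S T" if "j < 2*n+1"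
 using that by (auto simp: rgen_def lgen_def du_def)

lemma rgen_wt:
 assumes "rgen n j F T S ~= 0" "j < 2*n+1"
 shows "\<exists>S'. F T S' ~= 0 & wt n S = wt n S' - hdeg n j"
 using lgen_wt[of n "du n j" "%S T. F T S" S T] assms du_bound[OF assms(2)]
 by (simp add: rgen_lgen_transpose hdeg_du)

text \<open>\<open>y\<close> is a sum of weight vectors whose weights, evaluated at the grading element, satisfy \<open>Q\<close>.\<close>
definition wt_pred :: "nat => (int => bool) => 'a::comm_ring_1 fock_op => bool" where
 "wt_pred n Q y \<longleftrightarrow> (\<forall>T S. ent y T S ~= 0 --> Q (wt n T - wt n S))"

lemma ent_gen2_mult: "ent (gen n a*gen n b*y) = lgen n a (lgen n b (ent y))"
 by (simp add: mult.assoc ent_gen_mult)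

lemma ent_mult_gen2: "ent (y*(gen n a*gen n b)) = rgen n b (rgen n a (ent y))"
 by (simp add: mult.assoc[symmetric] ent_mult_gen)

lemma ent_ad_gen2: "ent (ad (gen n a*gen n b) y) = (%T S. lgen n a (lgen n b (ent y)) T S - rgen n b (rgen n a (ent y)) T S)"
 by (intro ext) (simp add: ad_def ent_diff ent_gen2_mult ent_mult_gen2)

lemma wt_pred_ad:
 assumes "wt_pred n Q y" "a < 2*n+1" "b < 2*n+1"
 shows "wt_pred n (%c. Q (c - hdeg n a - hdeg n b)) (ad (gen n a*gen n b) y)"
 unfolding wt_pred_def
proof (intro allI impI)
 fix T S assume nz: "ent (ad (gen n a*gen n b) y) T S ~= 0"
 have e: "ent (ad (gen n a*gen n b) y) T S = lgen n a (lgen n b (ent y)) T S - rgen n b (rgen n a (ent y)) T S"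
  by (simp add: ent_ad_gen2)
 have "Q (wt n T - wt n S - hdeg n a - hdeg n b)" if l: "lgen n a (lgen n b (ent y)) T S ~= 0"
 proof -
  obtain T1 where T1: "lgen n b (ent y) T1 S ~= 0" "wt n T = wt n T1 + hdeg n a"
   using lgen_wt[OF l assms(2)] by blast
  obtain T2 where "ent y T2 S ~= 0" "wt n T1 = wt n T2 + hdeg n b"
   using lgen_wt[OF T1(1) assms(3)] by blast
  then show ?thesis using assms(1) T1 by (fastforce simp: wt_pred_def algebra_simps)
 qed
 moreover have "Q (wt n T - wt n S - hdeg n a - hdeg n b)" if r: "rgen n b (rgen n a (ent y)) T S ~= 0"
 proof -
  obtain T1 where T1: "rgen n a (ent y) T T1 ~= 0" "wt n S = wt n T1 - hdeg n b"
   using rgen_wt[OF r assms(3)] by blast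
  obtain T2 where "ent y T T2 ~= 0" "wt n T1 = wt n T2 - hdeg n a"
   using rgen_wt[OF T1(1) assms(2)] by blast
  then show ?thesis using assms(1) T1 by (fastforce simp: wt_pred_def algebra_simps)
 qed
 ultimately show "Q (wt n T - wt n S - hdeg n a - hdeg n b)" using nz e by force
qed

lemma hwop_wt: "k \<le> n ==> wt_pred n (%c. c = (\<Sum>i<k. hdeg n i)) (hwop n k)"
proof (induct k)
 case 0
 then show ?case by (auto simp: wt_pred_def ent_1)
next
 case (Suc k)
 show ?case unfolding wt_pred_def
 proof (intro allI impI)
  fix T S assume "ent (hwop n (Suc k) :: 'a fock_op) T S ~= 0"
  then have "rgen n k (ent (hwop n k :: 'a fock_op)) T S ~= 0" by (simp add: hwop_Suc ent_mult_gen)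
  then obtain S' where "ent (hwop n k :: 'a fock_op) T S' ~= 0" "wt n S = wt n S' - hdeg n k"
   using rgen_wt[of n k] Suc.prems by force
  then show "wt n T - wt n S = (\<Sum>i<Suc k. hdeg n i)"
   using Suc by (auto simp: wt_pred_def sum.lessThan_Suc)
 qed
qed

text \<open>The Hilbert-Schmidt product of matrices over \<open>n\<close> sites; it serves as the
  positive definite contravariant form.\<close>

definition pairing :: "nat => (nat set => nat set => complex) => (nat set => nat set => complex) => complex" where
 "pairing n F G = (\<Sum>T\<in>Pow {..<n}. \<Sum>S\<in>Pow {..<n}. F T S*cnj (G T S))"

text \<open>Adding and removing the site \<open>i\<close> are inverse bijections; this is the
  adjointness of creation and annihilation.\<close>

lemma sum_Pow_move:
 assumes "i < (n::nat)"
 shows "(\<Sum>T\<in>Pow {..<n}. if i : T then f (T - {i}) T else 0) = (\<Sum>T\<in>Pow {..<n}. if i : T then 0 else f T (insert i T))"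
proof -
 have "(\<Sum>T\<in>Pow {..<n}. if i : T then f (T - {i}) T else 0) = (\<Sum>T | T : Pow {..<n} & i : T. f (T - {i}) T)"
  by (rule sum.inter_filter[symmetric]) simp
 also have "... = (\<Sum>T | T : Pow {..<n} & i ~: T. f T (insert i T))"
  by (rule sum.reindex_bij_witness[where i="insert i" and j="%T. T - {i}"]) (use assms in \<open>auto simp: insert_absorb\<close>)
 also have "... = (\<Sum>T\<in>Pow {..<n}. if i ~: T then f T (insert i T) else 0)"
  by (rule sum.inter_filter) simp
 also have "... = (\<Sum>T\<in>Pow {..<n}. if i : T then 0 else f T (insert i T))"
  by (intro sum.cong) auto
 finally show ?thesis .
qed

lemma cnj_sgn_below [simp]: "cnj (sgn_below i T) = sgn_below i T"
 by (simp add: sgn_below_def)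

lemma sum_lgen_adjoint:
 assumes "j < 2*n+1"
 shows "(\<Sum>T\<in>Pow {..<n}. lgen n j F T S*cnj (G T S)) = (\<Sum>T\<in>Pow {..<n}. F T S*cnj (lgen n (du n j) G T S))"
proof -
 consider "j < n" | "n \<le> j" "j < 2*n" | "j = 2*n" using assms by linarith
 then show ?thesis
 proof cases
  case 1
  have "(\<Sum>T\<in>Pow {..<n}. lgen n j F T S*cnj (G T S)) =
   (\<Sum>T\<in>Pow {..<n}. if j : T then sgn_below j (T - {j})*F (T - {j}) S*cnj (G T S) else 0)"
   using 1 by (intro sum.cong refl) (auto simp: lgen_def sgn_below_remove)
  also have "... = (\<Sum>T\<in>Pow {..<n}. if j : T then 0 else sgn_below j T*F T S*cnj (G (insert j T) S))"
   by (rule sum_Pow_move[OF 1, where f="%A B. sgn_below j A*F A S*cnj (G B S)"])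
  also have "... = (\<Sum>T\<in>Pow {..<n}. F T S*cnj (lgen n (du n j) G T S))"
   using 1 by (intro sum.cong refl) (auto simp: lgen_def du_def)
  finally show ?thesis .
 next
  case 2
  then have i: "j - n < n" by linarith
  have "(\<Sum>T\<in>Pow {..<n}. F T S*cnj (lgen n (du n j) G T S)) =
   (\<Sum>T\<in>Pow {..<n}. if j - n : T then sgn_below (j - n) (T - {j - n})*F T S*cnj (G (T - {j - n}) S) else 0)"
   using 2 i by (intro sum.cong refl) (auto simp: lgen_def du_def sgn_below_remove)
  also have "... = (\<Sum>T\<in>Pow {..<n}. if j - n : T then 0 else sgn_below (j - n) T*F (insert (j - n) T) S*cnj (G T S))"
   by (rule sum_Pow_move[OF i, where f="%A B. sgn_below (j - n) A*F B S*cnj (G A S)"])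
  also have "... = (\<Sum>T\<in>Pow {..<n}. lgen n j F T S*cnj (G T S))"
   using 2 by (intro sum.cong refl) (auto simp: lgen_def du_def)
  finally show ?thesis by simp
 next
  case 3
  then show ?thesis by (intro sum.cong refl) (auto simp: lgen_def du_def)
 qed
qed

lemma pairing_lgen: "j < 2*n+1 ==> pairing n (lgen n j F) G = pairing n F (lgen n (du n j) G)"
 proof -
 assume j: "j < 2*n+1"
 have sw: "pairing n F G = (\<Sum>S\<in>Pow {..<n}. \<Sum>T\<in>Pow {..<n}. F T S*cnj (G T S))" for F G
  unfolding pairing_def by (rule sum.swap)
 show ?thesis
  unfolding sw by (intro sum.cong refl sum_lgen_adjoint j)
qed

lemma pairing_rgen:
 assumes "j < 2*n+1"
 shows "pairing n (rgen n j F) G = pairing n F (rgen n (du n j) G)"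
 unfolding pairing_def
proof (rule sum.cong[OF refl])
 fix T
 show "(\<Sum>S\<in>Pow {..<n}. rgen n j F T S*cnj (G T S)) = (\<Sum>S\<in>Pow {..<n}. F T S*cnj (rgen n (du n j) G T S))"
  using sum_lgen_adjoint[OF du_bound[OF assms], where F="%S T. F T S" and G="%S T. G T S" and S=T]
   assms du_bound[OF assms]
  by (simp add: rgen_lgen_transpose)
qed

lemma pairing_diff: "pairing n (%T S. F T S - F' T S) G = pairing n F G - pairing n F' G"
 "pairing n G (%T S. F T S - F' T S) = pairing n G F - pairing n G F'"
 and pairing_add: "pairing n G (%T S. F T S + F' T S) = pairing n G F + pairing n G F'"
 and pairing_scal: "pairing n G (%T S. c*F T S) = cnj c*pairing n G F"
 by (simp_all add: pairing_def algebra_simps sum_subtractf sum.distrib sum_distrib_left)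

text \<open>The adjoint of a generator is the dual generator, and adjoints reverse products. By
  \<open>neg_root_pair\<close> the adjoint of a root vector therefore belongs to the negative
  root.\<close>

lemma pairing_ad_gen2:
 assumes "a < 2*n+1" "b < 2*n+1"
 shows "pairing n (ent (ad (gen n a*gen n b) y)) (ent z) = pairing n (ent y) (ent (ad (gen n (du n b)*gen n (du n a)) z))"
 using assms du_bound[OF assms(1)] du_bound[OF assms(2)]
 by (simp add: ent_ad_gen2 pairing_diff pairing_lgen pairing_rgen)

lemma pairing_self_zero:
 assumes "pairing n F F = 0" "T <= {..<n}" "S <= {..<n}"
 shows "F T S = 0"
proof -
 have "pairing n F F = of_real (\<Sum>T\<in>Pow {..<n}. \<Sum>S\<in>Pow {..<n}. (cmod (F T S))\<^sup>2)"
  unfolding pairing_def of_real_sum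
  by (intro sum.cong refl) (simp only: complex_norm_square)
 then have "(\<Sum>T\<in>Pow {..<n}. \<Sum>S\<in>Pow {..<n}. (cmod (F T S))\<^sup>2) = 0"
  using assms(1) by (metis of_real_eq_0_iff)
 moreover have "(\<Sum>T\<in>Pow {..<n}. \<Sum>S\<in>Pow {..<n}. (cmod (F T S))\<^sup>2) = 0 \<longleftrightarrow>
   (\<forall>T\<in>Pow {..<n}. (\<Sum>S\<in>Pow {..<n}. (cmod (F T S))\<^sup>2) = 0)"
  by (rule sum_nonneg_eq_0_iff) (auto intro: sum_nonneg)
 ultimately have "(\<Sum>S\<in>Pow {..<n}. (cmod (F T S))\<^sup>2) = 0"
  using assms(2) by simp
 moreover have "(\<Sum>S\<in>Pow {..<n}. (cmod (F T S))\<^sup>2) = 0 \<longleftrightarrow> (\<forall>S\<in>Pow {..<n}. (cmod (F T S))\<^sup>2 = 0)"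
  by (rule sum_nonneg_eq_0_iff) auto
 ultimately show ?thesis
  using assms(3) by simp
qed

lemma pairing_wt_zero:
 assumes "wt_pred n (%c. c < m) y" "wt_pred n (%c. c = m) z"
 shows "pairing n (ent y) (ent z) = 0"
 unfolding pairing_def
proof (intro sum.neutral ballI)
 fix T S
 show "ent y T S*cnj (ent z T S) = 0"
  using assms by (cases "ent y T S = 0"; cases "ent z T S = 0") (force simp: wt_pred_def)+
qed

section \<open>The irreducible module and the graph of its comparison with the model\<close>

locale hw_module =
 fixes n \<kappa> :: nat and M :: "(complex, 'v) module" (structure) and \<rho> :: "complex mat => 'v => 'v" and v :: 'v
 assumes n_pos: "0 < n" and kap_le: "\<kappa> \<le> n"
  and hw: "irreducible_hw_module n M \<rho> (lambda_circ n \<kappa>) v"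
begin

lemma rep: "lie_rep n M \<rho>"
 using hw by (simp add: irreducible_hw_module_def irreducible_rep_def)

sublocale M: vectorspace "class_ring :: complex ring" M
 using rep by (simp add: lie_rep_def)

lemma v_carrier [simp]: "v : carrier M" and v_nonzero: "v ~= \<zero>"
 and v_pos: "\<alpha> : pos_roots n ==> \<rho> (crv n \<alpha>) v = \<zero>"
 and v_coroot: "j : {1..n} ==>
  \<rho> (map_mat of_int (coroot n (simple_root n j))) v = of_int (lambda_circ n \<kappa> j) \<odot> v"
 using hw by (auto simp: irreducible_hw_module_def highest_weight_vector_def crv_def)

lemma smult_carrier [simp]: "x : carrier M ==> c \<odot> x : carrier M"
 and smult_add_left: "x : carrier M ==> (a + b) \<odot> x = a \<odot> x \<oplus> b \<odot> x"
 and smult_add_right: "x : carrier M ==> y : carrier M ==> c \<odot> (x \<oplus> y) = c \<odot> x \<oplus> c \<odot> y"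
 and smult_smult: "x : carrier M ==> a \<odot> (b \<odot> x) = (a*b) \<odot> x"
 and smult_1 [simp]: "x : carrier M ==> 1 \<odot> x = x"
 and smult_0 [simp]: "x : carrier M ==> 0 \<odot> x = \<zero>"
 and smult_zero [simp]: "c \<odot> \<zero> = \<zero>"
 using M.smult_closed[of c x] M.smult_l_distr[of a b x] M.smult_r_distr[of c x y] M.smult_assoc1[of a b x]
  M.smult_one[of x] M.smult_l_null[of x] M.smult_r_null[of c]
 by simp_all

lemma smult_minus_1: "x : carrier M ==> (- 1) \<odot> x = \<ominus> x"
 using smult_add_left[of x "- 1" 1] M.minus_equality[of "(- 1) \<odot> x" x] by simp

lemma minus_smult: "x : carrier M ==> y : carrier M ==> x \<ominus> y = x \<oplus> (- 1) \<odot> y"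
 by (simp add: smult_minus_1 a_minus_def)

lemma rho_carrier [simp]: "X : lie_o n ==> x : carrier M ==> \<rho> X x : carrier M"
 and rho_add: "X : lie_o n ==> x : carrier M ==> y : carrier M ==> \<rho> X (x \<oplus> y) = \<rho> X x \<oplus> \<rho> X y"
 and rho_smult: "X : lie_o n ==> x : carrier M ==> \<rho> X (c \<odot> x) = c \<odot> \<rho> X x"
proof -
 assume "X : lie_o n"
 then have h: "\<rho> X : module_hom class_ring M M" using rep by (simp add: lie_rep_def)
 {
  assume "x : carrier M"
  then show "\<rho> X x : carrier M" using h by (auto simp: module_hom_def)
 }
 {
  assume "x : carrier M" "y : carrier M"
  then show "\<rho> X (x \<oplus> y) = \<rho> X x \<oplus> \<rho> X y" using h by (simp add: module_hom_def)
 }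
 {
  assume "x : carrier M"
  then show "\<rho> X (c \<odot> x) = c \<odot> \<rho> X x" using h by (simp add: module_hom_def)
 }
qed

lemma rho_mat_add: "X : lie_o n ==> Y : lie_o n ==> x : carrier M ==> \<rho> (X + Y) x = \<rho> X x \<oplus> \<rho> Y x"
 and rho_mat_smult: "X : lie_o n ==> x : carrier M ==> \<rho> (c \<cdot>\<^sub>m X) x = c \<odot> \<rho> X x"
 and rho_comm: "X : lie_o n ==> Y : lie_o n ==> x : carrier M ==>
  \<rho> (X*Y - Y*X) x = \<rho> X (\<rho> Y x) \<ominus> \<rho> Y (\<rho> X x)"
 using rep by (simp_all add: lie_rep_def)

lemma rho_swap:
 assumes "X : lie_o n" "Y : lie_o n" "x : carrier M"
 shows "\<rho> X (\<rho> Y x) = \<rho> Y (\<rho> X x) \<oplus> \<rho> (X*Y - Y*X) x"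
 using assms by (simp add: rho_comm minus_smult smult_minus_1 M.a_lcomm M.r_neg)

lemma rho_zero_vec [simp]: "X : lie_o n ==> \<rho> X \<zero> = \<zero>"
 using rho_smult[of X "\<zero>" 0] by simp

text \<open>The last simple coroot is twice the last Cartan element and the other simple coroots are
  differences of neighbours, so the eigenvalues are found from the last index downwards.\<close>

lemma rho_h_v: "i < n ==> \<rho> (hmat n i) v = (if i < \<kappa> then 1 else 0) \<odot> v"
proof (induct "n - 1 - i" arbitrary: i)
 case 0
 then have i: "i = n - 1" by linarith
 have "simple_root n n = Short i" using i by (simp add: simple_root_def)
 then have "\<rho> (2 \<cdot>\<^sub>m hmat n i) v = of_int (lambda_circ n \<kappa> n) \<odot> v"
  using v_coroot[of n] n_pos coroot_Short[of i n] 0 by simp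
 then have "2 \<odot> \<rho> (hmat n i) v = of_int (lambda_circ n \<kappa> n) \<odot> v"
  using 0 by (simp add: rho_mat_smult hmat_lie_o)
 then have "(1 / 2) \<odot> (2 \<odot> \<rho> (hmat n i) v) = (1 / 2) \<odot> (of_int (lambda_circ n \<kappa> n) \<odot> v)"
  by simp
 then have "\<rho> (hmat n i) v = (of_int (lambda_circ n \<kappa> n) / 2) \<odot> v"
  using 0 by (simp add: smult_smult hmat_lie_o)
 moreover have "of_int (lambda_circ n \<kappa> n) / 2 = (if i < \<kappa> then 1 else (0::complex))"
  using i n_pos kap_le by (auto simp: lambda_circ_def fund_weight_def)
 ultimately show ?case by simp
next
 case (Suc m)
 then have i: "Suc i < n" by linarith
 have IH: "\<rho> (hmat n (Suc i)) v = (if Suc i < \<kappa> then 1 else 0) \<odot> v"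
  using Suc(2) by (intro Suc(1)) (use i in auto)
 have "simple_root n (Suc i) = Diff i (Suc i)" using i by (simp add: simple_root_def)
 then have e: "\<rho> (hmat n i + (- 1) \<cdot>\<^sub>m hmat n (Suc i)) v = of_int (lambda_circ n \<kappa> (Suc i)) \<odot> v"
  using v_coroot[of "Suc i"] i coroot_Diff[of i n "Suc i"] by simp
 have "\<rho> (hmat n i + (- 1) \<cdot>\<^sub>m hmat n (Suc i)) v = \<rho> (hmat n i) v \<oplus> (- 1) \<odot> \<rho> (hmat n (Suc i)) v"
  using i by (simp add: rho_mat_add rho_mat_smult hmat_lie_o lie_o_smult)
 then have "\<rho> (hmat n i) v \<oplus> (- 1) \<odot> \<rho> (hmat n (Suc i)) v = of_int (lambda_circ n \<kappa> (Suc i)) \<odot> v"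
  using e by simp
 then have "\<rho> (hmat n i) v = of_int (lambda_circ n \<kappa> (Suc i)) \<odot> v \<oplus> \<rho> (hmat n (Suc i)) v"
  using i hmat_lie_o[of i n] hmat_lie_o[of "Suc i" n]
  by (metis (no_types, lifting) M.add.m_comm M.add.r_inv_ex M.minus_equality M.r_neg2 M.a_inv_closed Suc_lessD rho_carrier smult_minus_1 v_carrier M.add.inv_solve_right' smult_carrier)
 also have "... = (of_int (lambda_circ n \<kappa> (Suc i)) + (if Suc i < \<kappa> then 1 else 0)) \<odot> v"
  by (simp add: IH smult_add_left)
 also have "of_int (lambda_circ n \<kappa> (Suc i)) + (if Suc i < \<kappa> then 1 else 0) = (if i < \<kappa> then 1 else (0::complex))"
  using i kap_le by (auto simp: lambda_circ_def fund_weight_def)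
 finally show ?case .
qed

abbreviation w :: "complex fock_op" where "w \<equiv> hwop n \<kappa>"

definition top_weight :: int where "top_weight = (\<Sum>i<\<kappa>. hdeg n i)"

abbreviation H0 :: "complex mat" where "H0 \<equiv> grading_mat n n"

lemma H0_lie [simp]: "H0 : lie_o n"
 by (simp add: grading_mat_lie_o)

lemma H0_v: "\<rho> H0 v = of_int top_weight \<odot> v"
proof -
 have "j \<le> n ==> \<rho> (grading_mat n j) v = of_int (\<Sum>i<min j \<kappa>. hdeg n i) \<odot> v" for j
 proof (induct j)
  case 0
  have "\<rho> (0 \<cdot>\<^sub>m H0) v = \<zero>" by (simp add: rho_mat_smult)
  moreover have "grading_mat n 0 = 0 \<cdot>\<^sub>m H0" by (intro eq_matI) (auto simp: grading_mat_def)
  ultimately show ?case by simp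
 next
  case (Suc j)
  have j: "j < n" using Suc by simp
  have "\<rho> (grading_mat n (Suc j)) v = \<rho> (grading_mat n j) v \<oplus> of_nat (n - j) \<odot> \<rho> (hmat n j) v"
   using j by (simp add: grading_mat_Suc rho_mat_add rho_mat_smult grading_mat_lie_o hmat_lie_o lie_o_smult del: of_nat_diff)
  also have "... = (of_int (\<Sum>i<min j \<kappa>. hdeg n i) + of_nat (n - j)*(if j < \<kappa> then 1 else 0)) \<odot> v"
   using Suc j by (simp add: rho_h_v smult_smult smult_add_left del: of_nat_diff)
  also have "of_int (\<Sum>i<min j \<kappa>. hdeg n i) + of_nat (n - j)*(if j < \<kappa> then 1 else 0) = (of_int (\<Sum>i<min (Suc j) \<kappa>. hdeg n i) :: complex)"
   using j by (cases "j < \<kappa>") (simp_all add: min.absorb1 min.absorb2 sum.lessThan_Suc hdeg_def of_nat_diff)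
  finally show ?case .
 qed
 from this[of n] show ?thesis using kap_le by (simp add: top_weight_def min_absorb2)
qed

text \<open>The graph of the isomorphism between \<open>M\<close> and the submodule of the Clifford algebra generated
 by \<^const>\<open>hwop\<close>. Only negative root vectors are used to generate it, which makes its elements lie
 in the span of the highest weight vector and vectors of lower weight.\<close>
inductive graph :: "'v => complex fock_op => bool" where
 graph_base: "graph v w"
| graph_add: "graph x y ==> graph x' y' ==> graph (x \<oplus> x') (y + y')"
| graph_smult: "graph x y ==> graph (c \<odot> x) (scal c*y)"
| graph_neg: "graph x y ==> \<beta> : pos_roots n ==>
  graph (\<rho> (crv n (neg_root \<beta>)) x) (ad (rsp n (neg_root \<beta>)) y)"

lemma neg_root_lie: "\<beta> : pos_roots n ==> crv n (neg_root \<beta>) : lie_o n"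
 and neg_root_roots: "\<beta> : pos_roots n ==> neg_root \<beta> : roots n"
 by (metis crv_lie_o neg_root_pair(2) pos_roots_roots prod.exhaust)+

lemma graph_carrier: "graph x y ==> x : carrier M & y : cliff n"
 by (induct rule: graph.induct)
   (auto simp: neg_root_lie hwop_cliff kap_le cliff_add cliff_scal cliff_ad rsp_cliff neg_root_roots)

lemma graph_zero: "graph \<zero> 0"
 using graph_smult[OF graph_base, of 0] by simp

lemma graph_diff: "graph x y ==> graph x' y' ==> graph (x \<ominus> x') (y - y')"
 using graph_add[OF _ graph_smult, of x y x' y' "- 1"] graph_carrier[of x y] graph_carrier[of x' y']
 by (simp add: minus_smult scal_minus)

text \<open>The implementing operator is quantified inside the induction: one of
  \<open>A + B\<close> need not split, and \<open>implements_unique\<close> exchanges it for a sum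
  of implementing operators.\<close>

lemma graph_base_lie:
 assumes "Z : lie_o n"
 shows "\<forall>s. implements n s Z --> graph (\<rho> Z v) (ad s w)"
 using assms
proof (rule lie_o_induct)
 fix \<alpha> assume \<alpha>: "\<alpha> : roots n"
 show "\<forall>s. implements n s (crv n \<alpha>) --> graph (\<rho> (crv n \<alpha>) v) (ad s w)"
 proof (intro allI impI)
  fix s assume "implements n s (crv n \<alpha>)"
  then have s: "ad s w = ad (rsp n \<alpha>) w"
   using implements_crv[OF \<alpha>] hwop_cliff[OF kap_le] by (rule implements_unique)
  from roots_cases_pos[OF \<alpha>] show "graph (\<rho> (crv n \<alpha>) v) (ad s w)"
  proof (elim disjE bexE)
   assume "\<alpha> : pos_roots n"
   then show ?thesis using s v_pos[of \<alpha>] ad_pos_hwop[of \<alpha> n \<kappa>, where 'a=complex] kap_le graph_zero by simp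
  next
   fix \<beta> assume "\<beta> : pos_roots n" "\<alpha> = neg_root \<beta>"
   then show ?thesis using s graph_neg[OF graph_base] by simp
  qed
 qed
next
 fix i assume i: "i < n"
 show "\<forall>s. implements n s (hmat n i) --> graph (\<rho> (hmat n i) v) (ad s w)"
 proof (intro allI impI)
  fix s assume "implements n s (hmat n i)"
  moreover have "implements n (gen n i*gen n (n + i)) (hmat n i)"
   unfolding hmat_def using i by (intro implements_gmat) auto
  ultimately have "ad s w = ad (gen n i*gen n (n + i)) w"
   using hwop_cliff[OF kap_le] by (rule implements_unique)
  also have "... = scal (if i < \<kappa> then 1 else 0)*w" using ad_h_hwop[OF i kap_le, where 'a=complex] by simp
  finally show "graph (\<rho> (hmat n i) v) (ad s w)"
   using rho_h_v[OF i] graph_smult[OF graph_base] by metis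
 qed
next
 fix A B assume AB: "A : lie_o n" "B : lie_o n"
  and IH: "\<forall>s. implements n s A --> graph (\<rho> A v) (ad s w)" "\<forall>s. implements n s B --> graph (\<rho> B v) (ad s w)"
 show "\<forall>s. implements n s (A + B) --> graph (\<rho> (A + B) v) (ad s w)"
 proof (intro allI impI)
  fix s assume s: "implements n s (A + B)"
  obtain a b where ab: "implements n a A" "implements n b B"
   using implements_exists AB by blast
  have "ad s w = ad (a + b) w"
   using s implements_add[OF ab AB] hwop_cliff[OF kap_le] by (rule implements_unique)
  then show "graph (\<rho> (A + B) v) (ad s w)"
   using IH ab AB by (auto simp: ad_add_left rho_mat_add intro: graph_add)
 qed
next
 fix c A assume A: "A : lie_o n" and IH: "\<forall>s. implements n s A --> graph (\<rho> A v) (ad s w)"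
 show "\<forall>s. implements n s (c \<cdot>\<^sub>m A) --> graph (\<rho> (c \<cdot>\<^sub>m A) v) (ad s w)"
 proof (intro allI impI)
  fix s assume s: "implements n s (c \<cdot>\<^sub>m A)"
  obtain a where a: "implements n a A" using implements_exists A by blast
  have "ad s w = ad (scal c*a) w"
   using s implements_smult[OF a A] hwop_cliff[OF kap_le] by (rule implements_unique)
  then show "graph (\<rho> (c \<cdot>\<^sub>m A) v) (ad s w)"
   using IH a A by (auto simp: ad_scal_left rho_mat_smult intro: graph_smult)
 qed
qed (rule n_pos)

text \<open>Closure under the whole Lie algebra although only negative root vectors generate the
  graph: \<open>Z\<close> is commuted past the last factor, and the induction hypothesis is applied
  to \<open>Z\<close> and to the commutator.\<close>

lemma graph_lie:
 assumes "graph x y" "Z : lie_o n" "implements n s Z"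
 shows "graph (\<rho> Z x) (ad s y)"
 using assms
proof (induct arbitrary: Z s rule: graph.induct)
 case graph_base
 then show ?case using graph_base_lie by blast
next
 case (graph_add x y x' y')
 then show ?case
  using graph_carrier[OF graph_add(1)] graph_carrier[OF graph_add(3)]
  by (simp add: rho_add ad_add_right graph.graph_add)
next
 case (graph_smult x y c)
 then show ?case
  using graph_carrier[OF graph_smult(1)]
  by (simp add: rho_smult ad_scal_right graph.graph_smult)
next
 case (graph_neg x y \<beta>)
 let ?F = "crv n (neg_root \<beta>)" and ?f = "rsp n (neg_root \<beta>) :: complex fock_op"
 have F: "?F : lie_o n" "implements n ?f ?F"
  using graph_neg(3) by (auto simp: neg_root_lie neg_root_roots intro: implements_crv)
 have 1: "graph (\<rho> ?F (\<rho> Z x)) (ad ?f (ad s y))"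
  using graph_neg by (intro graph.graph_neg) auto
 have 2: "graph (\<rho> (Z*?F - ?F*Z) x) (ad (ad s ?f) y)"
  using graph_neg F by (intro graph_neg(2) lie_o_comm implements_ad) auto
 have "\<rho> Z (\<rho> ?F x) = \<rho> ?F (\<rho> Z x) \<oplus> \<rho> (Z*?F - ?F*Z) x"
  using graph_neg F graph_carrier[OF graph_neg(1)] by (intro rho_swap) auto
 moreover have "ad s (ad ?f y) = ad ?f (ad s y) + ad (ad s ?f) y"
  by (simp add: ad_Jacobi)
 ultimately show ?case using graph.graph_add[OF 1 2] by simp
qed

lemma graph_root: "graph x y ==> \<alpha> : roots n ==> graph (\<rho> (crv n \<alpha>) x) (ad (rsp n \<alpha>) y)"
 by (rule graph_lie) (auto intro: crv_lie_o implements_crv)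

section \<open>Separating the highest weight from the lower ones\<close>

inductive_set low :: "'v set" where
 low_eig: "x : carrier M ==> \<rho> H0 x = of_int c \<odot> x ==> c < top_weight ==> x : low"
| low_add: "x : low ==> y : low ==> x \<oplus> y : low"

lemma low_carrier: "x : low ==> x : carrier M"
 by (induct rule: low.induct) auto

lemma H0_root:
 assumes "\<alpha> : roots n" "root_pair n \<alpha> = (a, b)" "x : carrier M" "\<rho> H0 x = of_int c \<odot> x"
 shows "\<rho> H0 (\<rho> (crv n \<alpha>) x) = of_int (c + hdeg n a + hdeg n b) \<odot> \<rho> (crv n \<alpha>) x"
proof -
 have "\<rho> H0 (\<rho> (crv n \<alpha>) x) = \<rho> (crv n \<alpha>) (\<rho> H0 x) \<oplus> \<rho> (H0*crv n \<alpha> - crv n \<alpha>*H0) x"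
  using assms by (intro rho_swap) (auto simp: crv_lie_o)
 also have "H0*crv n \<alpha> - crv n \<alpha>*H0 = of_int (hdeg n a + hdeg n b) \<cdot>\<^sub>m crv n \<alpha>"
  unfolding crv_gmat[OF assms(1,2)] using root_pair_bounds[OF assms(1,2)] by (intro grading_comm)
 also have "\<rho> (of_int (hdeg n a + hdeg n b) \<cdot>\<^sub>m crv n \<alpha>) x = of_int (hdeg n a + hdeg n b) \<odot> \<rho> (crv n \<alpha>) x"
  using assms by (intro rho_mat_smult) (auto simp: crv_lie_o)
 also have "\<rho> (crv n \<alpha>) (\<rho> H0 x) = of_int c \<odot> \<rho> (crv n \<alpha>) x"
  using assms by (simp add: rho_smult crv_lie_o)
 also have "of_int c \<odot> \<rho> (crv n \<alpha>) x \<oplus> of_int (hdeg n a + hdeg n b) \<odot> \<rho> (crv n \<alpha>) x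
  = (of_int c + of_int (hdeg n a + hdeg n b)) \<odot> \<rho> (crv n \<alpha>) x"
  using assms by (simp add: smult_add_left crv_lie_o)
 finally show ?thesis by (simp add: add.assoc)
qed

lemma neg_pair:
 assumes "\<beta> : pos_roots n"
 obtains a b where "root_pair n (neg_root \<beta>) = (a, b)" "hdeg n a + hdeg n b < 0" "a < 2*n+1" "b < 2*n+1"
proof -
 obtain a b where ab: "root_pair n \<beta> = (a, b)" by fastforce
 have "root_pair n (neg_root \<beta>) = (du n b, du n a)"
  using neg_root_pair[OF pos_roots_roots[OF assms] ab] by simp
 moreover have "hdeg n (du n b) + hdeg n (du n a) < 0"
  using pos_root_height[OF assms ab] by (simp add: hdeg_du)
 ultimately show thesis
  using that root_pair_bounds[OF pos_roots_roots[OF assms] ab] du_bound by blast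
qed

lemma low_neg:
 assumes "x : low" "\<beta> : pos_roots n"
 shows "\<rho> (crv n (neg_root \<beta>)) x : low"
 using assms(1)
proof induct
 case (low_eig x c)
 obtain a b where ab: "root_pair n (neg_root \<beta>) = (a, b)" "hdeg n a + hdeg n b < 0"
  using neg_pair[OF assms(2)] by metis
 have "\<rho> H0 (\<rho> (crv n (neg_root \<beta>)) x) = of_int (c + hdeg n a + hdeg n b) \<odot> \<rho> (crv n (neg_root \<beta>)) x"
  using low_eig assms(2) ab by (intro H0_root) (auto simp: neg_root_roots)
 then show ?case
  by (rule low.low_eig[rotated]) (use low_eig ab assms(2) in \<open>auto simp: neg_root_lie\<close>)
next
 case (low_add x y)
 then show ?case using assms(2) by (simp add: rho_add neg_root_lie low_carrier low.low_add)
qed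

definition shift :: "int => 'v => 'v" where
 "shift c x = \<rho> H0 x \<oplus> (- of_int c) \<odot> x"

lemma shift_carrier [simp]: "x : carrier M ==> shift c x : carrier M"
 by (simp add: shift_def)

lemma shift_add: "x : carrier M ==> y : carrier M ==> shift c (x \<oplus> y) = shift c x \<oplus> shift c y"
 by (simp add: shift_def rho_add smult_add_right M.a_ac)

lemma shift_smult: "x : carrier M ==> shift c (a \<odot> x) = a \<odot> shift c x"
 by (simp add: shift_def rho_smult smult_add_right smult_smult mult.commute)

lemma shift_zero [simp]: "shift c \<zero> = \<zero>"
 by (simp add: shift_def)

lemma shift_commute: "x : carrier M ==> shift c (shift d x) = shift d (shift c x)"
 by (simp add: shift_def rho_add rho_smult smult_add_right smult_smult M.a_ac mult.commute)

lemma shift_eig: "x : carrier M ==> \<rho> H0 x = of_int d \<odot> x ==> shift c x = of_int (d - c) \<odot> x"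
 by (simp add: shift_def smult_add_left[symmetric])

lemma foldr_shift_carrier [simp]: "x : carrier M ==> foldr shift cs x : carrier M"
 by (induct cs) auto

lemma foldr_shift_add: "x : carrier M ==> y : carrier M ==>
  foldr shift cs (x \<oplus> y) = foldr shift cs x \<oplus> foldr shift cs y"
 by (induct cs) (auto simp: shift_add)

lemma foldr_shift_zero [simp]: "foldr shift cs \<zero> = \<zero>"
 by (induct cs) auto

lemma foldr_shift_commute1: "x : carrier M ==> foldr shift cs (shift d x) = shift d (foldr shift cs x)"
 by (induct cs) (auto simp: shift_commute)

lemma foldr_shift_commute: "x : carrier M ==> foldr shift cs (foldr shift ds x) = foldr shift ds (foldr shift cs x)"
 by (induct ds) (auto simp: foldr_shift_commute1)

text \<open>A product of factors \<open>H0 - c\<close> with \<open>c\<close> below the top weight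
  annihilates the vector. The same product acts on \<open>v\<close> by a nonzero scalar, as
  \<open>v_not_low\<close> shows, and this replaces the independence of eigenspaces.\<close>

lemma low_kill:
 assumes "x : low"
 shows "\<exists>cs. (\<forall>c\<in>set cs. c < top_weight) & foldr shift cs x = \<zero>"
 using assms
proof induct
 case (low_eig x c)
 then show ?case by (intro exI[of _ "[c]"]) (auto simp: shift_eig)
next
 case (low_add x y)
 then obtain cs ds where c: "\<forall>c\<in>set cs. c < top_weight" "foldr shift cs x = \<zero>"
  "\<forall>c\<in>set ds. c < top_weight" "foldr shift ds y = \<zero>" by blast
 have "foldr shift (cs @ ds) x = \<zero>"
  using c(2) foldr_shift_commute[OF low_carrier[OF low_add(1)], of cs ds] by simp
 moreover have "foldr shift (cs @ ds) y = \<zero>" using c(4) by simp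
 ultimately have "foldr shift (cs @ ds) (x \<oplus> y) = \<zero>"
  using low_carrier[OF low_add(1)] low_carrier[OF low_add(3)] by (simp only: foldr_shift_add) simp
 then show ?case using c by (intro exI[of _ "cs @ ds"]) auto
qed

lemma smult_v_zero: "a \<odot> v = \<zero> ==> a = 0"
 using smult_smult[of v "1 / a" a] v_nonzero by (cases "a = 0") auto

lemma v_not_low:
 assumes "c \<odot> v : low"
 shows "c = 0"
proof -
 obtain cs where cs: "\<forall>c\<in>set cs. c < top_weight" "foldr shift cs (c \<odot> v) = \<zero>"
  using low_kill[OF assms] by blast
 have "foldr shift cs (a \<odot> v) = (a*(\<Prod>c\<leftarrow>cs. of_int (top_weight - c))) \<odot> v" for a
 proof (induct cs)
  case (Cons c cs)
  then show ?case by (simp add: shift_smult shift_eig[OF v_carrier H0_v] smult_smult mult_ac)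
 qed simp
 then have "c*(\<Prod>c\<leftarrow>cs. of_int (top_weight - c)) = 0"
  using cs(2) smult_v_zero by metis
 moreover have "(\<Prod>c\<leftarrow>cs. of_int (top_weight - c)) ~= (0::complex)"
  using cs(1) by (auto simp: prod_list_zero_iff)
 ultimately show ?thesis by simp
qed

text \<open>The point is the common coefficient \<open>c\<close> of the two leading terms. A
  negative root vector sends everything to lower weights on both sides and so resets
  \<open>c\<close> to 0.\<close>

lemma graph_decomp:
 assumes "graph x y"
 shows "\<exists>c l y'. l : low & wt_pred n (%m. m < top_weight) y' & x = c \<odot> v \<oplus> l & y = scal c*w + y'"
 using assms
proof induct
 case graph_base
 have "\<zero> : low" by (rule low_eig[where c="top_weight - 1"]) auto
 then show ?case by (intro exI[of _ 1] exI[of _ "\<zero>"] exI[of _ 0]) (auto simp: wt_pred_def)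
next
 case (graph_add x y x' y')
 then obtain c l z c' l' z' where *: "l : low" "wt_pred n (%m. m < top_weight) z" "x = c \<odot> v \<oplus> l" "y = scal c*w + z"
  "l' : low" "wt_pred n (%m. m < top_weight) z'" "x' = c' \<odot> v \<oplus> l'" "y' = scal c'*w + z'"
  by metis
 have "wt_pred n (%m. m < top_weight) (z + z')"
  unfolding wt_pred_def
 proof (intro allI impI)
  fix T S assume "ent (z + z') T S ~= 0"
  then have "ent z T S ~= 0 \<or> ent z' T S ~= 0" by (auto simp: ent_add)
  then show "wt n T - wt n S < top_weight" using *(2,6) by (auto simp: wt_pred_def)
 qed
 then show ?case
  using * low_carrier[of l] low_carrier[of l']
  by (intro exI[of _ "c + c'"] exI[of _ "l \<oplus> l'"] exI[of _ "z + z'"])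
    (auto simp: low_add smult_add_left M.a_ac scal_add algebra_simps)
next
 case (graph_smult x y d)
 then obtain c l z where *: "l : low" "wt_pred n (%m. m < top_weight) z" "x = c \<odot> v \<oplus> l" "y = scal c*w + z"
  by metis
 have "d \<odot> l : low" using *(1)
 proof induct
  case (low_eig x c)
  then show ?case by (intro low.low_eig[where c=c]) (auto simp: rho_smult smult_smult mult.commute)
 next
  case (low_add x y)
  then show ?case by (simp add: smult_add_right low_carrier low.low_add)
 qed
 moreover have "wt_pred n (%m. m < top_weight) (scal d*z)" using *(2) by (auto simp: wt_pred_def ent_scal)
 ultimately show ?case
  using * low_carrier[of l]
  by (intro exI[of _ "d*c"] exI[of _ "d \<odot> l"] exI[of _ "scal d*z"])
    (auto simp: smult_add_right smult_smult scal_mult distrib_left mult.assoc)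
next
 case (graph_neg x y \<beta>)
 then obtain c l z where *: "l : low" "wt_pred n (%m. m < top_weight) z" "x = c \<odot> v \<oplus> l" "y = scal c*w + z"
  by metis
 obtain a b where ab: "root_pair n (neg_root \<beta>) = (a, b)" "hdeg n a + hdeg n b < 0" "a < 2*n+1" "b < 2*n+1"
  using neg_pair[OF graph_neg(3)] by metis
 let ?F = "crv n (neg_root \<beta>)" and ?f = "rsp n (neg_root \<beta>) :: complex fock_op"
 have f: "?f = gen n a*gen n b" by (simp add: rsp_def ab)
 have w: "wt_pred n (%m. m - hdeg n a - hdeg n b = top_weight) (ad ?f w)"
  using wt_pred_ad[OF hwop_wt[OF kap_le, where 'a=complex] ab(3,4)] by (simp add: f top_weight_def)
 have z: "wt_pred n (%m. m - hdeg n a - hdeg n b < top_weight) (ad ?f z)"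
  using wt_pred_ad[OF *(2) ab(3,4)] by (simp add: f)
 have "wt_pred n (%m. m < top_weight) (scal c*ad ?f w + ad ?f z)"
  unfolding wt_pred_def
 proof (intro allI impI)
  fix T S assume "ent (scal c*ad ?f w + ad ?f z) T S ~= 0"
  then have "ent (ad ?f w) T S ~= 0 \<or> ent (ad ?f z) T S ~= 0" by (auto simp: ent_add ent_scal)
  then have "wt n T - wt n S - hdeg n a - hdeg n b \<le> top_weight" using w z by (force simp: wt_pred_def)
  then show "wt n T - wt n S < top_weight" using ab(2) by linarith
 qed
 moreover have "\<rho> ?F (c \<odot> v \<oplus> l) : low"
 proof -
  have "\<rho> H0 (\<rho> ?F v) = of_int (top_weight + hdeg n a + hdeg n b) \<odot> \<rho> ?F v"
   using graph_neg(3) ab H0_v by (intro H0_root) (auto simp: neg_root_roots)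
  then have "\<rho> H0 (c \<odot> \<rho> ?F v) = of_int (top_weight + hdeg n a + hdeg n b) \<odot> (c \<odot> \<rho> ?F v)"
   using graph_neg(3) by (simp add: rho_smult smult_smult neg_root_lie mult.commute)
  then have "c \<odot> \<rho> ?F v : low"
   by (rule low_eig[rotated]) (use graph_neg(3) ab in \<open>auto simp: neg_root_lie\<close>)
  then show ?thesis
   using *(1) graph_neg(3) low_carrier[of l]
   by (simp add: rho_add rho_smult neg_root_lie low_add low_neg)
 qed
 ultimately show ?case
  using * graph_neg(3) low_carrier[of l]
  by (intro exI[of _ 0] exI[of _ "\<rho> ?F x"] exI[of _ "scal c*ad ?f w + ad ?f z"])
    (auto simp: ad_add_right ad_scal_right low_carrier neg_root_lie)
qed

lemma graph_zero_pairing_w: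
 assumes "graph \<zero> y"
 shows "pairing n (ent y) (ent w) = 0"
proof -
 obtain c l y' where d: "l : low" "wt_pred n (%m. m < top_weight) y'"
  "\<zero> = c \<odot> v \<oplus> l" "y = scal c*w + y'"
  using graph_decomp[OF assms] by blast
 have "(- c) \<odot> v = (- c) \<odot> v \<oplus> (c \<odot> v \<oplus> l)" using d(3)[symmetric] by simp
 also have "... = ((- c) + c) \<odot> v \<oplus> l"
  using low_carrier[OF d(1)] by (simp only: smult_add_left[OF v_carrier]) (simp add: M.a_assoc)
 finally have "(- c) \<odot> v = l" using low_carrier[OF d(1)] by simp
 then have "c = 0" using v_not_low[of "- c"] d(1) by simp
 then have "y = y'" using d(4) by simp
 then show ?thesis
  using pairing_wt_zero[OF d(2) hwop_wt[OF kap_le, folded top_weight_def]] by simp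
qed

text \<open>Contravariance moves the negative root vectors of \<open>z\<close> to positive ones
  acting on \<open>y\<close>. These keep \<open>y\<close> related to zero, and in the end only the
  pairing with \<open>w\<close> is left.\<close>

lemma graph_zero_pairing:
 assumes "graph x z" "graph \<zero> y"
 shows "pairing n (ent y) (ent z) = 0"
 using assms
proof (induct arbitrary: y rule: graph.induct)
 case graph_base
 then show ?case by (rule graph_zero_pairing_w)
next
 case (graph_add x z x' z')
 have "ent (z + z') = (%T S. ent z T S + ent z' T S)" by (intro ext) (simp add: ent_add)
 then show ?case using graph_add by (simp add: pairing_add)
next
 case (graph_smult x z c)
 have "ent (scal c*z) = (%T S. c*ent z T S)" by (intro ext) (simp add: ent_scal)
 then show ?case using graph_smult by (simp add: pairing_scal)
next
 case (graph_neg x z \<beta>)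
 obtain a b where ab: "root_pair n \<beta> = (a, b)" by fastforce
 have \<beta>: "\<beta> : roots n" using graph_neg(3) by (rule pos_roots_roots)
 note bd = root_pair_bounds[OF \<beta> ab]
 have "graph \<zero> (ad (rsp n \<beta>) y)"
  using graph_root[OF graph_neg(4) \<beta>] \<beta> by (simp add: crv_lie_o)
 then have "pairing n (ent (ad (rsp n \<beta>) y)) (ent z) = 0" by (rule graph_neg(2))
 then show ?case
  using pairing_ad_gen2[OF bd(1,2), of y z] by (simp add: rsp_def ab neg_root_pair[OF \<beta> ab])
qed

text \<open>The case \<open>z = y\<close> together with definiteness. Thus a vector determines the
  related matrix.\<close>

lemma graph_zero_ent:
 assumes "graph \<zero> y" "T <= {..<n}" "S <= {..<n}"
 shows "ent y T S = 0"
 using graph_zero_pairing[OF assms(1) assms(1)] assms(2,3) by (rule pairing_self_zero)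

definition vanishing :: "complex fock_op => bool" where
 "vanishing y \<longleftrightarrow> (\<forall>T S. T <= {..<n} --> S <= {..<n} --> ent y T S = 0)"

lemma vanishing_cliff:
 assumes "s : cliff n" "vanishing y"
 shows "vanishing (s*y) & vanishing (y * s)"
 using assms
proof (induct arbitrary: y)
 case (cliff_gen j)
 have "A - {x} <= {..<n}" if "A <= {..<n}" for A and x :: nat using that by auto
 then show ?case using cliff_gen
  by (auto simp: vanishing_def ent_gen_mult ent_mult_gen lgen_def rgen_def)
next
 case (cliff_add x x')
 then show ?case by (simp add: vanishing_def distrib_left distrib_right ent_add)
next
 case (cliff_mult x x')
 then show ?case by (metis mult.assoc)
next
 case (cliff_scal x c)
 then show ?case by (simp add: vanishing_def mult.assoc ent_scal scal_left_commute)
qed simp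

section \<open>Consequences of irreducibility for the graph\<close>

lemma submodule_dichotomy:
 assumes "H <= carrier M" "\<zero> : H" "!!x y. x : H ==> y : H ==> x \<oplus> y : H"
  "!!c x. x : H ==> c \<odot> x : H" "!!X x. X : lie_o n ==> x : H ==> \<rho> X x : H"
 shows "H = {\<zero>} \<or> H = carrier M"
proof -
 have "subspace class_ring H M"
  by (intro subspace.intro submodule.intro M.vectorspace_axioms M.module_axioms) (use assms in auto)
 then show ?thesis
  using hw assms(5) by (simp add: irreducible_hw_module_def irreducible_rep_def)
qed

text \<open>The vectors related to a vanishing matrix form a submodule. It does not contain
  \<open>v\<close>, whose matrix has a nonzero entry, so irreducibility leaves only zero.\<close>

lemma graph_inj:
 assumes "graph x y" "vanishing y"
 shows "x = \<zero>"
proof -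
 define H where "H = {x. \<exists>y. graph x y & vanishing y}"
 have "H = {\<zero>} \<or> H = carrier M"
 proof (rule submodule_dichotomy)
  show "H <= carrier M" using graph_carrier by (auto simp: H_def)
  show "\<zero> : H" using graph_zero by (auto simp: H_def vanishing_def)
  show "x \<oplus> y : H" if xy: "x : H" "y : H" for x y
  proof -
   obtain x' y' where "graph x x'" "vanishing x'" "graph y y'" "vanishing y'" using xy by (auto simp: H_def)
   then show ?thesis unfolding H_def
    by (intro CollectI exI[of _ "x' + y'"]) (auto simp: vanishing_def ent_add intro: graph_add)
  qed
  show "c \<odot> x : H" if x: "x : H" for c x
  proof -
   obtain x' where "graph x x'" "vanishing x'" using x by (auto simp: H_def)
   then show ?thesis unfolding H_def
    by (intro CollectI exI[of _ "scal c*x'"]) (auto simp: vanishing_def ent_scal intro: graph_smult)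
  qed
  show "\<rho> X x : H" if X: "X : lie_o n" and x: "x : H" for X x
  proof -
   obtain x' where x': "graph x x'" "vanishing x'" using x by (auto simp: H_def)
   obtain s where s: "s : cliff n" "implements n s X" using implements_exists[OF X] by blast
   have "vanishing (ad s x')"
    using vanishing_cliff[OF s(1) x'(2)] by (auto simp: vanishing_def ad_def ent_diff)
   then show ?thesis using graph_lie[OF x'(1) X s(2)] by (auto simp: H_def)
  qed
 qed
 moreover have "v ~: H"
 proof
  assume "v : H"
  then obtain y where y: "graph v y" "vanishing y" by (auto simp: H_def)
  have "graph \<zero> (w - y)"
   using graph_diff[OF graph_base y(1)] by (simp add: a_minus_def M.r_neg)
  then have "ent (w - y) {..<\<kappa>} {} = 0" by (rule graph_zero_ent) (use kap_le in auto)
  then have "ent w {..<\<kappa>} {} = 0"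
   using y(2) kap_le by (simp add: vanishing_def ent_diff)
  then show False using hwop_entry[OF kap_le, where 'a=complex] by simp
 qed
 ultimately have "H = {\<zero>}" by (metis v_carrier)
 then show ?thesis using assms by (auto simp: H_def)
qed

lemma graph_total:
 assumes "x : carrier M"
 shows "\<exists>y. graph x y"
proof -
 define H where "H = {x. \<exists>y. graph x y}"
 have "H = {\<zero>} \<or> H = carrier M"
 proof (rule submodule_dichotomy)
  show "\<rho> X x : H" if X: "X : lie_o n" and x: "x : H" for X x
   using graph_lie[OF _ X] implements_exists[OF X] x by (auto simp: H_def)
 qed (use graph_carrier graph_zero graph_add graph_smult in \<open>auto simp: H_def\<close>, blast+)
 moreover have "v : H" using graph_base by (auto simp: H_def)
 ultimately show ?thesis using assms v_nonzero by (auto simp: H_def)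
qed

end

section \<open>The enveloping algebra and the Kostant lattice\<close>

lemma poly_mapping_sum_singles: "(\<Sum>x\<in>pkeys p. psingle x (plookup p x)) = p"
 by (rule poly_mapping_eqI)
   (simp add: lookup_sum lookup_single when_def not_in_keys_iff_lookup_eq_zero)

lemma poly_mapping_keys_induct [consumes 1, case_names zero single add]:
 assumes "pkeys p <= A"
  and "P 0"
  and "!!x c. x : A ==> P (psingle x c)"
  and "!!p q. pkeys p <= A ==> pkeys q <= A ==> P p ==> P q ==> P (p + q)"
 shows "P (p :: 'a \<Rightarrow>\<^sub>0 'b::comm_monoid_add)"
proof -
 have "finite I ==> I <= A ==> pkeys (\<Sum>x\<in>I. psingle x (plookup p x)) <= A \<and>
   P (\<Sum>x\<in>I. psingle x (plookup p x))" for I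
 proof (induct I rule: finite_induct)
  case empty
  then show ?case using assms(2) by simp
 next
  case (insert x I)
  have k: "pkeys (psingle x (plookup p x)) <= A"
   using insert by auto
  then show ?case
   using insert assms(3,4) keys_add[of "psingle x (plookup p x)"]
   by (simp add: order_trans[OF keys_add])
 qed
 from this[of "pkeys p"] show ?thesis
  using assms(1) by (simp add: poly_mapping_sum_singles)
qed

definition words :: "'a set => 'a word set" where
 "words A = {w. set (letters w) <= A}"

lemma free_algebra_carrier: "p : carrier (free_algebra A) \<longleftrightarrow> pkeys p <= words A"
 by (auto simp: free_algebra_def words_def)

lemma words_add: "u : words A ==> w : words A ==> u + w : words A"
 by (auto simp: words_def plus_word_def)

lemma free_algebra_ring: "ring (free_algebra A)"
proof (rule ringI)
 have keys0: "pkeys (p*q) <= words A"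
  if "pkeys p <= words A" "pkeys q <= words A" for p q :: "'a word \<Rightarrow>\<^sub>0 complex"
  using keys_mult[of p q] that words_add by blast
 show "abelian_group (free_algebra A)"
 proof (rule abelian_groupI)
  fix x assume "x : carrier (free_algebra A)"
  then show "\<exists>y\<in>carrier (free_algebra A). y \<oplus>\<^bsub>free_algebra A\<^esub> x = \<zero>\<^bsub>free_algebra A\<^esub>"
   by (intro bexI[of _ "- x"]) (auto simp: free_algebra_def keys_minus)
 qed (auto simp: free_algebra_def algebra_simps dest: subsetD[OF keys_add])
 show "monoid (free_algebra A)"
 proof (rule monoidI)
  fix x y assume "x : carrier (free_algebra A)" "y : carrier (free_algebra A)"
  then have "x*y : carrier (free_algebra A)" by (simp add: free_algebra_carrier keys0)
  then show "x \<otimes>\<^bsub>free_algebra A\<^esub> y : carrier (free_algebra A)" by (simp add: free_algebra_def)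
 next
  have "(1 :: 'a word \<Rightarrow>\<^sub>0 complex) : carrier (free_algebra A)"
   by (simp add: free_algebra_carrier words_def zero_word_def)
  then show "\<one>\<^bsub>free_algebra A\<^esub> : carrier (free_algebra A)" by (simp add: free_algebra_def)
 qed (auto simp: free_algebra_def mult.assoc)
qed (auto simp: free_algebra_def algebra_simps)

lemma free_algebra_ops: "mult (free_algebra A) = (*)" "add (free_algebra A) = (+)"
 "one (free_algebra A) = 1" "zero (free_algebra A) = 0"
 by (simp_all add: free_algebra_def)

section \<open>The enveloping algebra acting on the irreducible module\<close>

context hw_module
begin

interpretation FA: ring "free_algebra (lie_o n)"
 by (rule free_algebra_ring)

definition act :: "(complex mat word \<Rightarrow>\<^sub>0 complex) => 'v => 'v" where
 "act p x = (\<Oplus>\<^bsub>M\<^esub>u\<in>pkeys p. plookup p u \<odot> foldr \<rho> (letters u) x)"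

lemma foldr_rho_carrier [simp]: "set us <= lie_o n ==> x : carrier M ==> foldr \<rho> us x : carrier M"
 by (induct us) auto

lemma foldr_rho_add: "set us <= lie_o n ==> x : carrier M ==> y : carrier M ==>
  foldr \<rho> us (x \<oplus> y) = foldr \<rho> us x \<oplus> foldr \<rho> us y"
 by (induct us) (auto simp: rho_add)

lemma foldr_rho_smult: "set us <= lie_o n ==> x : carrier M ==>
  foldr \<rho> us (c \<odot> x) = c \<odot> foldr \<rho> us x"
 by (induct us) (auto simp: rho_smult)

lemma foldr_rho_zero [simp]: "set us <= lie_o n ==> foldr \<rho> us \<zero> = \<zero>"
 by (induct us) auto

lemma act_superset:
 assumes "finite I" "pkeys p <= I" "I <= words (lie_o n)" "x : carrier M"
 shows "act p x = (\<Oplus>\<^bsub>M\<^esub>u\<in>I. plookup p u \<odot> foldr \<rho> (letters u) x)"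
 unfolding act_def
proof (rule M.add.finprod_mono_neutral_cong_left[OF assms(1,2)])
 fix u assume "u : I - pkeys p"
 then show "plookup p u \<odot> foldr \<rho> (letters u) x = \<zero>"
  using assms by (auto simp: not_in_keys_iff_lookup_eq_zero words_def)
qed (use assms in \<open>auto simp: words_def\<close>)

lemma act_carrier [simp]: "pkeys p <= words (lie_o n) ==> x : carrier M ==> act p x : carrier M"
 unfolding act_def by (intro M.finsum_closed) (auto simp: words_def)

lemma act_zero [simp]: "act 0 x = \<zero>"
 by (simp add: act_def)

lemma act_add:
 assumes "pkeys p <= words (lie_o n)" "pkeys q <= words (lie_o n)" "x : carrier M"
 shows "act (p + q) x = act p x \<oplus> act q x"
proof -
 let ?I = "pkeys p \<union> pkeys q"
 have I: "finite ?I" "?I <= words (lie_o n)" using assms by auto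
 have c: "f : ?I \<rightarrow> carrier M" if "!!u. u : words (lie_o n) ==> f u : carrier M" for f
  using that assms by blast
 have "act (p + q) x = (\<Oplus>\<^bsub>M\<^esub>u\<in>?I. plookup p u \<odot> foldr \<rho> (letters u) x \<oplus> plookup q u \<odot> foldr \<rho> (letters u) x)"
  unfolding act_superset[OF I(1) keys_add I(2) assms(3)]
  using I assms(3) by (intro M.finsum_cong') (auto simp: lookup_add smult_add_left words_def)
 also have "... = act p x \<oplus> act q x"
  unfolding act_superset[OF I(1) Un_upper1 I(2) assms(3)] act_superset[OF I(1) Un_upper2 I(2) assms(3)]
  using assms(3) by (intro M.finsum_addf c) (auto simp: words_def)
 finally show ?thesis .
qed

lemma act_single: "u : words (lie_o n) ==> x : carrier M ==>
  act (psingle u c) x = c \<odot> foldr \<rho> (letters u) x"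
 using act_superset[of "{u}" "psingle u c" x]
 by (auto simp: words_def M.finsum_insert[where F="{}", simplified])

lemma act_mult:
 assumes "pkeys p <= words (lie_o n)" "pkeys q <= words (lie_o n)" "x : carrier M"
 shows "act (p*q) x = act p (act q x)"
proof -
 have k: "pkeys (p*q) <= words (lie_o n)"
  if "pkeys p <= words (lie_o n)" "pkeys q <= words (lie_o n)" for p q :: "complex mat word \<Rightarrow>\<^sub>0 complex"
  using keys_mult[of p q] that words_add by blast
 have single: "act (psingle u c*q) x = act (psingle u c) (act q x)" 
  if u: "u : words (lie_o n)" for u c
  using assms(2)
 proof (induct q rule: poly_mapping_keys_induct)
  case zero
  then show ?case using u by (simp add: act_single words_def)
 next
  case (single y d)
  have "letters (u + y) = letters u @ letters y" by (simp add: plus_word_def)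
  then show ?case
   using u single assms(3) words_add[OF u single]
   by (auto simp: mult_single act_single words_def foldr_rho_smult smult_smult)
 next
  case (add p q)
  have ku: "pkeys (psingle u c) <= words (lie_o n)" using u by auto
  have us: "set (letters u) <= lie_o n" using u by (simp add: words_def)
  show ?case
   using add u us k[OF ku] assms(3)
   by (simp add: distrib_left act_add act_single smult_add_right foldr_rho_add)
 qed
 from assms(1) show ?thesis
 proof (induct p rule: poly_mapping_keys_induct)
  case (add p q')
  then show ?case using k[OF _ assms(2)] assms by (simp add: distrib_right act_add)
 qed (use single in auto)
qed

lemma act_one: "x : carrier M ==> act 1 x = x"
 using act_single[of 0 x 1] by (simp add: single_one[symmetric] words_def zero_word_def)

lemma env_rels_carrier: "env_rels n <= carrier (free_algebra (lie_o n))"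
proof -
 have m: "monomial c us : carrier (free_algebra (lie_o n))" if "set us <= lie_o n" for c us
  using that by (auto simp: free_algebra_carrier words_def)
 have d: "p - q : carrier (free_algebra (lie_o n))"
  if "p : carrier (free_algebra (lie_o n))" "q : carrier (free_algebra (lie_o n))" for p q
  using that keys_diff[of p q] by (auto simp: free_algebra_carrier)
 show ?thesis
  unfolding env_rels_def by (auto intro!: d m lie_o_add lie_o_smult lie_o_comm)
qed

lemma act_minus:
 assumes "pkeys p <= words (lie_o n)" "x : carrier M"
 shows "act (- p) x = \<ominus> act p x"
 using act_add[of "- p" p x] assms M.minus_equality[of "act (- p) x" "act p x"] by (simp add: keys_minus)

lemma act_diff:
 assumes "pkeys p <= words (lie_o n)" "pkeys q <= words (lie_o n)" "x : carrier M"
 shows "act (p - q) x = act p x \<ominus> act q x"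
 using act_add[of p "- q" x] assms by (simp add: keys_minus act_minus a_minus_def)

text \<open>The elements of the free algebra that annihilate the module form a two-sided ideal, and
  it contains the defining relations.\<close>

lemma env_ideal_act:
 assumes "p : env_ideal n"
 shows "pkeys p <= words (lie_o n)" "x : carrier M ==> act p x = \<zero>"
proof -
 define I where "I = {p : carrier (free_algebra (lie_o n)). \<forall>x\<in>carrier M. act p x = \<zero>}"
 have "ideal I (free_algebra (lie_o n))"
 proof (rule idealI)
  show "ring (free_algebra (lie_o n))" by (rule free_algebra_ring)
  show "subgroup I (add_monoid (free_algebra (lie_o n)))"
  proof (rule FA.add.subgroupI)
   show "I ~= {}" using FA.zero_closed by (force simp: I_def free_algebra_ops)
   fix a assume a: "a : I"
   have "- a : carrier (free_algebra (lie_o n))" using a by (auto simp: I_def free_algebra_carrier)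
   then have "\<ominus>\<^bsub>free_algebra (lie_o n)\<^esub> a = - a"
    using a by (intro FA.minus_equality) (auto simp: I_def free_algebra_ops)
   then show "\<ominus>\<^bsub>free_algebra (lie_o n)\<^esub> a : I"
    using a by (auto simp: I_def free_algebra_carrier act_minus)
  next
   fix a b assume "a : I" "b : I"
   then show "a \<oplus>\<^bsub>free_algebra (lie_o n)\<^esub> b : I"
    using keys_add[of a b] by (auto simp: I_def free_algebra_carrier free_algebra_ops act_add)
  qed (auto simp: I_def)
 next
  fix a x assume ax: "a : I" "x : carrier (free_algebra (lie_o n))"
  have "x*a : carrier (free_algebra (lie_o n))" "a*x : carrier (free_algebra (lie_o n))"
   using ax FA.m_closed by (auto simp: I_def free_algebra_ops)
  moreover have "act x \<zero> = \<zero>"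
   using ax act_mult[of x 0 "\<zero>"] by (auto simp: free_algebra_carrier)
  ultimately show "x \<otimes>\<^bsub>free_algebra (lie_o n)\<^esub> a : I" "a \<otimes>\<^bsub>free_algebra (lie_o n)\<^esub> x : I"
   using ax by (auto simp: I_def free_algebra_carrier free_algebra_ops act_mult)
 qed
 moreover have "env_rels n <= I"
 proof
  fix p assume p: "p : env_rels n"
  have s: "Word us : words (lie_o n)" if "set us <= lie_o n" for us using that by (simp add: words_def)
  have k: "pkeys (monomial c us) <= words (lie_o n)" if "set us <= lie_o n" for c us
   using that by (auto simp: words_def)
  have kd: "pkeys (p - q) <= words (lie_o n)"
   if "pkeys p <= words (lie_o n)" "pkeys q <= words (lie_o n)" for p q :: "complex mat word \<Rightarrow>\<^sub>0 complex"
   using that keys_diff[of p q] by auto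
  have z3: "B \<oplus> C \<ominus> B \<ominus> C = \<zero>" if "B : carrier M" "C : carrier M" for B C
  proof -
   have "B \<oplus> C \<ominus> B = C" using that by (simp add: a_minus_def M.a_comm M.r_neg1)
   then show ?thesis using that by (simp add: a_minus_def M.r_neg)
  qed
  have act0: "act p x = \<zero>" if x: "x : carrier M" for x
   using p unfolding env_rels_def
  proof (elim UnE CollectE exE conjE)
   fix X Y assume *: "p = monomial 1 [X + Y] - monomial 1 [X] - monomial 1 [Y]" "X : lie_o n" "Y : lie_o n"
   have "act p x = \<rho> (X + Y) x \<ominus> \<rho> X x \<ominus> \<rho> Y x"
    using * x by (simp add: act_diff act_single s k kd lie_o_add)
   then show ?thesis using * x by (simp add: rho_mat_add z3)
  next
   fix c X assume *: "p = monomial 1 [c \<cdot>\<^sub>m X] - monomial c [X]" "X : lie_o n"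
   then show ?thesis using x
    by (simp add: act_diff act_single s k kd lie_o_smult rho_mat_smult a_minus_def M.r_neg)
  next
   fix X Y assume *: "p = monomial 1 [X*Y - Y*X] - (monomial 1 [X, Y] - monomial 1 [Y, X])"
    "X : lie_o n" "Y : lie_o n"
   have "act p x = \<rho> (X*Y - Y*X) x \<ominus> (\<rho> X (\<rho> Y x) \<ominus> \<rho> Y (\<rho> X x))"
    using * x by (simp add: act_diff act_single s k kd lie_o_comm)
   then show ?thesis using * x by (simp add: rho_comm)
  qed
  then show "p : I" using p env_rels_carrier by (auto simp: I_def)
 qed
 ultimately have "env_ideal n <= I"
  unfolding env_ideal_def by (rule FA.genideal_minimal)
 then show "pkeys p <= words (lie_o n)" "x : carrier M ==> act p x = \<zero>"
  using assms by (auto simp: I_def free_algebra_carrier)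
qed

interpretation EI: ideal "env_ideal n" "free_algebra (lie_o n)"
 unfolding env_ideal_def by (rule FA.genideal_ideal[OF env_rels_carrier])

interpretation EA: ring "env_algebra n"
 unfolding env_algebra_def by (rule EI.quotient_is_ring)

abbreviation cos :: "(complex mat word \<Rightarrow>\<^sub>0 complex) => (complex mat word \<Rightarrow>\<^sub>0 complex) set" where
 "cos p \<equiv> env_ideal n +>\<^bsub>free_algebra (lie_o n)\<^esub> p"

text \<open>All representatives of a coset act alike, so the set from which \<open>the_elem\<close>
  picks is a singleton.\<close>

lemma env_act_cos:
 assumes "pkeys p <= words (lie_o n)" "x : carrier M"
 shows "env_act M \<rho> (cos p) x = act p x"
proof -
 have "act q x = act p x" if q: "q : cos p" for q
 proof -
  obtain i where i: "i : env_ideal n" "q = i + p"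
   using q by (auto simp: a_r_coset_def' free_algebra_ops)
  then show ?thesis using env_ideal_act[OF i(1)] assms by (simp add: act_add)
 qed
 moreover have "p : cos p"
  using EI.a_rcos_self[of p] assms by (simp add: free_algebra_carrier)
 ultimately have "(%p. act p x) ` cos p = {act p x}" by blast
 then show ?thesis by (simp add: env_act_def act_def[abs_def])
qed

lemma env_algebra_carrier:
 assumes "u : carrier (env_algebra n)"
 obtains p where "pkeys p <= words (lie_o n)" "u = cos p"
 using assms by (auto simp: env_algebra_def FactRing_def A_RCOSETS_def' free_algebra_carrier)

lemma env_act_carrier: "u : carrier (env_algebra n) ==> x : carrier M ==> env_act M \<rho> u x : carrier M"
 by (metis act_carrier env_act_cos env_algebra_carrier)

lemma env_act_add:
 assumes "u : carrier (env_algebra n)" "u' : carrier (env_algebra n)" "x : carrier M"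
 shows "env_act M \<rho> (u \<oplus>\<^bsub>env_algebra n\<^esub> u') x = env_act M \<rho> u x \<oplus> env_act M \<rho> u' x"
proof -
 obtain p q where pq: "pkeys p <= words (lie_o n)" "u = cos p" "pkeys q <= words (lie_o n)" "u' = cos q"
  using assms env_algebra_carrier by metis
 have "u \<oplus>\<^bsub>env_algebra n\<^esub> u' = cos (p + q)"
  using EI.a_rcos_sum[of p q] pq by (simp add: env_algebra_def FactRing_def free_algebra_carrier free_algebra_ops)
 moreover have "pkeys (p + q) <= words (lie_o n)" using pq keys_add[of p q] by blast
 ultimately show ?thesis using pq assms(3) by (simp add: env_act_cos act_add)
qed

lemma env_act_mult:
 assumes "u : carrier (env_algebra n)" "u' : carrier (env_algebra n)" "x : carrier M"
 shows "env_act M \<rho> (u \<otimes>\<^bsub>env_algebra n\<^esub> u') x = env_act M \<rho> u (env_act M \<rho> u' x)"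
proof -
 obtain p q where pq: "pkeys p <= words (lie_o n)" "u = cos p" "pkeys q <= words (lie_o n)" "u' = cos q"
  using assms env_algebra_carrier by metis
 have "u \<otimes>\<^bsub>env_algebra n\<^esub> u' = cos (p*q)"
  using EI.rcoset_mult_add[of p q] pq by (simp add: env_algebra_def FactRing_def free_algebra_carrier free_algebra_ops)
 moreover have "pkeys (p*q) <= words (lie_o n)"
  using FA.m_closed[of p q] pq by (simp add: free_algebra_carrier free_algebra_ops)
 ultimately show ?thesis using pq assms(3) by (simp add: env_act_cos act_mult)
qed

lemma env_act_one: "x : carrier M ==> env_act M \<rho> \<one>\<^bsub>env_algebra n\<^esub> x = x"
 using env_act_cos[of 1 x]
 by (simp add: env_algebra_def FactRing_def free_algebra_ops act_one words_def zero_word_def)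

lemma env_act_neg:
 assumes "u : carrier (env_algebra n)" "x : carrier M"
 shows "env_act M \<rho> (\<ominus>\<^bsub>env_algebra n\<^esub> u) x = \<ominus> env_act M \<rho> u x"
proof -
 have "env_act M \<rho> \<zero>\<^bsub>env_algebra n\<^esub> x = \<zero>"
  using env_act_add[OF EA.zero_closed EA.zero_closed assms(2)] env_act_carrier[OF EA.zero_closed assms(2)]
  by (simp add: M.add.l_cancel_one')
 then have "env_act M \<rho> (\<ominus>\<^bsub>env_algebra n\<^esub> u) x \<oplus> env_act M \<rho> u x = \<zero>"
  using env_act_add[OF EA.a_inv_closed[OF assms(1)] assms] by (simp add: EA.l_neg assms(1))
 then show ?thesis
  using M.minus_equality env_act_carrier assms by (metis EA.a_inv_closed)
qed

lemma divided_power_word: "\<alpha> : roots n ==> pkeys (monomial c (replicate m (crv n \<alpha>))) <= words (lie_o n)"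
 by (auto simp: words_def crv_lie_o)

lemma divided_power_carrier: "\<alpha> : roots n ==> divided_power n \<alpha> m : carrier (env_algebra n)"
 using divided_power_word[of \<alpha>, where c="1 / fact m" and m=m]
 by (auto simp: env_algebra_def FactRing_def divided_power_def A_RCOSETS_def' free_algebra_carrier crv_def[symmetric] simp del: keys_single)

lemma env_act_divided_power:
 assumes "\<alpha> : roots n" "x : carrier M"
 shows "env_act M \<rho> (divided_power n \<alpha> m) x = (1 / fact m) \<odot> ((\<rho> (crv n \<alpha>)) ^^ m) x"
proof -
 have "foldr \<rho> (replicate m X) x = (\<rho> X ^^ m) x" for X by (induct m) auto
 moreover have "Word (replicate m (crv n \<alpha>)) : words (lie_o n)" using assms by (auto simp: words_def crv_lie_o)
 ultimately show ?thesis
  using env_act_cos[OF divided_power_word[OF assms(1)] assms(2), where c1="1 / fact m" and m1=m] assms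
  by (simp add: divided_power_def crv_def[symmetric] act_single)
qed

section \<open>Closure properties of the Kostant lattice\<close>

abbreviation K :: "'v set" where "K \<equiv> kostant_lattice n M \<rho> v"

abbreviation "dp \<alpha> m \<equiv> env_act M \<rho> (divided_power n \<alpha> m)"

lemma kostant_form_carrier: "u : kostant_form n ==> u : carrier (env_algebra n)"
 unfolding kostant_form_def
 by (rule EA.generate_ring_in_carrier[rotated], assumption) (auto intro: divided_power_carrier)

lemma K_carrier: "x : K ==> x : carrier M"
 by (auto simp: kostant_lattice_def kostant_form_carrier env_act_carrier)

lemma K_v: "v : K"
 unfolding kostant_lattice_def kostant_form_def
 by (rule CollectI, rule exI[of _ "\<one>\<^bsub>env_algebra n\<^esub>"]) (simp add: env_act_one generate_ring.one)

lemma K_add: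
 assumes "x : K" "y : K"
 shows "x \<oplus> y : K"
proof -
 obtain u u' where u: "u : kostant_form n" "x = env_act M \<rho> u v" "u' : kostant_form n" "y = env_act M \<rho> u' v"
  using assms by (auto simp: kostant_lattice_def)
 have "u \<oplus>\<^bsub>env_algebra n\<^esub> u' : kostant_form n"
  using u unfolding kostant_form_def by (intro generate_ring.eng_add)
 moreover have "x \<oplus> y = env_act M \<rho> (u \<oplus>\<^bsub>env_algebra n\<^esub> u') v"
  using u by (simp add: env_act_add kostant_form_carrier)
 ultimately show ?thesis by (auto simp: kostant_lattice_def)
qed

lemma K_neg:
 assumes "x : K"
 shows "\<ominus> x : K"
proof -
 obtain u where u: "u : kostant_form n" "x = env_act M \<rho> u v"
  using assms by (auto simp: kostant_lattice_def)
 have "\<ominus>\<^bsub>env_algebra n\<^esub> u : kostant_form n"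
  using u unfolding kostant_form_def by (intro generate_ring.a_inv)
 moreover have "\<ominus> x = env_act M \<rho> (\<ominus>\<^bsub>env_algebra n\<^esub> u) v"
  using u by (simp add: env_act_neg kostant_form_carrier)
 ultimately show ?thesis by (auto simp: kostant_lattice_def)
qed

lemma K_dp: 
 assumes "\<alpha> : roots n" "x : K"
 shows "dp \<alpha> m x : K"
proof -
 obtain u where u: "u : kostant_form n" "x = env_act M \<rho> u v" using assms(2) by (auto simp: kostant_lattice_def)
 have d: "divided_power n \<alpha> m : kostant_form n"
  unfolding kostant_form_def using assms(1) by (intro generate_ring.incl) auto
 then have "divided_power n \<alpha> m \<otimes>\<^bsub>env_algebra n\<^esub> u : kostant_form n"
  using u unfolding kostant_form_def by (intro generate_ring.eng_mult)
 moreover have "dp \<alpha> m x = env_act M \<rho> (divided_power n \<alpha> m \<otimes>\<^bsub>env_algebra n\<^esub> u) v"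
  using u d by (simp add: env_act_mult kostant_form_carrier)
 ultimately show ?thesis by (auto simp: kostant_lattice_def)
qed

text \<open>Induction over the generated ring proves the stronger statement that every element of
  the Kostant form preserves \<open>P\<close>; products force the vector to be arbitrary.\<close>

lemma K_induct:
 assumes "x : K" and carr: "!!x. P x ==> x : carrier M" and "P v"
  and add: "!!x y. P x ==> P y ==> P (x \<oplus> y)" and neg: "!!x. P x ==> P (\<ominus> x)"
  and dp: "!!\<alpha> m x. \<alpha> : roots n ==> P x ==> P (dp \<alpha> m x)"
 shows "P x"
proof -
 have "u : kostant_form n ==> P y ==> P (env_act M \<rho> u y)" for u y
  unfolding kostant_form_def
 proof (induct arbitrary: y rule: generate_ring.induct)
  case one
  then show ?case using carr by (simp add: env_act_one)
 next
  case (incl h)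
  then show ?case using dp by auto
 next
  case (a_inv h)
  then show ?case using carr neg kostant_form_carrier by (simp add: env_act_neg kostant_form_def)
 next
  case (eng_add h1 h2)
  then show ?case using carr add kostant_form_carrier by (simp add: env_act_add kostant_form_def)
 next
  case (eng_mult h1 h2)
  then show ?case using carr kostant_form_carrier by (simp add: env_act_mult kostant_form_def)
 qed
 then show ?thesis using assms(1,3) by (auto simp: kostant_lattice_def)
qed

end

section \<open>Reduction of the Kostant lattice modulo 2\<close>

subsection \<open>Linear relations over the rationals and the integers\<close>

text \<open>Elimination of one coordinate at a time. The coefficient of the pivot \<open>i0\<close>
  is fixed last, by the coordinate that was eliminated.\<close>

lemma rat_relation:
 fixes q :: "'i => 'l => rat"
 assumes "finite L" "finite I" "card L < card I"
 shows "\<exists>a. (\<exists>i\<in>I. a i ~= 0) & (\<forall>l\<in>L. (\<Sum>i\<in>I. a i*q i l) = 0)"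
 using assms
proof (induct L arbitrary: I q rule: finite_induct)
 case empty
 then have "I ~= {}" by auto
 then show ?case by (intro exI[of _ "%_. 1"]) auto
next
 case (insert l L)
 show ?case
 proof (cases "\<forall>i\<in>I. q i l = 0")
  case True
  obtain a where a: "\<exists>i\<in>I. a i ~= 0" "\<forall>l\<in>L. (\<Sum>i\<in>I. a i*q i l) = 0"
   using insert(3)[of I q] insert by fastforce
  then show ?thesis using True by (intro exI[of _ a]) auto
 next
  case False
  then obtain i0 where i0: "i0 : I" "q i0 l ~= 0" by blast
  define q' where "q' i l' = q i l' - q i l / q i0 l*q i0 l'" for i l'
  have "card L < card (I - {i0})" using insert i0 by simp
  then obtain a where a: "\<exists>i\<in>I - {i0}. a i ~= 0" "\<forall>l\<in>L. (\<Sum>i\<in>I - {i0}. a i*q' i l) = 0"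
   using insert(3)[of "I - {i0}" q'] insert(4) by (meson finite_Diff)
  define c where "c = - (\<Sum>i\<in>I - {i0}. a i*q i l) / q i0 l"
  define a' where "a' i = (if i = i0 then c else a i)" for i
  have s: "(\<Sum>i\<in>I. a' i*q i l') = c*q i0 l' + (\<Sum>i\<in>I - {i0}. a i*q i l')" for l'
   using insert i0 by (subst sum.remove[of I i0]) (auto simp: a'_def intro!: sum.cong)
  have "(\<Sum>i\<in>I - {i0}. a i*q' i l') = (\<Sum>i\<in>I - {i0}. a i*q i l') + c*q i0 l'" for l'
   by (simp add: q'_def c_def right_diff_distrib sum_subtractf sum_distrib_right sum_divide_distrib mult.assoc)
  then have "\<forall>l'\<in>insert l L. (\<Sum>i\<in>I. a' i*q i l') = 0"
   using a(2) i0(2) by (auto simp: s add.commute) (simp add: c_def)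
  moreover have "\<exists>i\<in>I. a' i ~= 0" using a(1) by (auto simp: a'_def)
  ultimately show ?thesis by blast
 qed
qed

lemma common_denominator:
 fixes a :: "'i => rat"
 assumes "finite I"
 shows "\<exists>d::int. d > 0 & (\<forall>i\<in>I. \<exists>b::int. of_int b = a i*of_int d)"
 using assms
proof (induct I rule: finite_induct)
 case empty
 then show ?case by (intro exI[of _ 1]) auto
next
 case (insert i I)
 then obtain d where d: "d > 0" "\<forall>i\<in>I. \<exists>b::int. of_int b = a i*of_int d" by blast
 obtain p r where pr: "quotient_of (a i) = (p, r)" by fastforce
 then have r: "r > 0" "a i = of_int p / of_int r"
  using quotient_of_denom_pos quotient_of_div by auto
 have "\<exists>b::int. of_int b = a j*of_int (d*r)" if j: "j : insert i I" for j
 proof (cases "j = i")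
  case True
  then show ?thesis using r by (intro exI[of _ "p*d"]) simp
 next
  case False
  then obtain b where "of_int b = a j*of_int d" using d(2) j by blast
  then show ?thesis by (intro exI[of _ "b*r"]) simp
 qed
 then show ?case using d(1) r(1) by (intro exI[of _ "d*r"]) auto
qed

text \<open>While all coefficients are even, halving them lowers the sum of their absolute
  values.\<close>

lemma int_relation_primitive:
 fixes b :: "'i => int"
 assumes "finite I" "\<exists>i\<in>I. b i ~= 0" "\<forall>l\<in>L. (\<Sum>i\<in>I. of_int (b i)*q i l) = (0::rat)"
 shows "\<exists>b::'i => int. (\<exists>i\<in>I. odd (b i)) & (\<forall>l\<in>L. (\<Sum>i\<in>I. of_int (b i)*q i l) = (0::rat))"
 using assms(2,3)
proof (induct "nat (\<Sum>i\<in>I. \<bar>b i\<bar>)" arbitrary: b rule: less_induct)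
 case less
 show ?case
 proof (cases "\<exists>i\<in>I. odd (b i)")
  case True
  then show ?thesis using less by blast
 next
  case False
  define c where "c i = b i div 2" for i
  have b: "i : I ==> b i = 2*c i" for i using False by (simp add: c_def)
  have e: "(\<Sum>i\<in>I. \<bar>b i\<bar>) = 2*(\<Sum>i\<in>I. \<bar>c i\<bar>)"
   by (simp add: b sum_distrib_left abs_mult)
  obtain i where i: "i : I" "b i ~= 0" using less by blast
  have "\<bar>c i\<bar> \<le> (\<Sum>i\<in>I. \<bar>c i\<bar>)"
   using i assms(1) by (intro member_le_sum) auto
  then have "(\<Sum>i\<in>I. \<bar>c i\<bar>) > 0" using i b by fastforce
  then have "nat (\<Sum>i\<in>I. \<bar>c i\<bar>) < nat (\<Sum>i\<in>I. \<bar>b i\<bar>)" using e by linarith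
  moreover have "\<exists>i\<in>I. c i ~= 0" using i b by force
  moreover have "(\<Sum>i\<in>I. of_int (c i)*q i l) = 0" if l: "l : L" for l
  proof -
   have "(\<Sum>i\<in>I. of_int (b i)*q i l) = 2*(\<Sum>i\<in>I. of_int (c i)*q i l)"
    by (simp add: b sum_distrib_left mult.assoc)
   then show ?thesis using less(3) l by simp
  qed
  ultimately show ?thesis using less(1)[of c] by blast
 qed
qed

lemma primitive_relation:
 fixes q :: "'i => 'l => rat"
 assumes "finite L" "finite I" "card L < card I"
 obtains a :: "'i => int" where "\<exists>i\<in>I. odd (a i)" "!!l. l : L ==> (\<Sum>i\<in>I. of_int (a i)*q i l) = 0"
proof -
 obtain a where a: "\<exists>i\<in>I. a i ~= 0" "\<forall>l\<in>L. (\<Sum>i\<in>I. a i*q i l) = 0"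
  using rat_relation[OF assms] by blast
 obtain d where d: "d > 0" "\<forall>i\<in>I. \<exists>b::int. of_int b = a i*of_int d"
  using common_denominator[OF assms(2)] by blast
 then obtain b :: "'i => int" where b: "!!i. i : I ==> of_int (b i) = a i*of_int d" by metis
 have "\<exists>i\<in>I. b i ~= 0" using a(1) b d(1) by force
 moreover have "\<forall>l\<in>L. (\<Sum>i\<in>I. of_int (b i)*q i l) = 0"
 proof
  fix l assume "l : L"
  have "(\<Sum>i\<in>I. of_int (b i)*q i l) = of_int d*(\<Sum>i\<in>I. a i*q i l)"
   by (simp add: b sum_distrib_left mult_ac)
  then show "(\<Sum>i\<in>I. of_int (b i)*q i l) = 0" using a(2) \<open>l \<in> L\<close> by simp
 qed
 ultimately obtain c :: "'i => int" where
  c: "\<exists>i\<in>I. odd (c i)" "\<forall>l\<in>L. (\<Sum>i\<in>I. of_int (c i)*q i l) = 0"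
  using int_relation_primitive[OF assms(2), of b L q] by metis
 show thesis by (rule that[OF c(1)]) (use c(2) in simp)
qed

subsection \<open>A rational spanning set of the model\<close>

text \<open>Up to a scalar, \<open>Eop n [i\<^sub>1, \<dots>, i\<^sub>k]\<close> is the antisymmetrization of a product of \<open>k\<close> generators of
 the Clifford algebra, that is, the image of a \<open>k\<close>-vector.\<close>
fun Eop :: "nat => nat list => complex fock_op" where
 "Eop n [] = 1"
| "Eop n (i # us) = gen n i*Eop n us + (- 1) ^ length us*(Eop n us*gen n i)"

declare Eop.simps(2) [simp del]

definition slists :: "nat => nat => nat list set" where
 "slists n k = {us. sorted_wrt (<) us & length us = k & set us <= {..<2*n+1}}"

lemma slists_eq: "slists n k = sorted_list_of_set ` {S. S <= {..<2*n+1} & card S = k}"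
proof (intro equalityI subsetI)
 fix us assume "us : slists n k"
 then have "us = sorted_list_of_set (set us)" "set us <= {..<2*n+1}" "card (set us) = k"
  using strict_sorted_equal[of us "sorted_list_of_set (set us)"]
  by (auto simp: slists_def distinct_card strict_sorted_iff)
 then show "us : sorted_list_of_set ` {S. S <= {..<2*n+1} & card S = k}" by blast
next
 fix us assume "us : sorted_list_of_set ` {S. S <= {..<2*n+1} & card S = k}"
 then obtain S where S: "us = sorted_list_of_set S" "S <= {..<2*n+1}" "card S = k" by blast
 then show "us : slists n k"
  using finite_subset[OF S(2)] by (auto simp: slists_def)
qed

lemma finite_slists: "finite (slists n k)"
 unfolding slists_eq by (rule finite_imageI, rule finite_subset[of _ "Pow {..<2*n+1}"]) auto

lemma card_slists: "card (slists n k) = (2*n+1) choose k"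
proof -
 have "card (slists n k) = card {S. S <= {..<2*n+1} & card S = k}"
  unfolding slists_eq
 proof (rule card_image, rule inj_onI)
  fix S T assume "S : {S. S <= {..<2*n+1} & card S = k}" "T : {S. S <= {..<2*n+1} & card S = k}"
   "sorted_list_of_set S = sorted_list_of_set T"
  then show "S = T" by (metis (no_types, lifting) finite_lessThan finite_subset mem_Collect_eq set_sorted_list_of_set)
 qed
 then show ?thesis using n_subsets[of "{..<2*n+1}" k] by simp
qed

lemma minus_one_power_left_commute: "y*((- 1) ^ k*x) = (- 1 :: 'r::ring_1) ^ k*(y*x)"
 by (cases "even k") auto

text \<open>Antisymmetry, although the recursion singles out the first index: the anticommutator of
  two generators is a scalar and cancels between left and right multiplication.\<close>

lemma Eop_swap:
 assumes "i < 2*n+1" "j < 2*n+1"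
 shows "Eop n (i # j # js) = - Eop n (j # i # js)"
proof -
 define A where "A = Eop n js"
 define e :: "complex fock_op" where "e = (- 1) ^ length js"
 have ee: "e*e = 1" by (simp add: e_def flip: power_add mult_2)
 have ec: "gen n r*(e*y) = e*(gen n r*y)" for r y
  unfolding e_def by (rule minus_one_power_left_commute)
 have eec: "e*(e*x) = x" for x using ee by (simp flip: mult.assoc)
 have ac: "gen n i*gen n j = of_nat (bm n i j) - (gen n j*gen n i :: complex fock_op)"
  using gen_anticomm[OF assms, where 'a=complex] by (simp add: eq_diff_eq)
 have ac': "gen n i*(gen n j*x) = of_nat (bm n i j)*x - gen n j*(gen n i*x)" for x :: "complex fock_op"
  by (simp add: ac left_diff_distrib flip: mult.assoc)
 have "Eop n (i # j # js) = gen n i*(gen n j*A + e*(A*gen n j)) - e*((gen n j*A + e*(A*gen n j))*gen n i)"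
  by (simp add: A_def e_def Eop.simps(2))
 also have "... = gen n i*(gen n j*A) - A*(gen n j*gen n i) + e*(gen n i*(A*gen n j)) - e*(gen n j*(A*gen n i))"
  by (simp add: algebra_simps ec eec)
 finally have 1: "Eop n (i # j # js) = gen n i*(gen n j*A) - A*(gen n j*gen n i) + e*(gen n i*(A*gen n j)) - e*(gen n j*(A*gen n i))" .
 have "Eop n (j # i # js) = gen n j*(gen n i*A + e*(A*gen n i)) - e*((gen n i*A + e*(A*gen n i))*gen n j)"
  by (simp add: A_def e_def Eop.simps(2))
 also have "... = gen n j*(gen n i*A) - A*(gen n i*gen n j) + e*(gen n j*(A*gen n i)) - e*(gen n i*(A*gen n j))"
  by (simp add: algebra_simps ec eec)
 finally have 2: "Eop n (j # i # js) = gen n j*(gen n i*A) - A*(gen n i*gen n j) + e*(gen n j*(A*gen n i)) - e*(gen n i*(A*gen n j))" .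
 have "A*of_nat (bm n i j) = of_nat (bm n i j)*A" by (simp add: mult_of_nat_commute)
 then show ?thesis unfolding 1 2 ac' ac by (simp add: algebra_simps)
qed

lemma fock_op_double_zero: "x = - x ==> x = (0 :: complex fock_op)"
proof -
 assume "x = - x"
 then have "x + x = 0" by (simp add: add_eq_0_iff)
 then have "scal 2*x = 0" by (metis mult_2 one_add_one scal_1 scal_add)
 then have "scal (1/2)*(scal 2*x) = 0" by simp
 then have "scal (1/2*2)*x = 0" by (simp only: scal_mult mult.assoc)
 then show "x = 0" by simp
qed

lemma Eop_insort:
 assumes "i < 2*n+1" "set us <= {..<2*n+1}" "sorted_wrt (<) us"
 shows "Eop n (i # us) = 0 \<or> i ~: set us & (Eop n (i # us) = Eop n (insort i us) \<or> Eop n (i # us) = - Eop n (insort i us))"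
 using assms(2,3)
proof (induct us)
 case (Cons j js)
 consider "i < j" | "i = j" | "j < i" by linarith
 then show ?case
 proof cases
  case 1
  then show ?thesis using Cons by auto
 next
  case 2
  then show ?thesis using fock_op_double_zero[OF Eop_swap[of i n i js]] assms(1) by simp
 next
  case 3
  have j: "j < 2*n+1" using Cons by auto
  have sw: "Eop n (i # j # js) = - Eop n (j # i # js)" by (rule Eop_swap[OF assms(1) j])
  have len: "length (insort i js) = Suc (length js)" by simp
  from Cons have "Eop n (i # js) = 0 \<or> i ~: set js & (Eop n (i # js) = Eop n (insort i js) \<or> Eop n (i # js) = - Eop n (insort i js))"
   by simp
  then consider (a) "Eop n (i # js) = 0" | (b) "i ~: set js" "Eop n (i # js) = Eop n (insort i js)"
   | (c) "i ~: set js" "Eop n (i # js) = - Eop n (insort i js)" by blast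
  then show ?thesis
  proof cases
   case a
   have "Eop n (j # i # js) = 0" unfolding Eop.simps(2)[of n j "i # js"] a by simp
   then show ?thesis using sw by simp
  next
   case b
   have "Eop n (j # i # js) = Eop n (j # insort i js)"
    unfolding Eop.simps(2)[of n j] b(2) by simp
   then show ?thesis using sw 3 b by auto
  next
   case c
   have "Eop n (j # i # js) = - Eop n (j # insort i js)"
    unfolding Eop.simps(2)[of n j] c(2) by (simp add: algebra_simps)
   then show ?thesis using sw 3 c by auto
  qed
 qed
qed simp

lemma insort_sorted_wrt: "sorted_wrt (<) us ==> i ~: set us ==> sorted_wrt (<) (insort (i::nat) us)"
 by (simp add: strict_sorted_iff sorted_insort distinct_insort)

text \<open>Only spanning matters here, since the number of sorted lists is to bound the rank of the
  lattice. The coefficients are rational so that integral relations can be derived from it.\<close>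

definition rspan :: "nat => nat => complex fock_op set" where
 "rspan n k = {y. \<exists>q :: nat list => rat. y = (\<Sum>us\<in>slists n k. scal (of_rat (q us))*Eop n us)}"

lemma rspan_zero: "0 : rspan n k"
 unfolding rspan_def by (rule CollectI, rule exI[of _ "%_. 0"]) simp

lemma rspan_add: "x : rspan n k ==> y : rspan n k ==> x + y : rspan n k"
 unfolding rspan_def
proof (elim CollectE exE)
 fix p q assume "x = (\<Sum>us\<in>slists n k. scal (of_rat (p us))*Eop n us)" "y = (\<Sum>us\<in>slists n k. scal (of_rat (q us))*Eop n us)"
 then show "x + y : {y. \<exists>q :: nat list => rat. y = (\<Sum>us\<in>slists n k. scal (of_rat (q us))*Eop n us)}"
  by (intro CollectI exI[of _ "%us. p us + q us"]) (simp add: of_rat_add scal_add distrib_right sum.distrib)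
qed

lemma rspan_scal: "y : rspan n k ==> scal (of_rat c)*y : rspan n k"
 unfolding rspan_def
proof (elim CollectE exE)
 fix q assume "y = (\<Sum>us\<in>slists n k. scal (of_rat (q us))*Eop n us)"
 then show "scal (of_rat c)*y : {y. \<exists>q :: nat list => rat. y = (\<Sum>us\<in>slists n k. scal (of_rat (q us))*Eop n us)}"
  by (intro CollectI exI[of _ "%us. c*q us"]) (simp add: of_rat_mult scal_mult sum_distrib_left mult.assoc)
qed

lemma rspan_of_int: "y : rspan n k ==> of_int z*y : rspan n k"
 using rspan_scal[of y n k "of_int z"] by simp

lemma rspan_uminus: "y : rspan n k ==> - y : rspan n k"
 using rspan_scal[of y n k "- 1"] by (simp add: scal_minus of_rat_minus)

lemma rspan_sum: "(!!i. i : I ==> f i : rspan n k) ==> sum f I : rspan n k"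
 by (induct I rule: infinite_finite_induct) (auto simp: rspan_zero intro: rspan_add)

lemma rspan_Eop_sorted: "us : slists n k ==> Eop n us : rspan n k"
 unfolding rspan_def
 by (intro CollectI exI[of _ "%js. if js = us then 1 else 0"])
   (simp add: finite_slists if_distrib[of "%x. scal (of_rat x)*_"] cong: if_cong)

text \<open>Exterior multiplication by the basis vector \<open>i\<close> on antisymmetrized products
  of degree \<open>k\<close>, up to a scalar.\<close>

definition wop :: "nat => nat => nat => complex fock_op => complex fock_op" where
 "wop n k i y = gen n i*y + (- 1) ^ k*(y*gen n i)"

lemma wop_Eop: "wop n (length us) i (Eop n us) = Eop n (i # us)"
 by (simp add: wop_def Eop.simps(2))

lemma wop_scal: "wop n k i (scal c*y) = scal c*wop n k i y"
 by (simp add: wop_def distrib_left scal_left_commute mult.assoc)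

lemma wop_sum: "wop n k i (sum f I) = (\<Sum>j\<in>I. wop n k i (f j))"
 by (simp add: wop_def sum_distrib_left sum_distrib_right sum.distrib)

lemma rspan_wop:
 assumes "y : rspan n k" "i < 2*n+1"
 shows "wop n k i y : rspan n (Suc k)"
proof -
 obtain q where y: "y = (\<Sum>us\<in>slists n k. scal (of_rat (q us))*Eop n us)" using assms(1) by (auto simp: rspan_def)
 have "Eop n (i # us) : rspan n (Suc k)" if "us : slists n k" for us
 proof -
  have *: "set us <= {..<2*n+1}" "sorted_wrt (<) us" "length us = k" using that by (auto simp: slists_def)
  have "i ~: set us ==> insort i us : slists n (Suc k)"
   using * assms(2) by (auto simp: slists_def insort_sorted_wrt set_insort_key)
  then show ?thesis
   using Eop_insort[OF assms(2) *(1,2)] rspan_zero rspan_Eop_sorted rspan_uminus by metis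
 qed
 moreover have "wop n k i (Eop n us) = Eop n (i # us)" if "us : slists n k" for us
  using that wop_Eop[of n us i] by (simp add: slists_def)
 ultimately show ?thesis
  unfolding y wop_sum wop_scal by (intro rspan_sum rspan_scal) auto
qed

lemma rspan_Eop: "set us <= {..<2*n+1} ==> Eop n us : rspan n (length us)"
proof (induct us)
 case Nil
 have "[] : slists n 0" by (simp add: slists_def)
 then show ?case using rspan_Eop_sorted by force
next
 case (Cons i us)
 then show ?case using rspan_wop[of "Eop n us" n "length us" i] by (simp add: wop_Eop)
qed

text \<open>The commutator is a derivation and maps generators to integral combinations of
  generators, so it replaces one index at a time.\<close>

lemma rspan_ad_Eop:
 assumes "\<alpha> : roots n" "set us <= {..<2*n+1}"
 shows "ad (rsp n \<alpha>) (Eop n us) : rspan n (length us)"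
 using assms(2)
proof (induct us)
 case Nil
 then show ?case by (simp add: rspan_zero)
next
 case (Cons i us)
 let ?s = "rsp n \<alpha> :: complex fock_op" and ?A = "Eop n us" and ?l = "length us"
 have sg: "ad ?s ((- 1) ^ k*x) = (- 1) ^ k*ad ?s x" for k x
  by (cases "even k") (auto simp: ad_minus_right)
 have sg0: "ad ?s ((- 1) ^ k) = 0" for k
  using sg[of k 1] by simp
 have "ad ?s (Eop n (i # us)) = (ad ?s (gen n i)*?A + (- 1) ^ ?l*(?A*ad ?s (gen n i))) + wop n ?l i (ad ?s ?A)"
  by (simp add: wop_def Eop.simps(2) ad_add_right ad_mult_right sg0 algebra_simps)
 also have "ad ?s (gen n i) = (\<Sum>r<2*n+1. of_int (root_vector n \<alpha> $$ (r, i))*gen n r)"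
  using Cons assms(1) by (intro ad_rsp_gen) auto
 also have "(\<Sum>r<2*n+1. of_int (root_vector n \<alpha> $$ (r, i))*gen n r)*?A +
   (- 1) ^ ?l*(?A*(\<Sum>r<2*n+1. of_int (root_vector n \<alpha> $$ (r, i))*gen n r))
  = (\<Sum>r<2*n+1. scal (of_rat (of_int (root_vector n \<alpha> $$ (r, i))))*Eop n (r # us))"
 proof -
  have "scal (of_rat (of_int z)) = (of_int z :: complex fock_op)" for z by simp
  moreover have "?A*(of_int z*x) = of_int z*(?A*x)" for z x
   by (metis scal_left_commute scal_of_int)
  moreover have "(- 1) ^ ?l*(of_int z*x) = of_int z*((- 1) ^ ?l*x)" for z and x :: "complex fock_op"
   by (metis minus_one_power_left_commute)
  ultimately show ?thesis
   by (simp only: sum_distrib_left sum_distrib_right sum.distrib[symmetric] Eop.simps distrib_left mult.assoc)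
 qed
 finally show ?case
  using Cons assms rspan_Eop[of "_ # us"]
  by (auto intro!: rspan_add rspan_sum rspan_of_int rspan_wop)
qed

lemma rspan_ad: "\<alpha> : roots n ==> y : rspan n k ==> ad (rsp n \<alpha>) y : rspan n k"
proof -
 assume \<alpha>: "\<alpha> : roots n" and "y : rspan n k"
 then obtain q where y: "y = (\<Sum>us\<in>slists n k. scal (of_rat (q us))*Eop n us)" by (auto simp: rspan_def)
 show ?thesis
  unfolding y ad_sum_right ad_scal_right
  using rspan_ad_Eop[OF \<alpha>] by (intro rspan_sum rspan_scal) (auto simp: slists_def)
qed

text \<open>Antisymmetrizing a product of anticommuting creation operators only multiplies it by a
  power of 2, which is invertible over the rationals.\<close>

lemma hwop_rspan: "k \<le> n ==> hwop n k : rspan n k"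
proof -
 assume k: "k \<le> n"
 have comm: "set us <= {..<n} ==> i < n ==> gen n i*prod_list (map (gen n) us) = (- 1) ^ length us*(prod_list (map (gen n) us)*(gen n i :: complex fock_op))"
  for us i
 proof (induct us)
  case (Cons j js)
  let ?P = "prod_list (map (gen n) js) :: complex fock_op"
  have "gen n i*gen n j + gen n j*gen n i = (0 :: complex fock_op)"
   using Cons gen_anticomm[of i n j] by (simp add: bm_low_low)
  then have "gen n i*gen n j = - (gen n j*gen n i :: complex fock_op)" by (simp add: add_eq_0_iff2)
  then have "gen n i*(gen n j*?P) = - (gen n j*(gen n i*?P))" by (simp flip: mult.assoc)
  also have "gen n i*?P = (- 1) ^ length js*(?P*gen n i)" using Cons by simp
  finally show ?case by (simp add: minus_one_power_left_commute mult.assoc)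
 qed simp
 have "set us <= {..<n} ==> Eop n us = scal (2 ^ length us)*prod_list (map (gen n) us)" for us
 proof (induct us)
  case (Cons i us)
  let ?P = "prod_list (map (gen n) us) :: complex fock_op"
  have "Eop n (i # us) = scal (2 ^ length us)*(gen n i*?P + (- 1) ^ length us*(?P*gen n i))"
   using Cons by (simp add: Eop.simps(2) scal_left_commute distrib_left mult.assoc)
  also have "(- 1) ^ length us*(?P*gen n i) = gen n i*?P" using comm[of us i] Cons by simp
  also have "gen n i*?P + gen n i*?P = scal 2*(gen n i*?P)"
   by (metis mult_2 one_add_one scal_1 scal_add)
  also have "scal (2 ^ length us)*(scal 2*(gen n i*?P)) = scal (2 ^ length (i # us))*prod_list (map (gen n) (i # us))"
  proof -
   have "scal (2 ^ length us)*(scal 2*(gen n i*?P)) = scal (2 ^ length us*2)*(gen n i*?P)"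
    by (simp only: scal_mult mult.assoc)
   then show ?thesis by (simp add: mult.commute)
  qed
  finally show ?case .
 qed simp
 moreover have "set [0..<k] <= {..<n}" using k by auto
 ultimately have "Eop n [0..<k] = scal (2 ^ length [0..<k])*prod_list (map (gen n) [0..<k])" by blast
 then have "Eop n [0..<k] = scal (2 ^ k)*hwop n k" by (simp add: hwop_def)
 then have "scal (of_rat (1 / 2 ^ k))*Eop n [0..<k] = scal (of_rat (1 / 2 ^ k)*2 ^ k)*hwop n k"
  by (simp only: scal_mult mult.assoc)
 also have "of_rat (1 / 2 ^ k)*2 ^ k = (1::complex)" by (simp add: of_rat_divide of_rat_power)
 finally have "hwop n k = scal (of_rat (1 / 2 ^ k))*Eop n [0..<k]" by simp
 moreover have "[0..<k] : slists n k" using k by (auto simp: slists_def)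
 ultimately show ?thesis using rspan_scal[OF rspan_Eop_sorted, of "[0..<k]" n k "1 / 2 ^ k"] by simp
qed

section \<open>Divided powers of commutators\<close>

text \<open>The divided power \<open>(ad s)\<^sup>m / m!\<close> for an element \<open>s\<close> of square zero.\<close>
definition dpop :: "'r::ring_1 => nat => 'r => 'r" where
 "dpop s m y = (if m = 0 then y else if m = 1 then ad s y else if m = 2 then - (s*y * s) else 0)"

text \<open>The factor 2 on the right is what makes the second divided power integral.\<close>

lemma ad_pow_2: "s * s = 0 ==> ad s (ad s y) = - 2*(s*y * s)"
proof -
 assume s: "s * s = (0 :: 'a::ring_1)"
 have "ad s (ad s y) = s * s*y - s*y * s - s*y * s + y*(s * s)"
  by (simp add: ad_def algebra_simps)
 then show ?thesis by (simp add: s algebra_simps mult_2)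
qed

lemma ad_pow_ge3:
 assumes "s * s = (0 :: 'a::ring_1)" "m \<ge> 3"
 shows "(ad s ^^ m) y = 0"
proof -
 have 3: "ad s (ad s (ad s z)) = 0" for z
 proof -
  have "ad s (s*z * s) = (s * s)*z * s - s*z*(s * s)" by (simp add: ad_def mult.assoc)
  then have "ad s (s*z * s) = 0" by (simp add: assms)
  then have "ad s (s*z * s + s*z * s) = 0" by (simp add: ad_add_right)
  then have "ad s (- 2*(s*z * s)) = 0" by (simp only: mult_minus_left ad_minus_right mult_2) simp
  then show ?thesis by (simp only: ad_pow_2[OF assms(1)])
 qed
 obtain j where "m = j + 3" using assms(2) by (metis add.commute le_Suc_ex)
 then have "(ad s ^^ m) y = (ad s ^^ j) ((ad s ^^ 3) y)"
  by (simp only: funpow_add o_apply)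
 then have "(ad s ^^ m) y = (ad s ^^ j) (ad s (ad s (ad s y)))"
  by (simp add: numeral_3_eq_3)
 moreover have "(ad s ^^ j) 0 = 0" by (induct j) auto
 ultimately show ?thesis by (simp add: 3)
qed

lemma dpop_pow:
 fixes s y :: "complex fock_op"
 assumes "s * s = 0"
 shows "scal (1 / fact m)*(ad s ^^ m) y = dpop s m y"
proof -
 consider "m = 0" | "m = 1" | "m = 2" | "m \<ge> 3" by linarith
 then show ?thesis
 proof cases
  case 3
  have two: "(2 :: complex fock_op) = scal 2" by (metis one_add_one scal_1 scal_add)
  have "scal (1 / 2)*(- 2*(s*y * s)) = - (scal (1 / 2*2)*(s*y * s))"
   by (simp only: scal_mult two mult.assoc mult_minus_left mult_minus_right)
  then show ?thesis using 3 by (simp add: dpop_def numeral_2_eq_2 ad_pow_2[OF assms] del: One_nat_def)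
 qed (auto simp: dpop_def ad_pow_ge3[OF assms])
qed

definition dpf :: "nat => nat => nat => nat => (nat set => nat set => 'a::comm_ring_1) => nat set => nat set => 'a" where
 "dpf n a b m F = (if m = 0 then F
   else if m = 1 then (%T S. lgen n a (lgen n b F) T S - rgen n b (rgen n a F) T S)
   else if m = 2 then (%T S. - lgen n a (lgen n b (rgen n b (rgen n a F))) T S)
   else (%_ _. 0))"

lemma ent_dpop: "root_pair n \<alpha> = (a, b) ==> ent (dpop (rsp n \<alpha>) m y) = dpf n a b m (ent y)"
 by (intro ext) (simp add: dpop_def dpf_def rsp_def ent_ad_gen2 ent_minus mult.assoc[of _ y] ent_gen2_mult ent_mult_gen2)

text \<open>\<open>restr n F\<close> keeps the matrix entries of \<open>F\<close> on the Fock space of the first \<open>n\<close> sites.\<close>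
definition restr :: "nat => (nat set => nat set => 'a::comm_ring_1) => nat set => nat set => 'a" where
 "restr n F T S = (if T <= {..<n} & S <= {..<n} then F T S else 0)"

text \<open>A generator with index below \<open>2*n+1\<close> adds or removes only sites below
  \<open>n\<close>, so restriction commutes with it.\<close>

lemma lgen_restr: "j < 2*n+1 ==> lgen n j (restr n F) = restr n (lgen n j F)"
 and rgen_restr: "j < 2*n+1 ==> rgen n j (restr n F) = restr n (rgen n j F)"
proof -
 assume j: "j < 2*n+1"
 have rem: "T - {i} <= {..<n} \<longleftrightarrow> T <= {..<n}" if "i < n" for T and i :: nat using that by auto
 have h: "j - n < n" if "\<not> j < n" "j < 2*n" using that by linarith
 show "lgen n j (restr n F) = restr n (lgen n j F)" "rgen n j (restr n F) = restr n (rgen n j F)"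
  by (auto simp: fun_eq_iff lgen_def rgen_def restr_def rem h)
qed

lemma dpf_restr: "a < 2*n+1 ==> b < 2*n+1 ==> dpf n a b m (restr n F) = restr n (dpf n a b m F)"
 by (auto simp: dpf_def lgen_restr rgen_restr fun_eq_iff) (auto simp: restr_def)

lemma sgn_below_of_int [simp]: "of_int (sgn_below i S) = sgn_below i S"
 by (simp add: sgn_below_def)

lemma lgen_of_int: "lgen n j (%T S. of_int (F T S)) = (%T S. of_int (lgen n j F T S))"
 and rgen_of_int: "rgen n j (%T S. of_int (F T S)) = (%T S. of_int (rgen n j F T S))"
 by (auto simp: fun_eq_iff lgen_def rgen_def)

lemma dpf_of_int: "dpf n a b m (%T S. of_int (F T S)) = (%T S. of_int (dpf n a b m F T S))"
 by (auto simp: dpf_def lgen_of_int rgen_of_int)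

text \<open>One integral matrix represents the highest weight vector over every ring, which makes
  reduction modulo 2 compatible with the model.\<close>

lemma hwop_of_int: "ent (hwop n k :: 'a::comm_ring_1 fock_op) = (%T S. of_int (ent (hwop n k) T S))"
proof (induct k)
 case 0
 then show ?case by (auto simp: fun_eq_iff ent_1)
next
 case (Suc k)
 then show ?case by (simp add: hwop_Suc ent_mult_gen rgen_of_int)
qed

section \<open>Integral and rational structure of the lattice\<close>

context hw_module
begin

lemma rsp_sq_root: "\<alpha> : roots n ==> rsp n \<alpha>*rsp n \<alpha> = (0 :: complex fock_op)"
 by (rule rsp_sq)

lemma graph_dp:
 assumes "graph x y" "\<alpha> : roots n"
 shows "graph (dp \<alpha> m x) (dpop (rsp n \<alpha>) m y)"
proof -
 have "graph ((\<rho> (crv n \<alpha>) ^^ m) x) ((ad (rsp n \<alpha>) ^^ m) y)"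
  using assms by (induct m) (auto intro: graph_root)
 then have "graph ((1 / fact m) \<odot> (\<rho> (crv n \<alpha>) ^^ m) x) (scal (1 / fact m)*(ad (rsp n \<alpha>) ^^ m) y)"
  by (rule graph_smult)
 then show ?thesis
  using graph_carrier[OF assms(1)] assms(2) by (simp add: env_act_divided_power dpop_pow rsp_sq_root)
qed

definition comp :: "'v => complex fock_op" where
 "comp x = (SOME y. graph x y)"

definition th :: "'v => nat set => nat set => complex" where
 "th x = restr n (ent (comp x))"

text \<open>The choice made in \<open>comp\<close> is immaterial: two matrices related to the same
  vector differ by one related to zero.\<close>

lemma th_graph: "graph x y ==> th x = restr n (ent y)"
proof -
 assume g: "graph x y"
 then have c: "graph x (comp x)" unfolding comp_def by (rule someI)
 have "graph \<zero> (comp x - y)"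
  using graph_diff[OF c g] graph_carrier[OF g] by (simp add: a_minus_def M.r_neg)
 then have "ent (comp x - y) T S = 0" if "T <= {..<n}" "S <= {..<n}" for T S
  using that by (rule graph_zero_ent)
 then show ?thesis by (auto simp: th_def restr_def fun_eq_iff ent_diff)
qed

lemma th_add:
 assumes "x : carrier M" "y : carrier M"
 shows "th (x \<oplus> y) = (%T S. th x T S + th y T S)"
proof -
 obtain x' y' where g: "graph x x'" "graph y y'" using graph_total assms by metis
 show ?thesis
  unfolding th_graph[OF graph_add[OF g]] th_graph[OF g(1)] th_graph[OF g(2)]
  by (simp add: fun_eq_iff restr_def ent_add)
qed

lemma th_smult:
 assumes "x : carrier M"
 shows "th (c \<odot> x) = (%T S. c*th x T S)"
proof -
 obtain x' where g: "graph x x'" using graph_total assms by metis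
 show ?thesis
  unfolding th_graph[OF graph_smult[OF g]] th_graph[OF g]
  by (simp add: fun_eq_iff restr_def ent_scal)
qed

lemma th_dp:
 assumes "x : carrier M" "\<alpha> : roots n" "root_pair n \<alpha> = (a, b)"
 shows "th (dp \<alpha> m x) = dpf n a b m (th x)"
proof -
 obtain y where y: "graph x y" using graph_total[OF assms(1)] by blast
 show ?thesis
  using root_pair_bounds[OF assms(2,3)]
  by (simp add: th_graph[OF graph_dp[OF y assms(2)]] th_graph[OF y] ent_dpop[OF assms(3)] dpf_restr)
qed

text \<open>On the lattice the entries turn out to be integers, so taking the floor loses nothing
  there.\<close>

definition zfun :: "'v => nat set => nat set => int" where
 "zfun x T S = \<lfloor>Re (th x T S)\<rfloor>"

lemma zfun_eq: "th x = (%T S. of_int (F T S)) ==> zfun x = F"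
 by (simp add: zfun_def fun_eq_iff)

text \<open>Both properties pass through the same closure steps. For divided powers, integrality
  comes from the explicit formula \<open>dpf\<close>, and rationality from the ordinary power
  divided by a factorial.\<close>

lemma K_lattice:
 assumes "x : K"
 shows "th x = (%T S. of_int (zfun x T S)) & (\<exists>y. graph x y & y : rspan n \<kappa>)"
proof -
 let ?P = "%x. x : carrier M & th x = (%T S. of_int (zfun x T S)) & (\<exists>y. graph x y & y : rspan n \<kappa>)"
 have "?P x"
  using assms
 proof (rule K_induct)
  have "th v = (%T S. of_int (restr n (ent (hwop n \<kappa>)) T S))"
   unfolding th_graph[OF graph_base] hwop_of_int[where 'a=complex] by (auto simp: restr_def fun_eq_iff)
  then have "th v = (%T S. of_int (zfun v T S))" using zfun_eq by metis
  then show "?P v" using graph_base hwop_rspan[OF kap_le] by auto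
 next
  fix x y assume xy: "?P x" "?P y"
  then have "th (x \<oplus> y) = (%T S. of_int (zfun x T S + zfun y T S))"
   by (simp add: th_add)
  then have "th (x \<oplus> y) = (%T S. of_int (zfun (x \<oplus> y) T S))" using zfun_eq by metis
  moreover have "\<exists>z. graph (x \<oplus> y) z & z : rspan n \<kappa>"
   using xy graph_add rspan_add by meson
  ultimately show "?P (x \<oplus> y)" using xy by simp
 next
  fix x assume x: "?P x"
  have m: "\<ominus> x = (- 1) \<odot> x" using x by (simp add: smult_minus_1)
  have "th (\<ominus> x) = (%T S. of_int (- zfun x T S))"
   unfolding m using x by (simp add: th_smult)
  then have "th (\<ominus> x) = (%T S. of_int (zfun (\<ominus> x) T S))" using zfun_eq by metis
  moreover obtain y where y: "graph x y" "y : rspan n \<kappa>" using x by blast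
  have "graph (\<ominus> x) (scal (- 1)*y)" unfolding m by (rule graph_smult[OF y(1)])
  moreover have "scal (- 1)*y : rspan n \<kappa>" using rspan_uminus[OF y(2)] by (simp add: scal_minus)
  ultimately show "?P (\<ominus> x)" using x by auto
 next
  fix \<alpha> m x assume \<alpha>: "\<alpha> : roots n" and x: "?P x"
  obtain a b where ab: "root_pair n \<alpha> = (a, b)" by fastforce
  obtain y where y: "graph x y" "y : rspan n \<kappa>" using x by blast
  have "th (dp \<alpha> m x) = (%T S. of_int (dpf n a b m (zfun x) T S))"
   using th_dp[of x \<alpha> a b m] x \<alpha> ab dpf_of_int by metis
  then have "th (dp \<alpha> m x) = (%T S. of_int (zfun (dp \<alpha> m x) T S))" using zfun_eq by metis
  moreover have "scal (1 / fact m)*(ad (rsp n \<alpha>) ^^ m) y : rspan n \<kappa>"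
  proof -
   have "(ad (rsp n \<alpha>) ^^ m) y : rspan n \<kappa>" using y(2) \<alpha> by (induct m) (auto intro: rspan_ad)
   moreover have "of_rat (1 / fact m) = (1 / fact m :: complex)"
    by (metis of_nat_fact of_rat_1 of_rat_divide of_rat_of_nat_eq)
   ultimately show ?thesis using rspan_scal[of _ n \<kappa> "1 / fact m"] by metis
  qed
  then have "dpop (rsp n \<alpha>) m y : rspan n \<kappa>" using \<alpha> by (simp add: dpop_pow rsp_sq_root)
  moreover have "graph (dp \<alpha> m x) (dpop (rsp n \<alpha>) m y)" using y(1) \<alpha> by (rule graph_dp)
  ultimately show "?P (dp \<alpha> m x)" using graph_carrier by blast
 qed auto
 then show ?thesis by simp
qed

lemma th_zfun: "x : K ==> th x = (%T S. of_int (zfun x T S))"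
 using K_lattice by blast

lemma zfun_add: "x : K ==> y : K ==> zfun (x \<oplus> y) = (%T S. zfun x T S + zfun y T S)"
 by (rule zfun_eq) (simp add: th_add K_carrier th_zfun)

lemma zfun_dp:
 assumes "x : K" "\<alpha> : roots n" "root_pair n \<alpha> = (a, b)"
 shows "zfun (dp \<alpha> m x) = dpf n a b m (zfun x)"
 by (rule zfun_eq) (use th_dp[OF K_carrier[OF assms(1)] assms(2,3)] th_zfun[OF assms(1)] dpf_of_int in metis)

lemma zfun_v: "zfun v = restr n (ent (hwop n \<kappa>))"
 by (rule zfun_eq, unfold th_graph[OF graph_base] hwop_of_int[where 'a=complex]) (auto simp: restr_def fun_eq_iff)

definition red :: "'v => nat set => nat set => 'f::comm_ring_1" where
 "red x T S = of_int (zfun x T S)"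

lemma red_add: "x : K ==> y : K ==> red (x \<oplus> y) T S = red x T S + red y T S"
 by (simp add: red_def zfun_add)

lemma red_dp: "x : K ==> \<alpha> : roots n ==> root_pair n \<alpha> = (a, b) ==> red (dp \<alpha> m x) = dpf n a b m (red x)"
 unfolding red_def[abs_def] by (simp add: zfun_dp dpf_of_int)

lemma red_v: "red v = restr n (ent (hwop n \<kappa> :: 'f::comm_ring_1 fock_op))"
 unfolding red_def[abs_def] zfun_v hwop_of_int[where 'a='f] by (auto simp: restr_def fun_eq_iff)

lemma smult_int_K:
 assumes "x : K"
 shows "of_int z \<odot> x : K"
proof -
 have x: "x : carrier M" using assms by (rule K_carrier)
 have z0: "\<zero> : K" using K_add[OF assms K_neg[OF assms]] x by (simp add: M.r_neg)
 have nat: "of_nat k \<odot> x : K" for k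
 proof (induct k)
  case (Suc k)
  have "of_nat (Suc k) \<odot> x = of_nat k \<odot> x \<oplus> x"
   using x smult_add_left[of x "of_nat k" 1] by (simp add: add.commute)
  then show ?case using Suc assms K_add by simp
 qed (use x z0 in simp)
 show ?thesis
 proof (cases "z \<ge> 0")
  case True
  then show ?thesis using nat[of "nat z"] by simp
 next
  case False
  then have "of_int z \<odot> x = \<ominus> (of_nat (nat (- z)) \<odot> x)"
   using x by (simp add: smult_minus_1[symmetric] smult_smult)
  then show ?thesis using nat K_neg by simp
 qed
qed

text \<open>If enough elements of the lattice are independent modulo 2, then they generate it up to odd index:
 a primitive integral relation between them and \<open>x\<close> has an odd coefficient at \<open>x\<close>.\<close>
lemma purity:
 fixes b :: "'j => 'v"
 assumes char2: "CHAR('f::field) = 2"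
  and J: "finite J" "card (slists n \<kappa>) \<le> card J" "!!j. j : J ==> b j : K"
  and indep: "!!c :: 'j => 'f. (!!T S. (\<Sum>j\<in>J. c j*red (b j) T S) = 0) ==> \<forall>j\<in>J. c j = 0"
  and x: "x : K"
 obtains a0 :: int and a :: "'j => int"
 where "odd a0" "of_int a0 \<odot> x \<oplus> (\<Oplus>\<^bsub>M\<^esub>j\<in>J. of_int (a j) \<odot> b j) = \<zero>"
proof -
 \<comment> \<open>\<open>None\<close> stands for \<open>x\<close>. The family has one member more
   than the rank bound allows, so a relation exists.\<close>
 define b' where "b' i = (case i of None => x | Some j => b j)" for i
 define I where "I = insert None (Some ` J)"
 have b'K: "i : I ==> b' i : K" for i using J x by (auto simp: I_def b'_def)
 have "\<forall>i\<in>I. \<exists>y. graph (b' i) y & y : rspan n \<kappa>" using K_lattice b'K by blast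
 then obtain y where y: "!!i. i : I ==> graph (b' i) (y i)" "!!i. i : I ==> y i : rspan n \<kappa>" by metis
 have "\<forall>i\<in>I. \<exists>q :: nat list => rat. y i = (\<Sum>us\<in>slists n \<kappa>. scal (of_rat (q us))*Eop n us)"
  using y(2) by (auto simp: rspan_def)
 then obtain q :: "'j option => nat list => rat" where
  q: "!!i. i : I ==> y i = (\<Sum>us\<in>slists n \<kappa>. scal (of_rat (q i us))*Eop n us)" by metis
 have fI: "finite I" and cI: "card (slists n \<kappa>) < card I"
  using J by (auto simp: I_def card_image card_insert_if)
 obtain a where a: "\<exists>i\<in>I. odd (a i)" "!!us. us : slists n \<kappa> ==> (\<Sum>i\<in>I. of_int (a i)*q i us) = 0"
  using primitive_relation[OF finite_slists fI cI] by metis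
 have zero: "(\<Sum>i\<in>I. scal (of_int (a i))*y i) = 0"
 proof -
  have "(\<Sum>i\<in>I. scal (of_int (a i))*y i) = (\<Sum>i\<in>I. \<Sum>us\<in>slists n \<kappa>. scal (of_rat (of_int (a i)*q i us))*Eop n us)"
   by (intro sum.cong refl) (simp add: q sum_distrib_left of_rat_mult scal_mult mult.assoc del: scal_of_int)
  also have "... = (\<Sum>us\<in>slists n \<kappa>. \<Sum>i\<in>I. scal (of_rat (of_int (a i)*q i us))*Eop n us)"
   by (rule sum.swap)
  also have "... = (\<Sum>us\<in>slists n \<kappa>. scal (of_rat (\<Sum>i\<in>I. of_int (a i)*q i us))*Eop n us)"
   by (simp add: of_rat_sum scal_sum sum_distrib_right)
  also have "... = 0" using a(2) by simp
  finally show ?thesis .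
 qed
 have "graph (\<Oplus>\<^bsub>M\<^esub>i\<in>I'. of_int (a i) \<odot> b' i) (\<Sum>i\<in>I'. scal (of_int (a i))*y i)" if "I' <= I" for I'
  using finite_subset[OF that fI] that
 proof (induct I' rule: finite_induct)
  case empty
  then show ?case using graph_zero by simp
 next
  case (insert i I')
  have "(\<Oplus>\<^bsub>M\<^esub>i\<in>insert i I'. of_int (a i) \<odot> b' i) = of_int (a i) \<odot> b' i \<oplus> (\<Oplus>\<^bsub>M\<^esub>i\<in>I'. of_int (a i) \<odot> b' i)"
   using insert b'K by (intro M.finsum_insert) (auto simp: K_carrier)
  then show ?case using insert y(1) by (auto intro!: graph_add graph_smult simp del: scal_of_int)
 qed
 from this[OF subset_refl] have g: "graph (\<Oplus>\<^bsub>M\<^esub>i\<in>I. of_int (a i) \<odot> b' i) 0" by (simp only: zero)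
 \<comment> \<open>Injectivity of the comparison turns a relation between matrices into one between
   vectors of the module.\<close>
 then have sum0: "(\<Oplus>\<^bsub>M\<^esub>i\<in>I. of_int (a i) \<odot> b' i) = \<zero>"
  by (rule graph_inj) (simp add: vanishing_def)
 have "(\<Oplus>\<^bsub>M\<^esub>i\<in>I. of_int (a i) \<odot> b' i) = of_int (a None) \<odot> x \<oplus> (\<Oplus>\<^bsub>M\<^esub>i\<in>Some ` J. of_int (a i) \<odot> b' i)"
  unfolding I_def
  by (subst M.finsum_insert) (use J b'K K_carrier x in \<open>auto simp: b'_def I_def\<close>)
 also have "(\<Oplus>\<^bsub>M\<^esub>i\<in>Some ` J. of_int (a i) \<odot> b' i) = (\<Oplus>\<^bsub>M\<^esub>j\<in>J. of_int (a (Some j)) \<odot> b j)"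
  by (subst M.add.finprod_reindex) (use J K_carrier in \<open>auto simp: b'_def\<close>)
 finally have rel: "of_int (a None) \<odot> x \<oplus> (\<Oplus>\<^bsub>M\<^esub>j\<in>J. of_int (a (Some j)) \<odot> b j) = \<zero>"
  using sum0 by simp
 \<comment> \<open>Otherwise the term of \<open>x\<close> drops out modulo 2, and independence makes
   all other coefficients even as well, against primitivity.\<close>
 have "odd (a None)"
 proof (rule ccontr)
  assume ev: "\<not> odd (a None)"
  have of_int_even: "(of_int z :: 'f) = 0 \<longleftrightarrow> even z" for z
   using of_int_eq_0_iff_char_dvd[of z, where 'a='f] char2 by simp
  have "(\<Sum>j\<in>J. of_int (a (Some j))*zfun (b j) T S) + a None*zfun x T S = 0" for T S
  proof -
   have th_sum: "th (\<Oplus>\<^bsub>M\<^esub>j\<in>J'. of_int (a (Some j)) \<odot> b j) T S = (\<Sum>j\<in>J'. of_int (a (Some j))*th (b j) T S)"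
    if "J' <= J" for J'
    using finite_subset[OF that J(1)] that
   proof (induct J' rule: finite_induct)
    case empty
    have "th \<zero> = (%_ _. 0)" using th_smult[OF v_carrier, of 0] by simp
    then show ?case by simp
   next
    case (insert j J')
    have c: "i : insert j J' ==> b i : carrier M" for i using insert J K_carrier by blast
    have "(\<Oplus>\<^bsub>M\<^esub>i\<in>insert j J'. of_int (a (Some i)) \<odot> b i) = of_int (a (Some j)) \<odot> b j \<oplus> (\<Oplus>\<^bsub>M\<^esub>i\<in>J'. of_int (a (Some i)) \<odot> b i)"
     using insert c by (intro M.finsum_insert) auto
    moreover have "(\<Oplus>\<^bsub>M\<^esub>i\<in>J'. of_int (a (Some i)) \<odot> b i) : carrier M" using c by (intro M.finsum_closed) auto
    ultimately show ?case using insert c by (simp add: th_add th_smult)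
   qed
   have "th \<zero> T S = 0" using th_smult[OF v_carrier, of 0] by simp
   moreover have "(\<Oplus>\<^bsub>M\<^esub>j\<in>J. of_int (a (Some j)) \<odot> b j) : carrier M"
    using J K_carrier by (intro M.finsum_closed) auto
   ultimately have "of_int (a None)*th x T S + (\<Sum>j\<in>J. of_int (a (Some j))*th (b j) T S) = 0"
    using arg_cong[OF rel, of "%z. th z T S"] K_carrier[OF x]
    by (simp add: th_add th_smult th_sum)
   then have "of_int ((\<Sum>j\<in>J. a (Some j)*zfun (b j) T S) + a None*zfun x T S) = (0::complex)"
    using J(3) x by (simp add: th_zfun add.commute)
   then show ?thesis by (simp only: of_int_eq_0_iff) simp
  qed
  then have "of_int ((\<Sum>j\<in>J. of_int (a (Some j))*zfun (b j) T S) + a None*zfun x T S) = (0 :: 'f)" for T S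
   by simp
  then have "(\<Sum>j\<in>J. of_int (a (Some j))*red (b j) T S) = (0 :: 'f)" for T S
   using of_int_even[of "a None"] ev by (simp add: red_def)
  then have "\<forall>j\<in>J. (of_int (a (Some j)) :: 'f) = 0" by (rule indep)
  then have "\<forall>j\<in>J. even (a (Some j))" by (simp add: of_int_even)
  then show False using a(1) ev by (auto simp: I_def)
 qed
 then show thesis by (rule that[OF _ rel])
qed

end

section \<open>Standard matchings\<close>

text \<open>A matching is a list of pairs. The standard matchings of a list of sites are built by matching
 a new site with the first site that is still free; they correspond to the standard tableaux with two
 rows, and the products below to a basis of the Specht modules.\<close>

definition sites :: "(nat \<times> nat) list => nat set" where
 "sites Q = (\<Union>(a, b)\<in>set Q. {a, b})"

lemma sites_simps [simp]: "sites [] = {}" "sites ((a, b) # Q) = insert a (insert b (sites Q))"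
 by (auto simp: sites_def)

lemma finite_sites [simp]: "finite (sites Q)"
 by (auto simp: sites_def)

definition first_free :: "nat list => (nat \<times> nat) list => nat" where
 "first_free xs Q = hd (filter (%x. x ~: sites Q) xs)"

text \<open>The second argument bounds the number of pairs. Capping it at half the number of
  remaining sites guarantees a free partner whenever a pair is added.\<close>

fun stdm :: "nat list => nat => (nat \<times> nat) list set" where
 "stdm [] m = {[]}"
| "stdm (x # xs) m = stdm xs (min m (length xs div 2)) \<union>
   (if m = 0 then {} else (%Q. (x, first_free xs Q) # Q) ` stdm xs (m - 1))"

lemma stdm_0: "stdm xs 0 = {[]}"
 by (induct xs) auto

fun matching :: "(nat \<times> nat) list => bool" where
 "matching [] \<longleftrightarrow> True"
| "matching ((a, b) # Q) \<longleftrightarrow> a ~= b & a ~: sites Q & b ~: sites Q & matching Q"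

lemma card_sites: "matching Q ==> card (sites Q) = 2*length Q"
 by (induct Q rule: matching.induct) auto

lemma stdm_matching:
 assumes "distinct xs" "2*m \<le> length xs" "Q : stdm xs m"
 shows "matching Q & sites Q <= set xs & length Q \<le> m"
 using assms
proof (induct xs arbitrary: m Q)
 case (Cons x xs)
 from Cons.prems(3) consider "Q : stdm xs (min m (length xs div 2))"
  | Q' where "m ~= 0" "Q' : stdm xs (m - 1)" "Q = (x, first_free xs Q') # Q'"
  by (auto split: if_splits)
 then show ?case
 proof cases
  case 1
  have "2*min m (length xs div 2) \<le> length xs" by (auto simp: min_def)
  then show ?thesis using 1 Cons(1)[of "min m (length xs div 2)" Q] Cons.prems by auto
 next
  case 2
  have m: "2*(m - 1) < length xs" using 2 Cons.prems by simp
  have IH: "matching Q' & sites Q' <= set xs & length Q' \<le> m - 1"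
   using Cons(1)[of "m - 1" Q'] Cons.prems 2 m by simp
  have "card (sites Q') < card (set xs)"
   using card_sites[of Q'] IH m Cons.prems distinct_card[of xs] by simp
  then have "\<not> set xs <= sites Q'" using card_mono[of "sites Q'" "set xs"] by auto
  then have ne: "filter (%x. x ~: sites Q') xs ~= []" by (auto simp: filter_empty_conv)
  have "first_free xs Q' : set (filter (%x. x ~: sites Q') xs)"
   unfolding first_free_def by (rule hd_in_set[OF ne])
  then have ff: "first_free xs Q' : set xs" "first_free xs Q' ~: sites Q'" by auto
  then show ?thesis using 2 IH Cons.prems by auto
 qed
qed auto

lemma finite_stdm: "finite (stdm xs m)"
 by (induct xs arbitrary: m) auto

text \<open>Pascal's rule. The recursion departs from it only when the cap is active, and then the
  two binomial coefficients concerned are equal by symmetry.\<close>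

lemma card_stdm:
 assumes "distinct xs" "2*m \<le> length xs"
 shows "card (stdm xs m) = length xs choose m"
 using assms
proof (induct xs arbitrary: m)
 case (Cons x xs)
 show ?case
 proof (cases "m = 0")
  case True
  then show ?thesis by (simp add: stdm_0 del: stdm.simps)
 next
  case False
  then obtain k where k: "m = Suc k" using not0_implies_Suc by blast
  have IH: "card (stdm xs k) = length xs choose k" using Cons k by simp
  have ci: "card ((%Q. (x, first_free xs Q) # Q) ` stdm xs k) = card (stdm xs k)"
   by (rule card_image) (auto simp: inj_on_def)
  define m' where "m' = min m (length xs div 2)"
  have m': "2*m' \<le> length xs" by (simp add: m'_def)
  have "stdm xs m' \<inter> (%Q. (x, first_free xs Q) # Q) ` stdm xs k = {}"
   using stdm_matching[of xs m'] m' Cons.prems(1) by fastforce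
  moreover have "stdm (x # xs) m = stdm xs m' \<union> (%Q. (x, first_free xs Q) # Q) ` stdm xs k"
   using k by (simp add: m'_def)
  ultimately have "card (stdm (x # xs) m) = card (stdm xs m') + card ((%Q. (x, first_free xs Q) # Q) ` stdm xs k)"
   by (simp only:) (rule card_Un_disjoint, simp_all add: finite_stdm)
  then have c: "card (stdm (x # xs) m) = (length xs choose m') + (length xs choose k)"
   using ci IH Cons m' by simp
  show ?thesis
  proof (cases "2*m \<le> length xs")
   case True
   then have "m' = m" by (simp add: m'_def)
   then show ?thesis using c k by simp
  next
   case False
   then have len: "length xs = 2*k + 1" using Cons.prems k by simp
   then have "m' = k" by (simp add: m'_def k)
   moreover have "length xs choose Suc k = length xs choose k"
    using binomial_symmetric[of k "length xs"] len by simp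
   ultimately show ?thesis using c k by simp
  qed
 qed
qed simp

text \<open>The two families of functions to which this is applied are the products
 \<open>\<Prod>([a \<in> S] + [b \<notin> S])\<close> and the coefficients of \<open>\<Prod>(h\<^sub>a + h\<^sub>b)\<close>; the scalar \<open>u\<close> is
 \<open>- 1\<close> for the former and 0 for the latter.\<close>
lemma stdm_independent:
 fixes g :: "(nat \<times> nat) list => nat set => 'f::field" and u :: 'f
 assumes nil: "g [] {} ~= 0"
  and new: "!!x y Q S. x ~= y ==> x ~: sites Q ==> x ~: S ==>
    g ((x, y) # Q) (insert x S) + u*g ((x, y) # Q) S = g Q S"
  and old: "!!x Q S. x ~: sites Q ==> x ~: S ==> g Q (insert x S) + u*g Q S = 0"
  and xs: "distinct xs" "2*m \<le> length xs"
  and zero: "!!S. S <= set xs ==> (\<Sum>Q\<in>stdm xs m. c Q*g Q S) = 0"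
 shows "Q : stdm xs m ==> c Q = 0"
 using xs zero
proof (induct xs arbitrary: m c Q)
 case Nil
 then show ?case using nil by simp
next
 case (Cons x xs)
 define m' where "m' = min m (length xs div 2)"
 have m': "2*m' \<le> length xs" by (simp add: m'_def)
 define ex where "ex Q = (x, first_free xs Q) # Q" for Q
 define k where "k = m - 1"
 let ?E = "if m = 0 then {} else ex ` stdm xs k"
 have st: "stdm (x # xs) m = stdm xs m' \<union> ?E" by (simp add: m'_def ex_def[abs_def] k_def)
 have inj: "inj_on ex A" for A by (auto simp: inj_on_def ex_def)
 have d: "distinct xs" "x ~: set xs" using Cons.prems by auto
 have sub: "matching Q & sites Q <= set xs" if "Q : stdm xs m'" for Q
  using stdm_matching[OF d(1) m' that] by simp
 have k: "m ~= 0 ==> 2*k < length xs" using Cons.prems by (auto simp: k_def)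
 have subk: "matching Q & sites Q <= set xs & x ~= first_free xs Q" if "m ~= 0" "Q : stdm xs k" for Q
 proof -
  have "ex Q : stdm (x # xs) m" using that st by auto
  then have "matching (ex Q)" using stdm_matching[OF Cons.prems(2,3)] by simp
  then show ?thesis using stdm_matching[OF d(1), of k Q] k that by (auto simp: ex_def)
 qed
 have disj: "stdm xs m' \<inter> ?E = {}"
  using sub d by (force simp: ex_def)
 have split: "(\<Sum>Q\<in>stdm (x # xs) m. c Q*g Q S) = (\<Sum>Q\<in>stdm xs m'. c Q*g Q S) + (\<Sum>Q\<in>?E. c Q*g Q S)" for S
  unfolding st using disj by (intro sum.union_disjoint) (auto simp: finite_stdm)
 have E0: "c (ex Q) = 0" if m: "m ~= 0" and Q: "Q : stdm xs k" for Q
 proof -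
  have "(\<Sum>Q\<in>stdm xs k. c (ex Q)*g Q S) = 0" if S: "S <= set xs" for S
  proof -
   have xS: "x ~: S" using S d by auto
   have S': "insert x S <= set (x # xs)" "S <= set (x # xs)" using S by auto
   \<comment> \<open>Comparing the relation at \<open>insert x S\<close> and at \<open>S\<close>,
     with weight \<open>u\<close>, cancels all matchings that miss \<open>x\<close> and strips the
     pair of \<open>x\<close> from the others.\<close>
   have "0 = (\<Sum>Q\<in>stdm (x # xs) m. c Q*g Q (insert x S)) + u*(\<Sum>Q\<in>stdm (x # xs) m. c Q*g Q S)"
    unfolding Cons.prems(4)[OF S'(1)] Cons.prems(4)[OF S'(2)] by simp
   also have "... = (\<Sum>Q\<in>stdm xs m'. c Q*(g Q (insert x S) + u*g Q S)) + (\<Sum>Q\<in>?E. c Q*(g Q (insert x S) + u*g Q S))"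
    unfolding split by (simp add: sum_distrib_left distrib_left sum.distrib mult.left_commute)
   also have "(\<Sum>Q\<in>stdm xs m'. c Q*(g Q (insert x S) + u*g Q S)) = 0"
   proof (intro sum.neutral ballI)
    fix Q assume "Q : stdm xs m'"
    then have "x ~: sites Q" using sub d by blast
    then show "c Q*(g Q (insert x S) + u*g Q S) = 0" using old xS by simp
   qed
   also have "(\<Sum>Q\<in>?E. c Q*(g Q (insert x S) + u*g Q S)) = (\<Sum>Q\<in>stdm xs k. c (ex Q)*(g (ex Q) (insert x S) + u*g (ex Q) S))"
    using m by (simp add: sum.reindex[OF inj])
   also have "... = (\<Sum>Q\<in>stdm xs k. c (ex Q)*g Q S)"
   proof (rule sum.cong[OF refl])
    fix Q assume "Q : stdm xs k"
    then have "x ~= first_free xs Q" "x ~: sites Q" using subk[OF m] d by auto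
    then have "g (ex Q) (insert x S) + u*g (ex Q) S = g Q S" unfolding ex_def using xS by (rule new)
    then show "c (ex Q)*(g (ex Q) (insert x S) + u*g (ex Q) S) = c (ex Q)*g Q S" by simp
   qed
   finally show ?thesis by simp
  qed
  then show ?thesis using Cons(1)[of Q k "%Q. c (ex Q)"] Q d(1) k[OF m] by simp
 qed
 have "(\<Sum>Q\<in>stdm xs m'. c Q*g Q S) = 0" if "S <= set xs" for S
 proof -
  have "(\<Sum>Q\<in>?E. c Q*g Q S) = 0" using E0 by (intro sum.neutral) auto
  note z = this
  have "S <= set (x # xs)" using that by auto
  then have "0 = (\<Sum>Q\<in>stdm (x # xs) m. c Q*g Q S)" using Cons.prems(4) by (simp only:)
  also note split
  finally show ?thesis by (simp only: z add_0_right)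
 qed
 then have "Q : stdm xs m' ==> c Q = 0" for Q
  using Cons(1)[of Q m' c] d(1) m' by simp
 then show ?case using Cons.prems(1) E0 unfolding st by (auto split: if_splits)
qed

definition mev :: "(nat \<times> nat) list => nat set => 'f::field" where
 "mev Q S = (\<Prod>(a, b)\<leftarrow>Q. of_bool (a : S) + of_bool (b ~: S))"

lemma mev_simps [simp]: "mev [] S = 1" "mev ((a, b) # Q) S = (of_bool (a : S) + of_bool (b ~: S))*mev Q S"
 by (simp_all add: mev_def)

lemma mev_cong: "x ~: sites Q ==> mev Q (insert x S) = mev Q S"
 by (induct Q rule: matching.induct) auto

lemma mev_independent:
 assumes "distinct xs" "2*m \<le> length xs"
  and "!!S. S <= set xs ==> (\<Sum>Q\<in>stdm xs m. c Q*mev Q S) = (0::'f::field)" and "Q : stdm xs m"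
 shows "c Q = 0"
 by (rule stdm_independent[where g=mev and u="- 1", OF _ _ _ assms(1,2)])
   (use assms(3,4) in \<open>auto simp: mev_cong algebra_simps\<close>)

fun mco :: "(nat \<times> nat) list => nat set => 'f::field" where
 "mco [] C = of_bool (C = {})"
| "mco ((a, b) # Q) C = (if a : C then mco Q (C - {a}) else 0) + (if b : C then mco Q (C - {b}) else 0)"

lemma mco_nonzero: "mco Q C ~= (0 :: 'f::field) ==> C <= sites Q"
proof (induct Q C rule: mco.induct)
 case (2 a b Q C)
 then have "a : C & mco Q (C - {a}) ~= (0 :: 'f) \<or> b : C & mco Q (C - {b}) ~= (0 :: 'f)"
  by (auto split: if_splits)
 then show ?case using 2 by auto
qed (auto split: if_splits)

lemma mco_independent:
 assumes "distinct xs" "2*m \<le> length xs"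
  and "!!S. S <= set xs ==> (\<Sum>Q\<in>stdm xs m. c Q*mco Q S) = (0::'f::field)" and "Q : stdm xs m"
 shows "c Q = 0"
proof (rule stdm_independent[where g=mco and u=0, OF _ _ _ assms(1,2)])
 fix x y Q and S :: "nat set" assume "x ~= y" "x ~: sites Q" "x ~: S"
 moreover have "mco Q (insert x S - {y}) = (0::'f)"
  using mco_nonzero[of Q "insert x S - {y}", where 'f='f] \<open>x \<noteq> y\<close> \<open>x \<notin> sites Q\<close> by auto
 ultimately show "mco ((x, y) # Q) (insert x S) + 0*mco ((x, y) # Q) S = (mco Q S :: 'f)" by auto
next
 fix x Q and S :: "nat set" assume "x ~: sites Q" "x ~: S"
 then show "mco Q (insert x S) + 0*mco Q S = (0 :: 'f)"
  using mco_nonzero[of Q "insert x S", where 'f='f] by auto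
qed (use assms(3,4) in auto)

section \<open>Presented modules\<close>

lemma lookup_map_times [simp]: "plookup (pscale c p) x = (c :: 'f::field)*plookup p x"
 by (simp add: map.rep_eq when_def)

lemma keys_map_times: "pkeys (pscale c p) <= pkeys (p :: 'x \<Rightarrow>\<^sub>0 'f::field)"
 by (auto simp: in_keys_iff)

lemma free_module_sel: "carrier (free_module X) = {p. pkeys p <= X}"
 "add (free_module X) = (+)" "zero (free_module X) = 0"
 "smult (free_module X) = (%c. pscale c)"
 by (simp_all add: free_module_def)

lemma class_ring_field: "field (class_ring :: 'f::field ring)"
 by (rule class_field)

lemma free_module_module: "module (class_ring :: 'f::field ring) (free_module X :: ('f, 'x \<Rightarrow>\<^sub>0 'f) module)"
proof (rule moduleI)
 show "cring (class_ring :: 'f ring)" using class_ring_field by (rule fieldE(1))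
 show "abelian_group (free_module X :: ('f, 'x \<Rightarrow>\<^sub>0 'f) module)"
 proof (rule abelian_groupI)
  fix x assume "x : carrier (free_module X :: ('f, 'x \<Rightarrow>\<^sub>0 'f) module)"
  then show "\<exists>y\<in>carrier (free_module X). y \<oplus>\<^bsub>free_module X\<^esub> x = \<zero>\<^bsub>free_module X\<^esub>"
   by (intro bexI[of _ "- x"]) (auto simp: free_module_sel keys_minus)
 qed (use keys_add in \<open>fastforce simp: free_module_sel algebra_simps\<close>)+
qed (auto simp: free_module_sel algebra_simps lookup_add intro!: poly_mapping_eqI dest: subsetD[OF keys_map_times])

text \<open>The common theory of the two presented modules that occur: the scalar extension of the
  lattice and the exterior power.\<close>

locale presentation =
 fixes X :: "'x set" and R :: "('x \<Rightarrow>\<^sub>0 'f::field) set"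
 assumes R_keys: "r : R ==> pkeys r <= X"
begin

abbreviation "FM \<equiv> (free_module X :: ('f, 'x \<Rightarrow>\<^sub>0 'f) module)"
abbreviation "N \<equiv> relation_span X R"
abbreviation "PM \<equiv> presented_module X R"

sublocale FM: module "class_ring :: 'f ring" FM
 by (rule free_module_module)

lemma R_carrier: "R <= carrier FM"
 using R_keys by (auto simp: free_module_sel)

lemma N_submodule: "submodule class_ring N FM"
 unfolding relation_span_def by (rule FM.span_is_submodule[OF R_carrier])

lemma N_additive_subgroup: "additive_subgroup N FM"
proof (rule additive_subgroup.intro, rule FM.add.subgroupI)
 show "N <= carrier FM" using N_submodule by (rule submodule.subset)
 show "N ~= {}" using submodule.zero_closed[OF N_submodule] by auto
 fix a assume a: "a : N"
 then have ac: "a : carrier FM" using \<open>N \<subseteq> carrier FM\<close> by auto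
 have "pscale (- 1) a : N"
  using submodule.smult_closed[OF N_submodule _ a, of "- 1"] by (simp add: free_module_sel)
 moreover have m: "pscale (- 1) a = - a" by (rule poly_mapping_eqI) (simp add: lookup_uminus)
 moreover have "\<ominus>\<^bsub>FM\<^esub> a = - a"
  using ac by (intro FM.minus_equality) (auto simp: free_module_sel keys_minus)
 ultimately show "\<ominus>\<^bsub>FM\<^esub> a : N" by simp
next
 fix a b assume "a : N" "b : N"
 then show "a \<oplus>\<^bsub>FM\<^esub> b : N" by (rule submodule.m_closed[OF N_submodule])
qed

sublocale N: abelian_subgroup N FM
 by (rule abelian_subgroupI3[OF N_additive_subgroup FM.abelian_group_axioms])

lemma N_smult: "p : N ==> pscale c p : N"
 using submodule.smult_closed[OF N_submodule, of c p] by (simp add: free_module_sel)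

definition pcl :: "('x \<Rightarrow>\<^sub>0 'f) => ('x \<Rightarrow>\<^sub>0 'f) set" where
 "pcl p = N +>\<^bsub>FM\<^esub> p"

lemma pcl_mem: "q : pcl p \<longleftrightarrow> q - p : N"
 unfolding pcl_def a_r_coset_def' free_module_sel by (auto simp: image_iff intro: bexI[of _ "q - p"])

lemma PM_carrier: "carrier PM = pcl ` {p. pkeys p <= X}"
 by (auto simp: presented_module_def quot_module_def A_RCOSETS_def' pcl_def free_module_sel)

lemma pcl_carrier [simp]: "pkeys p <= X ==> pcl p : carrier PM"
 by (auto simp: PM_carrier)

lemma PM_zero: "\<zero>\<^bsub>PM\<^esub> = pcl 0"
 by (auto simp: presented_module_def quot_module_def pcl_mem)

lemma N_add: "p : N ==> q : N ==> p + q : N"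
 using N.a_closed[of p q] by (simp add: free_module_sel)

lemma N_diff: "p : N ==> q : N ==> p - q : N"
proof -
 assume "p : N" "q : N"
 then have "p + pscale (- 1) q : N" by (intro N_add N_smult)
 also have "p + pscale (- 1) q = p - q"
  by (rule poly_mapping_eqI) (simp add: lookup_add lookup_minus)
 finally show ?thesis .
qed

lemma pcl_eqI: "q - p : N ==> pcl q = pcl p"
proof -
 assume d: "q - p : N"
 have "x : pcl q \<longleftrightarrow> x : pcl p" for x
  using N_add[OF _ d, of "x - q"] N_diff[OF _ d, of "x - p"] by (auto simp: pcl_mem)
 then show ?thesis by blast
qed

lemma pcl_N: "p : N ==> pcl p = \<zero>\<^bsub>PM\<^esub>"
 using N.a_rcos_const[of p] by (simp add: pcl_def presented_module_def quot_module_def)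

lemma pcl_add: "pkeys p <= X ==> pkeys q <= X ==> pcl p \<oplus>\<^bsub>PM\<^esub> pcl q = pcl (p + q)"
 using N.a_rcos_sum[of p q] by (simp add: pcl_def presented_module_def quot_module_def free_module_sel)

lemma pcl_smult: "pkeys p <= X ==> c \<odot>\<^bsub>PM\<^esub> pcl p = pcl (pscale c p)"
proof -
 assume p: "pkeys p <= X"
 have "pcl (pscale c q) = pcl (pscale c p)" if q: "q : pcl p" for q
 proof (rule pcl_eqI)
  have "pscale c (q - p) : N" using q by (simp add: pcl_mem N_smult)
  moreover have "pscale c (q - p) = pscale c q - pscale c p"
   by (rule poly_mapping_eqI) (simp add: lookup_minus right_diff_distrib)
  ultimately show "pscale c q - pscale c p : N" by simp
 qed
 moreover have "p : pcl p" using N.zero_closed by (simp add: pcl_mem free_module_sel)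
 ultimately have "(\<Union>q\<in>pcl p. pcl (pscale c q)) = pcl (pscale c p)" by blast
 then show ?thesis by (simp add: presented_module_def quot_module_def pcl_def free_module_sel)
qed

lemma PM_cases:
 assumes "C : carrier PM"
 obtains p where "pkeys p <= X" "C = pcl p"
 using assms by (auto simp: PM_carrier)

lemma PM_vectorspace: "vectorspace class_ring PM"
proof (intro vectorspace.intro moduleI)
 show "cring (class_ring :: 'f ring)" using class_ring_field by (rule fieldE(1))
 show "field (class_ring :: 'f ring)" by (rule class_ring_field)
 have k: "pkeys (pscale c p) <= X" if "pkeys p <= X" for c and p :: "'x \<Rightarrow>\<^sub>0 'f"
  using that keys_map_times[of c p] by blast
 have ka: "pkeys (p + q) <= X" if "pkeys p <= X" "pkeys q <= X" for p q :: "'x \<Rightarrow>\<^sub>0 'f"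
  using that keys_add[of p q] by blast
 show "abelian_group PM"
 proof (rule abelian_groupI)
  fix x assume "x : carrier PM"
  then obtain p where p: "pkeys p <= X" "x = pcl p" using PM_cases by metis
  then show "\<exists>y\<in>carrier PM. y \<oplus>\<^bsub>PM\<^esub> x = \<zero>\<^bsub>PM\<^esub>"
   by (intro bexI[of _ "pcl (- p)"]) (simp_all add: pcl_add PM_zero keys_minus)
  show "\<zero>\<^bsub>PM\<^esub> \<oplus>\<^bsub>PM\<^esub> x = x" using p by (simp add: PM_zero pcl_add)
 next
  fix x y z assume "x : carrier PM" "y : carrier PM" "z : carrier PM"
  then obtain p q r where "pkeys p <= X" "x = pcl p" "pkeys q <= X" "y = pcl q"
   "pkeys r <= X" "z = pcl r"
   using PM_cases by metis
  then show "(x \<oplus>\<^bsub>PM\<^esub> y) \<oplus>\<^bsub>PM\<^esub> z = x \<oplus>\<^bsub>PM\<^esub> (y \<oplus>\<^bsub>PM\<^esub> z)"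
   "x \<oplus>\<^bsub>PM\<^esub> y : carrier PM" "x \<oplus>\<^bsub>PM\<^esub> y = y \<oplus>\<^bsub>PM\<^esub> x"
   using ka by (simp_all add: pcl_add ac_simps)
 qed (simp add: PM_zero)
 fix a b x y
 assume "x : carrier PM" "y : carrier PM"
 then obtain p q where pq: "pkeys p <= X" "x = pcl p" "pkeys q <= X" "y = pcl q"
  using PM_cases by metis
 have *: "pscale (a + b) p = pscale a p + pscale b p"
  "pscale a (p + q) = pscale a p + pscale a q"
  "pscale (a*b) p = pscale a (pscale b p)"
  "pscale 1 p = p" for a b
  by (rule poly_mapping_eqI, simp add: lookup_add algebra_simps)+
 show "a \<odot>\<^bsub>PM\<^esub> x : carrier PM" using pq k by (simp add: pcl_smult)
 show "(a \<oplus>\<^bsub>class_ring\<^esub> b) \<odot>\<^bsub>PM\<^esub> x = a \<odot>\<^bsub>PM\<^esub> x \<oplus>\<^bsub>PM\<^esub> b \<odot>\<^bsub>PM\<^esub> x"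
  using pq k by (simp add: pcl_smult pcl_add *)
 show "a \<odot>\<^bsub>PM\<^esub> (x \<oplus>\<^bsub>PM\<^esub> y) = a \<odot>\<^bsub>PM\<^esub> x \<oplus>\<^bsub>PM\<^esub> a \<odot>\<^bsub>PM\<^esub> y"
  using pq k ka by (simp add: pcl_smult pcl_add *)
 show "(a \<otimes>\<^bsub>class_ring\<^esub> b) \<odot>\<^bsub>PM\<^esub> x = a \<odot>\<^bsub>PM\<^esub> (b \<odot>\<^bsub>PM\<^esub> x)"
  using pq k by (simp add: pcl_smult *)
 show "\<one>\<^bsub>class_ring\<^esub> \<odot>\<^bsub>PM\<^esub> x = x" using pq by (simp add: pcl_smult *)
qed

sublocale PM: vectorspace "class_ring :: 'f ring" PM
 by (rule PM_vectorspace)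

lemma generator_pcl: "generator X R x = pcl (psingle x 1)"
 by (simp add: generator_def pcl_def)

lemma generator_carrier [simp]: "x : X ==> generator X R x : carrier PM"
 by (simp add: generator_pcl)

lemma PM_induct [consumes 1, case_names gen add smult]:
 assumes "C : carrier PM"
  and "!!x. x : X ==> P (generator X R x)"
  and "!!C D. C : carrier PM ==> D : carrier PM ==> P C ==> P D ==> P (C \<oplus>\<^bsub>PM\<^esub> D)"
  and "!!c C. C : carrier PM ==> P C ==> P (c \<odot>\<^bsub>PM\<^esub> C)"
  and "P \<zero>\<^bsub>PM\<^esub>"
 shows "P C"
proof -
 obtain p where p: "pkeys p <= X" "C = pcl p" using PM_cases[OF assms(1)] by metis
 have "P (pcl p)" using p(1)
 proof (induct p rule: poly_mapping_keys_induct)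
  case zero
  then show ?case using assms(5) by (simp add: PM_zero)
 next
  case (single x c)
  have "pscale c (psingle x 1) = psingle x c"
   by (rule poly_mapping_eqI) (simp add: lookup_single when_def)
  then have "pcl (psingle x c) = c \<odot>\<^bsub>PM\<^esub> generator X R x"
   using single by (simp add: generator_pcl pcl_smult)
  then show ?case using assms(2,4) single by simp
 next
  case (add p q)
  then show ?case using assms(3)[of "pcl p" "pcl q"] by (simp add: pcl_add)
 qed
 then show ?thesis using p by simp
qed

section \<open>Functionals and maps induced on presented modules\<close>

definition lin :: "('x => 'f) => ('x \<Rightarrow>\<^sub>0 'f) => 'f" where
 "lin h p = (\<Sum>x\<in>pkeys p. plookup p x*h x)"

lemma lin_superset: "finite I ==> pkeys p <= I ==> lin h p = (\<Sum>x\<in>I. plookup p x*h x)"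
 unfolding lin_def by (rule sum.mono_neutral_left) (auto simp: not_in_keys_iff_lookup_eq_zero)

lemma lin_add: "lin h (p + q) = lin h p + lin h q"
proof -
 let ?I = "pkeys p \<union> pkeys q"
 have "lin h (p + q) = (\<Sum>x\<in>?I. plookup (p + q) x*h x)" by (rule lin_superset[OF _ keys_add]) auto
 also have "... = lin h p + lin h q"
  by (simp add: lookup_add distrib_right sum.distrib lin_superset[of ?I])
 finally show ?thesis .
qed

lemma lin_smult: "lin h (pscale c p) = c*lin h p"
 using lin_superset[OF _ keys_map_times, of p h c]
 by (simp add: lin_def sum_distrib_left mult.assoc)

lemma lin_single [simp]: "lin h (psingle x c) = c*h x"
 using lin_superset[of "{x}" "psingle x c" h] by simp

lemma lin_zero [simp]: "lin h 0 = 0"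
 by (simp add: lin_def)

lemma lin_diff: "lin h (p - q) = lin h p - lin h q"
 using lin_add[of h "p - q" q] by simp

lemma lin_N:
 assumes "!!r. r : R ==> lin h r = 0" "p : N"
 shows "lin h p = 0"
proof -
 let ?H = "{p : carrier FM. lin h p = 0}"
 have "submodule class_ring ?H FM"
  using FM.a_closed FM.smult_closed
  by (intro submodule.intro FM.module_axioms) (auto simp: lin_add lin_smult free_module_sel)
 moreover have "R <= ?H" using R_carrier assms(1) by auto
 ultimately have "N <= ?H" unfolding relation_span_def by (intro FM.span_is_subset)
 then show ?thesis using assms(2) by auto
qed

text \<open>The universal property of the quotient; the choice of a representative is harmless once
  \<open>h\<close> kills the relations.\<close>

definition lift :: "('x => 'f) => ('x \<Rightarrow>\<^sub>0 'f) set => 'f" where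
 "lift h C = lin h (SOME p. p : C)"

context
 fixes h :: "'x => 'f"
 assumes hR: "!!r. r : R ==> lin h r = 0"
begin

lemma lift_pcl: "pkeys p <= X ==> lift h (pcl p) = lin h p"
proof -
 assume p: "pkeys p <= X"
 have "p : pcl p" using N.zero_closed by (simp add: pcl_mem free_module_sel)
 then have "(SOME q. q : pcl p) : pcl p" by (rule someI)
 from pcl_mem[THEN iffD1, OF this] have "lin h ((SOME q. q : pcl p) - p) = 0"
  by (rule lin_N[rotated]) (rule hR)
 then show ?thesis unfolding lift_def lin_diff by simp
qed

lemma lift_add: "C : carrier PM ==> D : carrier PM ==> lift h (C \<oplus>\<^bsub>PM\<^esub> D) = lift h C + lift h D"
 using keys_add by (elim PM_cases) (simp add: pcl_add lift_pcl lin_add order_trans[OF keys_add])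

lemma lift_smult: "C : carrier PM ==> lift h (c \<odot>\<^bsub>PM\<^esub> C) = c*lift h C"
 by (elim PM_cases) (simp add: pcl_smult lift_pcl lin_smult order_trans[OF keys_map_times])

lemma lift_zero: "lift h \<zero>\<^bsub>PM\<^esub> = 0"
 by (simp add: PM_zero lift_pcl)

lemma lift_generator: "x : X ==> lift h (generator X R x) = h x"
 by (simp add: generator_pcl lift_pcl)

end

definition push :: "('x => 'x) => ('x \<Rightarrow>\<^sub>0 'f) => ('x \<Rightarrow>\<^sub>0 'f)" where
 "push f p = (\<Sum>x\<in>pkeys p. psingle (f x) (plookup p x))"

lemma push_superset: "finite I ==> pkeys p <= I ==> push f p = (\<Sum>x\<in>I. psingle (f x) (plookup p x))"
 unfolding push_def by (rule sum.mono_neutral_left) (auto simp: not_in_keys_iff_lookup_eq_zero)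

lemma push_add: "push f (p + q) = push f p + push f q"
proof -
 let ?I = "pkeys p \<union> pkeys q"
 have "push f (p + q) = (\<Sum>x\<in>?I. psingle (f x) (plookup (p + q) x))" by (rule push_superset[OF _ keys_add]) auto
 also have "... = push f p + push f q"
  by (simp add: lookup_add single_add sum.distrib push_superset[of ?I])
 finally show ?thesis .
qed

lemma push_single [simp]: "push f (psingle x c) = psingle (f x) c"
 using push_superset[of "{x}" "psingle x c" f] by simp

lemma push_zero [simp]: "push f 0 = 0"
 by (simp add: push_def)

lemma push_diff: "push f (p - q) = push f p - push f q"
 using push_add[of f "p - q" q] by simp

lemma push_smult: "push f (pscale c p) = pscale c (push f p)"
proof -
 have m: "pscale c (\<Sum>x\<in>I. psingle (g x) (k x)) = (\<Sum>x\<in>I. psingle (g x) (c*k x))"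
  for I :: "'x set" and g :: "'x => 'x" and k
  by (rule poly_mapping_eqI) (simp add: lookup_sum lookup_single when_def sum_distrib_left if_distrib cong: if_cong)
 show ?thesis
  using push_superset[OF _ keys_map_times, of p f c] by (simp add: push_def m)
qed

lemma push_keys: "f ` X <= X ==> pkeys p <= X ==> pkeys (push f p) <= X"
proof -
 assume f: "f ` X <= X" and "pkeys p <= X"
 from this(2) show ?thesis
 proof (induct p rule: poly_mapping_keys_induct)
  case (add p q)
  then show ?case using keys_add[of "push f p" "push f q"] by (auto simp: push_add)
 qed (use f in auto)
qed

context
 fixes f :: "'x => 'x"
 assumes fX: "f ` X <= X" and fR: "!!r. r : R ==> push f r : N"
begin

lemma push_N: "p : N ==> push f p : N"
proof -
 assume p: "p : N"
 let ?H = "{p : carrier FM. push f p : N}"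
 have "submodule class_ring ?H FM"
  using FM.a_closed FM.smult_closed N.a_closed N.zero_closed N_smult
  by (intro submodule.intro FM.module_axioms) (auto simp: push_add push_smult free_module_sel)
 moreover have "R <= ?H" using R_carrier fR by auto
 ultimately have "N <= ?H" unfolding relation_span_def by (intro FM.span_is_subset)
 then show ?thesis using p by auto
qed

lemma presented_map_pcl: "pkeys p <= X ==> presented_map X R f (pcl p) = pcl (push f p)"
proof -
 assume p: "pkeys p <= X"
 have "pcl (push f q) = pcl (push f p)" if q: "q : pcl p" for q
 proof (rule pcl_eqI)
  show "push f q - push f p : N" using q push_N by (simp add: pcl_mem flip: push_diff)
 qed
 moreover have "p : pcl p" using N.zero_closed by (simp add: pcl_mem free_module_sel)
 ultimately have "(\<Union>q\<in>pcl p. pcl (push f q)) = pcl (push f p)" by blast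
 then show ?thesis by (simp add: presented_map_def pcl_def push_def)
qed

lemma presented_map_generator: "x : X ==> presented_map X R f (generator X R x) = generator X R (f x)"
 by (simp add: generator_pcl presented_map_pcl)

lemma presented_map_carrier: "C : carrier PM ==> presented_map X R f C : carrier PM"
 by (elim PM_cases) (simp add: presented_map_pcl push_keys[OF fX])

lemma presented_map_add: "C : carrier PM ==> D : carrier PM ==>
  presented_map X R f (C \<oplus>\<^bsub>PM\<^esub> D) = presented_map X R f C \<oplus>\<^bsub>PM\<^esub> presented_map X R f D"
 by (elim PM_cases) (simp add: presented_map_pcl push_keys[OF fX] pcl_add push_add order_trans[OF keys_add])

lemma presented_map_smult: "C : carrier PM ==>
  presented_map X R f (c \<odot>\<^bsub>PM\<^esub> C) = c \<odot>\<^bsub>PM\<^esub> presented_map X R f C"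
 by (elim PM_cases) (simp add: presented_map_pcl push_keys[OF fX] pcl_smult push_smult order_trans[OF keys_map_times])

end

end

section \<open>Root elements in characteristic 2\<close>

text \<open>The square of a root vector has even entries, so the division in
  \<open>root_elem\<close> is exact; a quadratic term in \<open>t\<close> requires that the root
  involves \<open>2*n\<close>, that is, a short root.\<close>

lemma root_elem_index:
 assumes "\<alpha> : roots n" "root_pair n \<alpha> = (a, b)" "r < 2*n+1" "s < 2*n+1"
 shows "root_elem n \<alpha> t $$ (r, s) = (if r = s then 1 else 0)
  + t*((if r = a then of_nat (bm n b s) else 0) - (if r = b then of_nat (bm n a s) else 0))
  - t\<^sup>2*((if r = b & a = 2*n then of_nat (bm n b s) else 0) + (if r = a & b = 2*n then of_nat (bm n a s) else (0::'f::field)))"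
proof -
 note bd = root_pair_bounds[OF assms(1,2)]
 let ?X = "root_vector n \<alpha>"
 have X: "?X = gmat n a b" by (rule root_vector_gmat[OF assms(1,2)])
 have "(?X ^\<^sub>m 2) = ?X*?X" using root_vector_carrier[of n \<alpha>] by (simp add: numeral_2_eq_2)
 then have "(?X ^\<^sub>m 2) $$ (r, s) = gmat n a b $$ (r, a)*of_nat (bm n b s) - gmat n a b $$ (r, b)*of_nat (bm n a s)"
  unfolding X using bd assms by (simp only: gmat_mult_index)
 also have "... = 2*(- (if r = b & a = 2*n then int (bm n b s) else 0) - (if r = a & b = 2*n then int (bm n a s) else 0))"
  using bd assms by (auto simp: gmat_index) (auto simp: bm_def)
 finally have 2: "(?X ^\<^sub>m 2) $$ (r, s) div 2 = - (if r = b & a = 2*n then int (bm n b s) else 0) - (if r = a & b = 2*n then int (bm n a s) else 0)"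
  by simp
 have dr: "dim_row ?X = 2*n+1" using root_vector_carrier[of n \<alpha>] by (rule carrier_matD(1))
 have "root_elem n \<alpha> t $$ (r, s) = of_int ((1\<^sub>m (2*n+1)) $$ (r, s)) + t*of_int (?X $$ (r, s)) + t\<^sup>2*(of_int ((?X ^\<^sub>m 2) $$ (r, s) div 2) :: 'f)"
  using assms(3,4) dr by (simp add: root_elem_def numeral_2_eq_2 sum.atMost_Suc)
 also have "?X $$ (r, s) = (if r = a then int (bm n b s) else 0) - (if r = b then int (bm n a s) else 0)"
  by (rule root_vector_index[OF assms])
 finally show ?thesis
  unfolding 2 using assms(3,4) by (cases "r = a"; cases "r = b"; cases "a = 2*n"; cases "b = 2*n"; simp add: ring_distribs)
qed

lemma root_elem_carrier [simp]: "root_elem n \<alpha> t : cmat n"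
 "root_elem n \<alpha> t : carrier_mat (Suc (2*n)) (Suc (2*n))"
 by (auto simp: root_elem_def)

lemma root_elem_mult_vec:
 assumes "\<alpha> : roots n" "root_pair n \<alpha> = (a, b)" "r < 2*n+1" "x : cvec n"
 shows "(root_elem n \<alpha> t *\<^sub>v x) $ r = x $ r
  + t*((if r = a then bcov n b x else 0) - (if r = b then bcov n a x else 0))
  - t\<^sup>2*((if r = b & a = 2*n then bcov n b x else 0) + (if r = a & b = 2*n then bcov n a x else (0::'f::field)))"
proof -
 note bd = root_pair_bounds[OF assms(1,2)]
 have "(root_elem n \<alpha> t *\<^sub>v x) $ r = (\<Sum>s<2*n+1. root_elem n \<alpha> t $$ (r, s)*x $ s)"
  using assms(3,4) carrier_matD[OF root_elem_carrier(2)[of n \<alpha> t]] by (simp add: scalar_prod_def atLeast0LessThan)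
 also have "... = (\<Sum>s<2*n+1. (if s = r then x $ r else 0)
   + t*((if r = a then of_nat (bm n b s)*x $ s else 0) - (if r = b then of_nat (bm n a s)*x $ s else 0))
   - t\<^sup>2*((if r = b & a = 2*n then of_nat (bm n b s)*x $ s else 0) + (if r = a & b = 2*n then of_nat (bm n a s)*x $ s else 0)))"
  by (intro sum.cong refl) (auto simp: root_elem_index[OF assms(1,2,3)] algebra_simps)
 also have "... = x $ r + t*((\<Sum>s<2*n+1. if r = a then of_nat (bm n b s)*x $ s else 0) - (\<Sum>s<2*n+1. if r = b then of_nat (bm n a s)*x $ s else 0))
   - t\<^sup>2*((\<Sum>s<2*n+1. if r = b & a = 2*n then of_nat (bm n b s)*x $ s else 0) + (\<Sum>s<2*n+1. if r = a & b = 2*n then of_nat (bm n a s)*x $ s else 0))"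
  using assms(3) by (simp add: sum.distrib sum_subtractf flip: sum_distrib_left)
 finally show ?thesis
  unfolding bcov_sum[OF bd(1)] bcov_sum[OF bd(2)] by simp
qed

text \<open>The family \<open>g\<close> is a parameter because the same combination is formed with
  the Clifford generators and with the creation operators that model the exterior algebra.\<close>

definition lc :: "nat => (nat => 'f::field fock_op) => 'f vec => 'f fock_op" where
 "lc n g x = (\<Sum>j<2*n+1. scal (x $ j)*g j)"

lemma lc_unit: "j < 2*n+1 ==> lc n g (unit_vec (2*n+1) j) = g j"
proof -
 assume j: "j < 2*n+1"
 have "lc n g (unit_vec (2*n+1) j) = (\<Sum>i<2*n+1. if i = j then g j else 0)"
  unfolding lc_def using j by (intro sum.cong) auto
 then show ?thesis using j by simp
qed

lemma lc_add: "x : cvec n ==> y : cvec n ==> lc n g (x + y) = lc n g x + lc n g y"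
 by (simp add: lc_def scal_add distrib_right sum.distrib)

lemma lc_smult: "x : cvec n ==> lc n g (c \<cdot>\<^sub>v x) = scal c*lc n g x"
 by (simp add: lc_def scal_mult sum_distrib_left mult.assoc)

section \<open>Characteristic 2 and the spin action of root elements\<close>

locale char2 =
 fixes ty :: "'f::field itself"
 assumes char2: "CHAR('f) = 2"
begin

lemma two_zero: "(2 :: 'f) = 0"
 using of_nat_CHAR[where 'a='f] char2 by simp

lemma add_self [simp]: "x + x = (0 :: 'f)"
 using two_zero by (metis mult_2 mult_zero_left)

lemma minus_self [simp]: "- x = (x :: 'f)"
 using add_self[of x] by (metis add_eq_0_iff)

lemma diff_eq_add: "x - y = x + (y :: 'f)"
 by (metis add_uminus_conv_diff minus_self)

lemma op_add_self [simp]: "A + A = (0 :: 'f fock_op)"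
proof -
 have "A + A = (scal 1 + scal 1)*A" by (simp add: distrib_right del: one_add_one)
 also have "... = scal (1 + 1)*A" by (simp only: scal_add)
 also have "... = 0" by (simp only: add_self) simp
 finally show ?thesis .
qed

lemma op_minus_self [simp]: "- A = (A :: 'f fock_op)"
 using op_add_self[of A] by (metis add_eq_0_iff)

lemma op_diff_eq_add: "A - B = A + (B :: 'f fock_op)"
 by (metis add_uminus_conv_diff op_minus_self)

lemma bcov_last: "bcov n (2*n) x = (0 :: 'f)"
 by (simp add: bcov_def bw_def two_zero)

abbreviation N1 :: "nat => nat" where "N1 n \<equiv> 2*n+1"

abbreviation uv :: "nat => nat => 'f vec" where "uv n j \<equiv> unit_vec (2*n+1) j"

lemma root_elem_vec:
 assumes "\<alpha> : roots n" "root_pair n \<alpha> = (a, b)" "x : cvec n"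
 shows "root_elem n \<alpha> t *\<^sub>v x = x + (t*bcov n b x + (if b = 2*n then t\<^sup>2*bcov n a x else 0)) \<cdot>\<^sub>v uv n a
  + (t*bcov n a x + (if a = 2*n then t\<^sup>2*bcov n b x else 0)) \<cdot>\<^sub>v uv n b"
proof (rule eq_vecI)
 note bd = root_pair_bounds[OF assms(1,2)]
 fix r assume "r < dim_vec (x + (t*bcov n b x + (if b = 2*n then t\<^sup>2*bcov n a x else 0)) \<cdot>\<^sub>v uv n a
  + (t*bcov n a x + (if a = 2*n then t\<^sup>2*bcov n b x else 0)) \<cdot>\<^sub>v uv n b)"
 then have r: "r < 2*n+1" by simp
 show "(root_elem n \<alpha> t *\<^sub>v x) $ r = (x + (t*bcov n b x + (if b = 2*n then t\<^sup>2*bcov n a x else 0)) \<cdot>\<^sub>v uv n a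
  + (t*bcov n a x + (if a = 2*n then t\<^sup>2*bcov n b x else 0)) \<cdot>\<^sub>v uv n b) $ r"
  unfolding root_elem_mult_vec[OF assms(1,2) r assms(3)]
  using r bd assms(3) by (auto simp: diff_eq_add algebra_simps)
qed (use assms carrier_matD(1)[OF root_elem_carrier(1)[of n \<alpha> t]] in auto)

text \<open>The element of the Clifford group above a root element; in characteristic 2 it is its
  own inverse.\<close>

definition xop :: "nat => broot => 'f => 'f fock_op" where
 "xop n \<alpha> t = 1 + scal t*rsp n \<alpha>"

lemma xop_sq: "\<alpha> : roots n ==> xop n \<alpha> t*xop n \<alpha> t = 1"
proof -
 assume \<alpha>: "\<alpha> : roots n"
 have "scal t*rsp n \<alpha>*(scal t*rsp n \<alpha>) = scal t*(scal t*(rsp n \<alpha>*rsp n \<alpha> :: 'f fock_op))"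
  by (simp only: mult.assoc scal_left_commute[of "rsp n \<alpha>"])
 then have z: "scal t*rsp n \<alpha>*(scal t*rsp n \<alpha>) = (0 :: 'f fock_op)"
  using rsp_sq[OF \<alpha>, where 'a='f] by simp
 have "xop n \<alpha> t*xop n \<alpha> t = 1 + (scal t*rsp n \<alpha> + scal t*rsp n \<alpha>) + scal t*rsp n \<alpha>*(scal t*rsp n \<alpha>)"
  unfolding xop_def by (simp only: distrib_left distrib_right mult_1_left mult_1_right add.assoc)
 then show ?thesis unfolding z by simp
qed

lemma gen_last_sq: "gen n (2*n)*gen n (2*n) = (1 :: 'f fock_op)"
 by (simp add: gen_def par_sq)

lemma ad_rsp_lc:
 assumes "\<alpha> : roots n" "root_pair n \<alpha> = (a, b)"
 shows "ad (rsp n \<alpha>) (lc n (gen n) x) = scal (bcov n b x)*gen n a + scal (bcov n a x)*(gen n b :: 'f fock_op)"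
proof -
 note bd = root_pair_bounds[OF assms]
 have "ad (rsp n \<alpha>) (lc n (gen n) x) = (\<Sum>j<2*n+1. scal (x $ j)*(of_nat (bm n b j)*gen n a - of_nat (bm n a j)*(gen n b :: 'f fock_op)))"
  using bd by (simp add: lc_def ad_sum_right ad_scal_right rsp_def assms(2) ad_gen_gen)
 also have "... = scal (\<Sum>j<2*n+1. of_nat (bm n b j)*x $ j)*gen n a + scal (\<Sum>j<2*n+1. of_nat (bm n a j)*x $ j)*gen n b"
  by (simp add: scal_sum scal_mult sum_distrib_right op_diff_eq_add distrib_left sum.distrib mult.assoc mult_of_nat_commute scal_of_nat)
 finally show ?thesis using bd by (simp add: bcov_sum)
qed

lemma xop_conj: "xop n \<alpha> t*A*xop n \<alpha> t = A + scal t*(rsp n \<alpha>*A + A*rsp n \<alpha>) + scal t*(scal t*(rsp n \<alpha>*A*rsp n \<alpha>))"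
proof -
 let ?s = "rsp n \<alpha> :: 'f fock_op" and ?T = "scal t :: 'f fock_op"
 have "xop n \<alpha> t*A*xop n \<alpha> t = A + (?T*(?s*A) + A*(?T*?s)) + ?T*(?s*(A*(?T*?s)))"
  unfolding xop_def by (simp add: algebra_simps)
 also have "A*(?T*?s) = ?T*(A*?s)" by (rule scal_left_commute)
 also have "?s*(?T*(A*?s)) = ?T*(?s*(A*?s))" by (rule scal_left_commute)
 finally show ?thesis by (simp only: distrib_left mult.assoc)
qed

text \<open>Conjugation by this unit of the Clifford algebra realizes the root element on the
  natural module. A term quadratic in \<open>t\<close> survives only through the last generator,
  whose square is 1.\<close>

lemma xop_lc:
 assumes "\<alpha> : roots n" "x : cvec n"
 shows "xop n \<alpha> t*lc n (gen n) x*xop n \<alpha> t = lc n (gen n) (root_elem n \<alpha> t *\<^sub>v x)"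
proof -
 obtain a b where ab: "root_pair n \<alpha> = (a, b)" by fastforce
 note bd = root_pair_bounds[OF assms(1) ab]
 let ?c = "lc n (gen n) x" and ?s = "rsp n \<alpha> :: 'f fock_op"
 have anti: "gen n a*gen n b = (gen n b*gen n a :: 'f fock_op)"
  using gen_anticomm[OF bd(1,2), where 'a='f] bd(3) by (simp add: add_eq_0_iff2)
 have s: "?s = gen n a*gen n b" by (simp add: rsp_def ab)
 have ss: "?s*?s = 0" by (rule rsp_sq[OF assms(1)])
 have "?s*?c = ?c*?s + ad ?s ?c" by (simp add: ad_def)
 then have cs: "?c*?s = ?s*?c + ad ?s ?c" by (metis add.assoc add.right_neutral op_add_self)
 have "?s*(?c*?s) = (?s*?s)*?c + ?s*ad ?s ?c" by (simp add: cs distrib_left mult.assoc)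
 also have "... = ?s*ad ?s ?c" by (simp add: ss)
 also have "... = scal (bcov n b x)*(?s*gen n a) + scal (bcov n a x)*(?s*gen n b)"
  by (simp add: ad_rsp_lc[OF assms(1) ab] distrib_left scal_left_commute)
 also have "?s*gen n b = gen n a*(gen n b*gen n b)" by (simp add: s mult.assoc)
 also have "... = (if b = 2*n then gen n a else 0)"
  using bd gen_isotropic_sq[of b n, where 'a='f] by (auto simp: gen_last_sq)
 also have "?s*gen n a = gen n b*(gen n a*gen n a)" by (simp add: s anti mult.assoc)
 also have "... = (if a = 2*n then gen n b else 0)"
  using bd gen_isotropic_sq[of a n, where 'a='f] by (auto simp: gen_last_sq)
 finally have scs: "?s*(?c*?s) = scal (bcov n b x)*(if a = 2*n then gen n b else 0) + scal (bcov n a x)*(if b = 2*n then gen n a else 0)" .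
 have "xop n \<alpha> t*?c*xop n \<alpha> t = ?c + scal t*(?s*?c + ?c*?s) + scal t*(scal t*(?s*(?c*?s)))"
  unfolding xop_conj by (simp only: mult.assoc)
 also have "?s*?c + ?c*?s = ad ?s ?c" by (simp add: ad_def op_diff_eq_add)
 finally have l: "xop n \<alpha> t*?c*xop n \<alpha> t = ?c + scal t*ad ?s ?c + scal t*(scal t*(?s*(?c*?s)))" .
 have u: "u \<cdot>\<^sub>v uv n j : cvec n" for u j by simp
 have "lc n (gen n) (root_elem n \<alpha> t *\<^sub>v x) = ?c + scal (t*bcov n b x + (if b = 2*n then t\<^sup>2*bcov n a x else 0))*gen n a
  + scal (t*bcov n a x + (if a = 2*n then t\<^sup>2*bcov n b x else 0))*gen n b"
  unfolding root_elem_vec[OF assms(1) ab assms(2)]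
  using assms(2) bd by (simp only: lc_add lc_smult u add_carrier_vec unit_vec_carrier lc_unit)
 then show ?thesis
  unfolding l scs ad_rsp_lc[OF assms(1) ab]
  by (cases "a = 2*n"; cases "b = 2*n"; simp only: if_True if_False simp_thms; simp add: scal_add scal_mult distrib_left distrib_right mult.assoc power2_eq_square add_ac)
qed

definition cprod :: "nat => 'f vec list => 'f fock_op" where
 "cprod n vs = prod_list (map (lc n (gen n)) vs)"

text \<open>The factors are conjugated separately after the square of
  \<open>xop n \<alpha> t\<close> has been inserted between them.\<close>

lemma xop_cprod:
 assumes "\<alpha> : roots n" "set vs <= cvec n"
 shows "xop n \<alpha> t*cprod n vs*xop n \<alpha> t = cprod n (map (%v. root_elem n \<alpha> t *\<^sub>v v) vs)"
 using assms(2)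
proof (induct vs)
 case Nil
 then show ?case using xop_sq[OF assms(1)] by (simp add: cprod_def)
next
 case (Cons v vs)
 let ?x = "xop n \<alpha> t"
 have v: "v : cvec n" "set vs <= cvec n" using Cons.prems by auto
 have "?x*cprod n (v # vs)*?x = ?x*lc n (gen n) v*(1*cprod n vs*?x)"
  by (simp only: cprod_def list.map prod_list.Cons mult.assoc mult_1_left)
 also have "... = ?x*lc n (gen n) v*((?x*?x)*cprod n vs*?x)" by (simp only: xop_sq[OF assms(1)])
 also have "... = (?x*lc n (gen n) v*?x)*(?x*cprod n vs*?x)" by (simp only: mult.assoc)
 also have "... = lc n (gen n) (root_elem n \<alpha> t *\<^sub>v v)*cprod n (map (%v. root_elem n \<alpha> t *\<^sub>v v) vs)"
  by (simp only: xop_lc[OF assms(1) v(1)] Cons.hyps[OF v(2)])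
 finally show ?case by (simp only: cprod_def list.map prod_list.Cons)
qed

definition xact :: "nat => broot => 'f => (nat set => nat set => 'f) => nat set => nat set => 'f" where
 "xact n \<alpha> t F T S = (case root_pair n \<alpha> of (a, b) =>
   F T S + t*dpf n a b 1 F T S + t\<^sup>2*dpf n a b 2 F T S)"

definition ctup :: "nat => 'f vec list => nat set => nat set => 'f" where
 "ctup n vs = restr n (ent (cprod n vs))"

lemma xact_restr: "\<alpha> : roots n ==> xact n \<alpha> t (restr n F) = restr n (xact n \<alpha> t F)"
proof -
 assume \<alpha>: "\<alpha> : roots n"
 obtain a b where ab: "root_pair n \<alpha> = (a, b)" by fastforce
 have d: "dpf n a b m (restr n F) = restr n (dpf n a b m F)" for m
  using root_pair_bounds[OF \<alpha> ab] by (simp add: dpf_restr)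
 show ?thesis
  by (intro ext) (simp add: xact_def ab d restr_def del: One_nat_def)
qed

lemma xact_ent: "xact n \<alpha> t (ent A) = ent (xop n \<alpha> t*A*xop n \<alpha> t)"
proof -
 obtain a b where ab: "root_pair n \<alpha> = (a, b)" by fastforce
 let ?s = "rsp n \<alpha> :: 'f fock_op"
 have "xop n \<alpha> t*A*xop n \<alpha> t = A + scal t*(?s*A + A*?s) + scal t*(scal t*(?s*A*?s))"
  by (rule xop_conj)
 also have "?s*A + A*?s = dpop ?s 1 A" by (simp add: dpop_def ad_def op_diff_eq_add)
 also have "?s*A*?s = dpop ?s 2 A" by (simp add: dpop_def)
 finally have e: "xop n \<alpha> t*A*xop n \<alpha> t = A + scal t*dpop ?s 1 A + scal t*(scal t*dpop ?s 2 A)" .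
 show ?thesis
  unfolding e by (intro ext) (simp add: xact_def ab ent_add ent_scal ent_dpop[OF ab, symmetric] power2_eq_square mult.assoc)
qed

lemma xact_ctup:
 assumes "\<alpha> : roots n" "set vs <= cvec n"
 shows "xact n \<alpha> t (ctup n vs) = ctup n (map (%v. root_elem n \<alpha> t *\<^sub>v v) vs)"
 unfolding ctup_def xact_restr[OF assms(1)] xact_ent xop_cprod[OF assms] ..

end

context char2
begin

subsection \<open>Tuples of singular vectors\<close>

inductive_set tups :: "nat => nat => 'f vec list set" for n k where
 tups_base: "map (uv n) [0..<k] : tups n k"
| tups_step: "vs : tups n k ==> \<alpha> : roots n ==> map (%v. root_elem n \<alpha> 1 *\<^sub>v v) vs : tups n k"

lemma tups_carrier: "vs : tups n k ==> set vs <= cvec n & length vs = k"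
proof (induct rule: tups.induct)
 case (tups_step vs \<alpha>)
 then show ?case using mult_mat_vec_carrier[OF root_elem_carrier(1)[of n \<alpha> 1]] by auto
qed auto

definition avoids :: "nat => nat set => 'f vec => bool" where
 "avoids n Z v \<longleftrightarrow> v : cvec n & (\<forall>z\<in>Z. v $ z = 0 & v $ (n + z) = 0)"

lemma avoids_fixed:
 fixes v :: "'f vec"
 assumes "\<alpha> : roots n" "root_pair n \<alpha> = (a, b)" "a = 2*n \<or> v $ du n a = 0" "b = 2*n \<or> v $ du n b = 0"
  "v : cvec n"
 shows "root_elem n \<alpha> 1 *\<^sub>v v = v"
proof -
 have "bcov n a v = 0" "bcov n b v = 0" using assms bcov_last[of n v] by (auto simp: bcov_def)
 then show ?thesis unfolding root_elem_vec[OF assms(1,2,5)] using assms(5) by (auto simp: bcov_last intro!: eq_vecI)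
qed

lemma map_fixed: "(!!v. v : set vs ==> f v = v) ==> map f vs = vs"
 by (induct vs) auto

lemma step_Diff:
 assumes "i < n" "j < n" "i ~= j" "l < n"
 shows "root_elem n (Diff i j) 1 *\<^sub>v uv n l = (if l = j then uv n j + uv n i else uv n l)"
proof -
 have r: "Diff i j : roots n" "root_pair n (Diff i j) = (i, n + j)" using assms by (auto simp: roots_def)
 show ?thesis
  unfolding root_elem_vec[OF r unit_vec_carrier] using assms
  by (auto simp: bcov_def du_def bw_def intro!: eq_vecI)
qed

text \<open>Three transvections compose to the transposition of two basis vectors, without a sign in
  characteristic 2.\<close>

lemma tups_swap:
 assumes "map (uv n) us : tups n k" "set us <= {..<n}" "i < n" "j < n" "i ~= j"
 shows "map (uv n) (map (%l. if l = i then j else if l = j then i else l) us) : tups n k"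
proof -
 let ?D = "%i j v. root_elem n (Diff i j) 1 *\<^sub>v v"
 have r: "Diff i j : roots n" "Diff j i : roots n" using assms by (auto simp: roots_def)
 have "map (?D i j) (map (?D j i) (map (?D i j) (map (uv n) us))) : tups n k"
  using assms r by (intro tups_step)
 moreover have "?D i j (?D j i (?D i j (uv n l))) = uv n (if l = i then j else if l = j then i else l)" if "l < n" for l
 proof -
  have c: "root_elem n \<alpha> 1 *\<^sub>v (x + y) = root_elem n \<alpha> 1 *\<^sub>v x + root_elem n \<alpha> 1 *\<^sub>v (y :: 'f vec)"
   if "x : cvec n" "y : cvec n" for \<alpha> x y
   using that by (intro mult_add_distrib_mat_vec[OF root_elem_carrier(1)])
  have z: "x + y + x = y" "x + (y + x) = y" "x + (x + y) = y" if "x : cvec n" "y : cvec n" for x y :: "'f vec"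
   using that by (auto intro!: eq_vecI simp: two_zero)
  consider "l = i" | "l = j" | "l ~= i" "l ~= j" by blast
  then show ?thesis
  proof cases
   case 1
   have "?D i j (uv n i) = uv n i" "?D j i (uv n i) = uv n i + uv n j" "?D i j (uv n i + uv n j) = uv n i + (uv n j + uv n i)"
    using assms by (simp_all add: step_Diff[simplified] c[simplified])
   then show ?thesis using 1 z(2)[of "uv n i" "uv n j"] by simp
  next
   case 2
   have "?D i j (uv n j) = uv n j + uv n i" "?D j i (uv n j + uv n i) = uv n j + (uv n i + uv n j)" "?D i j (uv n i) = uv n i"
    using assms by (simp_all add: step_Diff[simplified] c[simplified])
   then show ?thesis using 2 z(2)[of "uv n j" "uv n i"] assms by simp
  next
   case 3
   then show ?thesis using assms that by (simp add: step_Diff[simplified])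
  qed
 qed
 ultimately show ?thesis using assms(2) by (simp add: comp_def subset_iff cong: map_cong)
qed

text \<open>The positions are corrected from left to right by transpositions; distinctness leaves
  those already correct untouched.\<close>

lemma tups_units:
 assumes "distinct us" "length us = k" "set us <= {..<n}"
 shows "map (uv n) us : tups n k"
proof -
 have kn: "k \<le> n" using assms card_mono[of "{..<n}" "set us"] distinct_card[of us] by simp
 have "m \<le> k ==> \<exists>ws. distinct ws & length ws = k & set ws <= {..<n} & take m ws = take m us & map (uv n) ws : tups n k" for m
 proof (induct m)
  case 0
  then show ?case using tups_base[of n k] kn by (intro exI[of _ "[0..<k]"]) auto
 next
  case (Suc m)
  then obtain ws where ws: "distinct ws" "length ws = k" "set ws <= {..<n}" "take m ws = take m us" "map (uv n) ws : tups n k"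
   by auto
  let ?i = "ws ! m" and ?j = "us ! m"
  have m: "m < k" using Suc by simp
  have ij: "?i < n" "?j < n" using nth_mem[of m ws] nth_mem[of m us] subsetD[OF ws(3)] subsetD[OF assms(3)] ws(2) assms(2) m by auto
  show ?case
  proof (cases "?i = ?j")
   case True
   then have "take (Suc m) ws = take (Suc m) us" using ws assms m by (simp add: take_Suc_conv_app_nth)
   then show ?thesis using ws by blast
  next
   case False
   let ?sw = "%l. if l = ?i then ?j else if l = ?j then ?i else l"
   have inj: "inj_on ?sw A" for A by (auto simp: inj_on_def split: if_splits)
   have "?sw l = l" if l: "l : set (take m ws)" for l
   proof -
    obtain q where q: "q < m" "l = ws ! q" using l m ws(2) by (auto simp: in_set_conv_nth)
    have "l = us ! q" using q ws(2,4) assms(2) m by (metis nth_take)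
    have "l ~= ?i" using q ws(1,2) m by (simp add: nth_eq_iff_index_eq)
    moreover have "l ~= ?j" using \<open>l = us ! q\<close> q assms(1,2) m by (simp add: nth_eq_iff_index_eq)
    ultimately show ?thesis by simp
   qed
   then have "take m (map ?sw ws) = take m us" using ws(4) map_fixed[of "take m ws" ?sw] by (simp add: take_map)
   then have "take (Suc m) (map ?sw ws) = take (Suc m) us"
    using ws(2) assms(2) m by (simp add: take_Suc_conv_app_nth)
   moreover have "map (uv n) (map ?sw ws) : tups n k" using ws ij False by (intro tups_swap) auto
   moreover have "set (map ?sw ws) <= {..<n}" using ws(3) ij by auto
   moreover have "distinct (map ?sw ws)" using ws(1) inj by (simp add: distinct_map)
   ultimately show ?thesis using ws(2) by (intro exI[of _ "map ?sw ws"]) auto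
  qed
 qed
 from this[of k] assms show ?thesis by auto
qed

end

section \<open>Blocks of singular vectors and their expansions\<close>

datatype blk = Pos nat | Neg nat | Arc nat nat | Fil nat

primrec bsites :: "blk => nat list" where
 "bsites (Pos x) = [x]"
| "bsites (Neg y) = [y]"
| "bsites (Arc a b) = [a, b]"
| "bsites (Fil z) = [z]"

text \<open>Each block lists tuples of singular vectors whose products have a simple sum modulo 2.
  For \<open>Fil\<close> the sum is the last basis vector; for \<open>Arc\<close> the terms e_a e_b
  and e_{n+b} e_{n+a} cancel, and e_a e_{n+a} + e_{n+b} e_b remains.\<close>

primrec bopts :: "nat => blk => 'f::field vec list list" where
 "bopts n (Pos x) = [[unit_vec (2*n+1) x]]"
| "bopts n (Neg y) = [[unit_vec (2*n+1) (n + y)]]"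
| "bopts n (Arc a b) =
   [[unit_vec (2*n+1) a + unit_vec (2*n+1) (n + b), unit_vec (2*n+1) b + unit_vec (2*n+1) (n + a)],
   [unit_vec (2*n+1) a, unit_vec (2*n+1) b],
   [unit_vec (2*n+1) (n + a), unit_vec (2*n+1) (n + b)]]"
| "bopts n (Fil z) =
   [[unit_vec (2*n+1) z + unit_vec (2*n+1) (2*n) + unit_vec (2*n+1) (n + z)],
   [unit_vec (2*n+1) z], [unit_vec (2*n+1) (n + z)]]"

primrec choices :: "nat => blk list => 'f::field vec list list" where
 "choices n [] = [[]]"
| "choices n (b # bs) = concat (map (%o'. map ((@) o') (choices n bs)) (bopts n b))"

text \<open>Distributivity in a noncommutative ring; concatenation keeps the order of the
  blocks.\<close>

lemma sum_choices:
 fixes h :: "'f::field vec => 'r::ring_1"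
 shows "(\<Sum>c\<leftarrow>choices n bs. prod_list (map h c)) = (\<Prod>b\<leftarrow>bs. \<Sum>c\<leftarrow>bopts n b. prod_list (map h c))"
proof (induct bs)
 case (Cons b bs)
 have "(\<Sum>c\<leftarrow>concat (map (%o'. map ((@) o') (choices n bs)) os). prod_list (map h c))
   = (\<Sum>c\<leftarrow>os. prod_list (map h c))*(\<Sum>c\<leftarrow>choices n bs. prod_list (map h c))" for os
  by (induct os) (simp_all add: comp_def sum_list_const_mult distrib_right)
 then show ?case using Cons by simp
qed simp

lemma length_choices:
 fixes c :: "'f::field vec list"
 shows "c : set (choices n bs) ==> length c = length (concat (map bsites bs))"
proof (induct bs arbitrary: c)
 case (Cons b bs)
 have "length o' = length (bsites b)" if "o' : set (bopts n b)" for o' :: "'f vec list" using that by (cases b) auto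
 then show ?case using Cons by auto
qed simp

context char2
begin

lemma opts_avoid:
 assumes "c : set (bopts n b)" "v : set c" "Z \<inter> set (bsites b) = {}" "Z <= {..<n}" "set (bsites b) <= {..<n}"
 shows "avoids n Z (v :: 'f vec)"
proof -
 have "v $ z = 0 & v $ (n + z) = 0" if "z : Z" for z
 proof -
  have "z < n" using that assms by auto
  then show ?thesis using assms that by (cases b) (auto simp: index_add_vec(1))
 qed
 moreover have "v : cvec n" using assms by (cases b) auto
 ultimately show ?thesis by (simp add: avoids_def)
qed

lemma avoids_mono: "avoids n Z v ==> Z' <= Z ==> avoids n Z' v"
 by (auto simp: avoids_def)

lemma avoids_unit: "i < n ==> i ~: Z ==> Z <= {..<n} ==> avoids n Z (uv n i)"
proof -
 assume a: "i < n" "i ~: Z" "Z <= {..<n}"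
 have "uv n i $ z = 0 & uv n i $ (n + z) = 0" if "z : Z" for z
 proof -
  have "z < n" "z ~= i" using that a by auto
  then show ?thesis using a(1) by simp
 qed
 then show ?thesis by (simp add: avoids_def)
qed

lemma tups_act:
 assumes "us @ xs @ ws : tups n k" "\<alpha> : roots n" "!!v. v : set us \<union> set ws ==> root_elem n \<alpha> 1 *\<^sub>v v = v"
  "map (%v. root_elem n \<alpha> 1 *\<^sub>v v) xs = ys"
 shows "us @ ys @ ws : tups n k"
 using tups_step[OF assms(1,2)] assms(3,4) map_fixed[of us "%v. root_elem n \<alpha> 1 *\<^sub>v v"] map_fixed[of ws "%v. root_elem n \<alpha> 1 *\<^sub>v v"]
 by simp

lemma step_NegShort:
 assumes "z < n"
 shows "root_elem n (NegShort z) 1 *\<^sub>v uv n z = uv n z + uv n (2*n) + uv n (n + z)"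
proof -
 have r: "NegShort z : roots n" "root_pair n (NegShort z) = (2*n, n + z)" using assms by (auto simp: roots_def)
 show ?thesis
  unfolding root_elem_vec[OF r unit_vec_carrier] using assms
  by (auto simp: bcov_def du_def bw_def two_zero intro!: eq_vecI)
qed

lemma step_Short:
 assumes "z < n"
 shows "root_elem n (Short z) 1 *\<^sub>v (uv n z + uv n (2*n) + uv n (n + z)) = uv n (n + z)"
proof -
 have r: "Short z : roots n" "root_pair n (Short z) = (z, 2*n)" using assms by (auto simp: roots_def)
 have c: "uv n z + uv n (2*n) + uv n (n + z) : cvec n" by simp
 show ?thesis
  unfolding root_elem_vec[OF r c] using assms
  by (auto simp: bcov_def du_def bw_def two_zero intro!: eq_vecI)
qed

definition minus_root :: "nat => nat => broot" where
 "minus_root a b = (if a < b then Minus a b else Minus b a)"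

lemma step_Minus:
 assumes "a < n" "b < n" "a ~= b"
 shows "minus_root a b : roots n" "root_elem n (minus_root a b) 1 *\<^sub>v uv n a = uv n a + uv n (n + b)"
  "root_elem n (minus_root a b) 1 *\<^sub>v uv n b = uv n b + uv n (n + a)"
  "v : cvec n ==> v $ a = 0 ==> v $ b = 0 ==> root_elem n (minus_root a b) 1 *\<^sub>v v = (v :: 'f vec)"
proof -
 show r: "minus_root a b : roots n" using assms by (auto simp: roots_def minus_root_def)
 have rp: "root_pair n (minus_root a b) = (if a < b then (n + b, n + a) else (n + a, n + b))" by (simp add: minus_root_def)
 have v: "root_elem n (minus_root a b) 1 *\<^sub>v v = v + v $ a \<cdot>\<^sub>v uv n (n + b) + v $ b \<cdot>\<^sub>v uv n (n + a)" if "v : cvec n" for v :: "'f vec"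
 proof (cases "a < b")
  case True
  then have rp': "root_pair n (minus_root a b) = (n + b, n + a)" using rp by simp
  show ?thesis unfolding root_elem_vec[OF r rp' that] using assms that
   by (auto simp: bcov_def du_def bw_def intro!: eq_vecI)
 next
  case False
  then have rp': "root_pair n (minus_root a b) = (n + a, n + b)" using rp by simp
  show ?thesis unfolding root_elem_vec[OF r rp' that] using assms that
   by (auto simp: bcov_def du_def bw_def intro!: eq_vecI)
 qed
 show "root_elem n (minus_root a b) 1 *\<^sub>v uv n a = uv n a + uv n (n + b)"
  "root_elem n (minus_root a b) 1 *\<^sub>v uv n b = uv n b + uv n (n + a)"
  unfolding v[OF unit_vec_carrier] using assms by (auto intro!: eq_vecI)
 show "v : cvec n ==> v $ a = 0 ==> v $ b = 0 ==> root_elem n (minus_root a b) 1 *\<^sub>v v = (v :: 'f vec)"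
  by (subst v) (auto intro!: eq_vecI)
qed

text \<open>The two opposite short root elements move e_z first to e_z + e_{2n+1} + e_{n+z} and then
  to e_{n+z}, fixing every vector that avoids the site.\<close>

lemma tups_short:
 assumes "us @ [uv n z] @ ws : tups n k" "!!v. v : set us \<union> set ws ==> avoids n {z} v" "z < n"
 shows "us @ [uv n z + uv n (2*n) + uv n (n + z)] @ ws : tups n k" "us @ [uv n (n + z)] @ ws : tups n k"
proof -
 have r: "NegShort z : roots n" "Short z : roots n" using assms by (auto simp: roots_def)
 have du: "du n z = n + z" "du n (n + z) = z" using assms by (auto simp: du_def)
 have f1: "root_elem n (NegShort z) 1 *\<^sub>v v = v" "root_elem n (Short z) 1 *\<^sub>v v = v" if "v : set us \<union> set ws" for v
  using assms(2)[OF that] du avoids_fixed[OF r(1), of "2*n" "n + z" v] avoids_fixed[OF r(2), of z "2*n" v] by (auto simp: avoids_def)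
 show 1: "us @ [uv n z + uv n (2*n) + uv n (n + z)] @ ws : tups n k"
  by (rule tups_act[OF assms(1) r(1)]) (use f1 step_NegShort[OF assms(3)] in auto)
 show "us @ [uv n (n + z)] @ ws : tups n k"
  by (rule tups_act[OF 1 r(2)]) (use f1 step_Short[OF assms(3)] in auto)
qed

lemma tups_block:
 assumes "us @ map (uv n) (bsites b) @ ws : tups n k" "!!v. v : set us \<union> set ws ==> avoids n (set (bsites b)) v"
  "set (bsites b) <= {..<n}" "distinct (bsites b)" "c : set (bopts n b)"
 shows "us @ c @ ws : tups n k"
proof (cases b)
 case (Pos x)
 then show ?thesis using assms by simp
next
 case (Neg y)
 then show ?thesis using assms tups_short(2)[of us n y ws k] by simp
next
 case (Fil z)
 then show ?thesis using assms tups_short[of us n z ws k] by auto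
next
 case (Arc i j)
 then have ij: "i < n" "j < n" "i ~= j" and base: "us @ [uv n i, uv n j] @ ws : tups n k" using assms by auto
 have av: "avoids n {i, j} v" if "v : set us \<union> set ws" for v using assms(2)[OF that] Arc by simp
 have av': "avoids n {i} v" "avoids n {j} v" if "v : set us \<union> set ws" for v
  using avoids_mono[OF av[OF that]] by auto
 have 1: "us @ [uv n i + uv n (n + j), uv n j + uv n (n + i)] @ ws : tups n k"
 proof (rule tups_act[OF base step_Minus(1)[OF ij]])
  show "root_elem n (minus_root i j) 1 *\<^sub>v v = v" if "v : set us \<union> set ws" for v
   using av[OF that] by (intro step_Minus(4)[OF ij]) (auto simp: avoids_def)
  show "map ((*\<^sub>v) (root_elem n (minus_root i j) 1)) [uv n i, uv n j] = [uv n i + uv n (n + j), uv n j + uv n (n + i)]"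
   by (simp only: list.map step_Minus(2,3)[OF ij])
 qed
 have "us @ [uv n (n + i)] @ uv n j # ws : tups n k"
  by (rule tups_short(2)) (use base av'(1) ij in \<open>auto simp: avoids_def\<close>)
 then have "(us @ [uv n (n + i)]) @ [uv n (n + j)] @ ws : tups n k"
  using av'(2) ij by - (rule tups_short(2)[where z = j], auto simp: avoids_def)
 then show ?thesis using 1 base assms(5) Arc by auto
qed

text \<open>Blocks are processed from the left. The finished part \<open>us\<close> and the tail
  \<open>ws\<close> avoid the sites of all remaining blocks, so later steps do not disturb
  them.\<close>

lemma tups_choices_aux:
 assumes "us @ map (uv n) (concat (map bsites bs)) @ ws : tups n k"
  "!!v. v : set us \<union> set ws ==> avoids n (set (concat (map bsites bs))) v"
  "set (concat (map bsites bs)) <= {..<n}" "distinct (concat (map bsites bs))" "c : set (choices n bs)"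
 shows "us @ c @ ws : tups n k"
 using assms
proof (induct bs arbitrary: us c)
 case (Cons b bs)
 obtain c1 c2 where c: "c = c1 @ c2" "c1 : set (bopts n b)" "c2 : set (choices n bs)" using Cons.prems(5) by auto
 let ?r = "concat (map bsites bs)"
 have d: "set (bsites b) \<inter> set ?r = {}" "distinct (bsites b)" "distinct ?r" "set (bsites b) <= {..<n}" "set ?r <= {..<n}"
  using Cons.prems(3,4) by auto
 have "us @ c1 @ (map (uv n) ?r @ ws) : tups n k"
 proof (rule tups_block[OF _ _ d(4,2) c(2)])
  show "us @ map (uv n) (bsites b) @ map (uv n) ?r @ ws : tups n k" using Cons.prems(1) by simp
  fix v assume "v : set us \<union> set (map (uv n) ?r @ ws)"
  then have "v : set us \<union> set ws \<or> v : uv n ` set ?r" by (simp only: set_append set_map) blast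
  then show "avoids n (set (bsites b)) v"
  proof
   assume "v : set us \<union> set ws"
   then show ?thesis by (rule avoids_mono[OF Cons.prems(2)]) simp
  next
   assume "v : uv n ` set ?r"
   then obtain i where i: "i : set ?r" "v = uv n i" by (rule imageE)
   then have "i < n" "i ~: set (bsites b)" using d(1,5) by blast+
   then show ?thesis unfolding i(2) using d(4) by (rule avoids_unit)
  qed
 qed
 then have "(us @ c1) @ map (uv n) ?r @ ws : tups n k" by simp
 then have "(us @ c1) @ c2 @ ws : tups n k"
 proof (rule Cons.hyps[OF _ _ d(5,3) c(3)])
  fix v assume "v : set (us @ c1) \<union> set ws"
  then have "v : set us \<union> set ws \<or> v : set c1" by (simp only: set_append) blast
  then show "avoids n (set ?r) v"
  proof
   assume "v : set us \<union> set ws"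
   then show ?thesis by (rule avoids_mono[OF Cons.prems(2)]) simp
  next
   assume "v : set c1"
   then show ?thesis by (rule opts_avoid[OF c(2)]) (use d in blast)+
  qed
 qed
 then show ?case using c by simp
qed simp

lemma tups_choices:
 assumes "set (concat (map bsites bs)) <= {..<n}" "distinct (concat (map bsites bs))" "length (concat (map bsites bs)) = k"
  "c : set (choices n bs)"
 shows "c : tups n k"
 using tups_choices_aux[of "[]" n bs "[]" k c] tups_units[OF assms(2,3,1)] assms by simp

subsection \<open>Block sums\<close>

definition bval :: "nat => (nat => 'f fock_op) => blk => 'f fock_op" where
 "bval n g b = (case b of Pos x => g x | Neg y => g (n + y) | Arc a b => g a*g (n + a) + g (n + b)*g b | Fil z => g (2*n))"

lemma op_add_self_left [simp]: "A + (A + B) = (B :: 'f fock_op)"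
 by (metis add.assoc add.left_neutral op_add_self)

text \<open>A single commutation rule of \<open>g\<close> suffices, so that the computation serves
  the Clifford algebra and the exterior algebra alike.\<close>

lemma bopts_sum:
 assumes "set (bsites b) <= {..<n}" "!!i j. i < n ==> j < n ==> i ~= j ==> g (n + i)*g (n + j) = g (n + j)*g (n + i)"
  "distinct (bsites b)"
 shows "(\<Sum>c\<leftarrow>bopts n b. prod_list (map (lc n g) c)) = bval n g b"
proof (cases b)
 case (Arc i j)
 then have ij: "i < n" "j < n" "i ~= j" using assms by auto
 have l: "lc n g (uv n i) = g i" "lc n g (uv n j) = g j" "lc n g (uv n (n + i)) = g (n + i)" "lc n g (uv n (n + j)) = g (n + j)"
  by (rule lc_unit, use ij in simp)+
 have a: "lc n g (uv n i + uv n (n + j)) = g i + g (n + j)" "lc n g (uv n j + uv n (n + i)) = g j + g (n + i)"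
  by (simp_all only: lc_add unit_vec_carrier l)
 have "(g i + g (n + j))*(g j + g (n + i)) + (g i*g j + g (n + i)*g (n + j))
   = g i*g j + g (n + j)*g j + (g i*g (n + i) + g (n + j)*g (n + i)) + (g i*g j + g (n + j)*g (n + i))"
  by (simp only: distrib_left distrib_right assms(2)[OF ij])
 also have "... = g i*g (n + i) + g (n + j)*g j"
  by (simp add: add_ac)
 finally have "(g i + g (n + j))*(g j + g (n + i)) + (g i*g j + g (n + i)*g (n + j)) = g i*g (n + i) + g (n + j)*g j" .
 then show ?thesis using Arc by (simp add: l[simplified] a[simplified] bval_def)
next
 case (Fil z)
 have "lc n g (uv n z + uv n (2*n) + uv n (n + z)) = lc n g (uv n z) + lc n g (uv n (2*n)) + lc n g (uv n (n + z))"
  by (simp only: lc_add unit_vec_carrier add_carrier_vec)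
 moreover have "lc n g (uv n (2*n)) = g (2*n)" by (rule lc_unit) simp
 ultimately show ?thesis using Fil by (simp add: bval_def add_ac)
next
 case (Pos x)
 then show ?thesis using assms lc_unit[of x n g] by (simp add: bval_def)
next
 case (Neg y)
 then show ?thesis using assms lc_unit[of "n + y" n g] by (simp add: bval_def)
qed

lemma choices_sum:
 assumes "set (concat (map bsites bs)) <= {..<n}" "distinct (concat (map bsites bs))"
  "!!i j. i < n ==> j < n ==> i ~= j ==> g (n + i)*g (n + j) = g (n + j)*g (n + i)"
 shows "(\<Sum>c\<leftarrow>choices n bs. prod_list (map (lc n g) c)) = (\<Prod>b\<leftarrow>bs. bval n g b)"
 unfolding sum_choices using assms(1,2)
proof (induct bs)
 case (Cons b bs)
 have "(\<Sum>c\<leftarrow>bopts n b. prod_list (map (lc n g) c)) = bval n g b"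
  by (rule bopts_sum[where g = g and n = n, OF _ assms(3)]) (use Cons.prems in auto)
 moreover have "(\<Prod>b\<leftarrow>bs. \<Sum>c\<leftarrow>bopts n b. prod_list (map (lc n g) c)) = (\<Prod>b\<leftarrow>bs. bval n g b)"
  by (rule Cons.hyps) (use Cons.prems in auto)
 ultimately show ?case by (simp only: list.map prod_list.Cons)
qed simp

lemma cre_comm2: "cre i*cre j = (cre j*cre i :: 'f fock_op)"
 using cre_cre[of i j, where 'a='f] by (simp add: add_eq_0_iff2)

lemma gen_comm_high: "i < n ==> j < n ==> gen n (n + i)*gen n (n + j) = (gen n (n + j)*gen n (n + i) :: 'f fock_op)"
 using gen_anticomm[of "n + i" n "n + j", where 'a='f] by (simp add: bm_def add_eq_0_iff2)

lemma sgn_below_one [simp]: "sgn_below i S = (1 :: 'f)"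
 by (simp add: sgn_below_def)

text \<open>The signs in the parity operator disappear. Fillers therefore do not change a matrix,
  which makes the modules for different \<open>k\<close> comparable.\<close>

lemma gen_last: "gen n (2*n) = (1 :: 'f fock_op)"
 unfolding gen_def by simp (transfer, simp)

end

section \<open>The standard basis\<close>

text \<open>A smaller bound selects, from one and the same set, the matchings with few pairs. This
  makes the index set for \<open>k - 2\<close> a part of that for \<open>k\<close>.\<close>

lemma stdm_filter: "m' \<le> m ==> stdm xs m' = {Q : stdm xs m. length Q \<le> m'}"
proof (induct xs arbitrary: m m')
 case (Cons x xs)
 let ?h = "length xs div 2"
 have le: "min m' ?h \<le> min m ?h" using Cons.prems by auto
 have len: "length Q \<le> min m ?h" if "Q : stdm xs (min m ?h)" for Q
  using Cons.hyps[of "min m ?h" "min m ?h"] that by blast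
 have 1: "stdm xs (min m' ?h) = {Q : stdm xs (min m ?h). length Q \<le> m'}"
  unfolding Cons.hyps[OF le] using len by fastforce
 have 2: "stdm xs (m' - 1) = {Q : stdm xs (m - 1). length Q \<le> m' - 1}"
  by (rule Cons.hyps) (use Cons.prems in simp)
 let ?F = "%Q. (x, first_free xs Q) # Q"
 show ?case
 proof (cases "m' = 0")
  case True
  have "stdm xs (min m' ?h) = {[]}" using True stdm_0[of xs] by simp
  then have "[] : {Q : stdm xs (min m ?h). length Q \<le> m'}" unfolding 1[symmetric] by simp
  then have "[] : stdm (x # xs) m" by simp
  then show ?thesis using True stdm_0[of "x # xs"] by (simp del: stdm.simps) blast
 next
  case False
  have "{Q : ?F ` stdm xs (m - 1). length Q \<le> m'} = ?F ` {Q : stdm xs (m - 1). length Q \<le> m' - 1}"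
   using False by auto
  note im = this[folded 2]
  have m: "m ~= 0" using False Cons.prems by simp
  have a: "stdm (x # xs) m' = stdm xs (min m' ?h) \<union> ?F ` stdm xs (m' - 1)"
   "stdm (x # xs) m = stdm xs (min m ?h) \<union> ?F ` stdm xs (m - 1)"
   using False m by (simp_all only: stdm.simps if_False)
  show ?thesis unfolding a 1 im[symmetric] by blast
 qed
qed auto

definition free_sites :: "nat => nat set \<times> nat set => nat list" where
 "free_sites n p = sorted_list_of_set ({..<n} - fst p - snd p)"

definition disjoint_pairs :: "nat => nat => (nat set \<times> nat set) set" where
 "disjoint_pairs n k = {p. fst p <= {..<n} & snd p <= {..<n} & fst p \<inter> snd p = {} & card (fst p) + card (snd p) \<le> k}"

type_synonym bindex = "(nat set \<times> nat set) \<times> (nat \<times> nat) list"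

definition bindices :: "nat => nat => bindex set" where
 "bindices n k = (SIGMA p:disjoint_pairs n k. stdm (free_sites n p) ((k - card (fst p) - card (snd p)) div 2))"

definition bsize :: "bindex => nat" where
 "bsize i = card (fst (fst i)) + card (snd (fst i)) + 2*length (snd i)"

lemma finite_disjoint_pairs: "finite (disjoint_pairs n k)"
 by (rule finite_subset[of _ "Pow {..<n} \<times> Pow {..<n}"]) (auto simp: disjoint_pairs_def)

lemma finite_bindices [simp]: "finite (bindices n k)"
 by (auto simp: bindices_def finite_disjoint_pairs finite_stdm)

lemma set_free_sites: "set (free_sites n p) = {..<n} - fst p - snd p"
 and distinct_free_sites: "distinct (free_sites n p)"
 by (simp_all add: free_sites_def)

lemma length_free_sites:
 assumes "p : disjoint_pairs n k"
 shows "length (free_sites n p) = n - card (fst p) - card (snd p)"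
proof -
 have p: "fst p <= {..<n}" "snd p <= {..<n} - fst p" using assms by (auto simp: disjoint_pairs_def)
 then have "finite (fst p)" "finite (snd p)" using finite_subset by (blast, meson finite_Diff finite_lessThan finite_subset)
 then show ?thesis using p by (simp add: free_sites_def card_Diff_subset)
qed

lemma bindices_sub:
 assumes k: "k' \<le> k"
 shows "bindices n k' = {i : bindices n k. bsize i \<le> k'}"
proof (intro Set.set_eqI iffI)
 fix i assume i: "i : bindices n k'"
 obtain p Q where pq: "i = (p, Q)" by fastforce
 have le: "(k' - card (fst p) - card (snd p)) div 2 \<le> (k - card (fst p) - card (snd p)) div 2" using k by (intro div_le_mono) simp
 have "p : disjoint_pairs n k'" "Q : stdm (free_sites n p) ((k' - card (fst p) - card (snd p)) div 2)" using i pq by (auto simp: bindices_def)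
 then show "i : {i : bindices n k. bsize i \<le> k'}"
  unfolding stdm_filter[OF le] using k by (auto simp: bindices_def bsize_def pq disjoint_pairs_def)
next
 fix i assume i: "i : {i : bindices n k. bsize i \<le> k'}"
 obtain p Q where pq: "i = (p, Q)" by fastforce
 have le: "(k' - card (fst p) - card (snd p)) div 2 \<le> (k - card (fst p) - card (snd p)) div 2" using k by (intro div_le_mono) simp
 have s: "card (fst p) + card (snd p) + 2*length Q \<le> k'" using i pq by (simp add: bsize_def)
 then have "length Q \<le> (k' - card (fst p) - card (snd p)) div 2" by simp
 then have "Q : stdm (free_sites n p) ((k' - card (fst p) - card (snd p)) div 2)"
  unfolding stdm_filter[OF le] using i by (simp add: bindices_def pq)
 then show "i : bindices n k'"
  using i s by (auto simp: bindices_def pq disjoint_pairs_def)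
qed

lemma bindices_props:
 assumes "k \<le> n" "((X, Y), Q) : bindices n k"
 shows "X <= {..<n}" "Y <= {..<n}" "X \<inter> Y = {}" "matching Q" "sites Q <= {..<n} - X - Y" "card X + card Y + 2*length Q \<le> k"
  "Q : stdm (free_sites n (X, Y)) ((k - card X - card Y) div 2)" "2*((k - card X - card Y) div 2) \<le> length (free_sites n (X, Y))"
  "(X, Y) : disjoint_pairs n k"
proof -
 show p: "(X, Y) : disjoint_pairs n k" and Q: "Q : stdm (free_sites n (X, Y)) ((k - card X - card Y) div 2)"
  using assms(2) by (auto simp: bindices_def)
 show "X <= {..<n}" "Y <= {..<n}" "X \<inter> Y = {}" using p by (auto simp: disjoint_pairs_def)
 have "k - card X - card Y \<le> n - card X - card Y" using assms(1) by simp
 then show l: "2*((k - card X - card Y) div 2) \<le> length (free_sites n (X, Y))" using length_free_sites[OF p] by simp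
 note m = stdm_matching[OF distinct_free_sites l Q]
 show "matching Q" "sites Q <= {..<n} - X - Y" using m by (auto simp: set_free_sites)
 have "length Q \<le> (k - card X - card Y) div 2" "card X + card Y \<le> k" using m p by (auto simp: disjoint_pairs_def)
 then show "card X + card Y + 2*length Q \<le> k" by presburger
qed

lemma site_cases: "(x::nat) < 2*n+1 ==> x < n \<or> (\<exists>y<n. x = n + y) \<or> x = 2*n"
 by presburger

section \<open>Counting indices against subsets\<close>

definition lows :: "nat => nat set => nat set" where
 "lows n S = {x. x < n & x : S & n + x ~: S}"

definition highs :: "nat => nat set => nat set" where
 "highs n S = {x. x < n & x ~: S & n + x : S}"

definition boths :: "nat => nat set => nat set" where
 "boths n S = {x. x < n & x : S & n + x : S}"

lemma finite_lows [simp]: "finite (lows n S)" "finite (highs n S)" "finite (boths n S)"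
 by (auto simp: lows_def highs_def boths_def)

lemma card_lows:
 assumes "S <= {..<2*n+1}"
 shows "card S = card (lows n S) + card (highs n S) + 2*card (boths n S) + (if 2*n : S then 1 else 0)"
proof -
 let ?A = "lows n S \<union> boths n S" and ?B = "(+) n ` (highs n S \<union> boths n S)" and ?D = "if 2*n : S then {2*n} else {}"
 have "S = ?A \<union> (?B \<union> ?D)"
 proof (intro Set.set_eqI iffI)
  fix x assume x: "x : S"
  then have "x < 2*n+1" using assms by auto
  from site_cases[OF this] x show "x : ?A \<union> (?B \<union> ?D)" by (auto simp: lows_def highs_def boths_def)
 qed (auto simp: lows_def highs_def boths_def split: if_splits)
 then have "card S = card (?A \<union> (?B \<union> ?D))" by (rule arg_cong)
 also have "... = card ?A + card (?B \<union> ?D)"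
  by (rule card_Un_disjoint) (auto simp: lows_def highs_def boths_def)
 also have "card (?B \<union> ?D) = card ?B + card ?D"
  by (rule card_Un_disjoint) (auto simp: lows_def highs_def boths_def)
 also have "card ?A = card (lows n S) + card (boths n S)"
  by (rule card_Un_disjoint) (auto simp: lows_def boths_def)
 also have "card ?B = card (highs n S \<union> boths n S)" by (rule card_image) simp
 also have "... = card (highs n S) + card (boths n S)"
  by (rule card_Un_disjoint) (auto simp: highs_def boths_def)
 also have "card ?D = (if 2*n : S then 1 else 0)" by simp
 finally show ?thesis by linarith
qed

text \<open>A \<open>k\<close>-subset of the \<open>2*n+1\<close> coordinates is encoded by the
  sites that it meets only below, only above or on both levels; whether it contains the last
  coordinate is then decided by parity. For fixed first two sets, the possible third sets are as
  many as the standard matchings.\<close>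

lemma card_bindices:
 assumes "k \<le> n"
 shows "card (slists n k) \<le> card (bindices n k)"
proof -
 let ?m = "%p. (k - card (fst p) - card (snd p)) div 2"
 let ?T = "SIGMA p:disjoint_pairs n k. {C. C <= set (free_sites n p) & card C = ?m p}"
 let ?S = "{S. S <= {..<2*n+1} & card S = k}"
 let ?f = "%S. ((lows n S, highs n S), boths n S)"
 have cp: "card (stdm (free_sites n p) (?m p)) = card {C. C <= set (free_sites n p) & card C = ?m p}" if "p : disjoint_pairs n k" for p
 proof -
  have "2*?m p \<le> length (free_sites n p)" using length_free_sites[OF that] assms by linarith
  then show ?thesis by (simp add: card_stdm distinct_free_sites n_subsets distinct_card)
 qed
 have "card (bindices n k) = (\<Sum>p\<in>disjoint_pairs n k. card (stdm (free_sites n p) (?m p)))"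
  unfolding bindices_def by (rule card_SigmaI) (auto simp: finite_disjoint_pairs finite_stdm)
 also have "... = (\<Sum>p\<in>disjoint_pairs n k. card {C. C <= set (free_sites n p) & card C = ?m p})"
  by (rule sum.cong[OF refl cp])
 also have "... = card ?T"
  by (rule card_SigmaI[symmetric]) (auto simp: finite_disjoint_pairs)
 finally have cT: "card (bindices n k) = card ?T" .
 have cS: "k = card (lows n S) + card (highs n S) + 2*card (boths n S) + (if 2*n : S then 1 else 0)" if S: "S : ?S" for S
  using card_lows[of S n] S by simp
 have "inj_on ?f ?S"
 proof (intro inj_onI)
  fix S S' assume S: "S : ?S" "S' : ?S" and e: "?f S = ?f S'"
  have "(if 2*n : S then 1 else 0) = (if 2*n : S' then 1 else (0::nat))"
   using cS[OF S(1)] cS[OF S(2)] e by simp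
  then have last: "2*n : S \<longleftrightarrow> 2*n : S'" by (auto split: if_splits)
  have lo: "(x : S \<longleftrightarrow> x : S') & (n + x : S \<longleftrightarrow> n + x : S')" if "x < n" for x
  proof -
   have e': "x : lows n S \<longleftrightarrow> x : lows n S'" "x : highs n S \<longleftrightarrow> x : highs n S'" "x : boths n S \<longleftrightarrow> x : boths n S'"
    using e by simp_all
   then show ?thesis using that by (simp add: lows_def highs_def boths_def) blast
  qed
  show "S = S'"
  proof (intro Set.set_eqI)
   fix x
   show "x : S \<longleftrightarrow> x : S'"
   proof (cases "x < 2*n+1")
    case True
    from site_cases[OF this] lo last show ?thesis by blast
   next
    case False
    then show ?thesis using S by auto
   qed
  qed
 qed
 moreover have "?f ` ?S <= ?T"
 proof (rule image_subsetI)
  fix S assume S: "S : ?S"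
  note k = cS[OF S]
  then have "card (boths n S) = (k - card (lows n S) - card (highs n S)) div 2" by (simp split: if_splits)
  moreover have "(lows n S, highs n S) : disjoint_pairs n k"
   using k by (auto simp: disjoint_pairs_def lows_def highs_def)
  moreover have "boths n S <= set (free_sites n (lows n S, highs n S))"
   by (auto simp: set_free_sites lows_def highs_def boths_def)
  ultimately show "?f S : ?T" by simp
 qed
 moreover have "finite ?T" by (auto simp: finite_disjoint_pairs)
 ultimately have "card ?S \<le> card ?T" by (rule card_inj_on_le)
 then show ?thesis by (simp add: cT card_slists n_subsets)
qed

section \<open>Blocks attached to an index and the resulting matrices\<close>

definition fillers :: "nat => nat => bindex => nat list" where
 "fillers n k i = take (k - bsize i) (sorted_list_of_set ({..<n} - fst (fst i) - snd (fst i) - sites (snd i)))"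

text \<open>Fillers pad the tuple to length \<open>k\<close>. They come first, so that two of them
  stand side by side at the head when vanishing in the exterior power is shown.\<close>

definition blocks :: "nat => nat => bindex => blk list" where
 "blocks n k i = map Fil (fillers n k i) @ map Pos (sorted_list_of_set (fst (fst i))) @
   map Neg (sorted_list_of_set (snd (fst i))) @ map (%(a, b). Arc a b) (snd i)"

lemma concat_arcs: "set (concat (map bsites (map (%(a, b). Arc a b) Q))) = sites Q"
 "length (concat (map bsites (map (%(a, b). Arc a b) Q))) = 2*length Q"
 "matching Q ==> distinct (concat (map bsites (map (%(a, b). Arc a b) Q)))"
proof -
 show 1: "set (concat (map bsites (map (%(a, b). Arc a b) Q))) = sites Q" for Q
  by (induct Q) (auto)
 show "length (concat (map bsites (map (%(a, b). Arc a b) Q))) = 2*length Q"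
  by (induct Q) auto
 show "matching Q ==> distinct (concat (map bsites (map (%(a, b). Arc a b) Q)))"
 proof (induct Q)
  case (Cons q Q)
  obtain a b where q: "q = (a, b)" by fastforce
  then show ?case using Cons 1[of Q] by simp
 qed simp
qed

lemma concat_singles: "(!!x. bsites (f x) = [x]) ==> concat (map bsites (map f xs)) = xs"
 by (induct xs) auto

text \<open>The free sites number \<open>n - bsize i\<close>, which is enough because
  \<open>k \<le> n\<close>.\<close>

lemma fillers_props:
 assumes "k \<le> n" "i : bindices n k"
 shows "length (fillers n k i) = k - bsize i" "distinct (fillers n k i)"
  "set (fillers n k i) <= {..<n} - fst (fst i) - snd (fst i) - sites (snd i)"
proof -
 obtain X Y Q where i: "i = ((X, Y), Q)" by (metis prod.exhaust)
 note p = bindices_props[OF assms(1), of X Y Q] assms(2)[unfolded i]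
 have f: "finite X" "finite Y" using p finite_subset[OF _ finite_lessThan] by auto
 have "card ({..<n} - X - Y - sites Q) = n - card X - card Y - 2*length Q"
  using p f by (subst card_Diff_subset; (simp add: card_Diff_subset card_sites)?) (subst card_Diff_subset; (simp add: card_Diff_subset)?; blast)
 then show "length (fillers n k i) = k - bsize i"
  using p assms(1) by (simp add: fillers_def bsize_def i)
 show "distinct (fillers n k i)" by (simp add: fillers_def)
 show "set (fillers n k i) <= {..<n} - fst (fst i) - snd (fst i) - sites (snd i)"
  unfolding fillers_def by (rule order_trans[OF set_take_subset]) simp
qed

lemma blocks_props:
 assumes "k \<le> n" "i : bindices n k"
 shows "set (concat (map bsites (blocks n k i))) <= {..<n}" "distinct (concat (map bsites (blocks n k i)))"
  "length (concat (map bsites (blocks n k i))) = k"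
proof -
 obtain X Y Q where i: "i = ((X, Y), Q)" by (metis prod.exhaust)
 note p = bindices_props[OF assms(1) assms(2)[unfolded i]]
 note fp = fillers_props[OF assms]
 have f: "finite X" "finite Y" using p(1,2) finite_subset[OF _ finite_lessThan] by auto
 have c: "concat (map bsites (blocks n k i)) = fillers n k i @ sorted_list_of_set X @ sorted_list_of_set Y @
   concat (map bsites (map (%(a, b). Arc a b) Q))"
  unfolding blocks_def i by (simp only: map_append concat_append fst_conv snd_conv concat_singles bsites.simps)
 show "set (concat (map bsites (blocks n k i))) <= {..<n}"
  unfolding c set_append concat_arcs using p(1,2,5) fp(3) f by auto
 show "distinct (concat (map bsites (blocks n k i)))"
  unfolding c distinct_append set_append concat_arcs(1) using p fp(2,3) f concat_arcs(3)[OF p(4)] by (auto simp: i)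
 show "length (concat (map bsites (blocks n k i))) = k"
  unfolding c length_append concat_arcs(2) fp(1) using p(6) f by (simp add: bsize_def i)
qed

text \<open>The matrix over \<open>n\<close> sites of the product of the blocks of \<open>i\<close>.
  It contains no trace of \<open>k\<close>.\<close>

definition betaf :: "nat => bindex => nat set => nat set => 'f::field" where
 "betaf n i T S = (case i of ((X, Y), Q) =>
   of_bool (T <= {..<n} & S <= {..<n} & X <= T & (T - X) \<inter> Y = {} & (T - X) \<union> Y = S)*mev Q S)"

lemma mev_Un: "sites Q \<inter> Y = {} ==> finite Y ==> mev Q (S \<union> Y) = mev Q S"
proof -
 assume "finite Y" "sites Q \<inter> Y = {}"
 then show ?thesis by (induct Y) (auto simp: mev_cong)
qed

text \<open>The sets \<open>X\<close> and \<open>Y\<close> are the two differences of the row and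
  the column of a nonzero entry. Row \<open>X \<union> R\<close> and column
  \<open>R \<union> Y\<close> thus isolate the matchings that belong to one pair of sets, and these
  are independent as functions of \<open>R\<close>.\<close>

lemma betaf_independent:
 assumes "k \<le> n" "!!T S. (\<Sum>i\<in>bindices n k. c i*betaf n i T S) = (0 :: 'f::field)" "i : bindices n k"
 shows "c i = 0"
proof -
 obtain X Y Q where i: "i = ((X, Y), Q)" by (metis prod.exhaust)
 note p = bindices_props[OF assms(1) assms(3)[unfolded i]]
 have f: "finite X" "finite Y" using p(1,2) finite_subset[OF _ finite_lessThan] by auto
 let ?m = "%p. (k - card (fst p) - card (snd p)) div 2"
 have "(\<Sum>Q\<in>stdm (free_sites n (X, Y)) ((k - card X - card Y) div 2). c ((X, Y), Q)*mev Q R) = 0"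
  if R: "R <= set (free_sites n (X, Y))" for R
 proof -
  have R': "R <= {..<n} - X - Y" using R by (simp add: set_free_sites)
  have z: "betaf n (q, Q') (X \<union> R) (R \<union> Y) = (if q = (X, Y) then mev Q' R else (0 :: 'f))"
   if q: "(q, Q') : bindices n k" for q Q'
  proof -
   obtain X' Y' where q': "q = (X', Y')" by fastforce
   note p' = bindices_props[OF assms(1) q[unfolded q']]
   show ?thesis
   proof (cases "q = (X, Y)")
    case True
    then have "X' = X" "Y' = Y" using q' by auto
    moreover have "X \<union> R - X = R" using R' by auto
    moreover have "mev Q' (R \<union> Y) = (mev Q' R :: 'f)" using p'(5) calculation f by (intro mev_Un) auto
    ultimately show ?thesis using True R' p(1,2) by (simp add: betaf_def) blast
   next
    case False
    have "\<not> (X' <= X \<union> R & (X \<union> R - X') \<inter> Y' = {} & (X \<union> R - X') \<union> Y' = R \<union> Y)"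
    proof
     assume a: "X' <= X \<union> R & (X \<union> R - X') \<inter> Y' = {} & (X \<union> R - X') \<union> Y' = R \<union> Y"
     have "X' = X"
     proof (intro Set.set_eqI)
      fix x show "x : X' \<longleftrightarrow> x : X" using a p'(3) p(3) R' by blast
     qed
     moreover have "Y' = Y"
     proof (intro Set.set_eqI)
      fix x show "x : Y' \<longleftrightarrow> x : Y" using a p'(3) p(3) R' by blast
     qed
     ultimately have "q = (X, Y)" using q' by simp
     with False show False by simp
    qed
    then show ?thesis using False by (simp only: betaf_def q' prod.case) simp
   qed
  qed
  have "0 = (\<Sum>i\<in>bindices n k. c i*betaf n i (X \<union> R) (R \<union> Y))" using assms(2) by simp
  also have "... = (\<Sum>(q, Q')\<in>bindices n k. c (q, Q')*(if q = (X, Y) then mev Q' R else 0))"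
   by (intro sum.cong refl) (auto simp: z)
  also have "... = (\<Sum>q\<in>disjoint_pairs n k. \<Sum>Q'\<in>stdm (free_sites n q) (?m q). c (q, Q')*(if q = (X, Y) then mev Q' R else 0))"
   unfolding bindices_def by (rule sum.Sigma[symmetric]) (auto simp: finite_disjoint_pairs finite_stdm)
  also have "... = (\<Sum>q\<in>disjoint_pairs n k. if q = (X, Y) then \<Sum>Q'\<in>stdm (free_sites n q) (?m q). c (q, Q')*mev Q' R else 0)"
   by (intro sum.cong[OF refl]) simp
  also have "... = (\<Sum>Q'\<in>stdm (free_sites n (X, Y)) (?m (X, Y)). c ((X, Y), Q')*mev Q' R)"
   using p(9) by (simp add: finite_disjoint_pairs)
  finally show ?thesis by simp
 qed
 then show ?thesis unfolding i by (rule mev_independent[OF distinct_free_sites p(8) _ p(7)])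
qed

definition pairset :: "nat => nat set => nat set" where
 "pairset n C = C \<union> (+) n ` C"

definition prefix_idx :: "nat => nat => bindex => nat list" where
 "prefix_idx n k i = map (%_. 2*n) (fillers n k i) @ sorted_list_of_set (fst (fst i)) @ map ((+) n) (sorted_list_of_set (snd (fst i)))"

text \<open>The two sets are recovered from a monomial: \<open>pairset\<close> meets its sites on
  both levels, and \<open>D\<close> concerns only the last coordinate.\<close>

lemma lows_highs_union:
 assumes "X <= {..<n}" "Y <= {..<n}" "X \<inter> Y = {}" "C <= {..<n}" "D <= {2*n}"
  "(D \<union> X \<union> (+) n ` Y) \<inter> pairset n C = {}"
 shows "lows n ((D \<union> X \<union> (+) n ` Y) \<union> pairset n C) = X" "highs n ((D \<union> X \<union> (+) n ` Y) \<union> pairset n C) = Y"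
proof -
 let ?Z = "(D \<union> X \<union> (+) n ` Y) \<union> pairset n C"
 have XC: "X \<inter> C = {}" "Y \<inter> C = {}" using assms(6) by (auto simp: pairset_def)
 have lo: "x : ?Z \<longleftrightarrow> x : X \<or> x : C" if "x < n" for x
  using that assms(5) by (auto simp: pairset_def)
 have hi: "n + x : ?Z \<longleftrightarrow> x : Y \<or> x : C" if "x < n" for x
 proof -
  have "n + x ~: X" "n + x ~: C" "n + x ~: D" using assms(1,4,5) that by auto
  then show ?thesis by (auto simp: pairset_def)
 qed
 show "lows n ?Z = X"
 proof (rule Set.set_eqI)
  fix x show "x : lows n ?Z \<longleftrightarrow> x : X"
   using lo[of x] hi[of x] XC assms(1,3) by (cases "x < n") (auto simp: lows_def)
 qed
 show "highs n ?Z = Y"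
 proof (rule Set.set_eqI)
  fix x show "x : highs n ?Z \<longleftrightarrow> x : Y"
   using lo[of x] hi[of x] XC assms(2,3) by (cases "x < n") (auto simp: highs_def)
 qed
qed

lemma pairset_mem: "C <= {..<n} ==> a < n ==> (a : pairset n C \<longleftrightarrow> a : C) & (n + a : pairset n C \<longleftrightarrow> a : C)"
 by (auto simp: pairset_def)

lemma pairset_remove: "C <= {..<n} ==> a < n ==> pairset n C - {a} - {n + a} = pairset n (C - {a})"
 by (auto simp: pairset_def)

lemma pairset_insert: "pairset n (insert a C) = insert a (insert (n + a) (pairset n C))"
 by (auto simp: pairset_def)

context char2
begin

lemma ent_gen_low: "i < n ==> ent (gen n i*A) T S = of_bool (i : T)*(ent A (T - {i}) S :: 'f)"
 by (simp add: ent_gen_mult lgen_def)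

lemma ent_gen_high: "y < n ==> ent (gen n (n + y)*A) T S = of_bool (y ~: T)*(ent A (insert y T) S :: 'f)"
 by (simp add: ent_gen_mult lgen_def)

lemma ent_cre: "ent (cre i*A) T S = of_bool (i : T)*(ent A (T - {i}) S :: 'f)"
 by (simp add: ent.rep_eq times_fock_op.rep_eq cre.rep_eq)

lemma prod_fil: "prod_list (map (bval n (gen n)) (map Fil zs)) = (1 :: 'f fock_op)"
 by (induct zs) (simp_all add: bval_def gen_last)

text \<open>Modulo 2 the block \<open>Arc a b\<close> is the sum of two commuting projections, onto
  the sets with \<open>a\<close> occupied and onto those with \<open>b\<close> empty.\<close>

lemma ent_arcs: "sites Q <= {..<n} ==>
 ent (prod_list (map (bval n (gen n)) (map (%(a, b). Arc a b) Q))) T S = of_bool (T = S)*(mev Q T :: 'f)"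
proof (induct Q)
 case Nil
 then show ?case by (simp add: ent_1)
next
 case (Cons q Q)
 obtain a b where q: "q = (a, b)" by fastforce
 then have ab: "a < n" "b < n" "sites Q <= {..<n}" using Cons.prems by auto
 let ?P = "prod_list (map (bval n (gen n)) (map (%(a, b). Arc a b) Q)) :: 'f fock_op"
 have 1: "ent (gen n a*(gen n (n + a)*?P)) T S = of_bool (a : T)*ent ?P T S"
  unfolding ent_gen_low[OF ab(1)] ent_gen_high[OF ab(1)] by (simp add: insert_absorb)
 have 2: "ent (gen n (n + b)*(gen n b*?P)) T S = of_bool (b ~: T)*ent ?P T S"
  unfolding ent_gen_low[OF ab(2)] ent_gen_high[OF ab(2)] by (cases "b : T") simp_all
 have "prod_list (map (bval n (gen n)) (map (%(a, b). Arc a b) (q # Q))) = gen n a*(gen n (n + a)*?P) + gen n (n + b)*(gen n b*?P)"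
  by (simp add: q bval_def distrib_right mult.assoc)
 then show ?case by (simp only: ent_add 1 2 Cons.hyps[OF ab(3)]) (simp add: q distrib_left distrib_right)
qed

lemma ent_negs: "distinct ys ==> set ys <= {..<n} ==>
 ent (prod_list (map (bval n (gen n)) (map Neg ys))*A) T S = of_bool (T \<inter> set ys = {})*(ent A (T \<union> set ys) S :: 'f)"
proof (induct ys arbitrary: T)
 case (Cons y ys)
 have "insert y T \<inter> set ys = {} \<longleftrightarrow> T \<inter> set ys = {}" "insert y T \<union> set ys = T \<union> set (y # ys)" using Cons.prems by auto
 then show ?case using Cons by (simp add: bval_def ent_gen_high mult.assoc)
qed simp

lemma ent_poss: "distinct xs ==> set xs <= {..<n} ==>
 ent (prod_list (map (bval n (gen n)) (map Pos xs))*A) T S = of_bool (set xs <= T)*(ent A (T - set xs) S :: 'f)"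
proof (induct xs arbitrary: T)
 case (Cons x xs)
 have "x : T & set xs <= T - {x} \<longleftrightarrow> set (x # xs) <= T" "T - {x} - set xs = T - set (x # xs)" using Cons.prems by auto
 then show ?case using Cons by (auto simp: bval_def ent_gen_low mult.assoc)
qed simp

lemma ent_sum_list: "ent (sum_list As) T S = (\<Sum>A\<leftarrow>As. ent A T S)"
 by (induct As) (simp_all add: ent_add)

text \<open>Fillers contribute 1, the blocks \<open>Pos\<close> and \<open>Neg\<close> shift the row
  set, and the arcs contribute a diagonal factor.\<close>

lemma ctup_choices:
 assumes "k \<le> n" "i : bindices n k"
 shows "(\<Sum>c\<leftarrow>choices n (blocks n k i). ctup n c T S) = (betaf n i T S :: 'f)"
proof -
 obtain X Y Q where i: "i = ((X, Y), Q)" by (metis prod.exhaust)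
 note p = bindices_props[OF assms(1) assms(2)[unfolded i]]
 have f: "finite X" "finite Y" using p(1,2) finite_subset[OF _ finite_lessThan] by auto
 have sQ: "sites Q <= {..<n}" using p(5) by blast
 let ?L = "choices n (blocks n k i) :: 'f vec list list"
 have "(\<Sum>c\<leftarrow>?L. prod_list (map (lc n (gen n)) c)) = (\<Prod>b\<leftarrow>blocks n k i. bval n (gen n) b)"
  by (rule choices_sum[OF blocks_props(1,2)[OF assms]]) (rule gen_comm_high)
 then have s: "(\<Sum>c\<leftarrow>?L. ent (cprod n c) T S) = ent (\<Prod>b\<leftarrow>blocks n k i. bval n (gen n) b) T S"
  using ent_sum_list[of "map (cprod n) ?L" T S] by (simp add: cprod_def[abs_def] comp_def)
 have "(\<Prod>b\<leftarrow>blocks n k i. bval n (gen n) b) = prod_list (map (bval n (gen n)) (map Pos (sorted_list_of_set X)))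
   *(prod_list (map (bval n (gen n)) (map Neg (sorted_list_of_set Y)))*prod_list (map (bval n (gen n)) (map (%(a, b). Arc a b) Q)) :: 'f fock_op)"
  unfolding blocks_def i by (simp only: map_append prod_list.append prod_fil fst_conv snd_conv mult_1_left)
 then have e: "ent (\<Prod>b\<leftarrow>blocks n k i. bval n (gen n) b) T S = of_bool (X <= T)*(of_bool ((T - X) \<inter> Y = {})*(of_bool ((T - X) \<union> Y = S)*(mev Q ((T - X) \<union> Y) :: 'f)))"
  using p(1,2) f by (simp only: ent_poss ent_negs ent_arcs[OF sQ] distinct_sorted_list_of_set set_sorted_list_of_set)
 have "(\<Sum>c\<leftarrow>?L. ctup n c T S) = (if T <= {..<n} & S <= {..<n} then (\<Sum>c\<leftarrow>?L. ent (cprod n c) T S) else 0)"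
 proof -
  have "ctup n c T S = (if T <= {..<n} & S <= {..<n} then ent (cprod n c) T S else 0)" for c :: "'f vec list"
   by (simp only: ctup_def restr_def)
  note c = this
  show ?thesis unfolding c by (cases "T <= {..<n} & S <= {..<n}") (simp_all only: if_True if_False, simp_all)
 qed
 then show ?thesis unfolding s e by (auto simp: betaf_def i)
qed

subsection \<open>Coordinates of exterior products\<close>

text \<open>Coordinates of an exterior product. In characteristic 2 the creation operators on
  \<open>2*n+1\<close> sites commute and have square zero, so they model the exterior algebra, and
  applying a product of them to the vacuum lists its coefficients.\<close>

definition wfun :: "nat => nat set => 'f vec list => 'f" where
 "wfun n Z vs = ent (prod_list (map (lc n cre) vs)) Z {}"

definition arcprod :: "nat => (nat \<times> nat) list => 'f fock_op" where
 "arcprod n Q = prod_list (map (bval n cre) (map (%(a, b). Arc a b) Q))"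

definition wval :: "nat => nat => bindex => nat set => 'f" where
 "wval n k i Z = ent (\<Prod>b\<leftarrow>blocks n k i. bval n cre b) Z {}"

lemma wfun_choices:
 assumes "k \<le> n" "i : bindices n k"
 shows "(\<Sum>c\<leftarrow>choices n (blocks n k i). wfun n Z c) = wval n k i Z"
proof -
 let ?L = "choices n (blocks n k i) :: 'f vec list list"
 have "(\<Sum>c\<leftarrow>?L. prod_list (map (lc n cre) c)) = (\<Prod>b\<leftarrow>blocks n k i. bval n cre b)"
  by (rule choices_sum[OF blocks_props(1,2)[OF assms]]) (rule cre_comm2)
 then show ?thesis
  using ent_sum_list[of "map (%c. prod_list (map (lc n cre) c)) ?L" Z "{}"] by (simp add: wfun_def[abs_def] wval_def comp_def)
qed

lemma ent_arcprod_Cons: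
 assumes "a < n" "b < n" "0 < n"
 shows "ent (arcprod n ((a, b) # Q)) Z S = of_bool (a : Z & n + a : Z)*ent (arcprod n Q) (Z - {a} - {n + a}) S
  + of_bool (b : Z & n + b : Z)*(ent (arcprod n Q) (Z - {b} - {n + b}) S :: 'f)"
proof -
 have z: "Z - {n + b} - {b} = Z - {b} - {n + b}" by auto
 have "arcprod n ((a, b) # Q) = cre a*(cre (n + a)*arcprod n Q) + cre (n + b)*(cre b*arcprod n Q)"
  by (simp add: arcprod_def bval_def distrib_right mult.assoc)
 then show ?thesis using assms(3) by (auto simp: ent_add ent_cre z)
qed

text \<open>Here an arc is the sum of two commuting monomials, each a full pair of levels, so the
  entries are the squarefree coefficients of a product of binomials.\<close>

lemma ent_arcprod_pair: "sites Q <= {..<n} ==> C <= {..<n} ==> ent (arcprod n Q) (pairset n C) {} = (mco Q C :: 'f)"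
proof (induct Q arbitrary: C)
 case Nil
 then show ?case by (simp add: arcprod_def ent_1 pairset_def)
next
 case (Cons q Q)
 obtain a b where q: "q = (a, b)" by fastforce
 then have ab: "a < n" "b < n" "sites Q <= {..<n}" using Cons.prems by auto
 then have n: "0 < n" by simp
 have sub: "C - {a} <= {..<n}" "C - {b} <= {..<n}" using Cons.prems by auto
 show ?case
  unfolding q ent_arcprod_Cons[OF ab(1,2) n] pairset_remove[OF Cons.prems(2) ab(1)] pairset_remove[OF Cons.prems(2) ab(2)]
   Cons.hyps[OF ab(3) sub(1)] Cons.hyps[OF ab(3) sub(2)]
  using pairset_mem[OF Cons.prems(2) ab(1)] pairset_mem[OF Cons.prems(2) ab(2)] by simp
qed

lemma ent_arcprod_nonzero:
 "sites Q <= {..<n} ==> ent (arcprod n Q) Z {} ~= (0 :: 'f) ==> \<exists>C. C <= {..<n} & Z = pairset n C"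
proof (induct Q arbitrary: Z)
 case Nil
 then have "Z = {}" by (auto simp: arcprod_def ent_1)
 then show ?case by (intro exI[of _ "{}"]) (simp add: pairset_def)
next
 case (Cons q Q)
 obtain a b where q: "q = (a, b)" by fastforce
 then have ab: "a < n" "b < n" "sites Q <= {..<n}" using Cons.prems by auto
 then have n: "0 < n" by simp
 have "\<exists>c<n. c : Z & n + c : Z & ent (arcprod n Q) (Z - {c} - {n + c}) {} ~= (0 :: 'f)"
 proof -
  have h: "(P & x ~= 0) \<or> (R & y ~= 0)" if "of_bool P*x + of_bool R*y ~= (0 :: 'f)" for P R x y
   using that by (cases P; cases R) auto
  from h[OF Cons.prems(2)[unfolded q ent_arcprod_Cons[OF ab(1,2) n]]] ab show ?thesis by blast
 qed
 then obtain c where c: "c < n" "c : Z" "n + c : Z" "ent (arcprod n Q) (Z - {c} - {n + c}) {} ~= (0 :: 'f)" by blast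
 obtain C where C: "C <= {..<n}" "Z - {c} - {n + c} = pairset n C" using Cons.hyps[OF ab(3) c(4)] by blast
 have "Z = insert c (insert (n + c) (Z - {c} - {n + c}))" using c(2,3) by blast
 then have "Z = pairset n (insert c C)" unfolding C(2) pairset_insert .
 then show ?case using C(1) c(1) by (intro exI[of _ "insert c C"]) simp
qed

lemma ent_cres: "distinct L ==> ent (prod_list (map cre L)*A) Z S = of_bool (set L <= Z)*(ent A (Z - set L) S :: 'f)"
proof (induct L arbitrary: Z)
 case (Cons x L)
 have "x : Z & set L <= Z - {x} \<longleftrightarrow> set (x # L) <= Z" "Z - {x} - set L = Z - set (x # L)" using Cons.prems by auto
 then show ?case using Cons by (auto simp: ent_cre mult.assoc)
qed simp

lemma wval_prefix: "(\<Prod>b\<leftarrow>blocks n k ((X, Y), Q). bval n cre b) = prod_list (map cre (prefix_idx n k ((X, Y), Q)))*(arcprod n Q :: 'f fock_op)"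
 unfolding blocks_def prefix_idx_def arcprod_def
 by (simp add: comp_def bval_def mult.assoc)

text \<open>For indices of size above \<open>k - 2\<close> at most one filler occurs, so the
  creation operators before the arcs are distinct. A monomial then determines \<open>X\<close> and
  \<open>Y\<close>, and for fixed sets the coefficients are given by \<open>mco\<close>.\<close>

lemma wval_independent:
 assumes "k \<le> n" "!!Z. (\<Sum>i\<in>bindices n k. c i*wval n k i Z) = (0 :: 'f)"
  "!!i. i : bindices n k ==> bsize i + 2 \<le> k ==> c i = 0" "i : bindices n k"
 shows "c i = 0"
proof (cases "bsize i + 2 \<le> k")
 case True
 then show ?thesis using assms by blast
next
 case False
 obtain X Y Q where i: "i = ((X, Y), Q)" by (metis prod.exhaust)
 note p = bindices_props[OF assms(1) assms(4)[unfolded i]]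
 let ?m = "%p. (k - card (fst p) - card (snd p)) div 2"
 let ?D = "%i. if fillers n k i = [] then {} else {2*n}"
 have pre: "set (prefix_idx n k ((X', Y'), Q')) = ?D ((X', Y'), Q') \<union> X' \<union> (+) n ` Y'" "distinct (prefix_idx n k ((X', Y'), Q'))"
  if "((X', Y'), Q') : bindices n k" "\<not> bsize ((X', Y'), Q') + 2 \<le> k" for X' Y' Q'
 proof -
  note p' = bindices_props[OF assms(1) that(1)]
  have f: "finite X'" "finite Y'" using p'(1,2) finite_subset[OF _ finite_lessThan] by auto
  show "set (prefix_idx n k ((X', Y'), Q')) = ?D ((X', Y'), Q') \<union> X' \<union> (+) n ` Y'"
   using f by (auto simp: prefix_idx_def image_constant_conv)
  have "length (fillers n k ((X', Y'), Q')) \<le> 1" using fillers_props(1)[OF assms(1) that(1)] that(2) by simp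
  then have "distinct (map (%_. 2*n) (fillers n k ((X', Y'), Q')))" by (cases "fillers n k ((X', Y'), Q')") auto
  moreover have "X' \<inter> (+) n ` Y' = {}" "2*n ~: X'" "2*n ~: (+) n ` Y'" using p'(1,2) by auto
  ultimately show "distinct (prefix_idx n k ((X', Y'), Q'))"
   using f by (auto simp: prefix_idx_def distinct_map image_constant_conv)
 qed
 have "(\<Sum>Q\<in>stdm (free_sites n (X, Y)) ((k - card X - card Y) div 2). c ((X, Y), Q)*mco Q C) = 0"
  if C: "C <= set (free_sites n (X, Y))" for C
 proof -
  have C': "C <= {..<n}" "C \<inter> X = {}" "C \<inter> Y = {}" using C by (auto simp: set_free_sites)
  define D where "D = ?D i"
  define Z where "Z = (D \<union> X \<union> (+) n ` Y) \<union> pairset n C"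
  have D: "D <= {2*n}" by (simp add: D_def)
  have dis: "(D \<union> X \<union> (+) n ` Y) \<inter> pairset n C = {}"
  proof -
   have "x ~: D" "n + x ~: D" if "x : C" for x
    using that C'(1) subsetD[OF D, of x] subsetD[OF D, of "n + x"] by auto
   then show ?thesis using C' p(1,2) by (auto simp: pairset_def)
  qed
  note lh = lows_highs_union[OF p(1,2,3) C'(1) D dis, folded Z_def]
  have z: "c (q, Q')*wval n k (q, Q') Z = (if q = (X, Y) then c (q, Q')*mco Q' C else (0 :: 'f))"
   if q: "(q, Q') : bindices n k" for q Q'
  proof (cases "bsize (q, Q') + 2 \<le> k")
   case True
   then have "c (q, Q') = 0" by (rule assms(3)[OF q])
   then show ?thesis by (simp only: mult_zero_left if_cancel)
  next
   case sz: False
   obtain X' Y' where q': "q = (X', Y')" by fastforce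
   note p' = bindices_props[OF assms(1) q[unfolded q']]
   note pr = pre[OF q[unfolded q'] sz[unfolded q']]
   have sQ: "sites Q' <= {..<n}" using p'(5) by blast
   have w: "wval n k (q, Q') Z = of_bool (set (prefix_idx n k (q, Q')) <= Z)*(ent (arcprod n Q') (Z - set (prefix_idx n k (q, Q'))) {} :: 'f)"
    unfolding wval_def q' wval_prefix by (rule ent_cres[OF pr(2)])
   show ?thesis
   proof (cases "q = (X, Y)")
    case True
    then have e: "X' = X" "Y' = Y" using q' by auto
    \<comment> \<open>Both sizes are \<open>k\<close> or \<open>k - 1\<close>, and they have the
      same parity.\<close>
    have "k - bsize (q, Q') = k - bsize i"
     using sz False p(6) p'(6) by (simp add: i q' bsize_def e) presburger
    then have "?D (q, Q') = D" unfolding D_def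
     using fillers_props(1)[OF assms(1) q] fillers_props(1)[OF assms(1) assms(4)] by (metis length_0_conv)
    then have "set (prefix_idx n k (q, Q')) = D \<union> X \<union> (+) n ` Y" using pr(1) by (simp add: q' e)
    moreover have "Z - (D \<union> X \<union> (+) n ` Y) = pairset n C" using dis by (auto simp: Z_def)
    ultimately have "wval n k (q, Q') Z = (mco Q' C :: 'f)"
     unfolding w using ent_arcprod_pair[OF sQ C'(1)] by (simp add: Z_def)
    then show ?thesis using True by simp
   next
    case ne: False
    have "wval n k (q, Q') Z = (0 :: 'f)"
    proof (rule ccontr)
     assume nz: "wval n k (q, Q') Z ~= (0 :: 'f)"
     then have sub: "set (prefix_idx n k (q, Q')) <= Z" and nz': "ent (arcprod n Q') (Z - set (prefix_idx n k (q, Q'))) {} ~= (0 :: 'f)"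
      unfolding w by (auto split: if_splits)
     obtain C2 where C2: "C2 <= {..<n}" "Z - set (prefix_idx n k (q, Q')) = pairset n C2"
      using ent_arcprod_nonzero[OF sQ nz'] by blast
     let ?D' = "?D (q, Q')"
     have s: "set (prefix_idx n k (q, Q')) = ?D' \<union> X' \<union> (+) n ` Y'" using pr(1) by (simp add: q')
     have D': "?D' <= {2*n}" by simp
     have dis': "(?D' \<union> X' \<union> (+) n ` Y') \<inter> pairset n C2 = {}" unfolding C2(2)[symmetric] s by blast
     have Z2: "Z = (?D' \<union> X' \<union> (+) n ` Y') \<union> pairset n C2" unfolding C2(2)[symmetric] using sub s by blast
     note lh' = lows_highs_union[OF p'(1,2,3) C2(1) D' dis', folded Z2]
     show False using lh lh' ne q' by simp
    qed
    then show ?thesis using ne by simp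
   qed
  qed
  have "0 = (\<Sum>i\<in>bindices n k. c i*wval n k i Z)" using assms(2) by simp
  also have "... = (\<Sum>(q, Q')\<in>bindices n k. if q = (X, Y) then c (q, Q')*mco Q' C else 0)"
   by (intro sum.cong refl) (auto simp: z)
  also have "... = (\<Sum>q\<in>disjoint_pairs n k. \<Sum>Q'\<in>stdm (free_sites n q) (?m q). if q = (X, Y) then c (q, Q')*mco Q' C else 0)"
   unfolding bindices_def by (rule sum.Sigma[symmetric]) (auto simp: finite_disjoint_pairs finite_stdm)
  also have "... = (\<Sum>q\<in>disjoint_pairs n k. if q = (X, Y) then \<Sum>Q'\<in>stdm (free_sites n q) (?m q). c (q, Q')*mco Q' C else 0)"
   by (intro sum.cong[OF refl]) simp
  also have "... = (\<Sum>Q'\<in>stdm (free_sites n (X, Y)) (?m (X, Y)). c ((X, Y), Q')*mco Q' C)"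
   using p(9) by (simp add: finite_disjoint_pairs)
  finally show ?thesis by simp
 qed
 then show ?thesis unfolding i by (rule mco_independent[OF distinct_free_sites p(8) _ p(7)])
qed

end

section \<open>Weyl modules in characteristic 2\<close>

lemma lgen_add: "lgen n j (%T S. F T S + H T S) = (%T S. lgen n j F T S + lgen n j H T S)"
 and rgen_add: "rgen n j (%T S. F T S + H T S) = (%T S. rgen n j F T S + rgen n j H T S)"
 and lgen_smult: "lgen n j (%T S. c*F T S) = (%T S. c*lgen n j F T S)"
 and rgen_smult: "rgen n j (%T S. c*F T S) = (%T S. c*rgen n j F T S)"
 by (simp_all add: lgen_def rgen_def fun_eq_iff algebra_simps)

lemma dpf_add: "dpf n a b m (%T S. F T S + H T S) = (%T S. dpf n a b m F T S + dpf n a b m H T S)"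
 by (simp add: dpf_def lgen_add rgen_add fun_eq_iff)

lemma dpf_smult: "dpf n a b m (%T S. c*F T S) = (%T S. c*dpf n a b m F T S)"
 by (simp add: dpf_def lgen_smult rgen_smult fun_eq_iff right_diff_distrib)

locale weyl = hw_module n \<kappa> M \<rho> v + char2 ty
 for n \<kappa> :: nat and M :: "(complex, 'v) module" (structure) and \<rho> v and ty :: "'f::field itself"
begin

abbreviation TR :: "('v \<Rightarrow>\<^sub>0 'f) set" where "TR \<equiv> tensor_rels M K"

sublocale W: presentation K TR
proof
 fix r :: "'v \<Rightarrow>\<^sub>0 'f" assume "r : TR"
 then obtain x y where r: "r = psingle (x \<oplus> y) 1 - psingle x 1 - psingle y 1" and xy: "x : K" "y : K"
  by (auto simp: tensor_rels_def)
 have "z : K" if "plookup r z ~= 0" for z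
  using that K_add[OF xy] xy by (auto simp: r lookup_minus lookup_single when_def split: if_splits)
 then show "pkeys r <= K" by (auto simp: in_keys_iff)
qed

abbreviation WM :: "('f, ('v \<Rightarrow>\<^sub>0 'f) set) module" where "WM \<equiv> presented_module K TR"

abbreviation G :: "'v => ('v \<Rightarrow>\<^sub>0 'f) set" where "G y \<equiv> generator K TR y"

lemma weyl_module_eq: "weyl_module n M \<rho> v = WM"
 by (simp add: weyl_module_def scalar_ext_def)

lemma weyl_vector_eq: "weyl_vector n M \<rho> v y = G y"
 by (simp add: weyl_vector_def)

lemma TR_lin: "r : TR ==> W.lin (%y. red y T S) r = 0"
 by (auto simp: tensor_rels_def W.lin_diff red_add)

text \<open>Reduction modulo 2 extended linearly to the scalar extension of the lattice. The target
  is one function space for all highest weights.\<close>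

definition Psi :: "('v \<Rightarrow>\<^sub>0 'f) set => nat set => nat set => 'f" where
 "Psi C T S = W.lift (%y. red y T S) C"

lemma Psi_add: "C : carrier WM ==> D : carrier WM ==> Psi (C \<oplus>\<^bsub>WM\<^esub> D) = (%T S. Psi C T S + Psi D T S)"
 unfolding Psi_def[abs_def] by (intro ext W.lift_add TR_lin)

lemma Psi_smult: "C : carrier WM ==> Psi (c \<odot>\<^bsub>WM\<^esub> C) = (%T S. c*Psi C T S)"
 unfolding Psi_def[abs_def] by (intro ext W.lift_smult TR_lin)

lemma Psi_zero: "Psi \<zero>\<^bsub>WM\<^esub> = (%T S. 0)"
 unfolding Psi_def[abs_def] by (intro ext W.lift_zero TR_lin)

lemma Psi_gen: "y : K ==> Psi (G y) = red y"
 unfolding Psi_def[abs_def] by (intro ext W.lift_generator TR_lin)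

lemma Psi_finsum:
 assumes "finite I" "!!i. i : I ==> f i : carrier WM"
 shows "Psi (finsum WM f I) = (%T S. \<Sum>i\<in>I. Psi (f i) T S)"
 using assms
proof (induct I)
 case empty
 then show ?case using Psi_zero by simp
next
 case (insert i I)
 then have "finsum WM f (insert i I) = f i \<oplus>\<^bsub>WM\<^esub> finsum WM f I" by (intro W.PM.finsum_insert) auto
 moreover have "finsum WM f I : carrier WM" using insert by (intro W.PM.finsum_closed) auto
 ultimately show ?case using insert by (simp add: Psi_add)
qed

lemma K_zero: "\<zero> : K"
 using K_add[OF K_v K_neg[OF K_v]] by (simp add: M.r_neg)

lemma G_add: "x : K ==> y : K ==> G (x \<oplus> y) = G x \<oplus>\<^bsub>WM\<^esub> G y"
proof -
 assume xy: "x : K" "y : K"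
 have "psingle (x \<oplus> y) 1 - (psingle x 1 + psingle y 1) : TR"
  using xy by (auto simp: tensor_rels_def diff_diff_eq)
 then have "psingle (x \<oplus> y) 1 - (psingle x 1 + psingle y 1) : relation_span K TR"
  unfolding relation_span_def using W.FM.in_own_span[OF W.R_carrier] by blast
 then show ?thesis
  using xy by (simp add: W.generator_pcl W.pcl_add W.pcl_eqI)
qed

lemma WM_double: "C : carrier WM ==> C \<oplus>\<^bsub>WM\<^esub> C = \<zero>\<^bsub>WM\<^esub>"
 using W.PM.smult_l_distr[of 1 1 C] W.PM.smult_one[of C] W.PM.smult_l_null[of C] by (simp add: two_zero)

lemma WM_eq_of_sum: "C : carrier WM ==> D : carrier WM ==> C \<oplus>\<^bsub>WM\<^esub> D = \<zero>\<^bsub>WM\<^esub> ==> C = D"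
proof -
 assume CD: "C : carrier WM" "D : carrier WM" "C \<oplus>\<^bsub>WM\<^esub> D = \<zero>\<^bsub>WM\<^esub>"
 have "C = C \<oplus>\<^bsub>WM\<^esub> (D \<oplus>\<^bsub>WM\<^esub> D)" using CD by (simp only: WM_double W.PM.r_zero)
 also have "... = D" using CD by (simp only: W.PM.a_assoc[symmetric] W.PM.l_zero)
 finally show ?thesis .
qed

lemma G_zero: "G \<zero> = \<zero>\<^bsub>WM\<^esub>"
 using G_add[OF K_zero K_zero] WM_double[of "G \<zero>"] K_zero by simp

text \<open>In characteristic 2 only the parity of an integral coefficient survives in the tensor
  product.\<close>

lemma G_int: "y : K ==> G (of_int z \<odot> y) = (if odd z then G y else \<zero>\<^bsub>WM\<^esub>)"
proof -
 assume y: "y : K"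
 have yc: "y : carrier M" by (rule K_carrier[OF y])
 define q where "q = z div 2"
 have qK: "of_int q \<odot> y : K" by (rule smult_int_K[OF y])
 have qq: "of_int q \<odot> y \<oplus> of_int q \<odot> y = of_int (q + q) \<odot> y" using smult_add_left[OF yc, of "of_int q" "of_int q"] by (simp only: of_int_add)
 have e: "G (of_int (q + q) \<odot> y) = \<zero>\<^bsub>WM\<^esub>"
  unfolding qq[symmetric] G_add[OF qK qK] by (rule WM_double) (use qK in simp)
 show ?thesis
 proof (cases "odd z")
  case True
  then have "z = (q + q) + 1" unfolding q_def by presburger
  then have "of_int z \<odot> y = of_int (q + q) \<odot> y \<oplus> y" using yc smult_add_left[of y "of_int (q + q)" 1] by simp
  then have "G (of_int z \<odot> y) = \<zero>\<^bsub>WM\<^esub> \<oplus>\<^bsub>WM\<^esub> G y" using G_add[OF smult_int_K[OF y] y, of "q + q"] e by simp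
  then show ?thesis using True y by simp
 next
  case False
  then have "z = q + q" unfolding q_def by presburger
  then show ?thesis using e False by simp
 qed
qed

lemma G_finsum:
 assumes "finite I" "!!i. i : I ==> f i : K"
 shows "finsum M f I : K & G (finsum M f I) = finsum WM (%i. G (f i)) I"
 using assms
proof (induct I)
 case empty
 then show ?case using K_zero G_zero by simp
next
 case (insert i I)
 then have "finsum M f (insert i I) = f i \<oplus> finsum M f I" using K_carrier by (intro M.finsum_insert) auto
 moreover have "finsum WM (%i. G (f i)) (insert i I) = G (f i) \<oplus>\<^bsub>WM\<^esub> finsum WM (%i. G (f i)) I"
  using insert by (intro W.PM.finsum_insert) auto
 ultimately show ?case using insert K_add G_add by simp
qed

text \<open>Each step of \<open>tups\<close> lifts to the sum of the first three divided powers,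
  under which the lattice is closed.\<close>

lemma tup_lift: "vs : tups n \<kappa> ==> \<exists>y\<in>K. red y = ctup n vs"
proof (induct rule: tups.induct)
 case tups_base
 have "map (lc n (gen n)) (map (uv n) [0..<\<kappa>]) = map (gen n) [0..<\<kappa>]"
  using kap_le by (auto intro!: lc_unit[simplified])
 then have "cprod n (map (uv n) [0..<\<kappa>]) = hwop n \<kappa>" by (simp only: cprod_def hwop_def)
 moreover have "red v = restr n (ent (hwop n \<kappa> :: 'f fock_op))" by (rule red_v)
 ultimately show ?case using K_v by (intro bexI[of _ v]) (simp_all add: ctup_def)
next
 case (tups_step vs \<alpha>)
 then obtain y where y: "y : K" "red y = ctup n vs" by blast
 obtain a b where ab: "root_pair n \<alpha> = (a, b)" by fastforce
 have d: "dp \<alpha> m y : K" for m by (rule K_dp[OF tups_step(3) y(1)])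
 have "red (y \<oplus> (dp \<alpha> 1 y \<oplus> dp \<alpha> 2 y)) T S = xact n \<alpha> 1 (red y :: _ => _ => 'f) T S" for T S
  by (simp only: red_add K_add y(1) d red_dp[OF y(1) tups_step(3) ab] xact_def ab prod.case power_one mult_1_left add.assoc)
 moreover have "xact n \<alpha> 1 (ctup n vs) = ctup n (map (%v. root_elem n \<alpha> 1 *\<^sub>v v) vs)"
  using tups_carrier[OF tups_step(1)] by (intro xact_ctup tups_step(3)) blast
 ultimately have "red (y \<oplus> (dp \<alpha> 1 y \<oplus> dp \<alpha> 2 y)) = ctup n (map (%v. root_elem n \<alpha> 1 *\<^sub>v v) vs)"
  by (intro ext) (simp only: y(2))
 then show ?case using K_add[OF y(1) K_add[OF d d]] by blast
qed

lemma tups_sum_lift: "set cs <= tups n \<kappa> ==> \<exists>y\<in>K. \<forall>T S. red y T S = (\<Sum>c\<leftarrow>cs. ctup n c T S)"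
proof (induct cs)
 case Nil
 have "red \<zero> T S = (0 :: 'f)" for T S
 proof -
  have "red (\<zero> \<oplus> \<zero>) T S = red \<zero> T S + (red \<zero> T S :: 'f)" by (rule red_add[OF K_zero K_zero])
  then show ?thesis by simp
 qed
 then show ?case using K_zero by auto
next
 case (Cons c cs)
 then obtain x y where xy: "x : K" "\<forall>T S. red x T S = (\<Sum>c\<leftarrow>cs. ctup n c T S)" "y : K" "red y = ctup n c"
  using tup_lift[of c] by auto
 then show ?case using K_add[OF xy(3,1)] by (intro bexI[of _ "y \<oplus> x"]) (simp_all add: red_add)
qed

section \<open>A basis of the Weyl module\<close>

lemma choices_tups: "i : bindices n \<kappa> ==> set (choices n (blocks n \<kappa> i)) <= tups n \<kappa>"
 using tups_choices[OF blocks_props[OF kap_le]] by blast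

lemma beta_lift: "i : bindices n \<kappa> ==> \<exists>y. y : K & red y = (betaf n i :: nat set => nat set => 'f)"
 using tups_sum_lift[OF choices_tups] ctup_choices[OF kap_le] by (metis ext)

definition bl :: "bindex => 'v" where
 "bl i = (SOME y. y : K & red y = (betaf n i :: nat set => nat set => 'f))"

lemma bl: "i : bindices n \<kappa> ==> bl i : K" "i : bindices n \<kappa> ==> red (bl i) = (betaf n i :: nat set => nat set => 'f)"
 using someI_ex[OF beta_lift] by (auto simp: bl_def)

definition comb :: "(bindex => 'f) => ('v \<Rightarrow>\<^sub>0 'f) set" where
 "comb c = (\<Oplus>\<^bsub>WM\<^esub>i\<in>bindices n \<kappa>. c i \<odot>\<^bsub>WM\<^esub> G (bl i))"

lemma comb_carrier [simp]: "comb c : carrier WM"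
 unfolding comb_def by (intro W.PM.finsum_closed) (auto simp: bl)

lemma Psi_comb: "Psi (comb c) = (%T S. \<Sum>i\<in>bindices n \<kappa>. c i*betaf n i T S)"
 unfolding comb_def by (subst Psi_finsum) (auto simp: bl Psi_smult Psi_gen)

text \<open>For a lattice vector, \<open>purity\<close> yields a relation with an odd coefficient at
  that vector, and modulo 2 this expresses the vector by the chosen lifts. A basis of the lattice
  itself need not be found.\<close>

lemma comb_exists: "C : carrier WM ==> \<exists>c. C = comb c"
proof (induct rule: W.PM_induct[consumes 1, case_names gen add smult zero])
 case (gen x)
 have ind: "\<forall>j\<in>bindices n \<kappa>. c j = 0" if z: "!!T S. (\<Sum>j\<in>bindices n \<kappa>. c j*red (bl j) T S) = 0" for c :: "bindex => 'f"
 proof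
  fix j assume j: "j : bindices n \<kappa>"
  have "(\<Sum>j\<in>bindices n \<kappa>. c j*betaf n j T S) = (\<Sum>j\<in>bindices n \<kappa>. c j*red (bl j) T S)" for T S
   by (rule sum.cong[OF refl]) (simp add: bl(2))
  then have "(\<Sum>j\<in>bindices n \<kappa>. c j*betaf n j T S) = 0" for T S unfolding z by simp
  then show "c j = 0" by (rule betaf_independent[OF kap_le _ j])
 qed
 obtain a0 a where a: "odd a0" "of_int a0 \<odot> x \<oplus> (\<Oplus>\<^bsub>M\<^esub>j\<in>bindices n \<kappa>. of_int (a j) \<odot> bl j) = \<zero>"
  by (rule purity[where b = bl and J = "bindices n \<kappa>" and x = x, OF char2 finite_bindices card_bindices[OF kap_le] bl(1) ind gen])
 have s: "(\<Oplus>\<^bsub>M\<^esub>j\<in>bindices n \<kappa>. of_int (a j) \<odot> bl j) : K"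
  "G (\<Oplus>\<^bsub>M\<^esub>j\<in>bindices n \<kappa>. of_int (a j) \<odot> bl j) = (\<Oplus>\<^bsub>WM\<^esub>j\<in>bindices n \<kappa>. G (of_int (a j) \<odot> bl j))"
  using G_finsum[OF finite_bindices, of n \<kappa> "%j. of_int (a j) \<odot> bl j"] smult_int_K bl(1) by auto
 have "(\<Oplus>\<^bsub>WM\<^esub>j\<in>bindices n \<kappa>. G (of_int (a j) \<odot> bl j)) = comb (%j. if odd (a j) then 1 else 0)"
  unfolding comb_def
 proof (rule W.PM.finsum_cong')
  fix i assume i: "i : bindices n \<kappa>"
  then show "G (of_int (a i) \<odot> bl i) = (if odd (a i) then 1 else 0) \<odot>\<^bsub>WM\<^esub> G (bl i)"
   using W.PM.smult_one[of "G (bl i)"] W.PM.smult_l_null[of "G (bl i)"] bl(1)[OF i] by (simp add: G_int)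
 qed (auto simp: bl)
 then have "G (of_int a0 \<odot> x) \<oplus>\<^bsub>WM\<^esub> comb (%j. if odd (a j) then 1 else 0) = \<zero>\<^bsub>WM\<^esub>"
  using G_add[OF smult_int_K[OF gen] s(1), of a0] a(2) s(2) G_zero by simp
 then have "G x \<oplus>\<^bsub>WM\<^esub> comb (%j. if odd (a j) then 1 else 0) = \<zero>\<^bsub>WM\<^esub>" using a(1) gen by (simp add: G_int)
 then show ?case using gen WM_eq_of_sum by (metis comb_carrier W.generator_carrier)
next
 case (add C D)
 then obtain c d where cd: "C = comb c" "D = comb d" by blast
 have "comb c \<oplus>\<^bsub>WM\<^esub> comb d = (\<Oplus>\<^bsub>WM\<^esub>i\<in>bindices n \<kappa>. c i \<odot>\<^bsub>WM\<^esub> G (bl i) \<oplus>\<^bsub>WM\<^esub> d i \<odot>\<^bsub>WM\<^esub> G (bl i))"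
  unfolding comb_def by (rule W.PM.finsum_addf[symmetric]) (auto simp: bl)
 also have "... = comb (%i. c i + d i)"
  unfolding comb_def by (rule W.PM.finsum_cong') (auto simp: bl W.PM.smult_l_distr[simplified])
 finally show ?case using cd by blast
next
 case (smult d C)
 then obtain c where c: "C = comb c" by blast
 have "d \<odot>\<^bsub>WM\<^esub> comb c = (\<Oplus>\<^bsub>WM\<^esub>i\<in>bindices n \<kappa>. d \<odot>\<^bsub>WM\<^esub> (c i \<odot>\<^bsub>WM\<^esub> G (bl i)))"
  unfolding comb_def by (rule W.PM.finsum_smult) (auto simp: bl)
 also have "... = comb (%i. d*c i)"
  unfolding comb_def by (rule W.PM.finsum_cong') (auto simp: bl W.PM.smult_assoc1[simplified])
 finally show ?case using c by blast
next
 case zero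
 have "comb (%_. 0) = \<zero>\<^bsub>WM\<^esub>"
 proof -
  have "comb (%_. 0) = (\<Oplus>\<^bsub>WM\<^esub>i\<in>bindices n \<kappa>. \<zero>\<^bsub>WM\<^esub>)"
   unfolding comb_def by (rule W.PM.finsum_cong') (auto simp: bl W.PM.smult_l_null[simplified])
  then show ?thesis by simp
 qed
 then show ?case by metis
qed

text \<open>The lifts span the Weyl module, and their images are independent.\<close>

lemma Psi_inj: "C : carrier WM ==> D : carrier WM ==> Psi C = Psi D ==> C = D"
proof -
 assume CD: "C : carrier WM" "D : carrier WM" "Psi C = Psi D"
 obtain c where c: "C \<oplus>\<^bsub>WM\<^esub> D = comb c" using comb_exists[of "C \<oplus>\<^bsub>WM\<^esub> D"] CD by auto
 have "Psi (comb c) = (%T S. 0)" unfolding c[symmetric] Psi_add[OF CD(1,2)] CD(3) by simp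
 then have "(\<Sum>i\<in>bindices n \<kappa>. c i*betaf n i T S) = 0" for T S unfolding Psi_comb by (metis)
 then have c0: "c i = 0" if "i : bindices n \<kappa>" for i using betaf_independent[OF kap_le _ that, of c] by blast
 have "comb c = (\<Oplus>\<^bsub>WM\<^esub>i\<in>bindices n \<kappa>. \<zero>\<^bsub>WM\<^esub>)"
  unfolding comb_def by (rule W.PM.finsum_cong') (auto simp: bl c0 W.PM.smult_l_null[simplified])
 then have "C \<oplus>\<^bsub>WM\<^esub> D = \<zero>\<^bsub>WM\<^esub>" using c by simp
 then show ?thesis by (rule WM_eq_of_sum[OF CD(1,2)])
qed

section \<open>Divided powers and root elements on the Weyl module\<close>

lemma dp_add:
 assumes "\<alpha> : roots n" "x : K" "y : K"
 shows "dp \<alpha> m (x \<oplus> y) = dp \<alpha> m x \<oplus> dp \<alpha> m y"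
proof -
 have c: "x : carrier M" "y : carrier M" using assms K_carrier by auto
 have "(\<rho> (crv n \<alpha>) ^^ m) (x \<oplus> y) = (\<rho> (crv n \<alpha>) ^^ m) x \<oplus> (\<rho> (crv n \<alpha>) ^^ m) y \<and>
  (\<rho> (crv n \<alpha>) ^^ m) x : carrier M & (\<rho> (crv n \<alpha>) ^^ m) y : carrier M"
  using c assms(1) by (induct m) (auto simp: crv_lie_o rho_add)
 then show ?thesis using c assms(1) by (simp add: env_act_divided_power smult_add_right)
qed

abbreviation wact :: "broot => nat => ('v \<Rightarrow>\<^sub>0 'f) set => ('v \<Rightarrow>\<^sub>0 'f) set" where
 "wact \<alpha> m \<equiv> presented_map K TR (dp \<alpha> m)"

lemma wact_conds:
 assumes "\<alpha> : roots n"
 shows "dp \<alpha> m ` K <= K" "r : TR ==> W.push (dp \<alpha> m) r : relation_span K TR"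
proof -
 show "dp \<alpha> m ` K <= K" using K_dp[OF assms] by blast
 assume "r : TR"
 then obtain x y where r: "r = psingle (x \<oplus> y) 1 - psingle x 1 - psingle y 1" and xy: "x : K" "y : K"
  by (auto simp: tensor_rels_def)
 have "W.push (dp \<alpha> m) r : TR"
  unfolding r W.push_diff W.push_single dp_add[OF assms xy] tensor_rels_def
  by (rule CollectI) (intro exI[of _ "dp \<alpha> m x"] exI[of _ "dp \<alpha> m y"] conjI refl K_dp assms xy)
 then show "W.push (dp \<alpha> m) r : relation_span K TR"
  unfolding relation_span_def using W.FM.in_own_span[OF W.R_carrier] by blast
qed

lemma wact_gen: "\<alpha> : roots n ==> y : K ==> wact \<alpha> m (G y) = G (dp \<alpha> m y)"
 and wact_carrier: "\<alpha> : roots n ==> C : carrier WM ==> wact \<alpha> m C : carrier WM"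
 and wact_add: "\<alpha> : roots n ==> C : carrier WM ==> D : carrier WM ==> wact \<alpha> m (C \<oplus>\<^bsub>WM\<^esub> D) = wact \<alpha> m C \<oplus>\<^bsub>WM\<^esub> wact \<alpha> m D"
 and wact_smult: "\<alpha> : roots n ==> C : carrier WM ==> wact \<alpha> m (c \<odot>\<^bsub>WM\<^esub> C) = c \<odot>\<^bsub>WM\<^esub> wact \<alpha> m C"
proof -
 assume \<alpha>: "\<alpha> : roots n"
 show "y : K ==> wact \<alpha> m (G y) = G (dp \<alpha> m y)" by (rule W.presented_map_generator[OF wact_conds[OF \<alpha>]])
 show "C : carrier WM ==> wact \<alpha> m C : carrier WM" by (rule W.presented_map_carrier[OF wact_conds[OF \<alpha>]])
 show "C : carrier WM ==> D : carrier WM ==> wact \<alpha> m (C \<oplus>\<^bsub>WM\<^esub> D) = wact \<alpha> m C \<oplus>\<^bsub>WM\<^esub> wact \<alpha> m D"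
  by (rule W.presented_map_add[OF wact_conds[OF \<alpha>]])
 show "C : carrier WM ==> wact \<alpha> m (c \<odot>\<^bsub>WM\<^esub> C) = c \<odot>\<^bsub>WM\<^esub> wact \<alpha> m C"
  by (rule W.presented_map_smult[OF wact_conds[OF \<alpha>]])
qed

lemma wact_zero: "\<alpha> : roots n ==> wact \<alpha> m \<zero>\<^bsub>WM\<^esub> = \<zero>\<^bsub>WM\<^esub>"
proof -
 assume \<alpha>: "\<alpha> : roots n"
 have z: "\<zero>\<^bsub>WM\<^esub> : carrier WM" by simp
 have "wact \<alpha> m (0 \<odot>\<^bsub>WM\<^esub> \<zero>\<^bsub>WM\<^esub>) = 0 \<odot>\<^bsub>WM\<^esub> wact \<alpha> m \<zero>\<^bsub>WM\<^esub>" by (rule wact_smult[OF \<alpha> z])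
 then show ?thesis using W.PM.smult_l_null[simplified] wact_carrier[OF \<alpha> z] z by simp
qed

lemma Psi_act:
 assumes "\<alpha> : roots n" "root_pair n \<alpha> = (a, b)" "C : carrier WM"
 shows "Psi (wact \<alpha> m C) = dpf n a b m (Psi C)"
 using assms(3)
proof (induct rule: W.PM_induct[consumes 1, case_names gen add smult zero])
 case (gen x)
 then show ?case using assms by (simp add: wact_gen Psi_gen K_dp red_dp)
next
 case (add C D)
 then show ?case using assms by (simp add: wact_add Psi_add wact_carrier dpf_add)
next
 case (smult c C)
 then show ?case using assms by (simp add: wact_smult Psi_smult wact_carrier dpf_smult)
next
 case zero
 have "dpf n a b m (%T S. 0*0) = (%T S. 0*(dpf n a b m (%T S. 0) T S :: 'f))" by (rule dpf_smult)
 then show ?case using assms by (simp add: wact_zero Psi_zero)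
qed

text \<open>Read off through the embedding, where divided powers of the commutator vanish from the
  third on.\<close>

lemma wact_ge3:
 assumes "\<alpha> : roots n" "3 \<le> m" "C : carrier WM"
 shows "wact \<alpha> m C = \<zero>\<^bsub>WM\<^esub>"
proof -
 obtain a b where ab: "root_pair n \<alpha> = (a, b)" by fastforce
 show ?thesis
  using Psi_inj[OF wact_carrier[OF assms(1,3)], of "\<zero>\<^bsub>WM\<^esub>" m] Psi_act[OF assms(1) ab assms(3), of m] assms(2)
  by (simp add: Psi_zero dpf_def)
qed

lemma weyl_root:
 assumes "\<alpha> : roots n" "C : carrier WM"
 shows "weyl_root_act n M \<rho> v \<alpha> t C : carrier WM" "Psi (weyl_root_act n M \<rho> v \<alpha> t C) = xact n \<alpha> t (Psi C)"
proof -
 obtain a b where ab: "root_pair n \<alpha> = (a, b)" by fastforce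
 let ?I = "{m. wact \<alpha> m C ~= \<zero>\<^bsub>WM\<^esub>}"
 have I: "?I <= {..2}" 
 proof
  fix m assume "m : ?I"
  then have "\<not> 3 \<le> m" using wact_ge3[OF assms(1) _ assms(2), of m] by blast
  then show "m : {..2}" by simp
 qed
 have e: "weyl_root_act n M \<rho> v \<alpha> t C = (\<Oplus>\<^bsub>WM\<^esub>m\<in>?I. t ^ m \<odot>\<^bsub>WM\<^esub> wact \<alpha> m C)"
  by (simp add: weyl_root_act_def weyl_act_def weyl_module_eq)
 have c: "t ^ m \<odot>\<^bsub>WM\<^esub> wact \<alpha> m C : carrier WM" for m using wact_carrier[OF assms] by simp
 show "weyl_root_act n M \<rho> v \<alpha> t C : carrier WM" unfolding e by (rule W.PM.finsum_closed) (use c in auto)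
 have fin: "finite ?I" using I finite_subset by blast
 have "Psi (weyl_root_act n M \<rho> v \<alpha> t C) T S = (\<Sum>m\<in>?I. t ^ m*dpf n a b m (Psi C) T S)" for T S
  unfolding e by (simp only: Psi_finsum[OF fin c] Psi_smult[OF wact_carrier[OF assms]] Psi_act[OF assms(1) ab assms(2)])
 also have "(\<Sum>m\<in>?I. t ^ m*dpf n a b m (Psi C) T S) = (\<Sum>m\<le>2. t ^ m*dpf n a b m (Psi C) T S)" for T S
 proof (rule sum.mono_neutral_left[OF _ I], simp, rule ballI)
  fix m assume "m : {..2} - ?I"
  then have "wact \<alpha> m C = \<zero>\<^bsub>WM\<^esub>" by simp
  then have "dpf n a b m (Psi C) T S = 0" using Psi_act[OF assms(1) ab assms(2), of m] Psi_zero by (metis)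
  then show "t ^ m*dpf n a b m (Psi C) T S = 0" by simp
 qed
 also have "(\<Sum>m\<le>2. t ^ m*dpf n a b m (Psi C) T S) = xact n \<alpha> t (Psi C) T S" for T S
  by (simp add: xact_def ab numeral_2_eq_2) (simp add: dpf_def)
 finally show "Psi (weyl_root_act n M \<rho> v \<alpha> t C) = xact n \<alpha> t (Psi C)" by (intro ext)
qed

lemma Psi_v: "Psi (G v) = ctup n (map (uv n) [0..<\<kappa>])"
proof -
 have "map (lc n (gen n)) (map (uv n) [0..<\<kappa>]) = map (gen n) [0..<\<kappa>]"
  using kap_le by (auto intro!: lc_unit[simplified])
 then have "cprod n (map (uv n) [0..<\<kappa>]) = hwop n \<kappa>" by (simp only: cprod_def hwop_def)
 moreover have "red v = restr n (ent (hwop n \<kappa> :: 'f fock_op))" by (rule red_v)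
 ultimately show ?thesis using K_v by (simp add: ctup_def Psi_gen)
qed

end

section \<open>Generators of the orthogonal group\<close>

definition tor :: "nat => nat => 'f::field => 'f mat" where
 "tor n i a = mat (2*n+1) (2*n+1) (%(r, s). if r = s then (if r = i then a else if r = n + i then inverse a else 1) else 0)"

lemma tor_carrier [simp]: "tor n i a : cmat n" "tor n i a : carrier_mat (Suc (2*n)) (Suc (2*n))"
 by (auto simp: tor_def)

lemma tor_vec:
 assumes "x : cvec n"
 shows "tor n i a *\<^sub>v x = vec (2*n+1) (%r. (if r = i then a else if r = n + i then inverse a else 1)*x $ r)"
proof (rule eq_vecI)
 fix r assume "r < dim_vec (vec (2*n+1) (%r. (if r = i then a else if r = n + i then inverse a else 1)*x $ r))"
 then have r: "r < 2*n+1" by simp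
 have "(tor n i a *\<^sub>v x) $ r = (\<Sum>s\<in>{0..<2*n+1}. if s = r then (if r = i then a else if r = n + i then inverse a else 1)*x $ r else 0)"
 proof -
  have "(tor n i a *\<^sub>v x) $ r = (\<Sum>s\<in>{0..<2*n+1}. tor n i a $$ (r, s)*x $ s)"
   using r assms carrier_matD[OF tor_carrier(2)[of n i a]] by (simp add: scalar_prod_def)
  also have "... = (\<Sum>s\<in>{0..<2*n+1}. if s = r then (if r = i then a else if r = n + i then inverse a else 1)*x $ r else 0)"
   by (rule sum.cong[OF refl]) (use r in \<open>auto simp: tor_def\<close>)
  finally show ?thesis .
 qed
 then show "(tor n i a *\<^sub>v x) $ r = vec (2*n+1) (%r. (if r = i then a else if r = n + i then inverse a else 1)*x $ r) $ r"
  using r by simp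
qed (simp add: tor_def)

lemma mult_unit_vec_index: "A : carrier_mat N N ==> r < N ==> s < N ==> (A *\<^sub>v unit_vec N s) $ r = (A $$ (r, s) :: 'f::field)"
 by (simp add: scalar_prod_right_unit[of _ N])

lemma mat_eq_vecI:
 assumes "A : carrier_mat N N" "B : carrier_mat N N" "!!x. x : carrier_vec N ==> A *\<^sub>v x = B *\<^sub>v (x :: 'f::field vec)"
 shows "A = B"
proof (rule eq_matI)
 fix r s assume "r < dim_row B" "s < dim_col B"
 then have rs: "r < N" "s < N" using assms(2) by auto
 show "A $$ (r, s) = B $$ (r, s)"
  unfolding mult_unit_vec_index[OF assms(1) rs, symmetric] mult_unit_vec_index[OF assms(2) rs, symmetric] using assms(3)[of "unit_vec N s"] by simp
qed (use assms in auto)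

lemma mat_vec_unit_eqI:
 assumes "A : carrier_mat N N" "B : carrier_mat N N" "!!s. s < N ==> A *\<^sub>v unit_vec N s = B *\<^sub>v (unit_vec N s :: 'f::field vec)"
 shows "A = B"
proof (rule eq_matI)
 fix r s assume "r < dim_row B" "s < dim_col B"
 then have rs: "r < N" "s < N" using assms(2) by auto
 show "A $$ (r, s) = B $$ (r, s)"
  unfolding mult_unit_vec_index[OF assms(1) rs, symmetric] mult_unit_vec_index[OF assms(2) rs, symmetric] using assms(3)[OF rs(2)] by simp
qed (use assms in auto)

lemma SO_carrier: "A : carrier (SO n) \<longleftrightarrow> A : cmat n & det A = 1 \<and>
  (\<forall>x\<in>cvec n. qform n (A *\<^sub>v x) = qform n x)"
 and SO_mult: "A \<otimes>\<^bsub>SO n\<^esub> B = A*B" and SO_one: "\<one>\<^bsub>SO n\<^esub> = 1\<^sub>m (2*n+1)"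
 by (simp_all add: SO_def)

lemma SO_closed: "A : carrier (SO n) ==> B : carrier (SO n) ==> A*B : carrier (SO n)"
 unfolding SO_carrier
 by (auto simp: det_mult[of A "2*n+1"] assoc_mult_mat_vec[of A "2*n+1" "2*n+1" B "2*n+1"])

lemma tor_mult: "tor n i a*tor n i b = tor n i (a*b)"
proof (rule mat_eq_vecI[of _ "2*n+1"])
 fix x :: "'a vec" assume x: "x : cvec n"
 have "tor n i a*tor n i b *\<^sub>v x = tor n i a *\<^sub>v (tor n i b *\<^sub>v x)"
  using x by (intro assoc_mult_mat_vec[of _ "2*n+1" "2*n+1" _ "2*n+1"]) auto
 also have "... = tor n i (a*b) *\<^sub>v x"
  using x by (auto simp: tor_vec intro!: eq_vecI)
 finally show "tor n i a*tor n i b *\<^sub>v x = tor n i (a*b) *\<^sub>v x" .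
qed (use mult_carrier_mat[OF tor_carrier(2)[of n i a] tor_carrier(2)[of n i b]] in auto)

lemma tor_one: "i < n ==> tor n i 1 = 1\<^sub>m (2*n+1)"
 by (rule eq_matI) (auto simp: tor_def)

lemma qform_tor: "i < n ==> a ~= 0 ==> x : cvec n ==> qform n (tor n i a *\<^sub>v x) = qform n x"
 unfolding qform_def tor_vec by (intro arg_cong2[of _ _ _ _ "(+)"] sum.cong) auto

lemma det_tor:
 assumes "i < n" "a ~= 0"
 shows "det (tor n i a) = 1"
proof -
 let ?h = "%r. if r = i then a else if r = n + i then inverse a else 1"
 have "upper_triangular (tor n i a)" by (auto simp: tor_def)
 then have "det (tor n i a) = prod_list (diag_mat (tor n i a))" by (rule det_upper_triangular[OF _ tor_carrier(1)])
 also have "... = (\<Prod>r\<in>{0..<2*n+1}. ?h r)"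
  unfolding prod_list_diag_prod by (intro prod.cong) (auto simp: tor_def)
 also have "... = (\<Prod>r\<in>{i, n + i}. ?h r)"
  using assms by (intro prod.mono_neutral_right) auto
 also have "... = 1" using assms by simp
 finally show ?thesis .
qed

lemma tor_SO: "i < n ==> a ~= 0 ==> tor n i a : carrier (SO n)"
 by (simp add: SO_carrier det_tor qform_tor[simplified])

context char2
begin

lemma add_self_left [simp]: "x + (x + y) = (y :: 'f)"
 by (metis add.assoc add.left_neutral add_self)

lemma bcov_du: "a ~= 2*n ==> bcov n a x = (x $ du n a :: 'f)"
 by (simp add: bcov_def bw_def)

lemma root_of_pair:
 assumes "p < 2*n+1" "q < 2*n+1" "p ~= q" "q ~= du n p"
 shows "\<exists>\<alpha>\<in>roots n. root_pair n \<alpha> = (p, q) \<or> root_pair n \<alpha> = (q, p)"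
proof -
 have main: "\<exists>\<alpha>\<in>roots n. root_pair n \<alpha> = (p, q) \<or> root_pair n \<alpha> = (q, p)"
  if "p < q" "q < 2*n+1" "q ~= du n p" for p q
 proof -
  have "q < n \<or> (p < n & n \<le> q & q < 2*n) \<or> (n \<le> p & q < 2*n) \<or> (p < n & q = 2*n) \<or> (n \<le> p & q = 2*n)"
   using that(1,2) by arith
  then consider "q < n" | "p < n" "n \<le> q" "q < 2*n" | "n \<le> p" "q < 2*n" | "p < n" "q = 2*n" | "n \<le> p" "q = 2*n"
   by blast
  then show ?thesis
  proof cases
   case 1
   then show ?thesis using that by (intro bexI[of _ "Plus p q"]) (auto simp: roots_def)
  next
   case 2
   then have "p ~= q - n" "q - n < n" using that by (auto simp: du_def)
   then show ?thesis using 2 by (intro bexI[of _ "Diff p (q - n)"]) (auto simp: roots_def)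
  next
   case 3
   then show ?thesis using that by (intro bexI[of _ "Minus (p - n) (q - n)"]) (auto simp: roots_def)
  next
   case 4
   then show ?thesis by (intro bexI[of _ "Short p"]) (auto simp: roots_def)
  next
   case 5
   then show ?thesis using that by (intro bexI[of _ "NegShort (p - n)"]) (auto simp: roots_def)
  qed
 qed
 show ?thesis
 proof (cases "p < q")
  case True
  then show ?thesis using main assms by blast
 next
  case False
  then have "q < p" "p ~= du n q" using assms by (auto simp: du_du)
  then show ?thesis using main[of q p] assms by blast
 qed
qed

text \<open>The formula for a root element is symmetric in the two indices, so the elimination below
  need not know which kind of root a pair of indices gives.\<close>

lemma pair_elem:
 assumes "p < 2*n+1" "q < 2*n+1" "p ~= q" "q ~= du n p"
 obtains \<alpha> where "\<alpha> : roots n"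
  "!!t x. x : cvec n ==> root_elem n \<alpha> t *\<^sub>v x = x + (t*bcov n q x + (if q = 2*n then t\<^sup>2*bcov n p x else 0)) \<cdot>\<^sub>v uv n p
  + (t*bcov n p x + (if p = 2*n then t\<^sup>2*bcov n q x else 0)) \<cdot>\<^sub>v uv n q"
proof -
 obtain \<alpha> where \<alpha>: "\<alpha> : roots n" "root_pair n \<alpha> = (p, q) \<or> root_pair n \<alpha> = (q, p)" using root_of_pair[OF assms] by blast
 show ?thesis
 proof (rule that[OF \<alpha>(1)])
  fix t and x :: "'f vec" assume x: "x : cvec n"
  from \<alpha>(2) show "root_elem n \<alpha> t *\<^sub>v x = x + (t*bcov n q x + (if q = 2*n then t\<^sup>2*bcov n p x else 0)) \<cdot>\<^sub>v uv n p
   + (t*bcov n p x + (if p = 2*n then t\<^sup>2*bcov n q x else 0)) \<cdot>\<^sub>v uv n q"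
  proof
   assume r: "root_pair n \<alpha> = (q, p)"
   show ?thesis unfolding root_elem_vec[OF \<alpha>(1) r x] using x by (auto intro!: eq_vecI simp: add_ac)
  qed (rule root_elem_vec[OF \<alpha>(1) _ x])
 qed
qed

lemma qform_root_elem:
 assumes "\<alpha> : roots n" "x : cvec n"
 shows "qform n (root_elem n \<alpha> t *\<^sub>v x) = (qform n x :: 'f)"
proof -
 obtain a b where ab: "root_pair n \<alpha> = (a, b)" by fastforce
 note bd = root_pair_bounds[OF assms(1) ab]
 have qadd: "qform n (x + c \<cdot>\<^sub>v uv n j) = qform n x + c*bcov n j x + (if j = 2*n then c\<^sup>2 else 0)"
  if xj: "x : cvec n" "j < 2*n+1" for x c j
 proof -
  have "bilform n x (c \<cdot>\<^sub>v uv n j) = c*bcov n j x"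
  proof -
   have "bilform n x (c \<cdot>\<^sub>v uv n j) = (\<Sum>i<n. x $ i*(c \<cdot>\<^sub>v uv n j) $ (n + i) + (c \<cdot>\<^sub>v uv n j) $ i*x $ (n + i)) + 2*x $ (2*n)*(c \<cdot>\<^sub>v uv n j) $ (2*n)"
    using xj by (simp add: bilform_def qform_def algebra_simps power2_eq_square sum.distrib two_zero)
   also have "... = (\<Sum>i<n. (if j = n + i then c*x $ i else 0) + (if j = i then c*x $ (n + i) else 0))"
    unfolding two_zero mult_zero_left add_0_right by (rule sum.cong[OF refl]) (use xj in auto)
   also have "... = c*bcov n j x"
   proof -
    consider "j < n" | l where "j = n + l" "l < n" | "j = 2*n" using site_cases[OF xj(2)] by blast
    then show ?thesis
    proof cases
     case 1
     then have "(\<Sum>i<n. (if j = n + i then c*x $ i else 0) + (if j = i then c*x $ (n + i) else 0)) = (\<Sum>i<n. if i = j then c*x $ (n + j) else 0)"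
      by (intro sum.cong refl) auto
     then show ?thesis using 1 by (simp add: bcov_du du_def)
    next
     case 2
     then have "(\<Sum>i<n. (if j = n + i then c*x $ i else 0) + (if j = i then c*x $ (n + i) else 0)) = (\<Sum>i<n. if i = l then c*x $ l else 0)"
      by (intro sum.cong refl) auto
     then show ?thesis using 2 by (simp add: bcov_du du_def)
    next
     case 3
     then show ?thesis by (simp add: bcov_last)
    qed
   qed
   finally show ?thesis .
  qed
  moreover have "qform n (c \<cdot>\<^sub>v uv n j) = (if j = 2*n then c\<^sup>2 else 0)"
   using xj by (auto simp: qform_def intro!: sum.neutral)
  moreover have "qform n (x + w) = bilform n x w + qform n x + qform n w" for w :: "'f vec"
  proof -
   have "a = a - b - d + b + d" for a b d :: 'f by (simp only: diff_eq_add) (simp add: add_ac)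
   then show ?thesis unfolding bilform_def .
  qed
  ultimately show ?thesis by (simp only: add_ac)
 qed
 have cv: "x + c \<cdot>\<^sub>v uv n j : cvec n" for c j using assms(2) by simp
 have bc: "bcov n b (x + c \<cdot>\<^sub>v uv n a) = bcov n b x" for c
 proof (cases "b = 2*n")
  case False
  have "du n b ~= a" using bd bm_du[of b n a] False by (auto simp: bw_def split: if_splits)
  moreover have "du n b < 2*n+1" by (rule du_bound[OF bd(2)])
  ultimately show ?thesis using assms(2) False bd(1) by (simp add: bcov_du)
 qed (simp add: bcov_last)
 have ab2: "\<not> (a = 2*n & b = 2*n)" using bd by simp
 show ?thesis
  unfolding root_elem_vec[OF assms(1) ab assms(2)] qadd[OF cv bd(2)] qadd[OF assms(2) bd(1)] bc
  using ab2 bcov_last[of n x] by (cases "a = 2*n"; cases "b = 2*n") (simp_all add: algebra_simps power2_eq_square two_zero)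
qed

lemma root_elem_sq:
 assumes "\<alpha> : roots n"
 shows "root_elem n \<alpha> t*root_elem n \<alpha> t = (1\<^sub>m (2*n+1) :: 'f mat)"
proof (rule mat_eq_vecI[of _ "2*n+1"])
 obtain a b where ab: "root_pair n \<alpha> = (a, b)" by fastforce
 note bd = root_pair_bounds[OF assms(1) ab]
 fix x :: "'f vec" assume x: "x : cvec n"
 let ?c = "t*bcov n b x + (if b = 2*n then t\<^sup>2*bcov n a x else 0)" and ?d = "t*bcov n a x + (if a = 2*n then t\<^sup>2*bcov n b x else 0)"
 let ?y = "x + ?c \<cdot>\<^sub>v uv n a + ?d \<cdot>\<^sub>v uv n b"
 have y: "?y : cvec n" using x by simp
 have d: "j ~= 2*n ==> du n j ~= j" if "j < 2*n+1" for j using that by (auto simp: du_def)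
 have e: "bcov n a ?y = bcov n a x" "bcov n b ?y = bcov n b x"
 proof -
  have du: "du n a ~= b" "du n b ~= a" if "a ~= 2*n \<or> b ~= 2*n" using bd bm_du[of a n b] bm_du[of b n a] by (auto simp: bw_def split: if_splits)
  show "bcov n a ?y = bcov n a x" using d[OF bd(1)] bd(1,2) du du_bound[OF bd(1)] x bcov_last[of n] by (cases "a = 2*n") (auto simp: bcov_du)
  show "bcov n b ?y = bcov n b x" using d[OF bd(2)] bd(1,2) du du_bound[OF bd(2)] x bcov_last[of n] by (cases "b = 2*n") (auto simp: bcov_du)
 qed
 have "root_elem n \<alpha> t*root_elem n \<alpha> t *\<^sub>v x = root_elem n \<alpha> t *\<^sub>v (root_elem n \<alpha> t *\<^sub>v x)"
  using x by (intro assoc_mult_mat_vec[of _ "2*n+1" "2*n+1" _ "2*n+1"]) auto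
 also have "... = ?y + ?c \<cdot>\<^sub>v uv n a + ?d \<cdot>\<^sub>v uv n b"
  unfolding root_elem_vec[OF assms ab x] root_elem_vec[OF assms ab y] e ..
 also have "... = x"
 proof -
  have "x + c \<cdot>\<^sub>v uv n a + d \<cdot>\<^sub>v uv n b + c \<cdot>\<^sub>v uv n a + d \<cdot>\<^sub>v uv n b = x" for c d
   using x by (intro eq_vecI) (auto simp: add_ac)
  then show ?thesis .
 qed
 finally show "root_elem n \<alpha> t*root_elem n \<alpha> t *\<^sub>v x = 1\<^sub>m (2*n+1) *\<^sub>v x" using x by simp
qed (use mult_carrier_mat[OF root_elem_carrier(2)[of n \<alpha> t] root_elem_carrier(2)[of n \<alpha> t]] in auto)

text \<open>By \<open>root_elem_sq\<close> the determinant has square 1, and in characteristic 2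
  this forces it to be 1.\<close>

lemma root_elem_SO:
 assumes "\<alpha> : roots n"
 shows "root_elem n \<alpha> (t :: 'f) : carrier (SO n)"
proof -
 have "det (root_elem n \<alpha> t)*det (root_elem n \<alpha> t) = (1 :: 'f)"
  using det_mult[OF root_elem_carrier(1)[of n \<alpha> t] root_elem_carrier(1)[of n \<alpha> t]] root_elem_sq[OF assms, of t] by simp
 then have "(det (root_elem n \<alpha> t) + 1)*(det (root_elem n \<alpha> t) + 1) = (0 :: 'f)"
  by (simp add: algebra_simps)
 then have "det (root_elem n \<alpha> t) = (1 :: 'f)" by (simp add: add_eq_0_iff2)
 then show ?thesis using qform_root_elem[OF assms] by (simp add: SO_carrier)
qed

inductive_set so_gen :: "nat => 'f mat set" for n where
 so_one: "1\<^sub>m (2*n+1) : so_gen n"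
| so_root: "g : so_gen n ==> \<alpha> : roots n ==> root_elem n \<alpha> t*g : so_gen n"
| so_tor: "g : so_gen n ==> i < n ==> a ~= 0 ==> tor n i a*g : so_gen n"

text \<open>Inverses of generators are generators, so a factor on the left can be removed
  again.\<close>

lemma so_gen_back:
 assumes "g : cmat n"
 shows "\<alpha> : roots n ==> root_elem n \<alpha> t*g : so_gen n ==> g : so_gen n"
  "i < n ==> a ~= 0 ==> tor n i a*g : so_gen n ==> g : so_gen n"
proof -
 assume r: "\<alpha> : roots n" "root_elem n \<alpha> t*g : so_gen n"
 have "root_elem n \<alpha> t*(root_elem n \<alpha> t*g) = (root_elem n \<alpha> t*root_elem n \<alpha> t)*g"
  using assms by (intro assoc_mult_mat[symmetric, of _ "2*n+1" "2*n+1" _ "2*n+1" _ "2*n+1"]) auto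
 also have "... = g" unfolding root_elem_sq[OF r(1)] using assms by (rule left_mult_one_mat)
 finally show "g : so_gen n" using so_root[OF r(2,1), of t] by simp
next
 assume r: "i < n" "a ~= 0" "tor n i a*g : so_gen n"
 have "tor n i (inverse a)*(tor n i a*g) = (tor n i (inverse a)*tor n i a)*g"
  using assms by (intro assoc_mult_mat[symmetric, of _ "2*n+1" "2*n+1" _ "2*n+1" _ "2*n+1"]) auto
 also have "... = g" unfolding tor_mult using r(1,2) assms tor_one[OF r(1), where 'a='f] left_mult_one_mat[OF assms] by simp
 finally show "g : so_gen n" using so_tor[OF r(3,1), of "inverse a"] r(2) by simp
qed

end

section \<open>Gaussian elimination in the orthogonal group\<close>

context char2
begin

text \<open>An admissible factor of a reduction: \<open>g\<close> is generated as soon as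
  \<open>E*g\<close> is. This form replaces closure of the generated set under products and
  inverses.\<close>

definition elim_mat :: "nat => 'f mat => bool" where
 "elim_mat n E \<longleftrightarrow> E : carrier (SO n) & (\<forall>g\<in>cmat n. E*g : so_gen n --> g : so_gen n)"

lemma SO_mat: "g : carrier (SO n) ==> g : cmat n"
 by (simp add: SO_carrier)

lemma mult_vec: "A : cmat n ==> B : cmat n ==>
  x : cvec n ==> A*B *\<^sub>v x = A *\<^sub>v (B *\<^sub>v (x :: 'f vec))"
 by (rule assoc_mult_mat_vec)

lemma elim_root: "\<alpha> : roots n ==> elim_mat n (root_elem n \<alpha> t)"
 using so_gen_back(1)[of _ n \<alpha> t] root_elem_SO[of \<alpha> n t] by (simp add: elim_mat_def)

lemma elim_tor: "i < n ==> a ~= 0 ==> elim_mat n (tor n i a)"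
 using so_gen_back(2)[of _ n i a] tor_SO[of i n a] by (simp add: elim_mat_def)

lemma elim_one: "elim_mat n (1\<^sub>m (2*n+1))"
 by (auto simp: elim_mat_def SO_carrier)

lemma elim_mult: "elim_mat n E ==> elim_mat n E' ==> elim_mat n (E*E')"
proof -
 assume E: "elim_mat n E" "elim_mat n E'"
 then have c: "E : cmat n" "E' : cmat n" by (auto simp: elim_mat_def SO_carrier)
 have "g : so_gen n" if g: "g : cmat n" "E*E'*g : so_gen n" for g
 proof -
  have "E*(E'*g) : so_gen n" using assoc_mult_mat[OF c g(1)] g(2) by simp
  moreover have "E'*g : cmat n" by (rule mult_carrier_mat[OF c(2) g(1)])
  ultimately have "E'*g : so_gen n" using E(1) by (simp add: elim_mat_def)
  then show ?thesis using E(2) g(1) by (simp add: elim_mat_def)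
 qed
 then show ?thesis using E SO_closed[of E n E'] by (auto simp: elim_mat_def)
qed

lemma du_lt: "c < 2*n ==> du n c < 2*n" "c < 2*n ==> du n c ~= c" "du n (2*n) = 2*n"
 by (auto simp: du_def)

text \<open>The root element for the indices \<open>l\<close> and \<open>du n c\<close>, with
  parameter \<open>u $ l\<close>, cancels the coordinate at \<open>l\<close> against the pivot 1 at
  \<open>c\<close>; apart from that it changes only the coordinate dual to the pivot. The last claim
  protects vectors that are already normalized.\<close>

lemma clear_step:
 assumes "c < 2*n" "l < 2*n+1" "l ~= c" "l ~= du n c" "u : cvec n" "u $ c = (1 :: 'f)"
 obtains E where "elim_mat n E" "(E *\<^sub>v u) $ l = 0"
  "!!r. r < 2*n+1 ==> r ~= l ==> r ~= du n c ==> (E *\<^sub>v u) $ r = u $ r"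
  "!!x. x : cvec n ==> x $ c = 0 ==> u $ l = 0 \<or> l = 2*n \<or> x $ du n l = 0 ==> E *\<^sub>v x = x"
proof -
 let ?q = "du n c"
 have q: "?q < 2*n" "?q ~= 2*n" using du_lt(1)[OF assms(1)] by auto
 have ql: "?q ~= du n l" using assms(3) du_du by metis
 have q1: "?q < 2*n+1" using q by simp
 obtain \<alpha> where \<alpha>: "\<alpha> : roots n"
  "!!t x. x : cvec n ==> root_elem n \<alpha> t *\<^sub>v x = x + (t*bcov n ?q x + (if ?q = 2*n then t\<^sup>2*bcov n l x else 0)) \<cdot>\<^sub>v uv n l
  + (t*bcov n l x + (if l = 2*n then t\<^sup>2*bcov n ?q x else 0)) \<cdot>\<^sub>v uv n ?q"
  using pair_elem[OF assms(2) q1 assms(4) ql] by metis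
 have bq: "bcov n ?q x = x $ c" for x :: "'f vec" using q by (simp add: bcov_du)
 let ?E = "root_elem n \<alpha> (u $ l)"
 show ?thesis
 proof (rule that[of ?E])
  show "elim_mat n ?E" by (rule elim_root[OF \<alpha>(1)])
  show "(?E *\<^sub>v u) $ l = 0" unfolding \<alpha>(2)[OF assms(5)] bq using assms q by simp
  show "(?E *\<^sub>v u) $ r = u $ r" if "r < 2*n+1" "r ~= l" "r ~= du n c" for r
   unfolding \<alpha>(2)[OF assms(5)] bq using assms q that by simp
  show "?E *\<^sub>v x = x" if x: "x : cvec n" "x $ c = 0" "u $ l = 0 \<or> l = 2*n \<or> x $ du n l = 0" for x
  proof -
   have "u $ l*bcov n l x = 0" using x(3) by (cases "l = 2*n") (auto simp: bcov_last bcov_du)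
   then show ?thesis unfolding \<alpha>(2)[OF x(1)] bq using x(1,2) q by (auto intro!: eq_vecI)
  qed
 qed
qed

lemma clear_list:
 assumes "c < 2*n" "distinct ls" "!!l. l : set ls ==> l < 2*n+1 & l ~= c & l ~= du n c"
  "u : cvec n" "u $ c = (1 :: 'f)"
  "!!x. x : Fx ==> x : cvec n & x $ c = 0 & (\<forall>l\<in>set ls. u $ l = 0 \<or> l = 2*n \<or> x $ du n l = 0)"
 shows "\<exists>E. elim_mat n E & (\<forall>l\<in>set ls. (E *\<^sub>v u) $ l = 0) & (\<forall>x\<in>Fx. E *\<^sub>v x = x) \<and>
  (\<forall>r<2*n+1. r ~: set ls --> r ~= du n c --> (E *\<^sub>v u) $ r = u $ r)"
 using assms(2-6)
proof (induct ls arbitrary: u)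
 case Nil
 then show ?case using elim_one by (intro exI[of _ "1\<^sub>m (2*n+1)"]) auto
next
 case (Cons l ls)
 have l: "l < 2*n+1" "l ~= c" "l ~= du n c" "l ~: set ls" "distinct ls" using Cons.prems by auto
 obtain E where E: "elim_mat n E" "(E *\<^sub>v u) $ l = 0"
  "!!r. r < 2*n+1 ==> r ~= l ==> r ~= du n c ==> (E *\<^sub>v u) $ r = u $ r"
  "!!x. x : cvec n ==> x $ c = 0 ==> u $ l = 0 \<or> l = 2*n \<or> x $ du n l = 0 ==> E *\<^sub>v x = x"
  by (rule clear_step[OF assms(1) l(1-3) Cons.prems(3,4)]) metis
 have Ec: "E : cmat n" using E(1) by (simp add: elim_mat_def SO_carrier)
 let ?u = "E *\<^sub>v u"
 have u: "?u : cvec n" by (rule mult_mat_vec_carrier[OF Ec Cons.prems(3)])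
 have uc: "?u $ c = 1" using E(3)[of c] l du_lt(2)[OF assms(1)] assms(1) Cons.prems(4) by simp
 have ul: "?u $ r = u $ r" if "r : set ls" for r using E(3)[of r] Cons.prems(2)[of r] l that by auto
 have "\<exists>E'. elim_mat n E' & (\<forall>l\<in>set ls. (E' *\<^sub>v ?u) $ l = 0) & (\<forall>x\<in>Fx. E' *\<^sub>v x = x) \<and>
  (\<forall>r<2*n+1. r ~: set ls --> r ~= du n c --> (E' *\<^sub>v ?u) $ r = ?u $ r)"
 proof (rule Cons.hyps[OF l(5) _ u uc])
  show "l < 2*n+1 & l ~= c & l ~= du n c" if "l : set ls" for l using Cons.prems(2) that by simp
  show "x : cvec n & x $ c = 0 & (\<forall>l\<in>set ls. ?u $ l = 0 \<or> l = 2*n \<or> x $ du n l = 0)" if "x : Fx" for x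
   using Cons.prems(5)[OF that] ul by simp
 qed
 then obtain E' where E': "elim_mat n E'" "\<forall>l\<in>set ls. (E' *\<^sub>v ?u) $ l = 0" "\<forall>x\<in>Fx. E' *\<^sub>v x = x"
  "\<forall>r<2*n+1. r ~: set ls --> r ~= du n c --> (E' *\<^sub>v ?u) $ r = ?u $ r" by blast
 have Ec': "E' : cmat n" using E'(1) by (simp add: elim_mat_def SO_carrier)
 have m: "E'*E *\<^sub>v x = E' *\<^sub>v (E *\<^sub>v x)" if "x : cvec n" for x by (rule mult_vec[OF Ec' Ec that])
 show ?case
 proof (intro exI[of _ "E'*E"] conjI ballI allI impI)
  show "elim_mat n (E'*E)" by (rule elim_mult[OF E'(1) E(1)])
  show "(E'*E *\<^sub>v u) $ r = 0" if "r : set (l # ls)" for r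
   unfolding m[OF Cons.prems(3)] using that E'(2,4) E(2) l by auto
  show "E'*E *\<^sub>v x = x" if "x : Fx" for x
   using Cons.prems(5)[OF that] E(4)[of x] E'(3) m[of x] that by simp
  show "(E'*E *\<^sub>v u) $ r = u $ r" if "r < 2*n+1" "r ~: set (l # ls)" "r ~= du n c" for r
   unfolding m[OF Cons.prems(3)] using that E'(4) E(3)[of r] by simp
 qed
qed

lemma bilform_SO:
 assumes "g : carrier (SO n)" "x : cvec n" "y : cvec n"
 shows "bilform n (g *\<^sub>v x) (g *\<^sub>v y) = bilform n x (y :: 'f vec)"
proof -
 have q: "qform n (g *\<^sub>v z) = qform n z" if "z : cvec n" for z using assms(1) that by (simp add: SO_carrier)
 have s: "g *\<^sub>v x + g *\<^sub>v y = g *\<^sub>v (x + y)" by (rule mult_add_distrib_mat_vec[OF SO_mat[OF assms(1)] assms(2,3), symmetric])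
 show ?thesis unfolding bilform_def s q[OF assms(2)] q[OF assms(3)] q[OF add_carrier_vec[OF assms(2,3)]] ..
qed

lemma bilform_uv:
 assumes "x : cvec n" "j < 2*n"
 shows "bilform n x (uv n j) = (x $ du n j :: 'f)"
 using bilform_unit(1)[OF assms(1), of j] assms(2) by (simp add: bcov_du)

definition fixes_below :: "nat => nat => 'f mat => bool" where
 "fixes_below n m g \<longleftrightarrow> (\<forall>j<m. g *\<^sub>v uv n j = uv n j & g *\<^sub>v uv n (n + j) = uv n (n + j))"

text \<open>This coordinate is the bilinear form with the fixed basis vector, which an isometry
  preserves.\<close>

lemma fixed_coord:
 assumes "g : carrier (SO n)" "j < 2*n" "g *\<^sub>v uv n j = uv n j" "x : cvec n"
 shows "(g *\<^sub>v x) $ du n j = (x $ du n j :: 'f)"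
proof -
 have c: "g *\<^sub>v x : cvec n" by (rule mult_mat_vec_carrier[OF SO_mat[OF assms(1)] assms(4)])
 have "(g *\<^sub>v x) $ du n j = bilform n (g *\<^sub>v x) (g *\<^sub>v uv n j)" unfolding assms(3) by (rule bilform_uv[OF c assms(2), symmetric])
 also have "... = x $ du n j" unfolding bilform_SO[OF assms(1,4) unit_vec_carrier] by (rule bilform_uv[OF assms(4,2)])
 finally show ?thesis .
qed

lemma fixes_below_coord:
 assumes "g : carrier (SO n)" "fixes_below n m g" "m \<le> n" "j < m" "x : cvec n"
 shows "(g *\<^sub>v x) $ j = (x $ j :: 'f)" "(g *\<^sub>v x) $ (n + j) = (x $ (n + j) :: 'f)"
 using fixed_coord[OF assms(1), of "n + j" x] fixed_coord[OF assms(1), of j x] assms by (auto simp: fixes_below_def du_def)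

lemma qform_two:
 assumes "x : cvec n" "m < n" "!!r. r < 2*n+1 ==> r ~= m ==> r ~= n + m ==> x $ r = (0 :: 'f)"
 shows "qform n x = x $ m*x $ (n + m)"
proof -
 have "(\<Sum>i<n. x $ i*x $ (n + i)) = (\<Sum>i<n. if i = m then x $ m*x $ (n + m) else 0)"
  by (rule sum.cong[OF refl]) (use assms in auto)
 then show ?thesis using assms by (simp add: qform_def)
qed

lemma qform_uv: "j < 2*n ==> qform n (uv n j) = (0 :: 'f)"
 by (auto simp: qform_def intro!: sum.neutral)

text \<open>All coordinates except the pivot and its dual are cleared. The dual coordinate cannot be
  cleared in this way, but it is zero at the end because the vector is singular.\<close>

lemma fix_step:
 assumes g: "g : carrier (SO n)" and m: "m < n" and c: "c = m \<or> c = n + m"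
  and Fx: "!!x. x : Fx ==> (\<exists>j<m. x = uv n j \<or> x = uv n (n + j)) \<or> x = uv n (du n c)"
  and fb: "fixes_below n m g" and one: "(g *\<^sub>v uv n c) $ c = (1 :: 'f)"
 shows "\<exists>E. elim_mat n E & (\<forall>x\<in>Fx. E *\<^sub>v x = x) & E *\<^sub>v (g *\<^sub>v uv n c) = uv n c"
proof -
 let ?u = "g *\<^sub>v uv n c"
 have c2: "c < 2*n" "du n c < 2*n" "du n c ~= c" and cd: "{c, du n c} = {m, n + m}" using c m by (auto simp: du_def)
 have u: "?u : cvec n" using SO_mat[OF g] by (intro mult_mat_vec_carrier) auto
 have u0: "?u $ j = 0" "?u $ (n + j) = 0" if "j < m" for j
  using fixes_below_coord[OF g fb _ that, of "uv n c"] that m c by auto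
 define ls where "ls = filter (%l. l ~= c & l ~= du n c) [0..<2*n+1]"
 have sls: "set ls = {l. l < 2*n+1 & l ~= c & l ~= du n c}" "distinct ls"
  unfolding ls_def by (auto simp only: set_filter set_upt distinct_filter distinct_upt atLeastLessThan_iff)
 have "\<exists>E. elim_mat n E & (\<forall>l\<in>set ls. (E *\<^sub>v ?u) $ l = 0) & (\<forall>x\<in>Fx. E *\<^sub>v x = x) \<and>
  (\<forall>r<2*n+1. r ~: set ls --> r ~= du n c --> (E *\<^sub>v ?u) $ r = ?u $ r)"
 proof (rule clear_list[OF c2(1) _ _ u one])
  show "x : cvec n & x $ c = 0 & (\<forall>l\<in>set ls. ?u $ l = 0 \<or> l = 2*n \<or> x $ du n l = 0)" if xF: "x : Fx" for x
  proof -
   obtain j where j: "x = uv n j" "j < 2*n" "j ~= c" "j = du n c \<or> ?u $ du n j = 0"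
    using Fx[OF xF] c2 u0 m c by (auto simp: du_def)
   have "?u $ l = 0 \<or> l = 2*n \<or> x $ du n l = 0" if l: "l : set ls" for l
   proof (cases "du n l = j")
    case True
    then have "l = du n j" using du_du by metis
    moreover have "l ~= c" using l unfolding sls by blast
    ultimately show ?thesis using j(4) du_du by metis
   next
    case False
    have "l < 2*n+1" using l unfolding sls by simp
    then show ?thesis using False j(1,2) du_bound[of l n] by simp
   qed
   then show ?thesis using j c2 by simp
  qed
 qed (auto simp: sls)
 then obtain E where E: "elim_mat n E" "\<forall>l\<in>set ls. (E *\<^sub>v ?u) $ l = 0" "\<forall>x\<in>Fx. E *\<^sub>v x = x"
  "\<forall>r<2*n+1. r ~: set ls --> r ~= du n c --> (E *\<^sub>v ?u) $ r = ?u $ r" by blast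
 let ?w = "E *\<^sub>v ?u"
 have Es: "E : carrier (SO n)" using E(1) by (simp add: elim_mat_def)
 have w: "?w : cvec n" by (rule mult_mat_vec_carrier[OF SO_mat[OF Es] u])
 have w0: "?w $ r = 0" if "r < 2*n+1" "r ~= c" "r ~= du n c" for r using E(2) that by (auto simp: sls)
 have wc: "?w $ c = 1" using E(4) c2 one by (auto simp: sls)
 have "qform n ?w = qform n ?u" using Es u by (simp add: SO_carrier)
 also have "... = qform n (uv n c)" using g by (simp add: SO_carrier)
 also have "... = 0" by (rule qform_uv[OF c2(1)])
 also have "qform n ?w = ?w $ m*?w $ (n + m)"
  by (rule qform_two[OF w m]) (use w0 cd in blast)
 finally have "?w $ du n c = 0" using wc c m by (auto simp: du_def)
 then have "?w = uv n c" using w w0 wc c2 carrier_matD(1)[OF SO_mat[OF Es]] by (intro eq_vecI) auto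
 then show ?thesis using E by blast
qed

text \<open>A root element makes coordinate \<open>m\<close> nonzero with the help of another
  nonzero coordinate, a short root being used if that one is dual to \<open>m\<close>; the torus
  then scales it to 1.\<close>

lemma pivot_step:
 assumes g: "g : carrier (SO n)" and m: "m < n" and fb: "fixes_below n m g"
 shows "\<exists>E. elim_mat n E & (\<forall>j<m. E *\<^sub>v uv n j = uv n j & E *\<^sub>v uv n (n + j) = uv n (n + j)) & (E *\<^sub>v (g *\<^sub>v uv n m)) $ m = (1 :: 'f)"
proof -
 let ?u = "g *\<^sub>v uv n m"
 have u: "?u : cvec n" using SO_mat[OF g] by (intro mult_mat_vec_carrier) auto
 have u0: "?u $ j = 0" "?u $ (n + j) = 0" if "j < m" for j
  using fixes_below_coord[OF g fb _ that, of "uv n m"] that m by auto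
 have "\<exists>E. elim_mat n E & (\<forall>j<m. E *\<^sub>v uv n j = uv n j & E *\<^sub>v uv n (n + j) = uv n (n + j)) & (E *\<^sub>v ?u) $ m ~= 0"
 proof (cases "?u $ m = 0")
  case False
  then show ?thesis using elim_one u by (intro exI[of _ "1\<^sub>m (2*n+1)"]) auto
 next
  case True
  \<comment> \<open>If only the last coordinate could be nonzero, singularity would make it zero
    too, and the image would not pair to 1 with that of the dual basis vector.\<close>
  have "\<exists>r<2*n. ?u $ r ~= 0"
  proof (rule ccontr)
   assume "\<not> ?thesis"
   then have z: "?u $ r = 0" if "r < 2*n" for r using that by blast
   have "qform n ?u = 0" using g qform_uv[of m n] m by (simp add: SO_carrier)
   then have "(?u $ (2*n))\<^sup>2 = 0" using z by (simp add: qform_def)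
   then have "?u = 0\<^sub>v (2*n+1)" using u z carrier_matD(1)[OF SO_mat[OF g]] by (intro eq_vecI) (auto simp: less_Suc_eq)
   then have "bilform n (g *\<^sub>v uv n m) (g *\<^sub>v uv n (n + m)) = (0 :: 'f)"
    using mult_mat_vec_carrier[OF SO_mat[OF g] unit_vec_carrier[of "2*n+1" "n + m"]] by (simp add: bilform_def qform_def)
   then have "bilform n (uv n m) (uv n (n + m)) = (0 :: 'f)" using bilform_SO[OF g, of "uv n m" "uv n (n + m)"] by simp
   moreover have "bilform n (uv n m) (uv n (n + m)) = uv n m $ du n (n + m)" by (rule bilform_uv) (use m in auto)
   ultimately show False using m by (simp add: du_def)
  qed
  then obtain r where r: "r < 2*n" "?u $ r ~= 0" by blast
  have rm: "r ~= m" using r True by auto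
  have rj: "r ~= j" "r ~= n + j" if "j < m" for j using u0[OF that] r(2) by auto
  show ?thesis
  proof (cases "r = n + m")
   case False
   have d: "du n r < 2*n" "m ~= du n r" "du n r ~= du n m" using du_lt(1)[OF r(1)] False rm m du_du by (auto simp: du_def split: if_splits)
   obtain \<alpha> where \<alpha>: "\<alpha> : roots n"
    "!!t x. x : cvec n ==> root_elem n \<alpha> t *\<^sub>v x = x + (t*bcov n (du n r) x + (if du n r = 2*n then t\<^sup>2*bcov n m x else 0)) \<cdot>\<^sub>v uv n m
    + (t*bcov n m x + (if m = 2*n then t\<^sup>2*bcov n (du n r) x else 0)) \<cdot>\<^sub>v uv n (du n r)"
    using pair_elem[of m n "du n r"] d m by (metis less_SucI mult_2 trans_less_add1 Suc_eq_plus1)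
   have b: "bcov n (du n r) x = x $ r" "bcov n m x = x $ (n + m)" for x :: "'f vec" using d m by (auto simp: bcov_du) (simp add: du_def)
   show ?thesis
   proof (intro exI[of _ "root_elem n \<alpha> 1"] conjI allI impI)
    show "elim_mat n (root_elem n \<alpha> 1)" by (rule elim_root[OF \<alpha>(1)])
    show "root_elem n \<alpha> 1 *\<^sub>v uv n j = uv n j" "root_elem n \<alpha> 1 *\<^sub>v uv n (n + j) = uv n (n + j)" if "j < m" for j
     unfolding \<alpha>(2)[OF unit_vec_carrier] b using d m r(1) rj[OF that] that by (auto intro!: eq_vecI)
    show "(root_elem n \<alpha> 1 *\<^sub>v ?u) $ m ~= 0" unfolding \<alpha>(2)[OF u] b using d m r True by simp
   qed
  next
   case e: True
   have \<alpha>: "Short m : roots n" "root_pair n (Short m) = (m, 2*n)" using m by (auto simp: roots_def)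
   have b: "bcov n (2*n) x = 0" "bcov n m x = x $ (n + m)" for x :: "'f vec" using m by (auto simp: bcov_du bcov_last) (simp add: du_def)
   show ?thesis
   proof (intro exI[of _ "root_elem n (Short m) 1"] conjI allI impI)
    show "elim_mat n (root_elem n (Short m) 1)" by (rule elim_root[OF \<alpha>(1)])
    show "root_elem n (Short m) 1 *\<^sub>v uv n j = uv n j" "root_elem n (Short m) 1 *\<^sub>v uv n (n + j) = uv n (n + j)" if "j < m" for j
     unfolding root_elem_vec[OF \<alpha> unit_vec_carrier] b using m that by (auto intro!: eq_vecI)
    show "(root_elem n (Short m) 1 *\<^sub>v ?u) $ m ~= 0" unfolding root_elem_vec[OF \<alpha> u] b using m r True e by simp
   qed
  qed
 qed
 then obtain E where E: "elim_mat n E" "\<forall>j<m. E *\<^sub>v uv n j = uv n j & E *\<^sub>v uv n (n + j) = uv n (n + j)" "(E *\<^sub>v ?u) $ m ~= 0" by blast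
 have Ec: "E : cmat n" using E(1) by (simp add: elim_mat_def SO_carrier)
 let ?a = "inverse ((E *\<^sub>v ?u) $ m)"
 have Eu: "E *\<^sub>v ?u : cvec n" by (rule mult_mat_vec_carrier[OF Ec u])
 have mv: "tor n m ?a*E *\<^sub>v x = tor n m ?a *\<^sub>v (E *\<^sub>v x)" if "x : cvec n" for x by (rule mult_vec[OF tor_carrier(1) Ec that])
 show ?thesis
 proof (intro exI[of _ "tor n m ?a*E"] conjI allI impI)
  show "elim_mat n (tor n m ?a*E)" using E m by (intro elim_mult elim_tor) auto
  show "tor n m ?a*E *\<^sub>v uv n j = uv n j" "tor n m ?a*E *\<^sub>v uv n (n + j) = uv n (n + j)" if "j < m" for j
   unfolding mv[OF unit_vec_carrier] using E(2) that m by (auto simp: tor_vec[simplified] intro!: eq_vecI)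
  show "(tor n m ?a*E *\<^sub>v ?u) $ m = 1" unfolding mv[OF u] tor_vec[OF Eu] using m E(3) by simp
 qed
qed

lemma fixes_below_mult:
 assumes "E : carrier (SO n)" "g : carrier (SO n)" "\<forall>j<m. E *\<^sub>v uv n j = uv n j & E *\<^sub>v uv n (n + j) = uv n (n + j)" "fixes_below n m g"
 shows "fixes_below n m (E*g)"
 using assms(3,4) by (auto simp: fixes_below_def mult_vec[OF SO_mat[OF assms(1)] SO_mat[OF assms(2)] unit_vec_carrier, simplified])

text \<open>Hyperbolic pairs are fixed one after another, the second vector of a pair without
  disturbing the first. Once all pairs are fixed, so is the last basis vector, because 1 is the only
  square root of 1.\<close>

lemma SO_generated:
 assumes "g : carrier (SO n)"
 shows "g : so_gen n"
proof -
 have "m \<le> n ==> g : carrier (SO n) ==> fixes_below n m g ==> g : so_gen n" for m and g :: "'f mat"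
 proof (induct "n - m" arbitrary: m g)
  case 0
  then have m: "m = n" by simp
  have gc: "g : cmat n" by (rule SO_mat[OF 0(3)])
  have lo: "g *\<^sub>v uv n j = uv n j" if "j < 2*n" for j
  proof (cases "j < n")
   case False
   then have "j = n + (j - n)" "j - n < n" using that by auto
   then show ?thesis using 0(4) m unfolding fixes_below_def by metis
  qed (use 0(4) m in \<open>simp add: fixes_below_def\<close>)
  let ?w = "g *\<^sub>v uv n (2*n)"
  have w: "?w : cvec n" using gc by (intro mult_mat_vec_carrier) auto
  have w0: "?w $ r = 0" if "r < 2*n" for r
   using fixed_coord[OF 0(3) du_lt(1)[OF that] lo[OF du_lt(1)[OF that]], of "uv n (2*n)"] that by (simp add: du_du)
  have "qform n ?w = qform n (uv n (2*n))" using 0(3) by (simp add: SO_carrier)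
  then have "(?w $ (2*n))\<^sup>2 = 1" using w0 by (simp add: qform_def)
  then have "(?w $ (2*n) + 1)*(?w $ (2*n) + 1) = 0" by (simp add: algebra_simps power2_eq_square)
  then have "?w $ (2*n) = 1" by (simp add: add_eq_0_iff2)
  then have w1: "?w = uv n (2*n)" using w w0 carrier_matD(1)[OF gc] by (intro eq_vecI) (auto simp: less_Suc_eq)
  have "g = 1\<^sub>m (2*n+1)"
  proof (rule mat_vec_unit_eqI[OF gc])
   fix s assume "s < 2*n+1"
   then show "g *\<^sub>v uv n s = 1\<^sub>m (2*n+1) *\<^sub>v uv n s" using lo[of s] w1 by (cases "s = 2*n") auto
  qed simp
  then show ?case using so_one by simp
 next
  case (Suc d)
  then have m: "m < n" by simp
  obtain E1 where E1: "elim_mat n E1" "\<forall>j<m. E1 *\<^sub>v uv n j = uv n j & E1 *\<^sub>v uv n (n + j) = uv n (n + j)" "(E1 *\<^sub>v (g *\<^sub>v uv n m)) $ m = 1"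
   using pivot_step[OF Suc(4) m Suc(5)] by blast
  have S1: "E1 : carrier (SO n)" using E1 by (simp add: elim_mat_def)
  let ?g1 = "E1*g"
  have g1: "?g1 : carrier (SO n)" "fixes_below n m ?g1" by (rule SO_closed[OF S1 Suc(4)], rule fixes_below_mult[OF S1 Suc(4) E1(2) Suc(5)])
  have one: "(?g1 *\<^sub>v uv n m) $ m = 1" using E1(3) mult_vec[OF SO_mat[OF S1] SO_mat[OF Suc(4)] unit_vec_carrier] by simp
  let ?F = "{x. \<exists>j<m. x = uv n j \<or> x = uv n (n + j)}"
  obtain E2 where E2: "elim_mat n E2" "\<forall>x\<in>?F. E2 *\<^sub>v x = x" "E2 *\<^sub>v (?g1 *\<^sub>v uv n m) = uv n m"
   using fix_step[OF g1(1) m disjI1[OF refl] _ g1(2) one, of ?F] by blast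
  have S2: "E2 : carrier (SO n)" using E2 by (simp add: elim_mat_def)
  let ?g2 = "E2*?g1"
  have E2': "\<forall>j<m. E2 *\<^sub>v uv n j = uv n j & E2 *\<^sub>v uv n (n + j) = uv n (n + j)" using E2(2) by blast
  have g2: "?g2 : carrier (SO n)" "fixes_below n m ?g2" by (rule SO_closed[OF S2 g1(1)], rule fixes_below_mult[OF S2 g1(1) E2' g1(2)])
  have f2: "?g2 *\<^sub>v uv n m = uv n m" using E2(3) mult_vec[OF SO_mat[OF S2] SO_mat[OF g1(1)] unit_vec_carrier] by simp
  \<comment> \<open>No pivot has to be created for the dual vector: its pairing with the fixed
    vector is already 1.\<close>
  have one2: "(?g2 *\<^sub>v uv n (n + m)) $ (n + m) = 1"
   using fixed_coord[OF g2(1) _ f2, of "uv n (n + m)"] m by (simp add: du_def)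
  let ?F2 = "insert (uv n m) ?F"
  obtain E3 where E3: "elim_mat n E3" "\<forall>x\<in>?F2. E3 *\<^sub>v x = x" "E3 *\<^sub>v (?g2 *\<^sub>v uv n (n + m)) = uv n (n + m)"
  proof -
   have "du n (n + m) = m" using m by (simp add: du_def)
   then show ?thesis using fix_step[OF g2(1) m disjI2[OF refl] _ g2(2) one2, of ?F2] that by auto
  qed
  have S3: "E3 : carrier (SO n)" using E3 by (simp add: elim_mat_def)
  let ?g3 = "E3*?g2"
  have E3': "\<forall>j<m. E3 *\<^sub>v uv n j = uv n j & E3 *\<^sub>v uv n (n + j) = uv n (n + j)" using E3(2) by blast
  have g3: "?g3 : carrier (SO n)" "fixes_below n m ?g3" by (rule SO_closed[OF S3 g2(1)], rule fixes_below_mult[OF S3 g2(1) E3' g2(2)])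
  have "?g3 *\<^sub>v uv n m = uv n m" "?g3 *\<^sub>v uv n (n + m) = uv n (n + m)"
   using E3(2,3) f2 mult_vec[OF SO_mat[OF S3] SO_mat[OF g2(1)] unit_vec_carrier] by auto
  then have "fixes_below n (Suc m) ?g3" using g3(2) by (auto simp: fixes_below_def less_Suc_eq)
  then have "?g3 : so_gen n" using Suc(1)[of "Suc m" ?g3] Suc(2) m g3(1) by simp
  then have "?g2 : so_gen n" using E3(1) SO_mat[OF g2(1)] by (simp add: elim_mat_def)
  then have "?g1 : so_gen n" using E2(1) SO_mat[OF g1(1)] by (simp add: elim_mat_def)
  then show ?case using E1(1) SO_mat[OF Suc(4)] by (simp add: elim_mat_def)
 qed
 from this[of 0 g] assms show ?thesis by (simp add: fixes_below_def)
qed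

end

declare One_nat_def [simp del]

section \<open>Exterior powers in characteristic 2\<close>

lemma wedge_presentation: "presentation (tuples N k) (wedge_rels N k)"
proof
 fix r :: "'a vec list \<Rightarrow>\<^sub>0 'a" assume r: "r : wedge_rels N k"
 have u: "vs[i := a] : tuples N k" if "vs : tuples N k" "a : carrier_vec N" for vs i and a :: "'a vec"
  using that set_update_subset_insert[of vs i a] by (auto simp: tuples_def)
 have k3: "pkeys (psingle a x - psingle b y - psingle c z) <= {a, b, c}" for a b c :: "'a vec list" and x y z :: 'a
  by (auto simp: in_keys_iff lookup_minus lookup_single when_def split: if_splits)
 have k2: "pkeys (psingle a x - psingle b y) <= {a, b}" for a b :: "'a vec list" and x y :: 'a
  by (auto simp: in_keys_iff lookup_minus lookup_single when_def split: if_splits)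
 from r show "pkeys r <= tuples N k"
  unfolding wedge_rels_def
 proof (elim UnE CollectE exE conjE)
  fix vs i a b assume "r = psingle (vs[i := a + b]) 1 - psingle (vs[i := a]) 1 - psingle (vs[i := b]) 1"
   "vs : tuples N k" "a : carrier_vec N" "b : carrier_vec N"
  then show ?thesis using k3[of "vs[i := a + b]" 1 "vs[i := a]" 1 "vs[i := b]" 1] u[of vs "a + b" i] u[of vs a i] u[of vs b i] by auto
 next
  fix vs i a c assume "r = psingle (vs[i := c \<cdot>\<^sub>v a]) 1 - psingle (vs[i := a]) c" "vs : tuples N k" "a : carrier_vec N"
  then show ?thesis using k2[of "vs[i := c \<cdot>\<^sub>v a]" 1 "vs[i := a]" c] u[of vs "c \<cdot>\<^sub>v a" i] u[of vs a i] by auto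
 qed auto
qed

locale ext_char2 = char2 ty for ty :: "'f::field itself" + fixes n k :: nat
begin

abbreviation TP :: "'f vec list set" where "TP \<equiv> tuples (2*n+1) k"
abbreviation WR :: "('f vec list \<Rightarrow>\<^sub>0 'f) set" where "WR \<equiv> wedge_rels (2*n+1) k"

sublocale E: presentation TP WR
 by (rule wedge_presentation)

abbreviation EM :: "('f, ('f vec list \<Rightarrow>\<^sub>0 'f) set) module" where "EM \<equiv> presented_module TP WR"
abbreviation wg :: "'f vec list => ('f vec list \<Rightarrow>\<^sub>0 'f) set" where "wg vs \<equiv> generator TP WR vs"

lemma ext_power_eq: "ext_power (2*n+1) k = EM"
 by (simp add: ext_power_def)

lemma wedge_eq: "length vs = k ==> wedge (2*n+1) vs = wg vs"
 by (simp add: wedge_def)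

lemma EM_double: "C : carrier EM ==> C \<oplus>\<^bsub>EM\<^esub> C = \<zero>\<^bsub>EM\<^esub>"
 using E.PM.smult_l_distr[of 1 1 C] E.PM.smult_one[of C] E.PM.smult_l_null[of C] by (simp add: two_zero)

lemma EM_double_left: "C : carrier EM ==> D : carrier EM ==> C \<oplus>\<^bsub>EM\<^esub> (C \<oplus>\<^bsub>EM\<^esub> D) = D"
 by (simp only: E.PM.a_assoc[symmetric] EM_double E.PM.l_zero)

lemma WR_span: "r : WR ==> r : relation_span TP WR"
 unfolding relation_span_def using E.FM.in_own_span[OF E.R_carrier] by blast

lemma update_tuples: "vs : TP ==> a : cvec n ==> vs[i := a] : TP"
 using set_update_subset_insert[of vs i a] by (auto simp: tuples_def)

lemma wg_add:
 assumes "vs : TP" "i < k" "a : cvec n" "b : cvec n"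
 shows "wg (vs[i := a + b]) = wg (vs[i := a]) \<oplus>\<^bsub>EM\<^esub> wg (vs[i := b])"
proof -
 have "psingle (vs[i := a + b]) 1 - (psingle (vs[i := a]) 1 + psingle (vs[i := b]) 1) : WR"
  unfolding wedge_rels_def diff_diff_eq[symmetric] using assms by blast
 from WR_span[OF this] show ?thesis
  using update_tuples[OF assms(1,3)] update_tuples[OF assms(1,4)] by (simp add: E.generator_pcl E.pcl_add E.pcl_eqI)
qed

lemma wg_repeat: "vs : TP ==> i < j ==> j < k ==> vs ! i = vs ! j ==> wg vs = \<zero>\<^bsub>EM\<^esub>"
proof -
 assume a: "vs : TP" "i < j" "j < k" "vs ! i = vs ! j"
 have "psingle vs 1 : WR" unfolding wedge_rels_def using a by blast
 from WR_span[OF this] show ?thesis by (simp add: E.generator_pcl E.pcl_N)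
qed

lemma map_conds:
 assumes g: "g : cmat n"
 shows "map (%v. g *\<^sub>v v) ` TP <= TP" "r : WR ==> E.push (map (%v. g *\<^sub>v v)) r : relation_span TP WR"
proof -
 let ?f = "%v. g *\<^sub>v v"
 have t: "map ?f vs : TP" if "vs : TP" for vs
  using that mult_mat_vec_carrier[OF g] by (auto simp: tuples_def)
 then show "map ?f ` TP <= TP" by blast
 assume r: "r : WR"
 from r[unfolded wedge_rels_def] have "E.push (map ?f) r : WR"
 proof (elim UnE CollectE exE conjE)
  fix vs i a b assume r: "r = psingle (vs[i := a + b]) 1 - psingle (vs[i := a]) 1 - psingle (vs[i := b]) 1"
   and "vs : TP" "i < k" and ab: "a : cvec n" "b : cvec n"
  moreover have "E.push (map ?f) r = psingle ((map ?f vs)[i := ?f a + ?f b]) 1 - psingle ((map ?f vs)[i := ?f a]) 1 - psingle ((map ?f vs)[i := ?f b]) 1"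
   unfolding r E.push_diff E.push_single map_update mult_add_distrib_mat_vec[OF g ab] ..
  ultimately have "E.push (map ?f) r : {psingle (vs[i := a + b]) 1 - psingle (vs[i := a]) 1
    - psingle (vs[i := b]) 1 | vs i a b. vs : TP & i < k & a : cvec n & b : cvec n}"
   using t[of vs] mult_mat_vec_carrier[OF g ab(1)] mult_mat_vec_carrier[OF g ab(2)] by blast
  then show ?thesis unfolding wedge_rels_def by (rule UnI1[OF UnI1])
 next
  fix vs i a c assume r: "r = psingle (vs[i := c \<cdot>\<^sub>v a]) 1 - psingle (vs[i := a]) c"
   and "vs : TP" "i < k" and a: "a : cvec n"
  moreover have "E.push (map ?f) r = psingle ((map ?f vs)[i := c \<cdot>\<^sub>v ?f a]) 1 - psingle ((map ?f vs)[i := ?f a]) c"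
   unfolding r E.push_diff E.push_single map_update mult_mat_vec[OF g a] ..
  ultimately have "E.push (map ?f) r : {psingle (vs[i := c \<cdot>\<^sub>v a]) 1 - psingle (vs[i := a]) c | vs i a c. vs : TP & i < k & a : cvec n}"
   using t[of vs] mult_mat_vec_carrier[OF g a] by blast
  then show ?thesis unfolding wedge_rels_def by (rule UnI1[OF UnI2])
 next
  fix vs i j assume r: "r = psingle vs 1" and vs: "vs : TP" "i < j" "j < k" "vs ! i = vs ! j"
  have "length vs = k" using vs by (simp add: tuples_def)
  then have "map ?f vs ! i = map ?f vs ! j" using vs by simp
  moreover have "E.push (map ?f) r = psingle (map ?f vs) 1" unfolding r E.push_single ..
  ultimately have "E.push (map ?f) r : {psingle vs 1 | vs i j. vs : TP & i < j & j < k & vs ! i = vs ! j}"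
   using t[OF vs(1)] vs(2,3) by blast
  then show ?thesis unfolding wedge_rels_def by (rule UnI2)
 qed
 then show "E.push (map ?f) r : relation_span TP WR" by (rule WR_span)
qed

lemma ext_act_wg:
 assumes "g : cmat n" "vs : TP"
 shows "ext_power_act (2*n+1) k g (c \<odot>\<^bsub>EM\<^esub> wg vs) = c \<odot>\<^bsub>EM\<^esub> wg (map (%v. g *\<^sub>v v) vs)"
 unfolding ext_power_act_def
 using E.presented_map_smult[OF map_conds[OF assms(1)], of "wg vs" c] E.presented_map_generator[OF map_conds[OF assms(1)], of vs] assms(2)
 by simp

lemma lc_cre_commute: "lc n cre a*lc n cre b = (lc n cre b*lc n cre a :: 'f fock_op)"
proof -
 have 1: "lc n cre a*cre j = (cre j*lc n cre a :: 'f fock_op)" for a j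
 proof -
  have "scal (a $ i)*cre i*cre j = cre j*(scal (a $ i)*cre i :: 'f fock_op)" for i
   unfolding scal_left_commute mult.assoc cre_comm2[of i j] ..
  then show ?thesis unfolding lc_def sum_distrib_left sum_distrib_right by simp
 qed
 have "lc n cre a*(scal (b $ i)*cre i) = (scal (b $ i)*cre i*lc n cre a :: 'f fock_op)" for i
  unfolding scal_left_commute 1 mult.assoc ..
 then show ?thesis unfolding lc_def[of n cre b] sum_distrib_left sum_distrib_right by simp
qed

text \<open>The cross terms cancel in pairs because the operators commute and the characteristic is
  2.\<close>

lemma lc_cre_sq: "lc n cre a*lc n cre a = (0 :: 'f fock_op)"
proof -
 let ?c = "%m. \<Sum>j<m. scal (a $ j)*cre j :: 'f fock_op"
 have s: "scal x*cre i*(scal y*cre j) = scal (x*y)*(cre i*cre j :: 'f fock_op)" for x y i j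
  unfolding scal_mult by (simp only: mult.assoc scal_left_commute[of "cre i"])
 have comm: "?c m*(scal x*cre i) = scal x*cre i*?c m" for m x i
  unfolding sum_distrib_left sum_distrib_right s by (simp only: cre_comm2[of _ i] mult.commute[of x])
 have "?c m*?c m = 0" for m
 proof (induct m)
  case (Suc m)
  let ?s = "scal (a $ m)*cre m :: 'f fock_op"
  have ss: "?s*?s = 0" unfolding s cre_sq by simp
  have "?c (Suc m) = ?c m + ?s" by (rule sum.lessThan_Suc)
  then have "?c (Suc m)*?c (Suc m) = ?c m*?c m + (?c m*?s + ?s*?c m) + ?s*?s"
   by (simp only: distrib_left distrib_right add_ac)
  then show ?case unfolding Suc ss comm by simp
 qed simp
 then show ?thesis unfolding lc_def .
qed

lemma wfun_split: "i < length vs ==> wfun n Z (vs[i := a]) =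
  ent (prod_list (map (lc n cre) (take i vs))*(lc n cre a*prod_list (map (lc n cre) (drop (Suc i) vs)))) Z ({} :: nat set)"
 by (simp add: wfun_def upd_conv_take_nth_drop)

lemma prod_lc_commute: "prod_list (map (lc n cre) vs)*lc n cre a = (lc n cre a*prod_list (map (lc n cre) vs) :: 'f fock_op)"
proof (induct vs)
 case (Cons v vs)
 have "lc n cre v*(prod_list (map (lc n cre) vs)*lc n cre a) = lc n cre v*lc n cre a*prod_list (map (lc n cre) vs)"
  by (simp only: Cons mult.assoc)
 also have "... = lc n cre a*(lc n cre v*prod_list (map (lc n cre) vs))" by (simp only: lc_cre_commute[of v a] mult.assoc)
 finally show ?case by (simp add: mult.assoc)
qed simp

text \<open>Multilinearity holds factor by factor, and a repeated vector can be moved next to its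
  copy, where the square is zero. Hence \<open>wfun\<close> descends to the exterior power.\<close>

lemma wfun_WR:
 assumes "r : WR"
 shows "E.lin (wfun n Z) r = 0"
 using assms unfolding wedge_rels_def
proof (elim UnE CollectE exE conjE)
 fix vs i a b assume r: "r = psingle (vs[i := a + b]) 1 - psingle (vs[i := a]) 1 - psingle (vs[i := b]) 1"
  and vs: "vs : TP" "i < k" and ab: "a : cvec n" "b : cvec n"
 have i: "i < length vs" using vs by (simp add: tuples_def)
 have "wfun n Z (vs[i := a + b]) = wfun n Z (vs[i := a]) + wfun n Z (vs[i := b])"
  unfolding wfun_split[OF i] lc_add[OF ab] by (simp only: distrib_left distrib_right ent_add)
 then show ?thesis unfolding r E.lin_diff E.lin_single by simp
next
 fix vs i a c assume r: "r = psingle (vs[i := c \<cdot>\<^sub>v a]) 1 - psingle (vs[i := a]) c"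
  and vs: "vs : TP" "i < k" and a: "a : cvec n"
 have i: "i < length vs" using vs by (simp add: tuples_def)
 have "wfun n Z (vs[i := c \<cdot>\<^sub>v a]) = c*wfun n Z (vs[i := a])"
  unfolding wfun_split[OF i] lc_smult[OF a] mult.assoc scal_left_commute[of _ c] ent_scal ..
 then show ?thesis unfolding r E.lin_diff E.lin_single by simp
next
 fix vs i j assume r: "r = psingle vs 1" and vs: "vs : TP" "i < j" "j < k" "vs ! i = vs ! j"
 have l: "length vs = k" using vs by (simp add: tuples_def)
 let ?a = "vs ! i" and ?p = "%xs. prod_list (map (lc n cre) xs) :: 'f fock_op"
 have "vs = take i vs @ ?a # drop (Suc i) vs" using vs l id_take_nth_drop[of i vs] by simp
 moreover have "drop (Suc i) vs = take (j - Suc i) (drop (Suc i) vs) @ ?a # drop (Suc j) vs"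
  using vs l id_take_nth_drop[of "j - Suc i" "drop (Suc i) vs"] by simp
 ultimately have "vs = take i vs @ ?a # take (j - Suc i) (drop (Suc i) vs) @ ?a # drop (Suc j) vs" by metis
 then have "?p vs = ?p (take i vs @ ?a # take (j - Suc i) (drop (Suc i) vs) @ ?a # drop (Suc j) vs)" by (rule arg_cong)
 also have "... = ?p (take i vs)*(lc n cre ?a*((?p (take (j - Suc i) (drop (Suc i) vs))*lc n cre ?a)*?p (drop (Suc j) vs)))"
  by (simp only: map_append list.map prod_list.append prod_list.Cons mult.assoc)
 also have "... = ?p (take i vs)*((lc n cre ?a*lc n cre ?a)*(?p (take (j - Suc i) (drop (Suc i) vs))*?p (drop (Suc j) vs)))"
  unfolding prod_lc_commute by (simp only: mult.assoc)
 also have "... = 0" unfolding lc_cre_sq by simp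
 finally show ?thesis unfolding r E.lin_single by (simp add: wfun_def)
qed

section \<open>Sums of wedges and their coordinates\<close>

definition wlist :: "'f vec list list => ('f vec list \<Rightarrow>\<^sub>0 'f) set" where
 "wlist cs = foldr (%c C. wg c \<oplus>\<^bsub>EM\<^esub> C) cs \<zero>\<^bsub>EM\<^esub>"

lemma wlist_simps [simp]: "wlist [] = \<zero>\<^bsub>EM\<^esub>" "wlist (c # cs) = wg c \<oplus>\<^bsub>EM\<^esub> wlist cs"
 by (simp_all add: wlist_def)

lemma wlist_carrier [simp]: "set cs <= TP ==> wlist cs : carrier EM"
 by (induct cs) auto

lemma wlist_append: "set cs <= TP ==> set ds <= TP ==> wlist (cs @ ds) = wlist cs \<oplus>\<^bsub>EM\<^esub> wlist ds"
 by (induct cs) (auto simp: E.PM.a_assoc)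

definition wco :: "nat set => ('f vec list \<Rightarrow>\<^sub>0 'f) set => 'f" where
 "wco Z C = E.lift (wfun n Z) C"

lemma wco_add: "C : carrier EM ==> D : carrier EM ==> wco Z (C \<oplus>\<^bsub>EM\<^esub> D) = wco Z C + wco Z D"
 unfolding wco_def by (intro E.lift_add wfun_WR)

lemma wco_smult: "C : carrier EM ==> wco Z (c \<odot>\<^bsub>EM\<^esub> C) = c*wco Z C"
 unfolding wco_def by (intro E.lift_smult wfun_WR)

lemma wco_zero: "wco Z \<zero>\<^bsub>EM\<^esub> = 0"
 unfolding wco_def by (intro E.lift_zero wfun_WR)

lemma wco_wg: "vs : TP ==> wco Z (wg vs) = wfun n Z vs"
 unfolding wco_def by (intro E.lift_generator wfun_WR)

lemma wco_wlist: "set cs <= TP ==> wco Z (wlist cs) = (\<Sum>c\<leftarrow>cs. wfun n Z c)"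
 by (induct cs) (auto simp: wco_zero wco_add wco_wg)

lemma wlist_sum3:
 assumes "!!c. c : set L ==> f c : TP & g c : TP & h c : TP & s c : TP & wg (f c) \<oplus>\<^bsub>EM\<^esub> (wg (g c) \<oplus>\<^bsub>EM\<^esub> wg (h c)) = wg (s c)"
 shows "wlist (map f L @ map g L @ map h L) = wlist (map s L)"
proof -
 have t: "set (map f L) <= TP" "set (map g L) <= TP" "set (map h L) <= TP" using assms by auto
 have "wlist (map f L) \<oplus>\<^bsub>EM\<^esub> (wlist (map g L) \<oplus>\<^bsub>EM\<^esub> wlist (map h L)) = wlist (map s L)"
  using assms
 proof (induct L)
  case (Cons c L)
  have c: "wg (f c) : carrier EM" "wg (g c) : carrier EM" "wg (h c) : carrier EM" "wg (s c) = wg (f c) \<oplus>\<^bsub>EM\<^esub> (wg (g c) \<oplus>\<^bsub>EM\<^esub> wg (h c))"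
   using Cons.prems by auto
  have "set (map f L) <= TP" "set (map g L) <= TP" "set (map h L) <= TP" using Cons.prems by auto
  note w = this[THEN wlist_carrier]
  have "wlist (map s L) = wlist (map f L) \<oplus>\<^bsub>EM\<^esub> (wlist (map g L) \<oplus>\<^bsub>EM\<^esub> wlist (map h L))" using Cons by simp
  then show ?case using c w by (simp add: E.PM.a_ac)
 qed simp
 then show ?thesis using t by (simp add: wlist_append)
qed

lemma wg_fil:
 assumes "pre @ x # c : TP" "z < n"
 shows "wg (pre @ (uv n z + uv n (2*n) + uv n (n + z)) # c) \<oplus>\<^bsub>EM\<^esub> (wg (pre @ uv n z # c) \<oplus>\<^bsub>EM\<^esub> wg (pre @ uv n (n + z) # c)) = wg (pre @ uv n (2*n) # c)"
proof -
 let ?i = "length pre" and ?vs = "pre @ x # c"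
 have i: "?i < k" using assms(1) by (auto simp: tuples_def)
 have u: "?vs[?i := a] = pre @ a # c" for a by simp
 have t: "wg (pre @ a # c) : carrier EM" if "a : cvec n" for a
  using update_tuples[OF assms(1) that, of ?i] u by simp
 have cv: "uv n z + uv n (2*n) : cvec n" by simp
 have "wg (pre @ (uv n z + uv n (2*n) + uv n (n + z)) # c) = wg (pre @ (uv n z + uv n (2*n)) # c) \<oplus>\<^bsub>EM\<^esub> wg (pre @ uv n (n + z) # c)"
  using wg_add[OF assms(1) i cv unit_vec_carrier, of "n + z"] unfolding u .
 moreover have "wg (pre @ (uv n z + uv n (2*n)) # c) = wg (pre @ uv n z # c) \<oplus>\<^bsub>EM\<^esub> wg (pre @ uv n (2*n) # c)"
  using wg_add[OF assms(1) i unit_vec_carrier unit_vec_carrier, of z "2*n"] unfolding u .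
 ultimately show ?thesis
  using t[OF unit_vec_carrier[of _ z]] t[OF unit_vec_carrier[of _ "2*n"]] t[OF unit_vec_carrier[of _ "n + z"]]
  by (simp add: E.PM.a_ac EM_double EM_double_left)
qed

lemma opts_carrier: "c : set (bopts n b) ==> set c <= cvec n"
 by (cases b) auto

lemma choices_carrier: "c : set (choices n bs) ==> set c <= cvec n"
proof (induct bs arbitrary: c)
 case (Cons b bs)
 then show ?case using opts_carrier[of _ b] by fastforce
qed simp

text \<open>At least two fillers head the blocks. Each collapses by \<open>wlist_sum3\<close> to the
  last basis vector, which then occurs twice. In the Clifford algebra the same two factors multiply
  to 1; this discrepancy is the kernel.\<close>

lemma wlist_blocks_zero:
 assumes "k \<le> n" "i : bindices n k" "bsize i + 2 \<le> k"
 shows "wlist (choices n (blocks n k i)) = \<zero>\<^bsub>EM\<^esub>"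
proof -
 have "length (fillers n k i) \<ge> 2" using fillers_props(1)[OF assms(1,2)] assms(3) by simp
 then obtain z z' zs where f: "fillers n k i = z # z' # zs" by (metis Suc_le_length_iff numeral_2_eq_2)
 obtain bs where b: "blocks n k i = Fil z # Fil z' # bs" by (simp add: blocks_def f)
 have zn: "z < n" "z' < n" using fillers_props(3)[OF assms(1,2)] by (auto simp: f)
 have len: "length (concat (map bsites bs)) + 2 = k" using blocks_props(3)[OF assms(1,2)] by (simp add: b)
 let ?L = "choices n bs :: 'f vec list list"
 let ?p = "%z. uv n z + uv n (2*n) + uv n (n + z)"
 have tp: "x # y # c : TP" if "c : set ?L" "x : cvec n" "y : cvec n" for x y c
  using that length_choices[OF that(1)] choices_carrier[OF that(1)] len by (simp add: tuples_def)
 let ?L' = "choices n (Fil z' # bs) :: 'f vec list list"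
 have L': "?L' = map (%c. ?p z' # c) ?L @ map (%c. uv n z' # c) ?L @ map (%c. uv n (n + z') # c) ?L" by simp
 have tp': "x # c : TP" if "c : set ?L'" "x : cvec n" for x c
  using that tp unfolding L' by auto
 have "wlist (choices n (blocks n k i)) = wlist (map (%c. ?p z # c) ?L' @ map (%c. uv n z # c) ?L' @ map (%c. uv n (n + z) # c) ?L')"
  unfolding b choices.simps(2)[of n "Fil z"] bopts.simps list.map concat.simps append_Nil2 append_Nil append_Cons ..
 also have "... = wlist (map (%c. uv n (2*n) # c) ?L')"
 proof (rule wlist_sum3)
  fix c assume c: "c : set ?L'"
  show "?p z # c : TP & uv n z # c : TP & uv n (n + z) # c : TP & uv n (2*n) # c : TP \<and>
   wg (?p z # c) \<oplus>\<^bsub>EM\<^esub> (wg (uv n z # c) \<oplus>\<^bsub>EM\<^esub> wg (uv n (n + z) # c)) = wg (uv n (2*n) # c)"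
   using wg_fil[of "[]" "uv n z" c z] tp'[OF c] zn(1) by simp
 qed
 also have "... = wlist (map (%c. uv n (2*n) # ?p z' # c) ?L @ map (%c. uv n (2*n) # uv n z' # c) ?L @ map (%c. uv n (2*n) # uv n (n + z') # c) ?L)"
  unfolding L' by (simp only: map_append map_map comp_def)
 also have "... = wlist (map (%c. uv n (2*n) # uv n (2*n) # c) ?L)"
 proof (rule wlist_sum3)
  fix c assume c: "c : set ?L"
  show "uv n (2*n) # ?p z' # c : TP & uv n (2*n) # uv n z' # c : TP & uv n (2*n) # uv n (n + z') # c : TP & uv n (2*n) # uv n (2*n) # c : TP \<and>
   wg (uv n (2*n) # ?p z' # c) \<oplus>\<^bsub>EM\<^esub> (wg (uv n (2*n) # uv n z' # c) \<oplus>\<^bsub>EM\<^esub> wg (uv n (2*n) # uv n (n + z') # c)) = wg (uv n (2*n) # uv n (2*n) # c)"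
   using wg_fil[of "[uv n (2*n)]" "uv n z'" c z'] tp[OF c] zn(2) by simp
 qed
 also have "... = \<zero>\<^bsub>EM\<^esub>"
 proof -
  have "wg (uv n (2*n) # uv n (2*n) # c) = \<zero>\<^bsub>EM\<^esub>" if "c : set ?L" for c
   using tp[OF that unit_vec_carrier unit_vec_carrier] len by (intro wg_repeat[of _ 0 1]) auto
  then have "set L <= set ?L ==> wlist (map (%c. uv n (2*n) # uv n (2*n) # c) L) = \<zero>\<^bsub>EM\<^esub>" for L by (induct L) auto
  then show ?thesis by blast
 qed
 finally show ?thesis .
qed

lemma wco_blocks:
 assumes "k \<le> n" "i : bindices n k"
 shows "wco Z (wlist (choices n (blocks n k i))) = wval n k i Z" "set (choices n (blocks n k i)) <= TP"
proof -
 show t: "set (choices n (blocks n k i)) <= TP"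
  using length_choices choices_carrier blocks_props(3)[OF assms] by (fastforce simp: tuples_def)
 show "wco Z (wlist (choices n (blocks n k i))) = wval n k i Z"
  unfolding wco_wlist[OF t] by (rule wfun_choices[OF assms])
qed

end

declare One_nat_def [simp]

section \<open>The action of the torus\<close>

text \<open>Applied to multiples of creation and annihilation at one site, this is the Clifford
  image of x_a(t) x_{-a}(1/t) x_a(t) for a short root a, a representative of a reflection in the
  Weyl group.\<close>

lemma reflection_product:
 fixes A C :: "'r::ring_1"
 assumes "C*C = 0" "C*A + A*C = 1" "!!x :: 'r. x + x = 0"
 shows "(1 + C)*(1 + A)*(1 + C) = A + C"
proof -
 have ac: "A*C = 1 + C*A"
  using assms(2) assms(3)[of "C*A"] by (metis add.assoc add.commute add.right_neutral)
 have "C*(A*C) = C + (C*C)*A" unfolding ac by (simp add: distrib_left mult.assoc)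
 then have cac: "C*(A*C) = C" using assms(1) by simp
 have "(1 + C)*(1 + A)*(1 + C) = 1 + (C + C) + A + (C*A + A*C) + C*C + C*(A*C)"
  by (simp add: distrib_left distrib_right mult.assoc add_ac)
 also have "... = (1 + 1) + A + C" unfolding assms(1,2) assms(3)[of C] cac by (simp add: add_ac)
 finally show ?thesis using assms(3)[of 1] by simp
qed

definition tw :: "nat => 'f::field => nat set => 'f" where
 "tw j a T = (if j : T then a else 1)"

text \<open>Conjugation by the diagonal operator with entry \<open>a\<close> on the sets that
  contain \<open>j\<close>. It scales the generators as the torus element scales the basis vectors,
  for squares and non-squares \<open>a\<close> alike.\<close>

definition dact :: "nat => 'f::field => (nat set => nat set => 'f) => nat set => nat set => 'f" where
 "dact j a F T S = tw j a T*inverse (tw j a S)*F T S"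

text \<open>The eigenvalue of \<open>tor n i a\<close> on the basis vector \<open>r\<close>.\<close>

definition twi :: "nat => nat => 'f::field => nat => 'f" where
 "twi n i a r = (if r = i then a else if r = n + i then inverse a else 1)"

context char2
begin

lemma lgen_dact:
 assumes "a ~= 0" "p < 2*n+1" "i < n"
 shows "lgen n p (dact i a F) = (%T S. inverse (twi n i a p)*(dact i a (lgen n p F) T S :: 'f))"
  "rgen n p (dact i a F) = (%T S. inverse (twi n i a p)*(dact i a (rgen n p F) T S :: 'f))"
 using assms by (auto simp: fun_eq_iff lgen_def rgen_def dact_def tw_def twi_def)

lemma dpf_dact:
 assumes "a ~= 0" "p < 2*n+1" "q < 2*n+1" "i < n"
 shows "dpf n p q 1 (dact i a F) T S = inverse (twi n i a p*twi n i a q)*(dact i a (dpf n p q 1 F) T S :: 'f)"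
  "dpf n p q 2 (dact i a F) T S = inverse ((twi n i a p*twi n i a q)\<^sup>2)*(dact i a (dpf n p q 2 F) T S :: 'f)"
 by (simp_all add: dpf_def lgen_dact[OF assms(1,2,4)] lgen_dact[OF assms(1,3,4)] lgen_smult rgen_smult)
   (simp_all add: dact_def algebra_simps power2_eq_square)

lemma xact_dact:
 assumes "a ~= 0" "\<alpha> : roots n" "root_pair n \<alpha> = (p, q)" "i < n"
 shows "xact n \<alpha> (twi n i a p*twi n i a q*t) (dact i a F) = dact i a (xact n \<alpha> t F)"
proof (intro ext)
 fix T S
 note bd = root_pair_bounds[OF assms(2,3)]
 let ?x = "twi n i a p*twi n i a q"
 have x: "?x ~= 0" using assms(1) by (auto simp: twi_def)
 have "xact n \<alpha> (?x*t) (dact i a F) T S = dact i a F T S + ?x*t*(inverse ?x*dact i a (dpf n p q 1 F) T S)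
   + (?x*t)\<^sup>2*(inverse (?x\<^sup>2)*dact i a (dpf n p q 2 F) T S)"
  by (simp only: xact_def assms(3) prod.case dpf_dact[OF assms(1) bd(1,2) assms(4)])
 also have "... = dact i a F T S + t*dact i a (dpf n p q 1 F) T S + t\<^sup>2*dact i a (dpf n p q 2 F) T S"
  using x by (simp add: power_mult_distrib field_simps)
 also have "... = dact i a (xact n \<alpha> t F) T S"
  by (simp only: dact_def xact_def assms(3) prod.case distrib_left mult.left_commute)
 finally show "xact n \<alpha> (?x*t) (dact i a F) T S = dact i a (xact n \<alpha> t F) T S" .
qed

lemma tor_root_elem:
 assumes "a ~= 0" "\<alpha> : roots n" "root_pair n \<alpha> = (p, q)" "i < n"
 shows "tor n i a*root_elem n \<alpha> t = root_elem n \<alpha> (twi n i a p*twi n i a q*t)*tor n i (a :: 'f)"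
proof (rule mat_eq_vecI[of _ "2*n+1"])
 note bd = root_pair_bounds[OF assms(2,3)]
 fix x :: "'f vec" assume x: "x : cvec n"
 have tx: "tor n i a *\<^sub>v x : cvec n" by (rule mult_mat_vec_carrier[OF tor_carrier(1) x])
 have rx: "root_elem n \<alpha> t *\<^sub>v x : cvec n" by (rule mult_mat_vec_carrier[OF root_elem_carrier(1) x])
 have tv: "tor n i a *\<^sub>v y = vec (2*n+1) (%r. twi n i a r*y $ r)" if "y : cvec n" for y :: "'f vec"
  unfolding tor_vec[OF that] twi_def ..
 have b: "bcov n r (tor n i a *\<^sub>v x) = inverse (twi n i a r)*bcov n r x" if "r < 2*n+1" for r
  using that assms(1,4) du_bound[OF that] x by (cases "r = 2*n") (auto simp: bcov_last bcov_du tv[simplified] twi_def du_def)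
 have nz: "twi n i a r ~= 0" for r using assms(1) by (simp add: twi_def)
 have last: "twi n i a (2*n) = 1" using assms(4) by (simp add: twi_def)
 have "root_elem n \<alpha> (twi n i a p*twi n i a q*t) *\<^sub>v (tor n i a *\<^sub>v x) = tor n i a *\<^sub>v (root_elem n \<alpha> t *\<^sub>v x)"
 proof (rule eq_vecI)
  fix r assume "r < dim_vec (tor n i a *\<^sub>v (root_elem n \<alpha> t *\<^sub>v x))"
  then have r: "r < 2*n+1" using carrier_matD(1)[OF tor_carrier(1)[of n i a]] by simp
  have l: "(root_elem n \<alpha> (twi n i a p*twi n i a q*t) *\<^sub>v (tor n i a *\<^sub>v x)) $ r =
   twi n i a r*x $ r + (if r = p then twi n i a p*(t*bcov n q x + (if q = 2*n then t\<^sup>2*bcov n p x else 0)) else 0)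
   + (if r = q then twi n i a q*(t*bcov n p x + (if p = 2*n then t\<^sup>2*bcov n q x else 0)) else 0)"
   unfolding root_elem_vec[OF assms(2,3) tx] b[OF bd(1)] b[OF bd(2)]
   using r x bd(1,2,4) nz[of p] nz[of q] last by (auto simp: tv[simplified] field_simps power2_eq_square)
  have "(tor n i a *\<^sub>v (root_elem n \<alpha> t *\<^sub>v x)) $ r = twi n i a r*(root_elem n \<alpha> t *\<^sub>v x) $ r"
   unfolding tv[OF rx] using r by simp
  also have "... = twi n i a r*x $ r + (if r = p then twi n i a p*(t*bcov n q x + (if q = 2*n then t\<^sup>2*bcov n p x else 0)) else 0)
   + (if r = q then twi n i a q*(t*bcov n p x + (if p = 2*n then t\<^sup>2*bcov n q x else 0)) else 0)"
   unfolding root_elem_vec[OF assms(2,3) x] using r x bd(1,2,4) by (auto simp: distrib_left)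
  finally show "(root_elem n \<alpha> (twi n i a p*twi n i a q*t) *\<^sub>v (tor n i a *\<^sub>v x)) $ r = (tor n i a *\<^sub>v (root_elem n \<alpha> t *\<^sub>v x)) $ r"
   unfolding l by simp
 qed (use carrier_matD(1)[OF tor_carrier(1)[of n i a]] carrier_matD(1)[OF root_elem_carrier(1)[of n \<alpha> "twi n i a p*twi n i a q*t"]] in simp)
 then show "tor n i a*root_elem n \<alpha> t *\<^sub>v x = root_elem n \<alpha> (twi n i a p*twi n i a q*t)*tor n i a *\<^sub>v x"
  unfolding mult_vec[OF tor_carrier(1) root_elem_carrier(1) x] mult_vec[OF root_elem_carrier(1) tor_carrier(1) x] by simp
qed (use mult_carrier_mat[OF root_elem_carrier(1) tor_carrier(1)] mult_carrier_mat[OF tor_carrier(1) root_elem_carrier(1)] in blast)+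

lemma tor_commute: "tor n i a*tor n j b = tor n j b*(tor n i a :: 'f mat)"
proof (rule mat_eq_vecI[of _ "2*n+1"])
 fix x :: "'f vec" assume x: "x : cvec n"
 have "tor n i a *\<^sub>v (tor n j b *\<^sub>v x) = tor n j b *\<^sub>v (tor n i a *\<^sub>v x)"
  unfolding tor_vec[OF mult_mat_vec_carrier[OF tor_carrier(1) x]] unfolding tor_vec[OF x] by (rule eq_vecI) simp_all
 then show "tor n i a*tor n j b *\<^sub>v x = tor n j b*tor n i a *\<^sub>v x"
  unfolding mult_vec[OF tor_carrier(1) tor_carrier(1) x] .
qed (rule mult_carrier_mat[OF tor_carrier(1) tor_carrier(1)])+

section \<open>Reflections and the squares in the torus\<close>

definition refl_elem :: "nat => nat => 'f => 'f mat" where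
 "refl_elem n j t = root_elem n (Short j) t*(root_elem n (NegShort j) (inverse t)*root_elem n (Short j) t)"

lemma refl_elem_vec:
 assumes "j < n" "t ~= 0" "x : cvec n"
 shows "refl_elem n j t *\<^sub>v x = vec (2*n+1) (%r. if r = j then t\<^sup>2*x $ (n + j) else if r = n + j then inverse (t\<^sup>2)*x $ j else x $ r)"
proof -
 have s: "Short j : roots n" "root_pair n (Short j) = (j, 2*n)" "NegShort j : roots n" "root_pair n (NegShort j) = (2*n, n + j)"
  using assms(1) by (auto simp: roots_def)
 have bj: "bcov n j y = y $ (n + j)" "bcov n (n + j) y = y $ j" for y :: "'f vec" using assms(1) by (auto simp: bcov_def bw_def du_def)
 have S: "root_elem n (Short j) t *\<^sub>v y = vec (2*n+1) (%r. if r = j then y $ j + t\<^sup>2*y $ (n + j) else if r = 2*n then y $ (2*n) + t*y $ (n + j) else y $ r)"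
  if "y : cvec n" for y :: "'f vec"
  unfolding root_elem_vec[OF s(1,2) that] bcov_last bj using that assms(1) by (intro eq_vecI) auto
 have R: "root_elem n (NegShort j) u *\<^sub>v y = vec (2*n+1) (%r. if r = n + j then y $ (n + j) + u\<^sup>2*y $ j else if r = 2*n then y $ (2*n) + u*y $ j else y $ r)"
  if "y : cvec n" for u and y :: "'f vec"
  unfolding root_elem_vec[OF s(3,4) that] bcov_last bj using that assms(1) by (intro eq_vecI) auto
 have v: "vec (2*n+1) f : cvec n" for f :: "nat => 'f" by simp
 have "refl_elem n j t *\<^sub>v x = root_elem n (Short j) t *\<^sub>v (root_elem n (NegShort j) (inverse t) *\<^sub>v (root_elem n (Short j) t *\<^sub>v x))"
  unfolding refl_elem_def
  by (simp only: mult_vec[OF root_elem_carrier(1) mult_carrier_mat[OF root_elem_carrier(1) root_elem_carrier(1)] assms(3)]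
    mult_vec[OF root_elem_carrier(1) root_elem_carrier(1) assms(3)])
 also have "... = vec (2*n+1) (%r. if r = j then t\<^sup>2*x $ (n + j) else if r = n + j then inverse (t\<^sup>2)*x $ j else x $ r)"
  unfolding S[OF assms(3)] R[OF v] S[OF v] using assms(1,2)
  by (intro eq_vecI) (auto simp: field_simps power2_eq_square two_zero)
 finally show ?thesis .
qed

lemma refl_elem_carrier: "refl_elem n j t : cmat n"
 unfolding refl_elem_def by (intro mult_carrier_mat[OF root_elem_carrier(1)] mult_carrier_mat[OF root_elem_carrier(1) root_elem_carrier(1)])

text \<open>Two reflections multiply to a torus element, but the parameter is a square, since a
  short coroot is twice a cocharacter of the group.\<close>

lemma refl_elem_tor:
 assumes "j < n" "b ~= 0"
 shows "refl_elem n j b*refl_elem n j 1 = tor n j (b\<^sup>2 :: 'f)"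
proof (rule mat_eq_vecI[of _ "2*n+1"])
 fix x :: "'f vec" assume x: "x : cvec n"
 have v: "vec (2*n+1) f : cvec n" for f :: "nat => 'f" by simp
 show "refl_elem n j b*refl_elem n j 1 *\<^sub>v x = tor n j (b\<^sup>2) *\<^sub>v x"
  unfolding mult_vec[OF refl_elem_carrier refl_elem_carrier x] refl_elem_vec[OF assms(1) one_neq_zero x] refl_elem_vec[OF assms(1,2) v] tor_vec[OF x]
  using assms by (intro eq_vecI) auto
qed (use mult_carrier_mat[OF refl_elem_carrier refl_elem_carrier] tor_carrier in auto)

definition refl_act :: "nat => nat => 'f => (nat set => nat set => 'f) => nat set => nat set => 'f" where
 "refl_act n j t F = xact n (Short j) t (xact n (NegShort j) (inverse t) (xact n (Short j) t F))"

lemma refl_act_ent: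
 assumes "j < n" "t ~= 0"
 shows "refl_act n j t (ent A) = ent ((scal (inverse t)*ann j + scal t*cre j)*A*(scal (inverse t)*ann j + scal t*cre j))"
proof -
 let ?C = "scal t*cre j :: 'f fock_op" and ?A = "scal (inverse t)*ann j :: 'f fock_op"
 have x: "xop n (Short j) t = 1 + ?C" "xop n (NegShort j) (inverse t) = 1 + ?A"
  using assms(1) gen_last[of n] by (simp_all add: xop_def rsp_def) (simp_all add: gen_def)
 have s: "scal x*B*(scal y*D) = scal (x*y)*(B*D)" for x y and B D :: "'f fock_op"
  unfolding scal_mult by (simp only: mult.assoc scal_left_commute[of B])
 have "?C*?C = 0" unfolding s cre_sq by simp
 moreover have "?C*?A + ?A*?C = 1"
  unfolding s using assms(2) cre_ann_same[of j, where 'a='f] by (simp flip: distrib_left)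
 ultimately have r: "(1 + ?C)*(1 + ?A)*(1 + ?C) = ?A + ?C"
  by (rule reflection_product) simp
 have "refl_act n j t (ent A) = ent ((1 + ?C)*((1 + ?A)*((1 + ?C)*A*(1 + ?C))*(1 + ?A))*(1 + ?C))"
  unfolding refl_act_def xact_ent x ..
 also have "(1 + ?C)*((1 + ?A)*((1 + ?C)*A*(1 + ?C))*(1 + ?A))*(1 + ?C)
  = ((1 + ?C)*(1 + ?A)*(1 + ?C))*A*((1 + ?C)*(1 + ?A)*(1 + ?C))"
  by (simp only: mult.assoc)
 finally show ?thesis unfolding r .
qed

text \<open>On the Fock space the product of the two reflections is diagonal with entries
  \<open>b\<close> and \<open>inverse b\<close>; conjugation sees only their ratio, the square of
  \<open>b\<close>.\<close>

lemma refl_act_tor: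
 assumes "j < n" "b ~= 0"
 shows "refl_act n j b (refl_act n j 1 (ent A)) = dact j (b\<^sup>2) (ent A :: nat set => nat set => 'f)"
proof -
 let ?c = "cre j :: 'f fock_op" and ?a = "ann j :: 'f fock_op"
 let ?n = "%t. scal (inverse t)*?a + scal t*?c"
 have s: "scal x*B*(scal y*D) = scal (x*y)*(B*D)" for x y and B D :: "'f fock_op"
  unfolding scal_mult by (simp only: mult.assoc scal_left_commute[of B])
 have H: "?n x*?n y = scal (inverse x*y)*(?a*?c) + scal (x*inverse y)*(?c*?a)" for x y
  by (simp only: distrib_left distrib_right s ann_sq cre_sq mult_zero_right add_0_right add_0_left) (rule add.commute)
 have "refl_act n j b (refl_act n j 1 (ent A)) = ent (?n b*(?n 1*A*?n 1)*?n b)"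
  unfolding refl_act_ent[OF assms(1) one_neq_zero] refl_act_ent[OF assms] ..
 also have "?n b*(?n 1*A*?n 1)*?n b = (?n b*?n 1)*A*(?n 1*?n b)"
  by (simp only: mult.assoc)
 also have "... = (scal (inverse b)*(?a*?c) + scal b*(?c*?a))*(A*(scal b*(?a*?c) + scal (inverse b)*(?c*?a)))"
  unfolding H by (simp add: mult.assoc)
 finally have e: "refl_act n j b (refl_act n j 1 (ent A)) = ent ((scal (inverse b)*(?a*?c) + scal b*(?c*?a))*(A*(scal b*(?a*?c) + scal (inverse b)*(?c*?a))))" .
 have g: "gen n j = ?c" "gen n (n + j) = ?a" using assms(1) by (simp_all add: gen_def)
 have l: "ent (?a*?c*B) T S = (if j : T then 0 else ent B T S)" "ent (?c*?a*B) T S = (if j : T then ent B T S else 0)" for B :: "'f fock_op" and T S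
  unfolding g[symmetric] mult.assoc ent_gen_low[OF assms(1)] ent_gen_high[OF assms(1)] by (simp_all add: insert_absorb)
 have L: "ent ((scal x*(?a*?c) + scal y*(?c*?a))*B) T S = (if j : T then y else x)*ent B T S" for x y B T S
  by (simp add: distrib_right mult.assoc[of "scal _"] ent_add ent_scal l)
 have r: "ent (A*(?a*?c)) T S = (if j : S then 0 else ent A T S)" "ent (A*(?c*?a)) T S = (if j : S then ent A T S else 0)" for T S
  unfolding g[symmetric] mult.assoc[symmetric] ent_mult_gen using assms(1) by (simp_all add: rgen_def insert_absorb)
 have R: "ent (A*(scal x*(?a*?c) + scal y*(?c*?a))) T S = (if j : S then y else x)*ent A T S" for x y T S
  by (simp add: distrib_left scal_left_commute[of A] ent_add ent_scal r)
 show ?thesis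
  unfolding e by (intro ext) (use assms(2) in \<open>simp add: L R dact_def tw_def power2_eq_square\<close>)
qed

lemma dact_restr: "dact j a (restr n F) = restr n (dact j a F)"
 by (intro ext) (simp add: dact_def restr_def)

lemma refl_act_restr: "j < n ==> refl_act n j t (restr n F) = restr n (refl_act n j t F)"
proof -
 assume "j < n"
 then have "Short j : roots n" "NegShort j : roots n" by (auto simp: roots_def)
 then show ?thesis unfolding refl_act_def by (simp only: xact_restr)
qed

lemma xact_smult: "xact n \<alpha> t (%T S. c*F T S) = (%T S. c*xact n \<alpha> t F T S)"
 by (cases "root_pair n \<alpha>") (simp add: xact_def fun_eq_iff dpf_smult algebra_simps)

end

section \<open>Generation by the highest weight vector, and its weight space\<close>

context weyl
begin

text \<open>The basis vectors are sums over tuples reached by root elements with parameter 1, so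
  these elements generate the module from the highest weight vector.\<close>

lemma weyl_induct [consumes 1, case_names v root add smult zero]:
 assumes "C : carrier WM" and v: "P (G v)"
  and root: "!!\<alpha> C. \<alpha> : roots n ==> C : carrier WM ==> P C ==> P (weyl_root_act n M \<rho> v \<alpha> 1 C)"
  and add: "!!C D. C : carrier WM ==> D : carrier WM ==> P C ==> P D ==> P (C \<oplus>\<^bsub>WM\<^esub> D)"
  and smult: "!!c C. C : carrier WM ==> P C ==> P (c \<odot>\<^bsub>WM\<^esub> C)"
  and zero: "P \<zero>\<^bsub>WM\<^esub>"
 shows "P C"
proof -
 have t: "\<exists>C\<in>carrier WM. P C & Psi C = ctup n vs" if "vs : tups n \<kappa>" for vs
  using that
 proof (induct rule: tups.induct)
  case tups_base
  then show ?case using v Psi_v K_v by (intro bexI[of _ "G v"]) auto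
 next
  case (tups_step vs \<alpha>)
  then obtain C where C: "C : carrier WM" "P C" "Psi C = ctup n vs" by blast
  have "set vs <= cvec n" using tups_carrier[OF tups_step(1)] by blast
  then have "Psi (weyl_root_act n M \<rho> v \<alpha> 1 C) = ctup n (map (%v. root_elem n \<alpha> 1 *\<^sub>v v) vs)"
   unfolding weyl_root(2)[OF tups_step(3) C(1)] C(3) by (rule xact_ctup[OF tups_step(3)])
  then show ?case using root[OF tups_step(3) C(1,2)] weyl_root(1)[OF tups_step(3) C(1)] by blast
 qed
 have ts: "\<exists>C\<in>carrier WM. P C & Psi C = (%T S. \<Sum>c\<leftarrow>cs. ctup n c T S)" if "set cs <= tups n \<kappa>" for cs
  using that
 proof (induct cs)
  case Nil
  then show ?case using zero Psi_zero by (intro bexI[of _ "\<zero>\<^bsub>WM\<^esub>"]) auto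
 next
  case (Cons c cs)
  then obtain C where C: "C : carrier WM" "P C" "Psi C = (%T S. \<Sum>c\<leftarrow>cs. ctup n c T S)" by auto
  obtain D where D: "D : carrier WM" "P D" "Psi D = ctup n c" using t[of c] Cons.prems by auto
  show ?case using add[OF D(1) C(1) D(2) C(2)] C D by (intro bexI[of _ "D \<oplus>\<^bsub>WM\<^esub> C"]) (simp_all add: Psi_add)
 qed
 have b: "P (G (bl i))" if i: "i : bindices n \<kappa>" for i
 proof -
  obtain C where C: "C : carrier WM" "P C" "Psi C = (%T S. \<Sum>c\<leftarrow>choices n (blocks n \<kappa> i). ctup n c T S)"
   using ts[OF choices_tups[OF i]] by blast
  then have "Psi C = betaf n i" using ctup_choices[OF kap_le i] by (simp add: fun_eq_iff)
  moreover have "Psi (G (bl i)) = betaf n i" using bl[OF i] by (simp add: Psi_gen)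
  ultimately have "C = G (bl i)" using Psi_inj[of C "G (bl i)"] C(1) bl(1)[OF i] by simp
  then show ?thesis using C(2) by simp
 qed
 have "P (\<Oplus>\<^bsub>WM\<^esub>i\<in>I. c i \<odot>\<^bsub>WM\<^esub> G (bl i))" if "finite I" "I <= bindices n \<kappa>" for c I
  using that
 proof (induct I)
  case empty
  then show ?case using zero by simp
 next
  case (insert i I)
  have fc: "c i \<odot>\<^bsub>WM\<^esub> G (bl i) : carrier WM" if "i : bindices n \<kappa>" for i using bl(1)[OF that] by simp
  have "(\<Oplus>\<^bsub>WM\<^esub>i\<in>insert i I. c i \<odot>\<^bsub>WM\<^esub> G (bl i)) = c i \<odot>\<^bsub>WM\<^esub> G (bl i) \<oplus>\<^bsub>WM\<^esub> (\<Oplus>\<^bsub>WM\<^esub>i\<in>I. c i \<odot>\<^bsub>WM\<^esub> G (bl i))"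
   using insert fc by (intro W.PM.finsum_insert) auto
  moreover have "(\<Oplus>\<^bsub>WM\<^esub>i\<in>I. c i \<odot>\<^bsub>WM\<^esub> G (bl i)) : carrier WM"
   using insert fc by (intro W.PM.finsum_closed) auto
  moreover have "P (c i \<odot>\<^bsub>WM\<^esub> G (bl i))" using smult[of "G (bl i)" "c i"] b[of i] bl(1)[of i] insert by simp
  ultimately show ?case using add[of "c i \<odot>\<^bsub>WM\<^esub> G (bl i)"] fc[of i] insert by simp
 qed
 then have "P (comb c)" for c unfolding comb_def by simp
 then show ?thesis using comb_exists[OF assms(1)] by blast
qed

text \<open>The formula \<open>refl_act_tor\<close> concerns matrices of operators; this provides an
  operator for every element of the Weyl module.\<close>

lemma Psi_ent:
 assumes "C : carrier WM"
 shows "\<exists>A. Psi C = restr n (ent (A :: 'f fock_op))"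
 using assms
proof (induct rule: weyl_induct)
 case v
 then show ?case unfolding Psi_v ctup_def by blast
next
 case (root \<alpha> C)
 then obtain A where "Psi C = restr n (ent (A :: 'f fock_op))" by blast
 then show ?case unfolding weyl_root(2)[OF root(1,2)] by (metis xact_restr[OF root(1)] xact_ent)
next
 case (add C D)
 then obtain A B where AB: "Psi C = restr n (ent (A :: 'f fock_op))" "Psi D = restr n (ent (B :: 'f fock_op))" by blast
 have "Psi (C \<oplus>\<^bsub>WM\<^esub> D) = restr n (ent (A + B))"
  unfolding Psi_add[OF add(1,2)] AB by (intro ext) (simp add: restr_def ent_add)
 then show ?case by blast
next
 case (smult c C)
 then obtain A where A: "Psi C = restr n (ent (A :: 'f fock_op))" by blast
 have "Psi (c \<odot>\<^bsub>WM\<^esub> C) = restr n (ent (scal c*A))"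
  unfolding Psi_smult[OF smult(1)] A by (intro ext) (simp add: restr_def ent_scal)
 then show ?case by blast
next
 case zero
 have "(%T S. 0) = restr n (ent (0 :: 'f fock_op))" by (intro ext) (simp add: restr_def)
 then show ?case unfolding Psi_zero by blast
qed

definition top_index :: bindex where "top_index = (({..<\<kappa>}, {}), [])"

lemma top_index: "top_index : bindices n \<kappa>"
proof -
 have "[] : stdm xs 0" for xs by (simp add: stdm_0)
 then show ?thesis using kap_le by (auto simp: top_index_def bindices_def disjoint_pairs_def)
qed

lemma choices_Pos: "choices n (map Pos xs) = [map (uv n) xs]"
 by (induct xs) auto

lemma Psi_v_beta: "Psi (G v) = betaf n top_index"
proof -
 have "blocks n \<kappa> top_index = map Pos [0..<\<kappa>]"
  by (simp add: blocks_def fillers_def bsize_def top_index_def lessThan_atLeast0)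
 then have "ctup n (map (uv n) [0..<\<kappa>]) T S = betaf n top_index T S" for T S
  using ctup_choices[OF kap_le top_index, of T S] by (simp only: choices_Pos list.map sum_list.Cons sum_list.Nil add_0_right)
 then show ?thesis unfolding Psi_v by (intro ext)
qed

lemma betaf_nonzero:
 assumes "i : bindices n \<kappa>" "betaf n i T S ~= (0 :: 'f)" "T - S = {..<\<kappa>}" "S <= T"
 shows "i = top_index"
proof -
 obtain X Y Q where i: "i = ((X, Y), Q)" by (metis prod.exhaust)
 note p = bindices_props[OF kap_le assms(1)[unfolded i]]
 have c: "X <= T" "(T - X) \<inter> Y = {}" "(T - X) \<union> Y = S" using assms(2) by (auto simp: betaf_def i split: if_splits)
 have "X = T - S" "Y = S - T" using c p(3) by blast+
 then have XY: "X = {..<\<kappa>}" "Y = {}" using assms(3,4) by auto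
 then have "Q = []" using p(6) by simp
 then show ?thesis using XY i by (simp add: top_index_def)
qed

lemma betaf_top: "betaf n top_index T S ~= (0 :: 'f) ==> T - S = {..<\<kappa>} & S <= T"
 by (auto simp: betaf_def top_index_def split: if_splits)

text \<open>The highest weight vector is determined up to scalars by its weight, since \<open>b\<^sup>2 \<noteq> 1 \<noteq> b\<^sup>4\<close>.\<close>
lemma weight_vector:
 assumes "C : carrier WM" "b ~= 0" "b ~= (1 :: 'f)"
  and w: "!!j. j < n ==> dact j (b\<^sup>2) (Psi C) = (%T S. (if j < \<kappa> then b\<^sup>2 else 1)*Psi C T S)"
 shows "\<exists>c. Psi C = (%T S. c*Psi (G v) T S)"
proof -
 obtain c where c: "C = comb c" using comb_exists[OF assms(1)] by blast
 have sq: "x\<^sup>2 ~= 1" if "x ~= 1" for x :: 'f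
 proof
  assume "x\<^sup>2 = 1"
  then have "(x + 1)*(x + 1) = 0" by (simp add: algebra_simps power2_eq_square)
  then show False using that by (simp add: add_eq_0_iff2)
 qed
 have b2: "b\<^sup>2 ~= 1" by (rule sq[OF assms(3)])
 \<comment> \<open>On a single entry the torus acts by \<open>b\<^sup>2\<close>, by 1 or by the
   inverse of \<open>b\<^sup>2\<close>; a fourth power different from 1 separates the first from the
   last.\<close>
 have b4: "b\<^sup>2*b\<^sup>2 ~= 1" using sq[OF b2] by (simp add: power2_eq_square)
 have nz: "b\<^sup>2 ~= 0" using assms(2) by simp
 have supp: "T - S = {..<\<kappa>} & S <= T" if ne: "Psi C T S ~= 0" for T S
 proof -
  have TS: "T <= {..<n}" "S <= {..<n}"
   using Psi_ent[OF assms(1)] ne by (auto simp: restr_def split: if_splits)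
  have e: "tw j (b\<^sup>2) T*inverse (tw j (b\<^sup>2) S) = (if j < \<kappa> then b\<^sup>2 else 1)" if "j < n" for j
   using fun_cong[OF fun_cong[OF w[OF that], of T], of S] ne by (simp add: dact_def)
  have jm: "(j : T \<longleftrightarrow> j < \<kappa> \<or> j : S) & (j < \<kappa> --> j ~: S)" if "j < n" for j
   using e[OF that] b2 b4 nz by (auto simp: tw_def field_simps split: if_splits)
  have "x : T - S \<longleftrightarrow> x < \<kappa>" for x
  proof (cases "x < n")
   case True
   then show ?thesis using jm[OF True] by blast
  next
   case False
   then have "x ~: T" "\<not> x < \<kappa>" using TS(1) kap_le by auto
   then show ?thesis by blast
  qed
  moreover have "x : T" if "x : S" for x
  proof -
   have "x < n" using that TS(2) by blast
   then show ?thesis using jm[of x] that by blast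
  qed
  ultimately show ?thesis by (intro conjI Set.set_eqI) auto
 qed
 have "Psi C T S = c top_index*Psi (G v) T S" for T S
 proof (cases "T - S = {..<\<kappa>} & S <= T")
  case True
  have "Psi C T S = (\<Sum>i\<in>bindices n \<kappa>. c i*betaf n i T S)" unfolding c Psi_comb ..
  also have "... = (\<Sum>i\<in>bindices n \<kappa>. if i = top_index then c top_index*betaf n top_index T S else 0)"
   using betaf_nonzero True by (intro sum.cong refl) auto
  finally show ?thesis using top_index by (simp add: Psi_v_beta)
 next
  case False
  have "Psi C T S = 0" using supp[of T S] False by blast
  moreover have "betaf n top_index T S = (0 :: 'f)" using betaf_top[of T S] False by blast
  ultimately show ?thesis by (simp add: Psi_v_beta)
 qed
 then show ?thesis by blast
qed

end

section \<open>The given group action on the torus\<close>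

locale weyl_action = weyl n \<kappa> M \<rho> v ty
 for n \<kappa> :: nat and M :: "(complex, 'v) module" (structure) and \<rho> v and ty :: "'f::field itself" +
 fixes \<sigma> :: "'f mat => ('v \<Rightarrow>\<^sub>0 'f) set => ('v \<Rightarrow>\<^sub>0 'f) set"
 assumes wga: "weyl_group_action n M \<rho> v \<sigma>"
begin

lemma sig_hom: "g : carrier (SO n) ==> \<sigma> g : module_hom class_ring WM WM"
 using wga by (simp add: weyl_group_action_def is_gmodule_def weyl_module_eq)

lemma sig_carrier: "g : carrier (SO n) ==> C : carrier WM ==> \<sigma> g C : carrier WM"
 using sig_hom[of g] by (auto simp: module_hom_def)

lemma sig_add: "g : carrier (SO n) ==> C : carrier WM ==> D : carrier WM ==> \<sigma> g (C \<oplus>\<^bsub>WM\<^esub> D) = \<sigma> g C \<oplus>\<^bsub>WM\<^esub> \<sigma> g D"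
 using sig_hom[of g] by (simp add: module_hom_def)

lemma sig_smult: "g : carrier (SO n) ==> C : carrier WM ==> \<sigma> g (c \<odot>\<^bsub>WM\<^esub> C) = c \<odot>\<^bsub>WM\<^esub> \<sigma> g C"
 using sig_hom[of g] by (simp add: module_hom_def)

lemma sig_one: "C : carrier WM ==> \<sigma> (1\<^sub>m (2*n+1)) C = C"
 using wga unfolding weyl_group_action_def is_gmodule_def weyl_module_eq SO_one by blast

lemma sig_mult: "g : carrier (SO n) ==> h : carrier (SO n) ==> C : carrier WM ==> \<sigma> (g*h) C = \<sigma> g (\<sigma> h C)"
 using wga unfolding weyl_group_action_def is_gmodule_def weyl_module_eq SO_mult by blast

lemma sig_root_eq: "\<alpha> : roots n ==> C : carrier WM ==> \<sigma> (root_elem n \<alpha> t) C = weyl_root_act n M \<rho> v \<alpha> t C"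
 using wga unfolding weyl_group_action_def weyl_module_eq by blast

lemma sig_root: "\<alpha> : roots n ==> C : carrier WM ==> Psi (\<sigma> (root_elem n \<alpha> t) C) = xact n \<alpha> t (Psi C)"
 using weyl_root(2)[of \<alpha> C t] by (simp add: sig_root_eq)

lemma sig_zero: "g : carrier (SO n) ==> \<sigma> g \<zero>\<^bsub>WM\<^esub> = \<zero>\<^bsub>WM\<^esub>"
proof -
 assume g: "g : carrier (SO n)"
 have z: "\<zero>\<^bsub>WM\<^esub> : carrier WM" by simp
 show ?thesis using sig_smult[OF g z, of 0] W.PM.smult_l_null[simplified, OF z] W.PM.smult_l_null[simplified, OF sig_carrier[OF g z]] by simp
qed

lemma sig_refl:
 assumes "j < n" "C : carrier WM"
 shows "refl_elem n j t : carrier (SO n)" "Psi (\<sigma> (refl_elem n j t) C) = refl_act n j t (Psi C)"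
proof -
 have r: "Short j : roots n" "NegShort j : roots n" using assms by (auto simp: roots_def)
 note s = root_elem_SO[OF r(1), of t] root_elem_SO[OF r(2), of "inverse t"]
 show "refl_elem n j t : carrier (SO n)" unfolding refl_elem_def by (intro SO_closed s)
 have c1: "\<sigma> (root_elem n (Short j) t) C : carrier WM" by (rule sig_carrier[OF s(1) assms(2)])
 have c2: "\<sigma> (root_elem n (NegShort j) (inverse t)) (\<sigma> (root_elem n (Short j) t) C) : carrier WM" by (rule sig_carrier[OF s(2) c1])
 have "\<sigma> (refl_elem n j t) C = \<sigma> (root_elem n (Short j) t) (\<sigma> (root_elem n (NegShort j) (inverse t)) (\<sigma> (root_elem n (Short j) t) C))"
  unfolding refl_elem_def by (simp only: sig_mult[OF s(1) SO_closed[OF s(2,1)] assms(2)] sig_mult[OF s(2,1) assms(2)])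
 then show "Psi (\<sigma> (refl_elem n j t) C) = refl_act n j t (Psi C)"
  by (simp only: refl_act_def sig_root[OF r(1) assms(2)] sig_root[OF r(2) c1] sig_root[OF r(1) c2])
qed

lemma sig_tor_sq:
 assumes "j < n" "b ~= 0" "C : carrier WM"
 shows "Psi (\<sigma> (tor n j (b\<^sup>2)) C) = dact j (b\<^sup>2) (Psi C)"
proof -
 obtain A where A: "Psi C = restr n (ent (A :: 'f fock_op))" using Psi_ent[OF assms(3)] by blast
 note s = sig_refl(1)[OF assms(1,3)]
 have c: "\<sigma> (refl_elem n j 1) C : carrier WM" by (rule sig_carrier[OF s assms(3)])
 have "Psi (\<sigma> (tor n j (b\<^sup>2)) C) = refl_act n j b (refl_act n j 1 (Psi C))"
  unfolding refl_elem_tor[OF assms(1,2), symmetric] sig_mult[OF s s assms(3)] sig_refl(2)[OF assms(1) c] sig_refl(2)[OF assms(1,3)] ..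
 also have "... = restr n (dact j (b\<^sup>2) (ent A))"
  unfolding A refl_act_restr[OF assms(1)] refl_act_tor[OF assms(1,2)] ..
 finally show ?thesis unfolding A dact_restr .
qed

lemma dact_smult: "dact j a (%T S. c*F T S) = (%T S. c*(dact j a F T S :: 'f))"
 and dact_add: "dact j a (%T S. F T S + H T S) = (%T S. dact j a F T S + (dact j a H T S :: 'f))"
 and dact_sq: "dact j a (dact j a F) = (dact j (a\<^sup>2) F :: nat set => nat set => 'f)"
 by (auto simp: fun_eq_iff dact_def tw_def algebra_simps power2_eq_square)

lemma dact_v: "j < n ==> a ~= 0 ==> dact j a (Psi (G v)) = (%T S. (if j < \<kappa> then a else 1)*Psi (G v) T S)"
proof (intro ext)
 fix T S assume a: "a ~= 0"
 show "dact j a (Psi (G v)) T S = (if j < \<kappa> then a else 1)*Psi (G v) T S"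
 proof (cases "Psi (G v) T S = 0")
  case False
  then have "T - S = {..<\<kappa>} & S <= T" using betaf_top by (simp add: Psi_v_beta)
  then have "j : T \<longleftrightarrow> j < \<kappa> \<or> j : S" "j < \<kappa> ==> j ~: S" by blast+
  then show ?thesis using a by (auto simp: dact_def tw_def)
 qed (simp add: dact_def)
qed

text \<open>The image of the highest weight vector is known up to a scalar, because
  \<open>tor n i a\<close> commutes with the torus elements with square parameter. Conjugation of
  root elements spreads the same scalar \<open>c\<close> over the module. The square of
  \<open>tor n i a\<close> is covered by \<open>sig_tor_sq\<close>, so \<open>c*c = 1\<close> and
  hence \<open>c = 1\<close>.\<close>

lemma sig_tor:
 assumes "i < n" "a ~= 0" "C : carrier WM"
 shows "Psi (\<sigma> (tor n i a) C) = dact i a (Psi C)"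
proof (cases "a = 1")
 case True
 have "dact i 1 F = F" for F :: "nat set => nat set => 'f" by (simp add: dact_def tw_def fun_eq_iff)
 then show ?thesis using True tor_one[OF assms(1), where 'a='f] sig_one[OF assms(3)] by simp
next
 \<comment> \<open>With \<open>a\<close> different from 1, the powers of \<open>a\<close> separate
   the weights as \<open>weight_vector\<close> requires.\<close>
 case a1: False
 let ?h = "tor n i a"
 have h: "?h : carrier (SO n)" by (rule tor_SO[OF assms(1,2)])
 have Gv: "G v : carrier WM" using K_v by simp
 have hv: "\<sigma> ?h (G v) : carrier WM" by (rule sig_carrier[OF h Gv])
 have "dact j (a\<^sup>2) (Psi (\<sigma> ?h (G v))) = (%T S. (if j < \<kappa> then a\<^sup>2 else 1)*Psi (\<sigma> ?h (G v)) T S)" if j: "j < n" for j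
 proof -
  have a2: "a\<^sup>2 ~= 0" using assms(2) by simp
  have t: "tor n j (a\<^sup>2) : carrier (SO n)" by (rule tor_SO[OF j a2])
  have "Psi (\<sigma> (tor n j (a\<^sup>2)) (G v)) = Psi ((if j < \<kappa> then a\<^sup>2 else 1) \<odot>\<^bsub>WM\<^esub> G v)"
   unfolding sig_tor_sq[OF j assms(2) Gv] Psi_smult[OF Gv] by (rule dact_v[OF j a2])
  then have v: "\<sigma> (tor n j (a\<^sup>2)) (G v) = (if j < \<kappa> then a\<^sup>2 else 1) \<odot>\<^bsub>WM\<^esub> G v"
   using Psi_inj[OF sig_carrier[OF t Gv]] Gv by simp
  have "dact j (a\<^sup>2) (Psi (\<sigma> ?h (G v))) = Psi (\<sigma> (tor n j (a\<^sup>2)*?h) (G v))"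
   unfolding sig_mult[OF t h Gv] by (rule sig_tor_sq[OF j assms(2) hv, symmetric])
  also have "... = Psi (\<sigma> ?h (\<sigma> (tor n j (a\<^sup>2)) (G v)))"
   unfolding tor_commute[of n j "a\<^sup>2"] sig_mult[OF h t Gv] ..
  also have "... = (%T S. (if j < \<kappa> then a\<^sup>2 else 1)*Psi (\<sigma> ?h (G v)) T S)"
   unfolding v sig_smult[OF h Gv] Psi_smult[OF hv] ..
  finally show ?thesis .
 qed
 then obtain c0 where c0: "Psi (\<sigma> ?h (G v)) = (%T S. c0*Psi (G v) T S)"
  using weight_vector[OF hv assms(2) a1] by blast
 define c where "c = c0*inverse (if i < \<kappa> then a else 1)"
 have c: "Psi (\<sigma> ?h (G v)) = (%T S. c*dact i a (Psi (G v)) T S)"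
  unfolding c0 dact_v[OF assms(1,2)] c_def using assms(2) by (auto simp: fun_eq_iff)
 have all: "Psi (\<sigma> ?h D) = (%T S. c*dact i a (Psi D) T S)" if "D : carrier WM" for D
  using that
 proof (induct rule: weyl_induct)
  case v
  then show ?case by (rule c)
 next
  case (root \<alpha> D)
  obtain p q where pq: "root_pair n \<alpha> = (p, q)" by fastforce
  let ?t = "twi n i a p*twi n i a q*1"
  note r = root_elem_SO[OF root(1), of 1] root_elem_SO[OF root(1), of ?t]
  have hD: "\<sigma> ?h D : carrier WM" by (rule sig_carrier[OF h root(2)])
  have "Psi (\<sigma> ?h (weyl_root_act n M \<rho> v \<alpha> 1 D)) = Psi (\<sigma> (?h*root_elem n \<alpha> 1) D)"
   unfolding sig_mult[OF h r(1) root(2)] sig_root_eq[OF root(1,2)] ..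
  also have "... = xact n \<alpha> ?t (Psi (\<sigma> ?h D))"
   unfolding tor_root_elem[OF assms(2) root(1) pq assms(1)] sig_mult[OF r(2) h root(2)] by (rule sig_root[OF root(1) hD])
  also have "... = (%T S. c*dact i a (xact n \<alpha> 1 (Psi D)) T S)"
   unfolding root(3) xact_smult xact_dact[OF assms(2) root(1) pq assms(1)] ..
  finally show ?case unfolding weyl_root(2)[OF root(1,2)] .
 next
  case (add D D')
  then show ?case
   unfolding sig_add[OF h add(1,2)] Psi_add[OF sig_carrier[OF h add(1)] sig_carrier[OF h add(2)]] Psi_add[OF add(1,2)] dact_add
   by (simp add: distrib_left)
 next
  case (smult d D)
  then show ?case
   unfolding sig_smult[OF h smult(1)] Psi_smult[OF sig_carrier[OF h smult(1)]] Psi_smult[OF smult(1)] dact_smult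
   by (simp add: mult.left_commute)
 next
  case zero
  show ?case unfolding sig_zero[OF h] Psi_zero by (simp add: dact_def)
 qed
 have "(%T S. c*c*dact i (a\<^sup>2) (Psi (G v)) T S) = Psi (\<sigma> ?h (\<sigma> ?h (G v)))"
  unfolding all[OF hv] all[OF Gv] dact_smult dact_sq by (simp add: mult.assoc)
 also have "... = dact i (a\<^sup>2) (Psi (G v))"
  unfolding sig_mult[OF h h Gv, symmetric] tor_mult power2_eq_square[symmetric] by (rule sig_tor_sq[OF assms(1,2) Gv])
 finally have e: "c*c*dact i (a\<^sup>2) (Psi (G v)) T S = dact i (a\<^sup>2) (Psi (G v)) T S" for T S by (metis)
 have "Psi (G v) {..<\<kappa>} {} = 1" using kap_le by (simp add: Psi_v_beta betaf_def top_index_def)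
 then have "dact i (a\<^sup>2) (Psi (G v)) {..<\<kappa>} {} ~= 0" using assms(2) by (simp add: dact_def tw_def)
 then have "c*c = 1" using e[of "{..<\<kappa>}" "{}"] by simp
 then have "(c + 1)*(c + 1) = 0" by (simp add: algebra_simps)
 then have "c = 1" by (simp add: add_eq_0_iff2)
 then show ?thesis using all[OF assms(3)] by simp
qed

end

declare One_nat_def [simp del]

section \<open>The kernel of the Grassmann homomorphism\<close>

locale weyl_phi = weyl_action n \<kappa> M \<rho> v ty \<sigma> + ext_char2 ty n \<kappa>
 for n \<kappa> :: nat and M :: "(complex, 'v) module" (structure) and \<rho> v and ty :: "'f::field itself" and \<sigma> +
 fixes \<phi> :: "('v \<Rightarrow>\<^sub>0 'f) set => ('f vec list \<Rightarrow>\<^sub>0 'f) set"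
 assumes gh: "grassmann_hom n \<kappa> M \<rho> v \<sigma> \<phi>"
begin

lemma W_circ_sel: "carrier (W_circ n \<kappa>) = module.span class_ring EM {wedge (2*n+1) vs | vs. totally_singular_tuple n \<kappa> vs}"
 "add (W_circ n \<kappa>) = add EM" "zero (W_circ n \<kappa>) = zero EM" "smult (W_circ n \<kappa>) = smult EM"
 unfolding W_circ_def ext_power_eq by simp_all

lemma wedges_carrier: "{wedge (2*n+1) vs | vs. totally_singular_tuple n \<kappa> vs} <= carrier EM"
proof -
 have "wedge (2*n+1) vs : carrier EM" if "totally_singular_tuple n \<kappa> vs" for vs :: "'f vec list"
 proof -
  have t: "vs : TP" using that unfolding totally_singular_tuple_def Let_def by blast
  then have l: "length vs = \<kappa>" by (simp add: tuples_def)
  show ?thesis unfolding wedge_eq[OF l] by (rule E.generator_carrier[OF t])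
 qed
 then show ?thesis by blast
qed

lemma W_circ_module: "module class_ring (W_circ n \<kappa> :: ('f, ('f vec list \<Rightarrow>\<^sub>0 'f) set) module)"
 unfolding W_circ_def ext_power_eq
 by (rule E.PM.submodule_is_module[OF E.PM.span_is_submodule[OF wedges_carrier]])

lemma W_circ_carrier: "carrier (W_circ n \<kappa>) <= carrier EM"
 unfolding W_circ_sel by (rule E.PM.span_is_subset2[OF wedges_carrier])

lemma phi_gmodule_hom: "\<phi> : gmodule_hom (SO n) WM \<sigma> (W_circ n \<kappa>) (ext_power_act (2*n+1) \<kappa>)"
 using gh unfolding grassmann_hom_def weyl_module_eq by (rule conjunct1)

lemma phi_image: "\<phi> ` module.span class_ring WM {G v} = module.span class_ring EM {wedge (2*n+1) (map (uv n) [0..<\<kappa>])}"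
 using gh unfolding grassmann_hom_def weyl_module_eq weyl_vector_eq ext_power_eq by (elim conjE)

lemma phi_hom: "\<phi> : module_hom class_ring WM (W_circ n \<kappa>)"
 using phi_gmodule_hom unfolding gmodule_hom_def by (elim CollectE conjE)

lemma phi_act: "g : carrier (SO n) ==> C : carrier WM ==> \<phi> (\<sigma> g C) = ext_power_act (2*n+1) \<kappa> g (\<phi> C)"
proof -
 assume a: "g : carrier (SO n)" "C : carrier WM"
 have "\<forall>g\<in>carrier (SO n). \<forall>C\<in>carrier WM. \<phi> (\<sigma> g C) = ext_power_act (2*n+1) \<kappa> g (\<phi> C)"
  using phi_gmodule_hom unfolding gmodule_hom_def by (elim CollectE conjE)
 from bspec[OF bspec[OF this a(1)] a(2)] show ?thesis .
qed

lemma phi_carrier: "C : carrier WM ==> \<phi> C : carrier EM"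
proof -
 assume C: "C : carrier WM"
 have "\<phi> : carrier WM \<rightarrow> carrier (W_circ n \<kappa>)" using phi_hom unfolding module_hom_def by (elim CollectE conjE)
 from subsetD[OF W_circ_carrier funcset_mem[OF this C]] show ?thesis .
qed

lemma phi_add: "C : carrier WM ==> D : carrier WM ==> \<phi> (C \<oplus>\<^bsub>WM\<^esub> D) = \<phi> C \<oplus>\<^bsub>EM\<^esub> \<phi> D"
proof -
 assume C: "C : carrier WM" "D : carrier WM"
 have "\<forall>m1 m2. m1 : carrier WM & m2 : carrier WM --> \<phi> (m1 \<oplus>\<^bsub>WM\<^esub> m2) = \<phi> m1 \<oplus>\<^bsub>W_circ n \<kappa>\<^esub> \<phi> m2"
  using phi_hom unfolding module_hom_def by (elim CollectE conjE)
 from mp[OF spec[OF spec[OF this, of C], of D] conjI[OF C]] show ?thesis unfolding W_circ_sel .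
qed

lemma phi_smult: "C : carrier WM ==> \<phi> (c \<odot>\<^bsub>WM\<^esub> C) = c \<odot>\<^bsub>EM\<^esub> \<phi> C"
proof -
 assume C: "C : carrier WM"
 have h: "\<forall>r m. r : carrier class_ring & m : carrier WM --> \<phi> (r \<odot>\<^bsub>WM\<^esub> m) = r \<odot>\<^bsub>W_circ n \<kappa>\<^esub> \<phi> m"
  using phi_hom unfolding module_hom_def by (elim CollectE conjE)
 have "c : carrier class_ring" by (simp add: class_ring_simps)
 from mp[OF spec[OF spec[OF h, of c], of C] conjI[OF this C]] show ?thesis unfolding W_circ_sel .
qed

lemma EM_smult_zero: "C : carrier EM ==> 0 \<odot>\<^bsub>EM\<^esub> C = \<zero>\<^bsub>EM\<^esub>"
 using E.PM.smult_l_null[of C] by (simp only: class_ring_simps)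

lemma WM_smult_zero: "C : carrier WM ==> 0 \<odot>\<^bsub>WM\<^esub> C = \<zero>\<^bsub>WM\<^esub>"
 using W.PM.smult_l_null[of C] by (simp only: class_ring_simps)

lemma phi_zero: "\<phi> \<zero>\<^bsub>WM\<^esub> = \<zero>\<^bsub>EM\<^esub>"
 using phi_smult[OF W.PM.zero_closed, of 0] unfolding WM_smult_zero[OF W.PM.zero_closed] EM_smult_zero[OF phi_carrier[OF W.PM.zero_closed]] .

lemma ker_eq: "mod_hom.ker WM (W_circ n \<kappa>) \<phi> = {C : carrier WM. \<phi> C = \<zero>\<^bsub>EM\<^esub>}"
proof -
 have "mod_hom class_ring WM (W_circ n \<kappa>) \<phi>"
  by (intro mod_hom.intro W.PM.module_axioms W_circ_module mod_hom_axioms.intro phi_hom)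
 from mod_hom.ker_def[OF this] show ?thesis unfolding W_circ_sel by simp
qed

section \<open>Normalizing the homomorphism on the highest weight vector\<close>

lemma std_tuple: "map (uv n) [0..<\<kappa>] : TP"
 unfolding tuples_def by (auto simp del: One_nat_def)

lemma wco_std: "wco {..<\<kappa>} (wg (map (uv n) [0..<\<kappa>])) = 1"
proof -
 have "map (lc n cre) (map (uv n) [0..<\<kappa>]) = map cre [0..<\<kappa>]"
  using kap_le by (auto intro!: lc_unit[simplified])
 then have "wfun n {..<\<kappa>} (map (uv n) [0..<\<kappa>]) = (ent (prod_list (map cre [0..<\<kappa>])*1) {..<\<kappa>} {} :: 'f)"
  unfolding wfun_def by (simp only: mult_1_right)
 also have "... = 1" unfolding ent_cres[OF distinct_upt] by (auto simp: ent_1)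
 finally show ?thesis unfolding wco_wg[OF std_tuple] .
qed

lemma span_single:
 assumes "x : carrier EM" "y : module.span class_ring EM {x}"
 shows "\<exists>c. y = c \<odot>\<^bsub>EM\<^esub> x"
proof -
 have "E.PM.span {x} = {E.PM.lincomb a {x} | a. a : {x} \<rightarrow> carrier class_ring}"
  by (rule E.PM.finite_span) (use assms(1) in simp_all)
 from assms(2)[unfolded this] obtain a where a: "y = E.PM.lincomb a {x}" by (elim CollectE exE conjE)
 have "E.PM.lincomb a {x} = a x \<odot>\<^bsub>EM\<^esub> x"
  unfolding E.PM.lincomb_def using assms(1) by (subst E.PM.finsum_insert) auto
 then show ?thesis using a by blast
qed

text \<open>The two lines correspond, so the image is a multiple of the standard wedge. A zero
  factor would put the wedge itself into the image of zero, while one of its coordinates is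
  1.\<close>

lemma phi_v: "\<exists>c. c ~= 0 & \<phi> (G v) = c \<odot>\<^bsub>EM\<^esub> wg (map (uv n) [0..<\<kappa>])"
proof -
 let ?w = "wg (map (uv n) [0..<\<kappa>])"
 have w: "?w : carrier EM" by (rule E.generator_carrier[OF std_tuple])
 have Gv: "G v : carrier WM" using K_v by simp
 have len: "length (map (uv n) [0..<\<kappa>]) = \<kappa>" by simp
 note im = phi_image[unfolded wedge_eq[OF len]]
 have Gs: "{G v} <= carrier WM" and ws: "{?w} <= carrier EM" using Gv w by simp_all
 have "G v : module.span class_ring WM {G v}" by (rule subsetD[OF W.PM.in_own_span[OF Gs] singletonI])
 then have "\<phi> (G v) : \<phi> ` module.span class_ring WM {G v}" by (rule imageI)
 from span_single[OF w this[unfolded im]] obtain c where c: "\<phi> (G v) = c \<odot>\<^bsub>EM\<^esub> ?w" by (rule exE)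
 have "c ~= 0"
 proof
  assume "c = 0"
  then have z: "\<phi> (G v) = \<zero>\<^bsub>EM\<^esub>" using c EM_smult_zero[OF w] by simp
  have "?w : module.span class_ring EM {?w}" by (rule subsetD[OF E.PM.in_own_span[OF ws] singletonI])
  then have "?w : \<phi> ` module.span class_ring WM {G v}" unfolding im .
  then obtain C where C: "?w = \<phi> C" "C : module.span class_ring WM {G v}" by (rule imageE)
  have "W.PM.span {G v} = {W.PM.lincomb a {G v} | a. a : {G v} \<rightarrow> carrier class_ring}"
   by (rule W.PM.finite_span[OF _ Gs]) simp
  from C(2)[unfolded this] obtain a where a: "C = W.PM.lincomb a {G v}" by (elim CollectE exE conjE)
  have "W.PM.lincomb a {G v} = a (G v) \<odot>\<^bsub>WM\<^esub> G v"
   unfolding W.PM.lincomb_def using Gv by (subst W.PM.finsum_insert) auto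
  then have "?w = a (G v) \<odot>\<^bsub>EM\<^esub> \<zero>\<^bsub>EM\<^esub>" unfolding C(1) a by (simp only: phi_smult[OF Gv] z)
  then have "wco {..<\<kappa>} ?w = wco {..<\<kappa>} (a (G v) \<odot>\<^bsub>EM\<^esub> \<zero>\<^bsub>EM\<^esub>)" by (rule arg_cong)
  also have "... = 0" unfolding wco_smult[OF E.PM.zero_closed] wco_zero by simp
  finally show False unfolding wco_std by simp
 qed
 then show ?thesis using c by blast
qed

definition pc :: 'f where "pc = (SOME c. c ~= 0 & \<phi> (G v) = c \<odot>\<^bsub>EM\<^esub> wg (map (uv n) [0..<\<kappa>]))"

lemma pc: "pc ~= 0" "\<phi> (G v) = pc \<odot>\<^bsub>EM\<^esub> wg (map (uv n) [0..<\<kappa>])"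
 using someI_ex[OF phi_v] by (auto simp: pc_def)

lemma tups_TP: "vs : tups n \<kappa> ==> vs : TP"
 using tups_carrier[of vs n \<kappa>] by (simp add: tuples_def)

text \<open>The matrix and the image in the exterior power are moved by the same root elements,
  starting from the highest weight vector, so the factor \<open>pc\<close> is the same for all
  tuples.\<close>

lemma tups_phi: "vs : tups n \<kappa> ==> \<exists>C\<in>carrier WM. Psi C = ctup n vs & \<phi> C = pc \<odot>\<^bsub>EM\<^esub> wg vs"
proof (induct rule: tups.induct)
 case tups_base
 then show ?case using pc(2) Psi_v K_v by (intro bexI[of _ "G v"] conjI) auto
next
 case (tups_step vs \<alpha>)
 then obtain C where C: "C : carrier WM" "Psi C = ctup n vs" "\<phi> C = pc \<odot>\<^bsub>EM\<^esub> wg vs" by blast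
 note r = root_elem_SO[OF tups_step(3), of 1]
 have "set vs <= cvec n" using tups_carrier[OF tups_step(1)] by blast
 then have "Psi (\<sigma> (root_elem n \<alpha> 1) C) = ctup n (map (%v. root_elem n \<alpha> 1 *\<^sub>v v) vs)"
  unfolding sig_root[OF tups_step(3) C(1)] C(2) by (rule xact_ctup[OF tups_step(3)])
 moreover have "\<phi> (\<sigma> (root_elem n \<alpha> 1) C) = pc \<odot>\<^bsub>EM\<^esub> wg (map (%v. root_elem n \<alpha> 1 *\<^sub>v v) vs)"
  unfolding phi_act[OF r C(1)] C(3) by (rule ext_act_wg[OF root_elem_carrier(1) tups_TP[OF tups_step(1)]])
 ultimately show ?case using sig_carrier[OF r C(1)] by blast
qed

lemma tups_phi_sum: "set cs <= tups n \<kappa> ==> \<exists>C\<in>carrier WM. Psi C = (%T S. \<Sum>c\<leftarrow>cs. ctup n c T S) & \<phi> C = pc \<odot>\<^bsub>EM\<^esub> wlist cs"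
proof (induct cs)
 case Nil
 have "pc \<odot>\<^bsub>EM\<^esub> \<zero>\<^bsub>EM\<^esub> = \<zero>\<^bsub>EM\<^esub>" using E.PM.smult_r_null[of pc] by simp
 then show ?case using phi_zero Psi_zero by (intro bexI[of _ "\<zero>\<^bsub>WM\<^esub>"]) auto
next
 case (Cons c cs)
 then obtain C where C: "C : carrier WM" "Psi C = (%T S. \<Sum>c\<leftarrow>cs. ctup n c T S)" "\<phi> C = pc \<odot>\<^bsub>EM\<^esub> wlist cs" by auto
 obtain D where D: "D : carrier WM" "Psi D = ctup n c" "\<phi> D = pc \<odot>\<^bsub>EM\<^esub> wg c" using tups_phi[of c] Cons.prems by auto
 have "set cs <= TP" "c : TP" using Cons.prems tups_TP by auto
 note t = E.generator_carrier[OF this(2)] wlist_carrier[OF this(1)]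
 have "Psi (D \<oplus>\<^bsub>WM\<^esub> C) = (%T S. \<Sum>c\<leftarrow>c # cs. ctup n c T S)" unfolding Psi_add[OF D(1) C(1)] C(2) D(2) by simp
 moreover have "\<phi> (D \<oplus>\<^bsub>WM\<^esub> C) = pc \<odot>\<^bsub>EM\<^esub> wlist (c # cs)"
  unfolding phi_add[OF D(1) C(1)] C(3) D(3) wlist_simps using E.PM.smult_r_distr[of pc "wg c" "wlist cs"] t by simp
 moreover have "D \<oplus>\<^bsub>WM\<^esub> C : carrier WM" using C D by simp
 ultimately show ?case by blast
qed

lemma phi_bl: "i : bindices n \<kappa> ==> \<phi> (G (bl i)) = pc \<odot>\<^bsub>EM\<^esub> wlist (choices n (blocks n \<kappa> i))"
proof -
 assume i: "i : bindices n \<kappa>"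
 obtain C where C: "C : carrier WM" "Psi C = (%T S. \<Sum>c\<leftarrow>choices n (blocks n \<kappa> i). ctup n c T S)"
  "\<phi> C = pc \<odot>\<^bsub>EM\<^esub> wlist (choices n (blocks n \<kappa> i))"
  using tups_phi_sum[OF choices_tups[OF i]] by blast
 have "Psi C = betaf n i" unfolding C(2) by (intro ext) (rule ctup_choices[OF kap_le i])
 moreover have "Psi (G (bl i)) = betaf n i" using bl[OF i] by (simp add: Psi_gen)
 ultimately have "C = G (bl i)" using Psi_inj[of C "G (bl i)"] C(1) bl(1)[OF i] by simp
 then show ?thesis using C(3) by simp
qed

section \<open>Determination of the kernel\<close>

lemma phi_finsum:
 assumes "finite I" "!!i. i : I ==> f i : carrier WM"
 shows "\<phi> (finsum WM f I) = finsum EM (%i. \<phi> (f i)) I & wco Z (\<phi> (finsum WM f I)) = (\<Sum>i\<in>I. wco Z (\<phi> (f i)))"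
 using assms
proof (induct I)
 case empty
 then show ?case using phi_zero wco_zero by simp
next
 case (insert i I)
 have c: "f i : carrier WM" "finsum WM f I : carrier WM" using insert by (auto intro!: W.PM.finsum_closed)
 have e1: "finsum WM f (insert i I) = f i \<oplus>\<^bsub>WM\<^esub> finsum WM f I" using insert by (intro W.PM.finsum_insert) auto
 have e2: "finsum EM (%i. \<phi> (f i)) (insert i I) = \<phi> (f i) \<oplus>\<^bsub>EM\<^esub> finsum EM (%i. \<phi> (f i)) I"
  using insert phi_carrier by (intro E.PM.finsum_insert) auto
 have ih: "\<phi> (finsum WM f I) = finsum EM (%i. \<phi> (f i)) I & wco Z (\<phi> (finsum WM f I)) = (\<Sum>i\<in>I. wco Z (\<phi> (f i)))"
  by (rule insert.hyps(3)) (rule insert.prems, simp)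
 have s: "wco Z (\<phi> (f i \<oplus>\<^bsub>WM\<^esub> finsum WM f I)) = wco Z (\<phi> (f i)) + wco Z (\<phi> (finsum WM f I))"
  unfolding phi_add[OF c] by (rule wco_add[OF phi_carrier[OF c(1)] phi_carrier[OF c(2)]])
 show ?case
 proof (rule conjI)
  show "\<phi> (finsum WM f (insert i I)) = finsum EM (%i. \<phi> (f i)) (insert i I)"
   unfolding e1 e2 phi_add[OF c] conjunct1[OF ih] ..
  show "wco Z (\<phi> (finsum WM f (insert i I))) = (\<Sum>i\<in>insert i I. wco Z (\<phi> (f i)))"
   unfolding e1 s conjunct2[OF ih] sum.insert[OF insert.hyps(1,2)] ..
 qed
qed

lemma phi_bl_zero:
 assumes "i : bindices n \<kappa>" "bsize i + 2 \<le> \<kappa>"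
 shows "\<phi> (G (bl i)) = \<zero>\<^bsub>EM\<^esub>"
 unfolding phi_bl[OF assms(1)] wlist_blocks_zero[OF kap_le assms] using E.PM.smult_r_null[of pc] by simp

text \<open>Basis vectors with two or more fillers go to zero by \<open>wlist_blocks_zero\<close>;
  the images of the others are independent, as their coordinates show by
  \<open>wval_independent\<close>.\<close>

lemma phi_comb_zero: "\<phi> (comb d) = \<zero>\<^bsub>EM\<^esub> \<longleftrightarrow> (\<forall>i\<in>bindices n \<kappa>. \<not> bsize i + 2 \<le> \<kappa> --> d i = 0)"
proof
 have c: "G (bl i) : carrier WM" if "i : bindices n \<kappa>" for i using bl(1)[OF that] by simp
 then have c': "d i \<odot>\<^bsub>WM\<^esub> G (bl i) : carrier WM" if "i : bindices n \<kappa>" for i using that by simp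
 have fs1: "\<phi> (comb d) = (\<Oplus>\<^bsub>EM\<^esub>i\<in>bindices n \<kappa>. \<phi> (d i \<odot>\<^bsub>WM\<^esub> G (bl i)))"
  unfolding comb_def by (rule conjunct1[OF phi_finsum[OF finite_bindices c']])
 have fs2: "wco Z (\<phi> (comb d)) = (\<Sum>i\<in>bindices n \<kappa>. wco Z (\<phi> (d i \<odot>\<^bsub>WM\<^esub> G (bl i))))" for Z
  unfolding comb_def by (rule conjunct2[OF phi_finsum[OF finite_bindices c']])
 {
  assume z: "\<phi> (comb d) = \<zero>\<^bsub>EM\<^esub>"
  \<comment> \<open>The coefficients at indices with two or more fillers are not constrained by the
    relation; they are set to 0 before independence is applied.\<close>
  let ?d = "%i. if bsize i + 2 \<le> \<kappa> then 0 else d i"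
  have "(\<Sum>i\<in>bindices n \<kappa>. ?d i*wval n \<kappa> i Z) = 0" for Z
  proof -
   have "pc*(?d i*wval n \<kappa> i Z) = wco Z (\<phi> (d i \<odot>\<^bsub>WM\<^esub> G (bl i)))" if i: "i : bindices n \<kappa>" for i
   proof (cases "bsize i + 2 \<le> \<kappa>")
    case True
    then show ?thesis
    proof -
     have "wco Z (\<phi> (d i \<odot>\<^bsub>WM\<^esub> G (bl i))) = d i*wco Z (\<phi> (G (bl i)))"
      unfolding phi_smult[OF c[OF i]] by (rule wco_smult[OF phi_carrier[OF c[OF i]]])
     moreover have "wco Z (\<phi> (G (bl i))) = 0" unfolding phi_bl_zero[OF i True] by (rule wco_zero)
     ultimately show ?thesis using True by simp
    qed
   next
    case False
    have w: "wlist (choices n (blocks n \<kappa> i)) : carrier EM" by (rule wlist_carrier[OF wco_blocks(2)[OF kap_le i]])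
    show ?thesis
     unfolding phi_smult[OF c[OF i]] wco_smult[OF phi_carrier[OF c[OF i]]]
     unfolding phi_bl[OF i] wco_smult[OF w] wco_blocks(1)[OF kap_le i] using False by (simp add: mult.left_commute)
   qed
   then have "pc*(\<Sum>i\<in>bindices n \<kappa>. ?d i*wval n \<kappa> i Z) = (\<Sum>i\<in>bindices n \<kappa>. wco Z (\<phi> (d i \<odot>\<^bsub>WM\<^esub> G (bl i))))"
    unfolding sum_distrib_left by (rule sum.cong[OF refl])
   also have "... = 0" unfolding fs2[symmetric] z by (rule wco_zero)
   finally show ?thesis using pc(1) by (simp only: mult_eq_0_iff) simp
  qed
  note sums = this
  have dz: "?d i = 0" if "i : bindices n \<kappa>" for i
   by (rule wval_independent[where c = ?d, OF kap_le sums _ that]) simp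
  show "\<forall>i\<in>bindices n \<kappa>. \<not> bsize i + 2 \<le> \<kappa> --> d i = 0"
  proof (intro ballI impI)
   fix i assume "i : bindices n \<kappa>" "\<not> bsize i + 2 \<le> \<kappa>"
   then show "d i = 0" using dz[of i] by (simp only: if_False)
  qed
 }
 assume z: "\<forall>i\<in>bindices n \<kappa>. \<not> bsize i + 2 \<le> \<kappa> --> d i = 0"
 have "\<phi> (d i \<odot>\<^bsub>WM\<^esub> G (bl i)) = \<zero>\<^bsub>EM\<^esub>" if i: "i : bindices n \<kappa>" for i
 proof (cases "bsize i + 2 \<le> \<kappa>")
  case True
  show ?thesis unfolding phi_smult[OF c[OF i]] phi_bl_zero[OF i True] using E.PM.smult_r_null[of "d i"] by simp
 next
  case False
  then have "d i = 0" using z i by blast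
  then show ?thesis using WM_smult_zero[OF c[OF i]] phi_zero by simp
 qed
 then have "finsum EM (%i. \<phi> (d i \<odot>\<^bsub>WM\<^esub> G (bl i))) (bindices n \<kappa>) = finsum EM (%i. \<zero>\<^bsub>EM\<^esub>) (bindices n \<kappa>)"
  by (intro E.PM.finsum_cong') auto
 then show "\<phi> (comb d) = \<zero>\<^bsub>EM\<^esub>" unfolding fs1 by simp
qed

text \<open>The kernel is described by its matrices alone, as the span of the basis matrices for
  \<open>\<kappa> - 2\<close>. The smaller Weyl module has the same description.\<close>

lemma kernel_comb:
 assumes "2 \<le> \<kappa>"
 shows "C : carrier WM ==> \<phi> C = \<zero>\<^bsub>EM\<^esub> \<longleftrightarrow> (\<exists>d. Psi C = (%T S. \<Sum>i\<in>bindices n (\<kappa> - 2). d i*betaf n i T S))"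
  "\<exists>C\<in>carrier WM. Psi C = (%T S. \<Sum>i\<in>bindices n (\<kappa> - 2). d i*betaf n i T S)"
proof -
 have B: "bindices n (\<kappa> - 2) = {i : bindices n \<kappa>. bsize i + 2 \<le> \<kappa>}"
 proof -
  have e: "bsize i \<le> \<kappa> - 2 \<longleftrightarrow> bsize i + 2 \<le> \<kappa>" for i using assms by arith
  show ?thesis using bindices_sub[OF diff_le_self[of \<kappa> 2], of n] unfolding e .
 qed
 have P: "Psi (comb (%i. if bsize i + 2 \<le> \<kappa> then d i else 0)) = (%T S. \<Sum>i\<in>bindices n (\<kappa> - 2). d i*betaf n i T S)" for d
 proof -
  have "(\<Sum>i\<in>bindices n \<kappa>. (if bsize i + 2 \<le> \<kappa> then d i else 0)*betaf n i T S) = (\<Sum>i\<in>bindices n (\<kappa> - 2). d i*betaf n i T S)" for T S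
   unfolding B by (rule sum.mono_neutral_cong_right) auto
  then show ?thesis unfolding Psi_comb by simp
 qed
 show "\<exists>C\<in>carrier WM. Psi C = (%T S. \<Sum>i\<in>bindices n (\<kappa> - 2). d i*betaf n i T S)"
  by (rule bexI, rule P, rule comb_carrier)
 assume C: "C : carrier WM"
 show "\<phi> C = \<zero>\<^bsub>EM\<^esub> \<longleftrightarrow> (\<exists>d. Psi C = (%T S. \<Sum>i\<in>bindices n (\<kappa> - 2). d i*betaf n i T S))"
 proof
  assume z: "\<phi> C = \<zero>\<^bsub>EM\<^esub>"
  obtain d where d: "C = comb d" using comb_exists[OF C] by blast
  have "(\<Sum>i\<in>bindices n \<kappa>. d i*betaf n i T S) = (\<Sum>i\<in>bindices n (\<kappa> - 2). d i*betaf n i T S)" for T S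
  proof -
   have "\<forall>i\<in>bindices n \<kappa>. \<not> bsize i + 2 \<le> \<kappa> --> d i = 0" using z unfolding d phi_comb_zero .
   then show ?thesis unfolding B by (intro sum.mono_neutral_right) auto
  qed
  then have "Psi C = (%T S. \<Sum>i\<in>bindices n (\<kappa> - 2). d i*betaf n i T S)" unfolding d Psi_comb by simp
  then show "\<exists>d. Psi C = (%T S. \<Sum>i\<in>bindices n (\<kappa> - 2). d i*betaf n i T S)" by blast
 next
  assume "\<exists>d. Psi C = (%T S. \<Sum>i\<in>bindices n (\<kappa> - 2). d i*betaf n i T S)"
  then obtain d where "Psi C = (%T S. \<Sum>i\<in>bindices n (\<kappa> - 2). d i*betaf n i T S)" by blast
  then have "Psi C = Psi (comb (%i. if bsize i + 2 \<le> \<kappa> then d i else 0))" unfolding P .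
  then have e: "C = comb (%i. if bsize i + 2 \<le> \<kappa> then d i else 0)" by (rule Psi_inj[OF C comb_carrier])
  show "\<phi> C = \<zero>\<^bsub>EM\<^esub>" unfolding e phi_comb_zero by simp
 qed
qed

end

text \<open>The kernel and the smaller Weyl module have the same image in one function space, and
  the isomorphism is the identity there. It commutes with the group because root and torus elements
  act on matrices by formulas that do not depend on \<open>k\<close>.\<close>

theorem corollary1p5:
  fixes n k :: nat
    and M :: "(complex, 'v) module" and \<rho> :: "complex mat \<Rightarrow> 'v \<Rightarrow> 'v" and v :: 'v
    and M' :: "(complex, 'w) module" and \<rho>' :: "complex mat \<Rightarrow> 'w \<Rightarrow> 'w" and v' :: 'w
    and \<sigma> :: "'f::field mat \<Rightarrow> ('v \<Rightarrow>\<^sub>0 'f) set \<Rightarrow> ('v \<Rightarrow>\<^sub>0 'f) set"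
    and \<sigma>' :: "'f mat \<Rightarrow> ('w \<Rightarrow>\<^sub>0 'f) set \<Rightarrow> ('w \<Rightarrow>\<^sub>0 'f) set"
    and \<phi> :: "('v \<Rightarrow>\<^sub>0 'f) set \<Rightarrow> ('f vec list \<Rightarrow>\<^sub>0 'f) set"
  assumes "CHAR('f) = 2" and "2 \<le> k" and "k \<le> n"
    and "irreducible_hw_module n M \<rho> (lambda_circ n k) v"
    and "weyl_group_action n M \<rho> v \<sigma>"
    and "irreducible_hw_module n M' \<rho>' (lambda_circ n (k - 2)) v'"
    and "weyl_group_action n M' \<rho>' v' \<sigma>'"
    and "grassmann_hom n k M \<rho> v \<sigma> \<phi>"
  shows "gmodule_iso (SO n)
    ((weyl_module n M \<rho> v)\<lparr>carrier :=
       mod_hom.ker (weyl_module n M \<rho> v) (W_circ n k) \<phi>\<rparr>) \<sigma>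
    (weyl_module n M' \<rho>' v') \<sigma>'"
proof -
 have n: "0 < n" "k - 2 \<le> n" using assms(2,3) by auto
 interpret A: weyl_phi n k M \<rho> v "TYPE('f)" \<sigma> \<phi>
  by (intro weyl_phi.intro weyl_action.intro weyl.intro hw_module.intro char2.intro weyl_action_axioms.intro
    ext_char2.intro weyl_phi_axioms.intro n assms)
 interpret B: weyl_action n "k - 2" M' \<rho>' v' "TYPE('f)" \<sigma>'
  by (intro weyl_action.intro weyl.intro hw_module.intro char2.intro weyl_action_axioms.intro n assms)
 define Ker where "Ker = {C : carrier A.WM. \<phi> C = \<zero>\<^bsub>A.EM\<^esub>}"
 \<comment> \<open>The vector of the smaller module with the same matrix; \<open>B.Psi_inj\<close>
   makes it unique.\<close>
 define f where "f C = (SOME D. D : carrier B.WM & B.Psi D = A.Psi C)" for C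
 have Ker: "C : Ker \<longleftrightarrow> C : carrier A.WM & (\<exists>D\<in>carrier B.WM. B.Psi D = A.Psi C)" for C
 proof (cases "C : carrier A.WM")
  case True
  have "(\<exists>d. A.Psi C = (%T S. \<Sum>i\<in>bindices n (k - 2). d i*betaf n i T S)) \<longleftrightarrow> (\<exists>D\<in>carrier B.WM. B.Psi D = A.Psi C)"
  proof
   assume "\<exists>d. A.Psi C = (%T S. \<Sum>i\<in>bindices n (k - 2). d i*betaf n i T S)"
   then obtain d where d: "A.Psi C = (%T S. \<Sum>i\<in>bindices n (k - 2). d i*betaf n i T S)" by (rule exE)
   have "B.Psi (B.comb d) = A.Psi C" unfolding d by (rule B.Psi_comb)
   then show "\<exists>D\<in>carrier B.WM. B.Psi D = A.Psi C" by (rule bexI[OF _ B.comb_carrier])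
  next
   assume "\<exists>D\<in>carrier B.WM. B.Psi D = A.Psi C"
   then obtain D where D: "D : carrier B.WM" "B.Psi D = A.Psi C" by (rule bexE)
   obtain d where d: "D = B.comb d" using B.comb_exists[OF D(1)] by (rule exE)
   show "\<exists>d. A.Psi C = (%T S. \<Sum>i\<in>bindices n (k - 2). d i*betaf n i T S)"
    unfolding D(2)[symmetric] d by (intro exI) (rule B.Psi_comb)
  qed
  then show ?thesis using A.kernel_comb(1)[OF assms(2) True] True by (simp add: Ker_def)
 qed (simp add: Ker_def)
 have f: "f C : carrier B.WM" "B.Psi (f C) = A.Psi C" if "C : Ker" for C
 proof -
  have "\<exists>D. D : carrier B.WM & B.Psi D = A.Psi C" using that Ker by blast
  from someI_ex[OF this] show "f C : carrier B.WM" "B.Psi (f C) = A.Psi C" by (simp_all add: f_def)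
 qed
 have f_eq: "f C = D" if "C : Ker" "D : carrier B.WM" "B.Psi D = A.Psi C" for C D
  using B.Psi_inj[OF f(1)[OF that(1)] that(2)] f(2)[OF that(1)] that(3) by simp
 have KA: "C : carrier A.WM" if "C : Ker" for C using that Ker by blast
 have addK: "C \<oplus>\<^bsub>A.WM\<^esub> D : Ker & f (C \<oplus>\<^bsub>A.WM\<^esub> D) = f C \<oplus>\<^bsub>B.WM\<^esub> f D" if "C : Ker" "D : Ker" for C D
 proof -
  have c: "f C \<oplus>\<^bsub>B.WM\<^esub> f D : carrier B.WM" "C \<oplus>\<^bsub>A.WM\<^esub> D : carrier A.WM" using f(1) KA that by auto
  have p: "B.Psi (f C \<oplus>\<^bsub>B.WM\<^esub> f D) = A.Psi (C \<oplus>\<^bsub>A.WM\<^esub> D)"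
   unfolding B.Psi_add[OF f(1)[OF that(1)] f(1)[OF that(2)]] A.Psi_add[OF KA[OF that(1)] KA[OF that(2)]] f(2)[OF that(1)] f(2)[OF that(2)] ..
  then have "C \<oplus>\<^bsub>A.WM\<^esub> D : Ker" using c Ker by blast
  then show ?thesis using f_eq[OF _ c(1) p] by blast
 qed
 have smultK: "c \<odot>\<^bsub>A.WM\<^esub> C : Ker & f (c \<odot>\<^bsub>A.WM\<^esub> C) = c \<odot>\<^bsub>B.WM\<^esub> f C" if "C : Ker" for c C
 proof -
  have c: "c \<odot>\<^bsub>B.WM\<^esub> f C : carrier B.WM" "c \<odot>\<^bsub>A.WM\<^esub> C : carrier A.WM" using f(1) KA that by auto
  have p: "B.Psi (c \<odot>\<^bsub>B.WM\<^esub> f C) = A.Psi (c \<odot>\<^bsub>A.WM\<^esub> C)"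
   unfolding B.Psi_smult[OF f(1)[OF that]] A.Psi_smult[OF KA[OF that]] f(2)[OF that] ..
  then have "c \<odot>\<^bsub>A.WM\<^esub> C : Ker" using c Ker by blast
  then show ?thesis using f_eq[OF _ c(1) p] by blast
 qed
 \<comment> \<open>The operator \<tau> on matrices is composed along a factorization of
   \<open>g\<close> into root and torus elements. What matters is that one \<tau> serves both
   modules.\<close>
 have good: "g : carrier (SO n) & (\<exists>\<tau>. (\<forall>C\<in>carrier A.WM. A.Psi (\<sigma> g C) = \<tau> (A.Psi C)) & (\<forall>D\<in>carrier B.WM. B.Psi (\<sigma>' g D) = \<tau> (B.Psi D)))"
  if "g : A.so_gen n" for g
  using that
 proof (induct rule: A.so_gen.induct)
  case so_one
  have "1\<^sub>m (2*n+1) : carrier (SO n)" by (simp add: SO_carrier)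
  then show ?case using A.sig_one B.sig_one by (intro conjI exI[of _ id]) auto
 next
  case (so_root g \<alpha> t)
  then obtain \<tau> where g: "g : carrier (SO n)" and \<tau>: "\<forall>C\<in>carrier A.WM. A.Psi (\<sigma> g C) = \<tau> (A.Psi C)" "\<forall>D\<in>carrier B.WM. B.Psi (\<sigma>' g D) = \<tau> (B.Psi D)"
   by blast
  note r = A.root_elem_SO[OF so_root(3), of t]
  show ?case
  proof (intro conjI exI[of _ "%F. A.xact n \<alpha> t (\<tau> F)"] ballI)
   show "root_elem n \<alpha> t*g : carrier (SO n)" by (rule SO_closed[OF r g])
   show "A.Psi (\<sigma> (root_elem n \<alpha> t*g) C) = A.xact n \<alpha> t (\<tau> (A.Psi C))" if "C : carrier A.WM" for C
    unfolding A.sig_mult[OF r g that] A.sig_root[OF so_root(3) A.sig_carrier[OF g that]] using \<tau>(1) that by simp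
   show "B.Psi (\<sigma>' (root_elem n \<alpha> t*g) D) = A.xact n \<alpha> t (\<tau> (B.Psi D))" if "D : carrier B.WM" for D
    unfolding B.sig_mult[OF r g that] B.sig_root[OF so_root(3) B.sig_carrier[OF g that]] using \<tau>(2) that by simp
  qed
 next
  case (so_tor g i a)
  then obtain \<tau> where g: "g : carrier (SO n)" and \<tau>: "\<forall>C\<in>carrier A.WM. A.Psi (\<sigma> g C) = \<tau> (A.Psi C)" "\<forall>D\<in>carrier B.WM. B.Psi (\<sigma>' g D) = \<tau> (B.Psi D)"
   by blast
  note r = tor_SO[OF so_tor(3,4)]
  show ?case
  proof (intro conjI exI[of _ "%F. dact i a (\<tau> F)"] ballI)
   show "tor n i a*g : carrier (SO n)" by (rule SO_closed[OF r g])
   show "A.Psi (\<sigma> (tor n i a*g) C) = dact i a (\<tau> (A.Psi C))" if "C : carrier A.WM" for C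
    unfolding A.sig_mult[OF r g that] A.sig_tor[OF so_tor(3,4) A.sig_carrier[OF g that]] using \<tau>(1) that by simp
   show "B.Psi (\<sigma>' (tor n i a*g) D) = dact i a (\<tau> (B.Psi D))" if "D : carrier B.WM" for D
    unfolding B.sig_mult[OF r g that] B.sig_tor[OF so_tor(3,4) B.sig_carrier[OF g that]] using \<tau>(2) that by simp
  qed
 qed
 have equiv: "f (\<sigma> g C) = \<sigma>' g (f C)" if g: "g : carrier (SO n)" and C: "C : Ker" for g C
 proof -
  obtain \<tau> where \<tau>: "\<forall>C\<in>carrier A.WM. A.Psi (\<sigma> g C) = \<tau> (A.Psi C)" "\<forall>D\<in>carrier B.WM. B.Psi (\<sigma>' g D) = \<tau> (B.Psi D)"
   using good[OF A.SO_generated[OF g]] by blast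
  have c: "\<sigma>' g (f C) : carrier B.WM" "\<sigma> g C : carrier A.WM"
   by (rule B.sig_carrier[OF g f(1)[OF C]], rule A.sig_carrier[OF g KA[OF C]])
  have p: "B.Psi (\<sigma>' g (f C)) = A.Psi (\<sigma> g C)" using \<tau> f[OF C] KA[OF C] by simp
  then have "\<sigma> g C : Ker" using c Ker by blast
  then show ?thesis by (rule f_eq[OF _ c(1) p])
 qed
 have hom: "f : gmodule_hom (SO n) (A.WM\<lparr>carrier := Ker\<rparr>) \<sigma> B.WM \<sigma>'"
  unfolding gmodule_hom_def module_hom_def using f(1) addK smultK equiv by simp
 have bij: "bij_betw f Ker (carrier B.WM)"
 proof (rule bij_betwI')
  show "f C = f D \<longleftrightarrow> C = D" if "C : Ker" "D : Ker" for C D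
   using f(2)[OF that(1)] f(2)[OF that(2)] A.Psi_inj[OF KA[OF that(1)] KA[OF that(2)]] by metis
  show "f C : carrier B.WM" if "C : Ker" for C by (rule f(1)[OF that])
  fix D assume D: "D : carrier B.WM"
  obtain d where "D = B.comb d" using B.comb_exists[OF D] by blast
  then have "B.Psi D = (%T S. \<Sum>i\<in>bindices n (k - 2). d i*betaf n i T S)" by (simp only: B.Psi_comb)
  then obtain C where C: "C : carrier A.WM" "A.Psi C = B.Psi D" using A.kernel_comb(2)[OF assms(2), of d] by metis
  then have "C : Ker" using Ker D by (metis)
  moreover have "f C = D" by (rule f_eq[OF calculation D C(2)[symmetric]])
  ultimately show "\<exists>C\<in>Ker. D = f C" by blast
 qed
 show ?thesis
  unfolding gmodule_iso_def A.weyl_module_eq B.weyl_module_eq A.ker_eq Ker_def[symmetric]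
  using hom bij by (intro bexI[of _ f]) simp_all
qed

end
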